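(* Let $N$ be a lattice of rank $n$, let $\Xi$ be a (finite) simplicial fan in $N_{\mathbb{R}}$, and let $X_\Xi$ be the associated simplicial toric variety with its natural orbifold structure. Then every twisted sector of $X_\Xi$ is isomorphic to the subvariety $\overline{O_\tau}$ of $X_\Xi$ for some cone $\tau\in\Xi$. Moreover, for each nonzero cone $\tau\in\Xi$ there is a one-to-one correspondence between the set of twisted sectors of type $\overline{O_\tau}$ (those which the natural map to $X_\Xi$ identifies with $\overline{O_\tau}$) and the set of integral vectors (elements of $N$) in the interior of $\tau$ which are linear combinations of the 1-dimensional generators of $\tau$ with coefficients in $(0,1)$.
   Context: Toric notation. $N\cong\mathbb{Z}^n$, $M=\mathrm{Hom}(N,\mathbb{Z})$, $N_{\mathbb{R}}=N\otimes\mathbb{R}$. The 1-dimensional cones of $\Xi$ are assumed to span $N_{\mathbb{R}}$. The generators of a cone $\sigma\in\Xi$ are the primitive elements of $N$ on its 1-dimensional faces; $\Xi$ (and $X_\Xi$) is simplicial if the generators of every cone are linearly independent over $\mathbb{R}$. $X_\Xi$ is the complex toric variety obtained by gluing $U_\sigma=\mathrm{Spec}\,\mathbb{C}[\check\sigma\cap M]$, $\sigma\in\Xi$, where $\check\sigma$ is the dual cone. $O_\tau$ is the torus orbit corresponding to $\tau\in\Xi$ and $\overline{O_\tau}=\bigsqcup_{\gamma\supseteq\tau}O_\gamma$ (union over cones $\gamma \in \Xi$ having $\tau$ as a face) is its closure. Orbifold structure on $X_\Xi$. For an $n$-dimensional cone $\sigma\in\Xi$ with generators $v_1,\dots,v_n$,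 let $N_\sigma=\bigoplus\mathbb{Z}v_i\subseteq N$, $G_\sigma=N/N_\sigma$ (a finite abelian group), $M_\sigma$ the dual lattice of $N_\sigma$, and $U_{\sigma'}=\mathrm{Spec}\,\mathbb{C}[\check\sigma\cap M_\sigma]\cong\mathbb{C}^n$. An element $v\in N$ acts on $\mathbb{C}[M_\sigma]$ by $\chi^u\mapsto\exp(2\pi i\langle u,v\rangle)\chi^u$; this induces an action of $G_\sigma$ on $U_{\sigma'}$ with $U_{\sigma'}/G_\sigma=U_\sigma$, and $(U_{\sigma'},G_\sigma)$ with the quotient map is an orbifold chart (uniformising system) over $U_\sigma$. More generally, for a cone $\tau$ of dimension $j$ with generators $v_1,\dots,v_j$, choose a complement $C$ in $N$ of the saturated sublattice $N\cap\mathrm{span}_{\mathbb{R}}(\tau)$ and put $N'=\mathbb{Z}v_1\oplus\cdots\oplus\mathbb{Z}v_j\oplus C$; then $N/N'\cong G_\tau:=(N\cap\mathrm{span}_{\mathbb{R}}(\tau))/\bigoplus_{i\le j}\mathbb{Z}v_i$ acts in the same way on the toric variety $\mathbb{C}^j\times(\mathbb{C}^* )^{n-j}$ of $\tau$ with respect to $N'$, with quotient $U_\tau$; this is the induced chart over $U_\tau$, and the local group at a point of $O_\tau$ is $G_\tau$. Twisted sectors. For an orbifold $X$, each point $p$ has a chart $(V_p,G_p,\pi_p)$ over a neighbourhood $U_p$ with $G_p$ fixing the preimage of $p$ (local group at $p$). Let $\tilde X=\{(p,(g)_{G_p}) : p\in X,\ g\in G_p\}$, where $(g)_{G_p}$ is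 the conjugacy class of $g$ in $G_p$; it is naturally an orbifold, with local charts $(V_p^g,C(g)/K_g)$ over $V_p^g/C(g)$, where $V_p^g$ is the fixed-point set, $C(g)$ the centralizer of $g$ in $G_p$ and $K_g$ the kernel of the action of $C(g)$ on $V_p^g$. For $q\in U_p$ there is an injective homomorphism $G_q\to G_p$ (canonical up to conjugation); identifying $(g)_{G_q}$ with $(g)_{G_p}$ for $g\in G_q$ generates an equivalence relation on conjugacy classes, and $\tilde X$ is the disjoint union of its connected components $X_{(g)}$ indexed by the equivalence classes $(g)$. The components $X_{(g)}$ with $g\ne1$ are the twisted sectors of $X$. The natural map $\tilde X\to X$ sends $(p,(g)_{G_p})$ to $p$. *)

theory Defs
  imports "HOL-Analysis.Analysis" "HOL-Algebra.Coset"
begin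

text \<open>
  Complex varieties are treated classically: a set of closed points with its Zariski topology and,
  for every open set, the complex-valued functions that are regular on it.  A function is a total
  HOL function, of which \<open>regular X U f\<close> only looks at the values on \<open>U\<close>.
\<close>

record 'x fspace =
  zariski :: "'x topology"
  regular :: "'x set \<Rightarrow> ('x \<Rightarrow> complex) \<Rightarrow> bool"

abbreviation pts :: "('x, 'z) fspace_scheme \<Rightarrow> 'x set" where
  "pts X \<equiv> topspace (zariski X)"

definition fspace_iso :: "('x \<Rightarrow> 'y) \<Rightarrow> 'x fspace \<Rightarrow> 'y fspace \<Rightarrow> bool" where
  "fspace_iso \<phi> X Y \<longleftrightarrow>
     homeomorphic_map (zariski X) (zariski Y) \<phi> \<and>
     (\<forall>U f. openin (zariski Y) U \<longrightarrow>
        (regular Y U f \<longleftrightarrow> regular X {x \<in> pts X. \<phi> x \<in> U} (f \<circ> \<phi>)))"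

definition isomorphic_fspace :: "'x fspace \<Rightarrow> 'y fspace \<Rightarrow> bool" where
  "isomorphic_fspace X Y \<longleftrightarrow> (\<exists>\<phi>. fspace_iso \<phi> X Y)"

text \<open>The reduced structure on a subset: regular functions are those that locally extend.\<close>

definition subfspace :: "'x fspace \<Rightarrow> 'x set \<Rightarrow> 'x fspace" where
  "subfspace X Y =
     \<lparr>zariski = subtopology (zariski X) Y,
      regular = (\<lambda>U f. \<forall>y\<in>U. \<exists>W g. openin (zariski X) W \<and> y \<in> W \<and> regular X W g \<and>
                              (\<forall>z\<in>U \<inter> W. f z = g z))\<rparr>"

text \<open>
  The final structure on a set \<open>X\<close> for maps \<open>c i\<close> from spaces \<open>A i\<close> into \<open>X\<close>: openness and
  regularity are tested after pulling back along every \<open>c i\<close>.  It serves for gluing open pieces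
  and also for quotients by finite groups (there it gives the invariant regular functions).
\<close>

definition final_fspace :: "'x set \<Rightarrow> 'i set \<Rightarrow> ('i \<Rightarrow> 'y fspace) \<Rightarrow> ('i \<Rightarrow> 'y \<Rightarrow> 'x) \<Rightarrow> 'x fspace" where
  "final_fspace X I A c =
     \<lparr>zariski = topology (\<lambda>U. U \<subseteq> X \<and> (\<forall>i\<in>I. openin (zariski (A i)) {y \<in> pts (A i). c i y \<in> U})),
      regular = (\<lambda>U f. \<forall>i\<in>I. regular (A i) {y \<in> pts (A i). c i y \<in> U} (f \<circ> c i))\<rparr>"

lemma openin_final_fspace:
  "openin (zariski (final_fspace X I A c)) U \<longleftrightarrow>
     U \<subseteq> X \<and> (\<forall>i\<in>I. openin (zariski (A i)) {y \<in> pts (A i). c i y \<in> U})"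
proof -
  let ?P = "\<lambda>U. U \<subseteq> X \<and> (\<forall>i\<in>I. openin (zariski (A i)) {y \<in> pts (A i). c i y \<in> U})"
  have "istopology ?P"
    unfolding istopology_def
  proof (intro conjI allI impI ballI)
    fix S T i assume "?P S" "?P T" "i \<in> I"
    moreover have "{y \<in> pts (A i). c i y \<in> S \<inter> T} =
        {y \<in> pts (A i). c i y \<in> S} \<inter> {y \<in> pts (A i). c i y \<in> T}" by auto
    ultimately show "openin (zariski (A i)) {y \<in> pts (A i). c i y \<in> S \<inter> T}" by auto
  next
    fix \<K> i assume *: "\<forall>K\<in>\<K>. ?P K" "i \<in> I"
    have "{y \<in> pts (A i). c i y \<in> \<Union>\<K>} = (\<Union>K\<in>\<K>. {y \<in> pts (A i). c i y \<in> K})" by auto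
    then show "openin (zariski (A i)) {y \<in> pts (A i). c i y \<in> \<Union>\<K>}" using * by auto
  qed auto
  then show ?thesis by (simp add: final_fspace_def)
qed

text \<open>
  The affine variety with point set \<open>V\<close> and coordinate ring \<open>R\<close>; the principal open sets form
  a basis of the Zariski topology, and regular functions are locally fractions.
\<close>

definition affine_fspace :: "'x set \<Rightarrow> ('x \<Rightarrow> complex) set \<Rightarrow> 'x fspace" where
  "affine_fspace V R =
     (let Z = topology_generated_by {{x \<in> V. a x \<noteq> 0} | a. a \<in> R}
      in \<lparr>zariski = Z,
          regular = (\<lambda>U f. \<forall>x\<in>U. \<exists>W a b. openin Z W \<and> x \<in> W \<and> W \<subseteq> U \<and> a \<in> R \<and> b \<in> R \<and>
                                    (\<forall>y\<in>W. b y \<noteq> 0 \<and> f y = a y / b y))\<rparr>)"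


text \<open>
  An orbifold is given by a chart \<open>(V\<^sub>p, G\<^sub>p, \<pi>\<^sub>p)\<close> around every point \<open>p\<close>, with \<open>G\<^sub>p\<close> the local group
  at \<open>p\<close>.  The charts carry two topologies: the Zariski topology of \<open>chart Q p\<close>, and the classical
  one, induced from the topology of the type \<open>'x\<close>.
\<close>

record ('p, 'x, 'g) orbifold =
  orb_points :: "'p set"
  chart :: "'p \<Rightarrow> 'x fspace"
  local_group :: "'p \<Rightarrow> 'g monoid"
  chart_action :: "'p \<Rightarrow> 'g \<Rightarrow> 'x \<Rightarrow> 'x"
  chart_proj :: "'p \<Rightarrow> 'x \<Rightarrow> 'p"

definition conj_class :: "('g, 'z) monoid_scheme \<Rightarrow> 'g \<Rightarrow> 'g set" where
  "conj_class G g = {h \<otimes>\<^bsub>G\<^esub> g \<otimes>\<^bsub>G\<^esub> inv\<^bsub>G\<^esub> h | h. h \<in> carrier G}"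

text \<open>
  A germ at \<open>q\<close> of an injection of the chart at \<open>q\<close> into the chart at \<open>p\<close>: a \<open>G\<^sub>q\<close>-stable classical
  neighbourhood \<open>W\<close> of the preimage of \<open>q\<close>, a homeomorphism \<open>\<phi>\<close> of \<open>W\<close> onto an open subset of \<open>V\<^sub>p\<close>
  over the orbifold, and an injective homomorphism \<open>l\<close> of local groups for which \<open>\<phi>\<close> is equivariant.
  For complex orbifolds such a \<open>\<phi>\<close> is automatically holomorphic, the projections being finite.
\<close>

definition chart_injection ::
  "('p, 'x::topological_space, 'g) orbifold \<Rightarrow> 'p \<Rightarrow> 'p \<Rightarrow> 'x set \<Rightarrow> ('x \<Rightarrow> 'x) \<Rightarrow> ('g \<Rightarrow> 'g) \<Rightarrow> bool" where
  "chart_injection Q q p W \<phi> l \<longleftrightarrow>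
     openin (top_of_set (pts (chart Q q))) W \<and>
     {y \<in> pts (chart Q q). chart_proj Q q y = q} \<subseteq> W \<and>
     (\<forall>g\<in>carrier (local_group Q q). \<forall>y\<in>W. chart_action Q q g y \<in> W) \<and>
     openin (top_of_set (pts (chart Q p))) (\<phi> ` W) \<and>
     homeomorphic_map (top_of_set W) (top_of_set (\<phi> ` W)) \<phi> \<and>
     (\<forall>y\<in>W. chart_proj Q p (\<phi> y) = chart_proj Q q y) \<and>
     l \<in> hom (local_group Q q) (local_group Q p) \<and>
     inj_on l (carrier (local_group Q q)) \<and>
     (\<forall>g\<in>carrier (local_group Q q). \<forall>y\<in>W.
        \<phi> (chart_action Q q g y) = chart_action Q p (l g) (\<phi> y))"

definition inertia_points :: "('p, 'x, 'g) orbifold \<Rightarrow> ('p \<times> 'g set) set" where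
  "inertia_points Q =
     {(p, conj_class (local_group Q p) g) | p g. p \<in> orb_points Q \<and> g \<in> carrier (local_group Q p)}"

definition class_identification ::
  "('p, 'x::topological_space, 'g) orbifold \<Rightarrow> (('p \<times> 'g set) \<times> ('p \<times> 'g set)) set" where
  "class_identification Q =
     {((q, conj_class (local_group Q q) g), (p, conj_class (local_group Q p) (l g))) | q p g l.
        p \<in> orb_points Q \<and> q \<in> orb_points Q \<and> q \<in> chart_proj Q p ` pts (chart Q p) \<and>
        g \<in> carrier (local_group Q q) \<and> (\<exists>W \<phi>. chart_injection Q q p W \<phi> l)}"

text \<open>The component \<open>X\<^bsub>(g)\<^esub>\<close> through the point \<open>a\<close>: its class for the generated equivalence relation.\<close>

definition sector_of ::
  "('p, 'x::topological_space, 'g) orbifold \<Rightarrow> 'p \<times> 'g set \<Rightarrow> ('p \<times> 'g set) set" where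
  "sector_of Q a = (class_identification Q \<union> (class_identification Q)\<inverse>)\<^sup>* `` {a}"

definition twisted_sectors ::
  "('p, 'x::topological_space, 'g) orbifold \<Rightarrow> ('p \<times> 'g set) set set" where
  "twisted_sectors Q =
     {sector_of Q (p, conj_class (local_group Q p) g) | p g.
        p \<in> orb_points Q \<and> g \<in> carrier (local_group Q p) \<and> g \<noteq> \<one>\<^bsub>local_group Q p\<^esub>}"

definition fixed_locus :: "('p, 'x, 'g) orbifold \<Rightarrow> 'p \<Rightarrow> 'g \<Rightarrow> 'x fspace" where
  "fixed_locus Q p g = subfspace (chart Q p) {x \<in> pts (chart Q p). chart_action Q p g x = x}"

text \<open>
  The projection of the chart \<open>(V\<^sub>p\<^sup>g, C(g)/K\<^sub>g)\<close>: a point \<open>x\<close> of \<open>V\<^sub>p\<close> fixed by \<open>g\<close>, lying over \<open>q\<close>, goes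
  to \<open>(q, (h))\<close>, where \<open>h\<close> corresponds to \<open>g\<close> when \<open>G\<^sub>q\<close> is identified with the stabilizer of \<open>x\<close> by a
  chart injection sending the preimage \<open>y\<close> of \<open>q\<close> to \<open>x\<close>.
\<close>

definition sector_chart_proj ::
  "('p, 'x::topological_space, 'g) orbifold \<Rightarrow> 'p \<Rightarrow> 'g \<Rightarrow> 'x \<Rightarrow> 'p \<times> 'g set" where
  "sector_chart_proj Q p g x =
     (let q = chart_proj Q p x in
      THE a. \<exists>W \<phi> l y h. chart_injection Q q p W \<phi> l \<and> y \<in> W \<and> chart_proj Q q y = q \<and> \<phi> y = x \<and>
               h \<in> carrier (local_group Q q) \<and> l h = g \<and> a = (q, conj_class (local_group Q q) h))"

text \<open>
  The fibres of the chart projection on \<open>V\<^sub>p\<^sup>g\<close> are the orbits of \<open>C(g)\<close>, so the final structure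
  is the one glued from the quotients \<open>V\<^sub>p\<^sup>g/C(g)\<close>.
\<close>

definition inertia_space :: "('p, 'x::topological_space, 'g) orbifold \<Rightarrow> ('p \<times> 'g set) fspace" where
  "inertia_space Q =
     final_fspace (inertia_points Q)
       {(p, g). p \<in> orb_points Q \<and> g \<in> carrier (local_group Q p)}
       (\<lambda>(p, g). fixed_locus Q p g) (\<lambda>(p, g). sector_chart_proj Q p g)"

definition sector_space ::
  "('p, 'x::topological_space, 'g) orbifold \<Rightarrow> ('p \<times> 'g set) set \<Rightarrow> ('p \<times> 'g set) fspace" where
  "sector_space Q S = subfspace (inertia_space Q) S"


definition int_span :: "'a::real_vector set \<Rightarrow> 'a set" where
  "int_span B = {\<Sum>b\<in>B. of_int (k b) *\<^sub>R b | k :: 'a \<Rightarrow> int. True}"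

text \<open>A lattice \<open>N\<close> with \<open>N\<^sub>\<real> = 'a\<close>; its rank is \<open>DIM('a)\<close>.\<close>

definition is_lattice :: "'a::euclidean_space set \<Rightarrow> bool" where
  "is_lattice N \<longleftrightarrow> (\<exists>B. independent B \<and> span B = UNIV \<and> N = int_span B)"

text \<open>The dual space of \<open>N\<^sub>\<real>\<close> is identified with \<open>N\<^sub>\<real>\<close> by the inner product.\<close>

definition dual_lattice :: "'a::euclidean_space set \<Rightarrow> 'a set" where
  "dual_lattice N = {u. \<forall>v\<in>N. u \<bullet> v \<in> \<int>}"

definition dual_cone :: "'a::euclidean_space set \<Rightarrow> 'a set" where
  "dual_cone \<sigma> = {u. \<forall>v\<in>\<sigma>. 0 \<le> u \<bullet> v}"

definition rational_cone :: "'a::euclidean_space set \<Rightarrow> 'a set \<Rightarrow> bool" where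
  "rational_cone N \<sigma> \<longleftrightarrow>
     (\<exists>S. finite S \<and> S \<subseteq> N \<and> \<sigma> = convex_cone hull S) \<and> (\<forall>v. v \<in> \<sigma> \<and> - v \<in> \<sigma> \<longrightarrow> v = 0)"

text \<open>The empty set, a face in the sense of \<open>face_of\<close>, does not count as a face of a cone.\<close>

definition is_fan :: "'a::euclidean_space set \<Rightarrow> 'a set set \<Rightarrow> bool" where
  "is_fan N \<Xi> \<longleftrightarrow>
     finite \<Xi> \<and> \<Xi> \<noteq> {} \<and>
     (\<forall>\<sigma>\<in>\<Xi>. rational_cone N \<sigma>) \<and>
     (\<forall>\<sigma>\<in>\<Xi>. \<forall>\<tau>. \<tau> face_of \<sigma> \<and> \<tau> \<noteq> {} \<longrightarrow> \<tau> \<in> \<Xi>) \<and>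
     (\<forall>\<sigma>\<in>\<Xi>. \<forall>\<tau>\<in>\<Xi>. \<sigma> \<inter> \<tau> face_of \<sigma> \<and> \<sigma> \<inter> \<tau> face_of \<tau>)"

definition primitive_in :: "'a::euclidean_space set \<Rightarrow> 'a \<Rightarrow> bool" where
  "primitive_in N v \<longleftrightarrow> v \<in> N \<and> v \<noteq> 0 \<and> (\<forall>w\<in>N. \<forall>k::nat. v = real k *\<^sub>R w \<longrightarrow> k = 1)"

definition cone_gens :: "'a::euclidean_space set \<Rightarrow> 'a set \<Rightarrow> 'a set" where
  "cone_gens N \<sigma> = {v. primitive_in N v \<and> (\<exists>\<rho>. \<rho> face_of \<sigma> \<and> dim \<rho> = 1 \<and> v \<in> \<rho>)}"

definition simplicial_fan :: "'a::euclidean_space set \<Rightarrow> 'a set set \<Rightarrow> bool" where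
  "simplicial_fan N \<Xi> \<longleftrightarrow> (\<forall>\<sigma>\<in>\<Xi>. independent (cone_gens N \<sigma>))"

definition rays_span :: "'a::euclidean_space set set \<Rightarrow> bool" where
  "rays_span \<Xi> \<longleftrightarrow> span (\<Union>{\<rho>\<in>\<Xi>. dim \<rho> = 1}) = UNIV"


text \<open>
  The closed points of \<open>Spec \<complex>[S]\<close> are the monoid homomorphisms from \<open>S\<close> to \<open>(\<complex>, \<cdot>)\<close>,
  extended by \<open>0\<close> outside \<open>S\<close>.  The product topology on the function type induces the classical
  topology on them.
\<close>

definition monoid_points :: "'a::euclidean_space set \<Rightarrow> ('a \<Rightarrow> complex) set" where
  "monoid_points S =
     {x. x 0 = 1 \<and> (\<forall>u\<in>S. \<forall>w\<in>S. x (u + w) = x u * x w) \<and> (\<forall>u. u \<notin> S \<longrightarrow> x u = 0)}"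

definition monoid_algebra :: "'a::euclidean_space set \<Rightarrow> (('a \<Rightarrow> complex) \<Rightarrow> complex) set" where
  "monoid_algebra S = {(\<lambda>x. \<Sum>u\<in>F. k u * x u) | F k. finite F \<and> F \<subseteq> S}"

definition affine_toric :: "'a::euclidean_space set \<Rightarrow> 'a set \<Rightarrow> ('a \<Rightarrow> complex) fspace" where
  "affine_toric N \<sigma> =
     (let S = dual_cone \<sigma> \<inter> dual_lattice N in affine_fspace (monoid_points S) (monoid_algebra S))"

definition restrict_point :: "'a::euclidean_space set \<Rightarrow> 'a set \<Rightarrow> ('a \<Rightarrow> complex) \<Rightarrow> ('a \<Rightarrow> complex)" where
  "restrict_point N \<sigma> x = (\<lambda>u. if u \<in> dual_cone \<sigma> \<inter> dual_lattice N then x u else 0)"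

type_synonym 'a toric_point = "('a set \<times> ('a \<Rightarrow> complex)) set"

text \<open>\<open>U\<^sub>\<sigma>\<close> and \<open>U\<^sub>\<sigma>\<^sub>'\<close> are glued along their common open subset \<open>U\<^bsub>\<sigma> \<inter> \<sigma>'\<^esub>\<close>.\<close>

definition glue_rel ::
  "'a::euclidean_space set \<Rightarrow> 'a set set \<Rightarrow> (('a set \<times> ('a \<Rightarrow> complex)) \<times> ('a set \<times> ('a \<Rightarrow> complex))) set" where
  "glue_rel N \<Xi> =
     {((\<sigma>, restrict_point N \<sigma> z), (\<sigma>', restrict_point N \<sigma>' z)) | \<sigma> \<sigma>' z.
        \<sigma> \<in> \<Xi> \<and> \<sigma>' \<in> \<Xi> \<and> z \<in> pts (affine_toric N (\<sigma> \<inter> \<sigma>'))}"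

definition toric_class ::
  "'a::euclidean_space set \<Rightarrow> 'a set set \<Rightarrow> 'a set \<Rightarrow> ('a \<Rightarrow> complex) \<Rightarrow> 'a toric_point" where
  "toric_class N \<Xi> \<sigma> x = glue_rel N \<Xi> `` {(\<sigma>, x)}"

definition toric_points :: "'a::euclidean_space set \<Rightarrow> 'a set set \<Rightarrow> 'a toric_point set" where
  "toric_points N \<Xi> = (SIGMA \<sigma>:\<Xi>. pts (affine_toric N \<sigma>)) // glue_rel N \<Xi>"

definition toric_variety :: "'a::euclidean_space set \<Rightarrow> 'a set set \<Rightarrow> 'a toric_point fspace" where
  "toric_variety N \<Xi> = final_fspace (toric_points N \<Xi>) \<Xi> (affine_toric N) (toric_class N \<Xi>)"

text \<open>The torus is \<open>Hom(M, \<complex>\<^sup>*)\<close>; \<open>O\<^sub>\<tau>\<close> is the orbit of the distinguished point of \<open>U\<^sub>\<tau>\<close>.\<close>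

definition distinguished_point :: "'a::euclidean_space set \<Rightarrow> 'a set \<Rightarrow> 'a \<Rightarrow> complex" where
  "distinguished_point N \<tau> =
     restrict_point N \<tau> (\<lambda>u. if \<forall>v\<in>\<tau>. u \<bullet> v = 0 then 1 else 0)"

definition orbit :: "'a::euclidean_space set \<Rightarrow> 'a set set \<Rightarrow> 'a set \<Rightarrow> 'a toric_point set" where
  "orbit N \<Xi> \<tau> =
     {toric_class N \<Xi> \<tau> (\<lambda>u. t u * distinguished_point N \<tau> u) | t.
        t \<in> monoid_points (dual_lattice N)}"

definition orbit_closure :: "'a::euclidean_space set \<Rightarrow> 'a set set \<Rightarrow> 'a set \<Rightarrow> 'a toric_point set" where
  "orbit_closure N \<Xi> \<tau> = (\<Union>\<gamma>\<in>{\<gamma> \<in> \<Xi>. \<tau> face_of \<gamma>}. orbit N \<Xi> \<gamma>)"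

definition orbit_closure_variety ::
  "'a::euclidean_space set \<Rightarrow> 'a set set \<Rightarrow> 'a set \<Rightarrow> 'a toric_point fspace" where
  "orbit_closure_variety N \<Xi> \<tau> = subfspace (toric_variety N \<Xi>) (orbit_closure N \<Xi> \<tau>)"


text \<open>
  \<open>C\<close> is a complement in \<open>N\<close> of the saturated sublattice \<open>N \<inter> span \<tau>\<close>; it is \<open>{0}\<close> if \<open>\<tau>\<close> has full
  dimension.
\<close>

definition lattice_complement :: "'a::euclidean_space set \<Rightarrow> 'a set \<Rightarrow> 'a set \<Rightarrow> bool" where
  "lattice_complement N \<tau> C \<longleftrightarrow>
     C \<subseteq> N \<and> 0 \<in> C \<and> (\<forall>v\<in>C. \<forall>w\<in>C. v - w \<in> C) \<and>
     N \<inter> span \<tau> \<inter> C = {0} \<and> N = {v + c | v c. v \<in> N \<inter> span \<tau> \<and> c \<in> C}"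

definition chart_lattice :: "'a::euclidean_space set \<Rightarrow> 'a set \<Rightarrow> 'a set \<Rightarrow> 'a set" where
  "chart_lattice N \<tau> C = {v + c | v c. v \<in> int_span (cone_gens N \<tau>) \<and> c \<in> C}"

definition cone_group :: "'a::euclidean_space set \<Rightarrow> 'a set \<Rightarrow> 'a set monoid" where
  "cone_group N \<tau> =
     \<lparr>carrier = N \<inter> span \<tau>, monoid.mult = (+), one = 0\<rparr> Mod int_span (cone_gens N \<tau>)"

text \<open>
  A coset acts through any of its representatives \<open>v\<close>, by \<open>\<chi>\<^sup>u \<mapsto> exp(2\<pi>i\<langle>u,v\<rangle>) \<chi>\<^sup>u\<close>.  Points vanish
  outside \<open>dual_cone \<tau> \<inter> dual_lattice (chart_lattice N \<tau> C)\<close>, where the choice of \<open>v\<close> would matter.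
\<close>

definition cone_action :: "'a::euclidean_space set \<Rightarrow> ('a \<Rightarrow> complex) \<Rightarrow> ('a \<Rightarrow> complex)" where
  "cone_action g x = (\<lambda>u. exp (2 * of_real pi * \<i> * of_real (u \<bullet> (SOME v. v \<in> g))) * x u)"

definition cone_of_point :: "'a::euclidean_space set \<Rightarrow> 'a set set \<Rightarrow> 'a toric_point \<Rightarrow> 'a set" where
  "cone_of_point N \<Xi> p = (THE \<tau>. \<tau> \<in> \<Xi> \<and> p \<in> orbit N \<Xi> \<tau>)"

text \<open>The chart around a point of \<open>O\<^sub>\<tau>\<close> is the one over \<open>U\<^sub>\<tau>\<close> for the chosen complement \<open>C \<tau>\<close>.\<close>

definition toric_orbifold ::
  "'a::euclidean_space set \<Rightarrow> 'a set set \<Rightarrow> ('a set \<Rightarrow> 'a set) \<Rightarrow>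
     ('a toric_point, 'a \<Rightarrow> complex, 'a set) orbifold" where
  "toric_orbifold N \<Xi> C =
     \<lparr>orb_points = toric_points N \<Xi>,
      chart = (\<lambda>p. let \<tau> = cone_of_point N \<Xi> p in affine_toric (chart_lattice N \<tau> (C \<tau>)) \<tau>),
      local_group = (\<lambda>p. cone_group N (cone_of_point N \<Xi> p)),
      chart_action = (\<lambda>p. cone_action),
      chart_proj = (\<lambda>p x. let \<tau> = cone_of_point N \<Xi> p in toric_class N \<Xi> \<tau> (restrict_point N \<tau> x))\<rparr>"

text \<open>The natural map from the inertia orbifold to \<open>X\<^sub>\<Xi>\<close> is \<open>fst\<close>.\<close>

definition sectors_of_type ::
  "'a::euclidean_space set \<Rightarrow> 'a set set \<Rightarrow> ('a set \<Rightarrow> 'a set) \<Rightarrow> 'a set \<Rightarrow>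
     ('a toric_point \<times> 'a set set) set set" where
  "sectors_of_type N \<Xi> C \<tau> =
     {S \<in> twisted_sectors (toric_orbifold N \<Xi> C).
        fspace_iso fst (sector_space (toric_orbifold N \<Xi> C) S) (orbit_closure_variety N \<Xi> \<tau>)}"

definition box_vectors :: "'a::euclidean_space set \<Rightarrow> 'a set \<Rightarrow> 'a set" where
  "box_vectors N \<tau> =
     {v \<in> N. v \<in> rel_interior \<tau> \<and>
        (\<exists>a. (\<forall>w\<in>cone_gens N \<tau>. 0 < a w \<and> a w < 1) \<and> v = (\<Sum>w\<in>cone_gens N \<tau>. a w *\<^sub>R w))}"

end

theory Submission
  imports Defs
begin

text \<open>
  A point of an affine toric chart is a face \<open>\<tau>\<close> (the characters not vanishing there are those
  orthogonal to \<open>\<tau>\<close>) together with a character, which extends to \<open>exp \<circ> l\<close> for a linear \<open>l\<close>. So points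
  of \<open>X\<^sub>\<Xi>\<close> are classes \<open>pt \<tau> l\<close>, and the charts are compared through these coordinates.

  Every injection of the chart at \<open>q \<in> O\<^bsub>\<gamma>'\<^esub>\<close> into the chart at \<open>p \<in> O\<^sub>\<gamma>\<close>, \<open>\<gamma>' \<subseteq> \<gamma>\<close>, induces the
  natural inclusion of \<open>G\<^bsub>\<gamma>'\<^esub>\<close> into \<open>G\<^sub>\<gamma>\<close> (by continuity along rotations), and such injections exist,
  written down with local logarithms. Hence the sector of a class of \<open>v\<close> depends only on the representative
  of \<open>v\<close> with coefficients in \<open>[0, 1)\<close>: if \<open>\<tau>\<close> is spanned by the generators with nonzero coefficient, the
  sector is the set of all \<open>(q, v)\<close> with \<open>q\<close> in the closure of \<open>O\<^sub>\<tau>\<close>.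

  The fixed locus of \<open>v\<close> in a chart is the preimage of the closure of \<open>O\<^sub>\<tau>\<close>, and the structure sheaf
  of a quotient by \<open>G\<^sub>\<gamma>\<close> is recovered by splitting functions into isotypic components; so \<open>fst\<close> is an
  isomorphism from the sector onto the closure of \<open>O\<^sub>\<tau>\<close>.
\<close>

section \<open>Lattices\<close>

text \<open>Two features of the definitions shape the proof. A chart injection is only a
  homeomorphism over the orbifold, equivariant for some injective homomorphism. Nothing ties that
  homomorphism to the lattice until a path argument does, and only then do the projections of the
  sector charts, defined by a \<open>THE\<close> over all injections, become computable. Secondly,
  the monoid of characters of an affine piece need not be free, so a point is not given by
  independent coordinates. This is why lattices are only compared with \<open>M\<close> up to
  multiples: a suitable multiple of a character is a monomial in multiples of the dual vectors of
  the generators, times a unit.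

  For the structure sheaves, openness and regularity on both sides are brought to one common form on
  each affine piece, with fractions valid on a whole preimage instead of near one point. Then only
  the passage from a chart to its quotient has content. The type of a sector is well defined because
  its image under \<open>fst\<close> is an orbit closure, and distinct cones have distinct orbit
  closures.\<close>

definition dual_family :: "'a::euclidean_space set \<Rightarrow> ('a \<Rightarrow> 'a) \<Rightarrow> bool" where
  "dual_family B d \<longleftrightarrow> (\<forall>b\<in>B. \<forall>b'\<in>B. d b \<bullet> b' = (if b = b' then 1 else 0))"

lemma linear_functional_inner:
  fixes f :: "'a::euclidean_space \<Rightarrow> real"
  assumes "linear f"
  obtains u where "\<And>x. f x = u \<bullet> x"
proof (rule that)
  fix x
  have "f x = f (\<Sum>i\<in>Basis. (x \<bullet> i) *\<^sub>R i)" by (simp add: euclidean_representation)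
  also have "\<dots> = (\<Sum>i\<in>Basis. (x \<bullet> i) * f i)"
    using assms by (simp add: linear_sum linear_cmul)
  finally show "f x = (\<Sum>i\<in>Basis. f i *\<^sub>R i) \<bullet> x"
    by (simp add: inner_sum_left inner_sum_right inner_commute[of _ x] mult.commute)
qed

text \<open>\<open>B\<close> need not span, so \<open>d\<close> is one choice among many; only its
  pairings with the span of \<open>B\<close> are determined. This freedom is what later allows dual
  vectors adapted to a chosen complement.\<close>

lemma dual_family_exists:
  fixes B :: "'a::euclidean_space set"
  assumes "independent B"
  obtains d where "dual_family B d"
proof -
  have "\<exists>u. \<forall>b'\<in>B. u \<bullet> b' = (if b = b' then 1 else 0)" for b
  proof -
    obtain f :: "'a \<Rightarrow> real" where f: "linear f" "\<forall>x\<in>B. f x = (if b = x then 1 else 0)"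
      using linear_independent_extend[OF assms, of "\<lambda>x. if b = x then 1 else 0"] by auto
    obtain u where "\<And>x. f x = u \<bullet> x" using linear_functional_inner[OF f(1)] by blast
    then show ?thesis using f(2) by (intro exI[of _ u]) auto
  qed
  then obtain d where "\<And>b. \<forall>b'\<in>B. d b \<bullet> b' = (if b = b' then 1 else 0)" by metis
  then show ?thesis using that unfolding dual_family_def by blast
qed

lemma dual_family_subset: "dual_family B d \<Longrightarrow> B' \<subseteq> B \<Longrightarrow> dual_family B' d"
  unfolding dual_family_def by blast

lemma dual_family_coord:
  assumes "dual_family B d" "finite B" "b \<in> B"
  shows "d b \<bullet> (\<Sum>b'\<in>B. k b' *\<^sub>R b') = k b"
proof -
  have "d b \<bullet> (\<Sum>b'\<in>B. k b' *\<^sub>R b') = (\<Sum>b'\<in>B. if b = b' then k b' else 0)"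
    unfolding inner_sum_right using assms by (intro sum.cong) (auto simp: dual_family_def)
  then show ?thesis using assms by simp
qed

lemma dual_family_expand:
  assumes "dual_family B d" "finite B" "x \<in> span B"
  shows "x = (\<Sum>b\<in>B. (d b \<bullet> x) *\<^sub>R b)"
proof -
  obtain k where k: "x = (\<Sum>b\<in>B. k b *\<^sub>R b)"
    using assms by (auto simp: span_finite)
  then have "d b \<bullet> x = k b" if "b \<in> B" for b
    using dual_family_coord[OF assms(1,2) that] by simp
  then show ?thesis using k by auto
qed

lemma dual_family_independent:
  assumes "dual_family B d" "finite B"
  shows "independent B"
proof (rule independent_if_scalars_zero[OF assms(2)])
  fix f x assume "(\<Sum>x\<in>B. f x *\<^sub>R x) = 0" "x \<in> B"
  then show "f x = 0" using dual_family_coord[OF assms, of x f] by simp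
qed

lemma dual_family_dual_independent:
  assumes "dual_family B d" "finite B"
  shows "inj_on d B" "independent (d ` B)"
proof -
  show inj: "inj_on d B"
    by (rule inj_onI) (metis assms(1) dual_family_def zero_neq_one)
  have "dual_family (d ` B) (inv_into B d)"
    using assms(1) inj by (auto simp: dual_family_def inner_commute dest: inj_onD)
  then show "independent (d ` B)" using dual_family_independent assms(2) by blast
qed

lemma int_span_subset_span: "int_span B \<subseteq> span B"
  by (auto simp: int_span_def span_base span_scale intro!: span_sum)

lemma zero_in_int_span: "0 \<in> int_span B"
  unfolding int_span_def by (intro CollectI exI[of _ "\<lambda>_. 0"]) auto

lemma int_span_diff:
  assumes "x \<in> int_span B" "y \<in> int_span B"
  shows "x - y \<in> int_span B"
proof -
  obtain k l where "x = (\<Sum>b\<in>B. of_int (k b) *\<^sub>R b)" "y = (\<Sum>b\<in>B. of_int (l b) *\<^sub>R b)"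
    using assms by (auto simp: int_span_def)
  then have "x - y = (\<Sum>b\<in>B. of_int (k b - l b) *\<^sub>R b)"
    by (simp add: sum_subtractf scaleR_diff_left)
  then show ?thesis unfolding int_span_def by (intro CollectI exI[of _ "\<lambda>b. k b - l b"]) auto
qed

lemma int_span_uminus: "x \<in> int_span B \<Longrightarrow> - x \<in> int_span B"
  using int_span_diff[OF zero_in_int_span, of x] by simp

lemma int_span_add: "x \<in> int_span B \<Longrightarrow> y \<in> int_span B \<Longrightarrow> x + y \<in> int_span B"
  using int_span_diff[OF _ int_span_uminus, of x B y] by simp

lemma int_span_base:
  assumes "finite B" "b \<in> B"
  shows "b \<in> int_span B"
proof -
  have "(\<Sum>x\<in>B. of_int (if x = b then 1 else 0) *\<^sub>R x) = (\<Sum>x\<in>B. if x = b then x else 0)"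
    by (rule sum.cong) auto
  also have "\<dots> = b" using assms by simp
  finally show ?thesis unfolding int_span_def
    by (intro CollectI exI[of _ "\<lambda>x. if x = b then 1 else 0"]) simp
qed

section \<open>Additive subgroups, bases of sublattices, characters\<close>

definition add_subgroup :: "'a::ab_group_add set \<Rightarrow> bool" where
  "add_subgroup D \<longleftrightarrow> 0 \<in> D \<and> (\<forall>x\<in>D. \<forall>y\<in>D. x - y \<in> D)"

lemma add_subgroupD:
  assumes "add_subgroup D"
  shows "0 \<in> D" "x \<in> D \<Longrightarrow> y \<in> D \<Longrightarrow> x - y \<in> D" "x \<in> D \<Longrightarrow> - x \<in> D"
    "x \<in> D \<Longrightarrow> y \<in> D \<Longrightarrow> x + y \<in> D"
proof -
  show 0: "0 \<in> D" and *: "\<And>x y. x \<in> D \<Longrightarrow> y \<in> D \<Longrightarrow> x - y \<in> D"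
    using assms by (auto simp: add_subgroup_def)
  show **: "x \<in> D \<Longrightarrow> - x \<in> D" for x using *[OF 0, of x] by simp
  show "x \<in> D \<Longrightarrow> y \<in> D \<Longrightarrow> x + y \<in> D" using *[OF _ **, of x y] by simp
qed

lemma add_subgroup_int_span: "add_subgroup (int_span B)"
  by (simp add: add_subgroup_def zero_in_int_span int_span_diff)

lemma add_subgroup_scale_nat:
  fixes x :: "'a::real_vector"
  assumes "add_subgroup D" "x \<in> D"
  shows "real k *\<^sub>R x \<in> D"
  by (induction k) (auto simp: add_subgroupD[OF assms(1)] assms scaleR_add_left)

lemma add_subgroup_scale_int:
  fixes x :: "'a::real_vector"
  assumes "add_subgroup D" "x \<in> D"
  shows "of_int k *\<^sub>R x \<in> D"
proof (cases "k \<ge> 0")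
  case True
  then show ?thesis using add_subgroup_scale_nat[OF assms, of "nat k"] by simp
next
  case False
  then show ?thesis
    using add_subgroupD(3)[OF assms(1) add_subgroup_scale_nat[OF assms, of "nat (- k)"]] by simp
qed

lemma add_subgroup_scale_Ints:
  fixes x :: "'a::real_vector"
  assumes "add_subgroup D" "x \<in> D" "c \<in> \<int>"
  shows "c *\<^sub>R x \<in> D"
  using assms(3) add_subgroup_scale_int[OF assms(1,2)] by (auto elim: Ints_cases)

lemma add_subgroup_sum:
  assumes "add_subgroup D" "\<And>i. i \<in> I \<Longrightarrow> f i \<in> D"
  shows "sum f I \<in> D"
proof (cases "finite I")
  case True
  then show ?thesis using assms(2)
    by (induction I) (auto simp: add_subgroupD[OF assms(1)])
qed (simp add: add_subgroupD[OF assms(1)])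

text \<open>Turns membership in a sublattice into integrality of coordinates. The span condition has
  to be kept, since \<open>d\<close> carries no information about the part of \<open>x\<close>
  outside the span.\<close>

lemma in_int_span_dual:
  assumes "dual_family B d" "finite B"
  shows "x \<in> int_span B \<longleftrightarrow> x \<in> span B \<and> (\<forall>b\<in>B. d b \<bullet> x \<in> \<int>)"
proof
  assume x: "x \<in> int_span B"
  then obtain k where k: "x = (\<Sum>b\<in>B. of_int (k b) *\<^sub>R b)" by (auto simp: int_span_def)
  have "d b \<bullet> x \<in> \<int>" if "b \<in> B" for b
    using dual_family_coord[OF assms that, of "\<lambda>b. of_int (k b)"] k by simp
  then show "x \<in> span B \<and> (\<forall>b\<in>B. d b \<bullet> x \<in> \<int>)" using x int_span_subset_span by auto
next
  assume x: "x \<in> span B \<and> (\<forall>b\<in>B. d b \<bullet> x \<in> \<int>)"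
  have "(\<Sum>b\<in>B. (d b \<bullet> x) *\<^sub>R b) \<in> int_span B"
    using x int_span_base[OF assms(2)]
    by (intro add_subgroup_sum add_subgroup_scale_Ints) (auto simp: add_subgroup_int_span)
  then show "x \<in> int_span B" using dual_family_expand[OF assms, of x] x by simp
qed

text \<open>Serves as the induction principle for lattices: if the vectors with a property form an
  additive subgroup, checking the property on generators is enough.\<close>

lemma int_span_mono_subgroup:
  assumes "B \<subseteq> D" "add_subgroup D"
  shows "int_span B \<subseteq> D"
  using assms by (auto simp: int_span_def intro!: add_subgroup_sum add_subgroup_scale_int)

text \<open>Division with remainder by the least positive element. The zero subgroup gives
  \<open>k = 0\<close>, which the basis construction has to treat apart.\<close>

lemma subgroup_int_generator:
  fixes K :: "int set"
  assumes "0 \<in> K" "\<And>x y. x \<in> K \<Longrightarrow> y \<in> K \<Longrightarrow> x - y \<in> K"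
  obtains k where "k \<in> K" "\<And>x. x \<in> K \<Longrightarrow> k dvd x"
proof (cases "K = {0}")
  case True
  then show ?thesis using that[of 0] by auto
next
  case False
  have neg: "- x \<in> K" if "x \<in> K" for x using assms(2)[OF assms(1) that] by simp
  have mult: "int n * x \<in> K" if "x \<in> K" for x n
  proof (induction n)
    case (Suc n)
    then show ?case using assms(2)[OF Suc neg[OF that]] by (simp add: algebra_simps)
  qed (simp add: assms)
  have mult: "n * x \<in> K" if "x \<in> K" for x n
    using mult[OF that, of "nat n"] mult[OF neg[OF that], of "nat (- n)"] by (cases "n \<ge> 0") auto
  obtain x where x: "x \<in> K" "x \<noteq> 0" using False assms(1) by auto
  then have "\<exists>n. n > 0 \<and> int n \<in> K"
    using neg[OF x(1)] by (cases "x > 0") (auto intro: exI[of _ "nat x"] exI[of _ "nat (- x)"])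
  then obtain n where n: "n > 0" "int n \<in> K" "\<And>m. m > 0 \<and> int m \<in> K \<Longrightarrow> n \<le> m"
    using exists_least_iff[of "\<lambda>n. n > 0 \<and> int n \<in> K"] by (metis not_less)
  show ?thesis
  proof (rule that[OF n(2)])
    fix y assume y: "y \<in> K"
    have "y mod int n \<in> K"
      using assms(2)[OF y mult[OF n(2), of "y div int n"]] by (simp add: minus_div_mult_eq_mod)
    moreover have "0 \<le> y mod int n" "y mod int n < int n" using n(1) by auto
    ultimately have "y mod int n = 0"
      using n(3)[of "nat (y mod int n)"] by (cases "y mod int n = 0") auto
    then show "int n dvd y" by auto
  qed
qed

text \<open>Induction on the ambient basis. The elements of \<open>D\<close> with vanishing
  \<open>b\<close>-coordinate have a basis by induction; the \<open>b\<close>-coordinates of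
  \<open>D\<close> form a subgroup of the integers, and an element \<open>c\<close> of
  \<open>D\<close> realising its generator completes the basis, because subtracting a multiple of
  \<open>c\<close> from any element kills the \<open>b\<close>-coordinate.\<close>

lemma subgroup_of_lattice_basis:
  fixes B :: "'a::euclidean_space set"
  assumes "finite B" "independent B" "D \<subseteq> int_span B" "add_subgroup D"
  shows "\<exists>B'. finite B' \<and> independent B' \<and> D = int_span B'"
  using assms
proof (induction B arbitrary: D rule: finite_induct)
  case empty
  then have "D = int_span {}" by (auto simp: int_span_def add_subgroup_def)
  then show ?case by (metis finite.emptyI independent_empty)
next
  case (insert b B)
  obtain d where d: "dual_family (insert b B) d" using dual_family_exists insert.prems(1) .
  have dB: "dual_family B d" using dual_family_subset[OF d] by auto
  have fin: "finite (insert b B)" using insert by simp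
  have b0: "d b \<bullet> x = 0" if "x \<in> span B" for x
  proof -
    have "d b \<bullet> y = 0" if "y \<in> B" for y using d that insert.hyps by (auto simp: dual_family_def)
    then have "d b \<bullet> (\<Sum>y\<in>B. (d y \<bullet> x) *\<^sub>R y) = 0" by (simp add: inner_sum_right)
    then show ?thesis using dual_family_expand[OF dB insert.hyps(1) that] by simp
  qed
  define D0 where "D0 = D \<inter> int_span B"
  have "add_subgroup D0"
    using insert.prems(3) add_subgroup_int_span[of B] by (auto simp: D0_def add_subgroup_def)
  then obtain B0 where B0: "finite B0" "independent B0" "D0 = int_span B0"
    using insert.IH[of D0] insert.prems by (auto simp: D0_def independent_insert split: if_splits)
  have kern: "x \<in> D0" if "x \<in> D" "d b \<bullet> x = 0" for x
  proof -
    have x: "x \<in> int_span (insert b B)" using that insert.prems by auto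
    have "x \<in> span (insert b B)" "\<forall>y\<in>insert b B. d y \<bullet> x \<in> \<int>" 
      using x in_int_span_dual[OF d fin] by auto
    have "x = (\<Sum>y\<in>insert b B. (d y \<bullet> x) *\<^sub>R y)"
      by (rule dual_family_expand[OF d fin \<open>x \<in> span _\<close>])
    also have "\<dots> = (\<Sum>y\<in>B. (d y \<bullet> x) *\<^sub>R y)" using that insert.hyps by simp
    also have "\<dots> \<in> span B" by (intro span_sum span_scale span_base)
    finally have "x \<in> span B" .
    then show ?thesis
      using in_int_span_dual[OF dB insert.hyps(1)] that \<open>\<forall>y\<in>insert b B. d y \<bullet> x \<in> \<int>\<close>
      by (auto simp: D0_def)
  qed
  define K where "K = {k::int. \<exists>x\<in>D. d b \<bullet> x = of_int k}"
  have "0 \<in> K" using add_subgroupD[OF insert.prems(3)] by (auto simp: K_def intro!: bexI[of _ 0])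
  moreover have "x - y \<in> K" if xy: "x \<in> K" "y \<in> K" for x y
  proof -
    obtain u w where "u \<in> D" "d b \<bullet> u = of_int x" "w \<in> D" "d b \<bullet> w = of_int y"
      using xy by (auto simp: K_def)
    then show ?thesis using add_subgroupD(2)[OF insert.prems(3), of u w]
      by (auto simp: K_def inner_diff_right intro!: bexI[of _ "u - w"])
  qed
  ultimately obtain k where k: "k \<in> K" "\<And>x. x \<in> K \<Longrightarrow> k dvd x" using subgroup_int_generator by blast
  then obtain c where c: "c \<in> D" "d b \<bullet> c = of_int k" by (auto simp: K_def)
  have int: "\<exists>j::int. d b \<bullet> x = of_int k * of_int j" if "x \<in> D" for x
  proof -
    have "d b \<bullet> x \<in> \<int>" using that insert.prems(2) in_int_span_dual[OF d fin] by auto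
    then obtain i where "d b \<bullet> x = of_int i" by (auto elim: Ints_cases)
    moreover from this have "i \<in> K" using that by (auto simp: K_def)
    then obtain j where "i = k * j" using k(2) by (auto simp: dvd_def)
    ultimately show ?thesis by auto
  qed
  show ?case
  proof (cases "k = 0")
    case True
    then have "D = D0" using kern int by (auto simp: D0_def)
    then show ?thesis using B0 by blast
  next
    case False
    have "B0 \<subseteq> D0" using B0 int_span_base by auto
    have B0b: "d b \<bullet> x = 0" if "x \<in> span B0" for x
    proof -
      have "B0 \<subseteq> span B" using \<open>B0 \<subseteq> D0\<close> int_span_subset_span by (auto simp: D0_def)
      then have "x \<in> span B" using that span_mono[of B0 "span B"] by (auto simp: span_span)
      then show ?thesis by (rule b0)
    qed
    have "c \<notin> span B0" using B0b[of c] c False by auto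
    then have ind: "independent (insert c B0)" using B0 by (simp add: independent_insert)
    have cB0: "c \<notin> B0" using \<open>c \<notin> span B0\<close> span_base by blast
    have sub: "add_subgroup (int_span (insert c B0))" by (rule add_subgroup_int_span)
    have "D \<subseteq> int_span (insert c B0)"
    proof
      fix x assume x: "x \<in> D"
      obtain j where j: "d b \<bullet> x = of_int k * of_int j" using int[OF x] by auto
      have "x - of_int j *\<^sub>R c \<in> D0"
        using x c j by (intro kern) (auto simp: inner_diff_right add_subgroup_scale_int
            add_subgroupD[OF insert.prems(3)] insert.prems(3))
      then have "x - of_int j *\<^sub>R c \<in> int_span B0" using B0 by simp
      then have "x - of_int j *\<^sub>R c \<in> int_span (insert c B0)"
        using int_span_mono_subgroup[OF _ sub, of B0] int_span_base B0(1)
        by (meson finite.insertI insertI2 subset_iff)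
      moreover have "of_int j *\<^sub>R c \<in> int_span (insert c B0)"
        using add_subgroup_scale_int[OF sub] int_span_base B0(1) by (metis finite.insertI insertI1)
      ultimately show "x \<in> int_span (insert c B0)" using add_subgroupD(4)[OF sub] by fastforce
    qed
    moreover have "int_span (insert c B0) \<subseteq> D"
      using c \<open>B0 \<subseteq> D0\<close> insert.prems(3) by (intro int_span_mono_subgroup) (auto simp: D0_def)
    ultimately show ?thesis using ind B0(1) by blast
  qed
qed

text \<open>\<open>P\<close> is only a monoid, and the values \<open>exp (l u)\<close> must be
  matched exactly. The nonvanishing character passes to the group \<open>D\<close> of differences,
  which has a basis; logarithms are chosen there and extended linearly.\<close>

lemma character_extends_to_exp:
  fixes P :: "'a::euclidean_space set" and t :: "'a \<Rightarrow> complex"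
  assumes "finite B" "independent B" "P \<subseteq> int_span B"
    and P: "0 \<in> P" "\<And>u w. u \<in> P \<Longrightarrow> w \<in> P \<Longrightarrow> u + w \<in> P"
    and t: "\<And>u. u \<in> P \<Longrightarrow> t u \<noteq> 0" "\<And>u w. u \<in> P \<Longrightarrow> w \<in> P \<Longrightarrow> t (u + w) = t u * t w"
  obtains l where "linear l" "\<And>u. u \<in> P \<Longrightarrow> t u = exp (l u)"
proof -
  define D where "D = {u - w | u w. u \<in> P \<and> w \<in> P}"
  have "add_subgroup D"
    unfolding add_subgroup_def
  proof (intro conjI ballI)
    show "0 \<in> D" using P(1) by (force simp: D_def)
    fix x y assume "x \<in> D" "y \<in> D"
    then obtain u w u' w' where "u \<in> P" "w \<in> P" "u' \<in> P" "w' \<in> P" "x = u - w" "y = u' - w'"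
      by (auto simp: D_def)
    moreover from this have "x - y = (u + w') - (w + u')" by simp
    ultimately show "x - y \<in> D" using P(2) unfolding D_def by blast
  qed
  moreover have "D \<subseteq> int_span B" using assms(3) int_span_diff by (force simp: D_def)
  ultimately obtain A where A: "finite A" "independent A" "D = int_span A"
    using subgroup_of_lattice_basis[OF assms(1,2)] by metis
  have PD: "P \<subseteq> D" using P(1) by (force simp: D_def)
  \<comment> \<open>The quotient depends only on \<open>u - w\<close>: from
    \<open>u + w' = u' + w\<close> one gets \<open>t u * t w' = t u' * t w\<close>, and no value
    vanishes on \<open>P\<close>.\<close>
  obtain t' where t': "\<And>u w. u \<in> P \<Longrightarrow> w \<in> P \<Longrightarrow> t' (u - w) = t u / t w"
  proof
    fix u w assume uw: "u \<in> P" "w \<in> P"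
    let ?Q = "\<lambda>z. \<exists>u' w'. u' \<in> P \<and> w' \<in> P \<and> u - w = u' - w' \<and> z = t u' / t w'"
    have "z = t u / t w" if Qz: "?Q z" for z
    proof -
      obtain u' w' where *: "u' \<in> P" "w' \<in> P" "u - w = u' - w'" "z = t u' / t w'" using Qz by auto
      have "u + w' = u' + w" using *(3) by (simp add: algebra_simps)
      then have "t u * t w' = t u' * t w" using t(2) uw * by metis
      then show ?thesis using t(1) uw * by (simp add: frac_eq_eq)
    qed
    then show "(SOME z. ?Q z) = t u / t w" using someI[of ?Q "t u / t w"] uw by blast
  qed
  have t'P: "t' u = t u" if "u \<in> P" for u
    using t'[OF that P(1)] t(1)[OF P(1)] t(2)[OF P(1) P(1)] by simp
  have t'0: "t' x \<noteq> 0" if "x \<in> D" for x using that t' t(1) by (force simp: D_def)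
  have t'add: "t' (x + y) = t' x * t' y" if xy: "x \<in> D" "y \<in> D" for x y
  proof -
    obtain u w u' w' where *: "u \<in> P" "w \<in> P" "u' \<in> P" "w' \<in> P" "x = u - w" "y = u' - w'"
      using xy by (auto simp: D_def)
    have "x + y = (u + u') - (w + w')" unfolding *(5,6) by simp
    then have "t' (x + y) = t' ((u + u') - (w + w'))" by (simp only:)
    also have "\<dots> = t (u + u') / t (w + w')" using * P t' by blast
    also have "\<dots> = t' x * t' y" using * t' t by simp
    finally show ?thesis .
  qed
  obtain l :: "'a \<Rightarrow> complex" where l: "linear l" "\<forall>a\<in>A. l a = Ln (t' a)"
    using linear_independent_extend[OF A(2), of "\<lambda>a. Ln (t' a)"] by auto
  \<comment> \<open>The two characters agree on the basis \<open>A\<close>; since the set where they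
    agree is a subgroup, they agree on all of \<open>D\<close>.\<close>
  define E where "E = {x \<in> D. t' x = exp (l x)}"
  have t'z: "t' 0 = 1" using t'P[OF P(1)] t(1)[OF P(1)] t(2)[OF P(1) P(1)] by simp
  have "add_subgroup E"
    unfolding add_subgroup_def
  proof (intro conjI ballI)
    show "0 \<in> E" using t'z l(1) \<open>add_subgroup D\<close> by (simp add: E_def linear_0 add_subgroup_def)
    fix x y assume xy: "x \<in> E" "y \<in> E"
    have "t' (x - y) * t' y = t' x"
      using t'add[of "x - y" y] xy add_subgroupD[OF \<open>add_subgroup D\<close>] by (simp add: E_def)
    then have "t' (x - y) = exp (l x) / exp (l y)"
      using xy by (simp add: E_def nonzero_eq_divide_eq)
    then show "x - y \<in> E"
      using xy add_subgroupD(2)[OF \<open>add_subgroup D\<close>] by (simp add: E_def linear_diff[OF l(1)] exp_diff)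
  qed
  moreover have "A \<subseteq> E" using A int_span_base l(2) t'0 by (auto simp: E_def)
  ultimately have "D \<subseteq> E" using int_span_mono_subgroup A(3) by blast
  then have "t u = exp (l u)" if "u \<in> P" for u using that PD t'P by (auto simp: E_def)
  then show ?thesis using that l(1) by blast
qed

text \<open>By Cauchy-Schwarz a bound on the norm bounds every integral coordinate, which leaves
  finitely many coordinate tuples.\<close>

lemma finite_lattice_bounded:
  fixes B :: "'a::euclidean_space set"
  assumes "finite B" "independent B" "bounded S"
  shows "finite (int_span B \<inter> S)"
proof -
  obtain d where d: "dual_family B d" using dual_family_exists assms(2) .
  obtain R where R: "\<And>x. x \<in> S \<Longrightarrow> norm x \<le> R" using assms(3) by (auto simp: bounded_iff)
  define K where "K b = \<lceil>norm (d b) * R\<rceil>" for b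
  have "int_span B \<inter> S \<subseteq> (\<lambda>k. \<Sum>b\<in>B. of_int (k b) *\<^sub>R b) ` (PiE B (\<lambda>b. {- K b..K b}))"
  proof
    fix x assume x: "x \<in> int_span B \<inter> S"
    then obtain k where k: "x = (\<Sum>b\<in>B. of_int (k b) *\<^sub>R b)" by (auto simp: int_span_def)
    have "\<bar>of_int (k b)\<bar> \<le> norm (d b) * R" if "b \<in> B" for b
    proof -
      have "\<bar>of_int (k b)\<bar> = \<bar>d b \<bullet> x\<bar>" using dual_family_coord[OF d assms(1) that] k by simp
      also have "\<dots> \<le> norm (d b) * norm x" by (rule Cauchy_Schwarz_ineq2)
      also have "\<dots> \<le> norm (d b) * R" using R[of x] x by (intro mult_left_mono) auto
      finally show ?thesis .
    qed
    then have *: "\<bar>k b\<bar> \<le> K b" if "b \<in> B" for b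
      using that le_ceiling_iff unfolding K_def
      by (metis ceiling_mono ceiling_of_int of_int_abs)
    have "k b \<in> {- K b..K b}" if "b \<in> B" for b using *[OF that] by auto
    then show "x \<in> (\<lambda>k. \<Sum>b\<in>B. of_int (k b) *\<^sub>R b) ` (PiE B (\<lambda>b. {- K b..K b}))"
      using k by (intro image_eqI[of _ _ "restrict k B"]) auto
  qed
  moreover have "finite (PiE B (\<lambda>b. {- K b..K b}))" using assms(1) by (intro finite_PiE) auto
  ultimately show ?thesis using finite_surj by blast
qed

text \<open>The multiples of \<open>v\<close>, reduced modulo \<open>int_span G\<close> into the half-open box, repeat.\<close>

lemma multiple_in_int_span:
  fixes B G :: "'a::euclidean_space set"
  assumes "finite B" "independent B" "independent G" "G \<subseteq> int_span B"
  obtains m :: nat where "m > 0" "\<And>v. v \<in> int_span B \<Longrightarrow> v \<in> span G \<Longrightarrow> real m *\<^sub>R v \<in> int_span G"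
proof -
  have fG: "finite G" using assms(3) by (rule independent_imp_finite)
  obtain d where d: "dual_family G d" using dual_family_exists assms(3) .
  define box where "box = (\<lambda>a. \<Sum>g\<in>G. a g *\<^sub>R g) ` {a. \<forall>g\<in>G. 0 \<le> a g \<and> a g \<le> (1::real)}"
  have "bounded box"
  proof -
    have "norm x \<le> (\<Sum>g\<in>G. norm g)" if x: "x \<in> box" for x
    proof -
      obtain a where a: "x = (\<Sum>g\<in>G. a g *\<^sub>R g)" "\<And>g. g \<in> G \<Longrightarrow> 0 \<le> a g \<and> a g \<le> 1"
        using x unfolding box_def by blast
      have "norm x \<le> (\<Sum>g\<in>G. norm (a g *\<^sub>R g))" using a(1) norm_sum by blast
      also have "\<dots> \<le> (\<Sum>g\<in>G. norm g)"
        using a(2) by (intro sum_mono) (simp add: mult_left_le_one_le)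
      finally show ?thesis .
    qed
    then show ?thesis unfolding bounded_iff by blast
  qed
  define X where "X = int_span B \<inter> box"
  have fX: "finite X" unfolding X_def using finite_lattice_bounded[OF assms(1,2) \<open>bounded box\<close>] .
  show ?thesis
  proof
    \<comment> \<open>Two of the first multiples of \<open>v\<close> have equal remainders, at
      indices that differ by at most \<open>card X\<close>. The factorial is divisible by every such
      difference, so one \<open>m\<close> serves all \<open>v\<close>.\<close>
    show "fact (card X) > (0::nat)" by simp
    fix v assume v: "v \<in> int_span B" "v \<in> span G"
    define r where "r k = (\<Sum>g\<in>G. frac (real k * (d g \<bullet> v)) *\<^sub>R g)" for k
    have kv: "real k *\<^sub>R v - r k \<in> int_span G" for k
    proof -
      have "real k *\<^sub>R v = (\<Sum>g\<in>G. (real k * (d g \<bullet> v)) *\<^sub>R g)"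
        using arg_cong[OF dual_family_expand[OF d fG v(2)], of "\<lambda>x. real k *\<^sub>R x"]
        by (simp add: scaleR_sum_right)
      then have "real k *\<^sub>R v - r k = (\<Sum>g\<in>G. of_int \<lfloor>real k * (d g \<bullet> v)\<rfloor> *\<^sub>R g)"
        by (simp add: r_def frac_def scaleR_diff_left sum_subtractf)
      then show ?thesis unfolding int_span_def by auto
    qed
    have GB: "int_span G \<subseteq> int_span B"
      using int_span_mono_subgroup[OF assms(4) add_subgroup_int_span] .
    have "r k \<in> X" for k
    proof -
      have "real k *\<^sub>R v \<in> int_span B"
        by (rule add_subgroup_scale_nat[OF add_subgroup_int_span v(1)])
      then have "real k *\<^sub>R v - (real k *\<^sub>R v - r k) \<in> int_span B"
        using kv GB int_span_diff by blast
      then have "r k \<in> int_span B" by simp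
      moreover have "r k \<in> box" unfolding box_def r_def
        by (rule imageI) (auto simp: less_imp_le[OF frac_lt_1])
      ultimately show ?thesis by (simp add: X_def)
    qed
    \<comment> \<open>The index set has \<open>card X + 1\<close> elements, one too many for
      \<open>r\<close> to be injective.\<close>
    then have "r ` {..card X} \<subseteq> X" by auto
    then have "card (r ` {..card X}) < card {..card X}"
      using card_mono[OF fX, of "r ` {..card X}"] by simp
    then have "\<not> inj_on r {..card X}" using pigeonhole by blast
    then obtain i j where ij: "i < j" "j \<le> card X" "r i = r j"
      by (auto simp: inj_on_def) (metis linorder_neqE_nat)
    have "(real j *\<^sub>R v - r j) - (real i *\<^sub>R v - r i) \<in> int_span G" using kv int_span_diff by blast
    then have *: "real (j - i) *\<^sub>R v \<in> int_span G"
      using ij by (simp add: scaleR_diff_left of_nat_diff)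
    have "(j - i) dvd fact (card X)" using ij by (intro dvd_fact) auto
    then obtain q where q: "fact (card X) = q * (j - i)" by (metis dvd_def mult.commute)
    have "real q *\<^sub>R (real (j - i) *\<^sub>R v) \<in> int_span G"
      using add_subgroup_scale_nat[OF add_subgroup_int_span *] .
    then show "real (fact (card X)) *\<^sub>R v \<in> int_span G" by (simp only: q of_nat_mult scaleR_scaleR)
  qed
qed

lemma dual_lattice_subgroup: "add_subgroup (dual_lattice N)"
  by (auto simp: add_subgroup_def dual_lattice_def inner_diff_left)

lemma dual_lattice_antimono: "N' \<subseteq> N \<Longrightarrow> dual_lattice N \<subseteq> dual_lattice N'"
  by (auto simp: dual_lattice_def)

text \<open>Because \<open>B\<close> spans, \<open>u\<close> is the combination of the vectors
  \<open>d b\<close> with coefficients \<open>u \<bullet> b\<close>, and these are integers for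
  \<open>u\<close> in the dual lattice.\<close>

lemma dual_lattice_int_span:
  assumes "dual_family B d" "finite B" "span B = UNIV"
  shows "dual_lattice (int_span B) = int_span (d ` B)"
proof
  have inj: "inj_on d B" using dual_family_dual_independent assms by blast
  show "dual_lattice (int_span B) \<subseteq> int_span (d ` B)"
  proof
    fix u assume u: "u \<in> dual_lattice (int_span B)"
    have "u \<bullet> x = (\<Sum>b\<in>B. (u \<bullet> b) *\<^sub>R d b) \<bullet> x" for x
    proof -
      have "u \<bullet> x = u \<bullet> (\<Sum>b\<in>B. (d b \<bullet> x) *\<^sub>R b)"
        by (rule arg_cong[OF dual_family_expand[OF assms(1,2)]]) (simp add: assms(3))
      then show ?thesis by (simp add: inner_sum_right inner_sum_left mult.commute)
    qed
    then have "u = (\<Sum>b\<in>B. (u \<bullet> b) *\<^sub>R d b)" by (metis vector_eq_rdot)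
    moreover have "(\<Sum>b\<in>B. (u \<bullet> b) *\<^sub>R d b) \<in> int_span (d ` B)"
      using u int_span_base[OF assms(2)] assms(2)
      by (intro add_subgroup_sum add_subgroup_scale_Ints)
        (auto simp: add_subgroup_int_span dual_lattice_def intro!: int_span_base)
    ultimately show "u \<in> int_span (d ` B)" by simp
  qed
  show "int_span (d ` B) \<subseteq> dual_lattice (int_span B)"
    using in_int_span_dual[OF assms(1,2)]
    by (intro int_span_mono_subgroup dual_lattice_subgroup) (auto simp: dual_lattice_def)
qed

section \<open>Simplicial cones\<close>

lemma in_independent_span_subset:
  assumes "independent G" "A \<subseteq> G" "g \<in> G" "g \<in> span A"
  shows "g \<in> A"
proof (rule ccontr)
  assume "g \<notin> A"
  then have "A \<subseteq> G - {g}" using assms(2) by auto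
  then have "g \<in> span (G - {g})" using assms(4) span_mono by blast
  then show False using assms(1,3) by (auto simp: dependent_def)
qed

lemma convex_cone_hull_sum:
  assumes "\<And>s. s \<in> S \<Longrightarrow> 0 \<le> a s" "\<And>s. s \<in> S \<Longrightarrow> f s \<in> convex_cone hull T"
  shows "(\<Sum>s\<in>S. a s *\<^sub>R f s) \<in> convex_cone hull T"
proof (cases "finite S")
  case True
  then show ?thesis using assms
    by (induction S) (auto simp: convex_cone_hull_contains_0 convex_cone_hull_add convex_cone_hull_mul)
qed (simp add: convex_cone_hull_contains_0)

lemma convex_cone_hull_finite:
  fixes S :: "'a::real_vector set"
  assumes "finite S"
  shows "convex_cone hull S = {\<Sum>s\<in>S. a s *\<^sub>R s | a. \<forall>s\<in>S. 0 \<le> a s}" (is "_ = ?R")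
proof
  show "?R \<subseteq> convex_cone hull S"
    using convex_cone_hull_sum[of S _ "\<lambda>s. s" S] by (auto simp: hull_inc)
  show "convex_cone hull S \<subseteq> ?R"
  proof (rule hull_minimal)
    show "S \<subseteq> ?R"
    proof
      fix x assume "x \<in> S"
      have "(\<Sum>s\<in>S. (if s = x then 1 else 0) *\<^sub>R s) = (\<Sum>s\<in>S. if s = x then s else 0)"
        by (rule sum.cong) auto
      then show "x \<in> ?R" using \<open>x \<in> S\<close> assms
        by (intro CollectI exI[of _ "\<lambda>s. if s = x then 1 else 0"]) auto
    qed
    have "convex ?R" unfolding convex_def
    proof (intro ballI allI impI)
      fix x y and u v :: real assume xy: "x \<in> ?R" "y \<in> ?R" and uv: "0 \<le> u" "0 \<le> v" "u + v = 1"
      obtain a b where "\<forall>s\<in>S. 0 \<le> a s" "\<forall>s\<in>S. 0 \<le> b s" "x = (\<Sum>s\<in>S. a s *\<^sub>R s)" "y = (\<Sum>s\<in>S. b s *\<^sub>R s)"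
        using xy by blast
      then show "u *\<^sub>R x + v *\<^sub>R y \<in> ?R" using uv
        by (intro CollectI exI[of _ "\<lambda>s. u * a s + v * b s"])
          (auto simp: scaleR_sum_right sum.distrib scaleR_add_left)
    qed
    moreover have "conic ?R" unfolding conic_def
    proof (intro ballI allI impI)
      fix x and c :: real assume x: "x \<in> ?R" and c: "0 \<le> c"
      obtain a where "\<forall>s\<in>S. 0 \<le> a s" "x = (\<Sum>s\<in>S. a s *\<^sub>R s)" using x by blast
      then show "c *\<^sub>R x \<in> ?R" using c
        by (intro CollectI exI[of _ "\<lambda>s. c * a s"]) (auto simp: scaleR_sum_right)
    qed
    moreover have "?R \<noteq> {}" by (auto intro: exI[of _ "\<lambda>_. 0"])
    ultimately show "convex_cone ?R" by (simp add: convex_cone_def)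
  qed
qed

lemma convex_cone_hull_subset_span: "convex_cone hull S \<subseteq> span S"
  by (rule hull_minimal) (auto simp: span_base convex_cone_def subspace_imp_convex conic_def span_scale
      intro: exI[of _ 0] span_zero)

lemma in_convex_cone_hull_dual:
  assumes "dual_family G d" "finite G"
  shows "x \<in> convex_cone hull G \<longleftrightarrow> x \<in> span G \<and> (\<forall>g\<in>G. 0 \<le> d g \<bullet> x)"
proof
  assume x: "x \<in> convex_cone hull G"
  then obtain a where a: "\<forall>s\<in>G. 0 \<le> a s" "x = (\<Sum>s\<in>G. a s *\<^sub>R s)"
    using convex_cone_hull_finite[OF assms(2)] by blast
  then show "x \<in> span G \<and> (\<forall>g\<in>G. 0 \<le> d g \<bullet> x)"
    using x convex_cone_hull_subset_span dual_family_coord[OF assms] by auto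
next
  assume x: "x \<in> span G \<and> (\<forall>g\<in>G. 0 \<le> d g \<bullet> x)"
  have "x = (\<Sum>g\<in>G. (d g \<bullet> x) *\<^sub>R g)" using dual_family_expand[OF assms] x by blast
  also have "\<dots> \<in> convex_cone hull G" using x by (intro convex_cone_hull_sum) (auto simp: hull_inc)
  finally show "x \<in> convex_cone hull G" .
qed

text \<open>The sum of the coordinates belonging to the omitted generators is nonnegative on the
  cone. A sum of nonnegative terms vanishes only if every term does, so this supporting hyperplane
  cuts out exactly the cone over \<open>G'\<close>.\<close>

lemma simplicial_cone_face:
  fixes G :: "'a::euclidean_space set"
  assumes "independent G" "G' \<subseteq> G"
  shows "convex_cone hull G' face_of convex_cone hull G"
proof -
  have fG: "finite G" using assms(1) by (rule independent_imp_finite)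
  then have fG': "finite G'" using assms(2) finite_subset by blast
  obtain d where d: "dual_family G d" using dual_family_exists assms(1) .
  have d': "dual_family G' d" using dual_family_subset[OF d assms(2)] .
  define u where "u = (\<Sum>g\<in>G - G'. d g)"
  have "convex_cone hull G \<inter> {x. u \<bullet> x = 0} face_of convex_cone hull G"
  proof (rule face_of_Int_supporting_hyperplane_ge[OF convex_convex_cone_hull])
    fix x assume "x \<in> convex_cone hull G"
    then show "u \<bullet> x \<ge> 0" using in_convex_cone_hull_dual[OF d fG]
      by (auto simp: u_def inner_sum_left intro!: sum_nonneg)
  qed
  moreover have "convex_cone hull G \<inter> {x. u \<bullet> x = 0} = convex_cone hull G'"
  proof (intro equalityI subsetI)
    fix x assume x: "x \<in> convex_cone hull G \<inter> {x. u \<bullet> x = 0}"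
    then have pos: "\<forall>g\<in>G. 0 \<le> d g \<bullet> x" and sp: "x \<in> span G"
      using in_convex_cone_hull_dual[OF d fG] by auto
    have "(\<Sum>g\<in>G - G'. d g \<bullet> x) = 0" using x by (simp add: u_def inner_sum_left)
    then have z: "\<forall>g\<in>G - G'. d g \<bullet> x = 0"
      using pos fG by (subst (asm) sum_nonneg_eq_0_iff) auto
    have "x = (\<Sum>g\<in>G. (d g \<bullet> x) *\<^sub>R g)" by (rule dual_family_expand[OF d fG sp])
    also have "\<dots> = (\<Sum>g\<in>G'. (d g \<bullet> x) *\<^sub>R g)"
      using z fG assms(2) by (intro sum.mono_neutral_right) auto
    also have "\<dots> \<in> convex_cone hull G'"
      using pos assms(2) by (intro convex_cone_hull_sum) (auto simp: hull_inc)
    finally show "x \<in> convex_cone hull G'" .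
  next
    fix x assume x: "x \<in> convex_cone hull G'"
    have "d g \<bullet> x = 0" if g: "g \<in> G - G'" for g
    proof -
      have "x = (\<Sum>h\<in>G'. (d h \<bullet> x) *\<^sub>R h)"
        using dual_family_expand[OF d' fG'] x convex_cone_hull_subset_span by blast
      then have "d g \<bullet> x = (\<Sum>h\<in>G'. (d h \<bullet> x) * (d g \<bullet> h))"
        by (metis (no_types, lifting) inner_scaleR_right inner_sum_right sum.cong)
      also have "\<dots> = 0"
      proof (rule sum.neutral, rule ballI)
        fix h assume "h \<in> G'"
        then have "h \<in> G" "g \<noteq> h" using g assms(2) by auto
        then have "d g \<bullet> h = 0" using d g by (simp add: dual_family_def)
        then show "(d h \<bullet> x) * (d g \<bullet> h) = 0" by simp
      qed
      finally show ?thesis .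
    qed
    then show "x \<in> convex_cone hull G \<inter> {x. u \<bullet> x = 0}"
      using x hull_mono[OF assms(2)] by (auto simp: u_def inner_sum_left)
  qed
  ultimately show ?thesis by simp
qed

text \<open>Divide \<open>s\<close> by the largest possible \<open>k\<close>. Such a
  \<open>k\<close> exists because some coordinate of \<open>s\<close> is a nonzero integer, and it
  bounds every divisor; a further divisor of the quotient would contradict maximality.\<close>

lemma primitive_multiple:
  fixes B :: "'a::euclidean_space set"
  assumes "finite B" "independent B" "s \<in> int_span B" "s \<noteq> 0"
  obtains w and k :: nat where "primitive_in (int_span B) w" "k > 0" "s = real k *\<^sub>R w"
proof -
  obtain d where d: "dual_family B d" using dual_family_exists assms(2) .
  obtain b where b: "b \<in> B" "d b \<bullet> s \<noteq> 0"
  proof (rule ccontr)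
    assume "\<not> thesis"
    then have "\<forall>b\<in>B. d b \<bullet> s = 0" using that by blast
    moreover have "s = (\<Sum>b\<in>B. (d b \<bullet> s) *\<^sub>R b)"
      using dual_family_expand[OF d assms(1)] assms(3) int_span_subset_span by blast
    ultimately show False using assms(4) by simp
  qed
  define K where "K = {k. k > 0 \<and> (\<exists>w\<in>int_span B. s = real k *\<^sub>R w)}"
  have "k \<le> nat \<lceil>\<bar>d b \<bullet> s\<bar>\<rceil>" if k: "k \<in> K" for k
  proof -
    obtain w where w: "w \<in> int_span B" "s = real k *\<^sub>R w" using k by (auto simp: K_def)
    have "d b \<bullet> w \<in> \<int>" using in_int_span_dual[OF d assms(1)] w b by auto
    moreover have "d b \<bullet> w \<noteq> 0" using b w by auto
    ultimately have "1 \<le> \<bar>d b \<bullet> w\<bar>" using Ints_nonzero_abs_ge1 by blast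
    then have "real k * 1 \<le> real k * \<bar>d b \<bullet> w\<bar>" by (intro mult_left_mono) auto
    also have "\<dots> = \<bar>d b \<bullet> s\<bar>" using w by (simp add: abs_mult)
    finally have "real k \<le> \<bar>d b \<bullet> s\<bar>" by simp
    then have "real k \<le> of_int \<lceil>\<bar>d b \<bullet> s\<bar>\<rceil>" using le_of_int_ceiling order_trans by blast
    then have "int k \<le> \<lceil>\<bar>d b \<bullet> s\<bar>\<rceil>" by simp
    then show ?thesis by simp
  qed
  then have "finite K" using finite_nat_set_iff_bounded_le by blast
  moreover have "1 \<in> K" using assms(3) by (auto simp: K_def)
  ultimately have "Max K \<in> K" and max: "\<And>k. k \<in> K \<Longrightarrow> k \<le> Max K" using Max_in by auto
  then obtain w where w: "Max K > 0" "w \<in> int_span B" "s = real (Max K) *\<^sub>R w"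
    unfolding K_def by blast
  have "primitive_in (int_span B) w" unfolding primitive_in_def
  proof (intro conjI ballI allI impI)
    show "w \<noteq> 0" using w(3) assms(4) by auto
    fix v and k :: nat assume v: "v \<in> int_span B" "w = real k *\<^sub>R v"
    then have "k \<noteq> 0" using \<open>w \<noteq> 0\<close> by auto
    moreover have "s = real (Max K * k) *\<^sub>R v" using w v by simp
    ultimately have "Max K * k \<in> K" using v(1) w(1) by (subst K_def) auto
    then have "Max K * k \<le> Max K * 1" using max by simp
    then have "k \<le> 1" using w(1) by (metis mult_le_cancel1)
    then show "k = 1" using \<open>k \<noteq> 0\<close> by simp
  qed (use w in auto)
  then show ?thesis using that w by blast
qed

lemma cone_gens_subset: "cone_gens N \<sigma> \<subseteq> \<sigma>" "cone_gens N \<sigma> \<subseteq> N"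
  by (auto simp: cone_gens_def primitive_in_def face_of_def)

lemma cone_gens_face: "\<tau> face_of \<sigma> \<Longrightarrow> cone_gens N \<tau> \<subseteq> cone_gens N \<sigma>"
  unfolding cone_gens_def using face_of_trans by blast

text \<open>If a point of the ray through \<open>s\<close> lies strictly between \<open>a\<close>
  and \<open>b\<close>, compare its coefficients: irredundancy bounds the coefficient of
  \<open>s\<close> from below, pointedness then kills the coefficients of all other generators, and
  by positivity they vanish for \<open>a\<close> and \<open>b\<close> separately.\<close>

lemma irredundant_generator_face:
  fixes S :: "'a::euclidean_space set"
  assumes "finite S" "s \<in> S"
    and irr: "\<And>s. s \<in> S \<Longrightarrow> s \<notin> convex_cone hull (S - {s})"
    and pointed: "\<And>v. v \<in> convex_cone hull S \<Longrightarrow> - v \<in> convex_cone hull S \<Longrightarrow> v = 0"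
  shows "(\<lambda>c. c *\<^sub>R s) ` {0..} face_of convex_cone hull S" (is "?\<rho> face_of _")
  unfolding face_of_def
proof (intro conjI ballI impI)
  show "?\<rho> \<subseteq> convex_cone hull S" using assms(2) by (auto simp: convex_cone_hull_mul hull_inc)
  have "?\<rho> = convex_cone hull {s}"
    using convex_cone_hull_finite[of "{s}"] by (auto intro: exI[of _ "\<lambda>_. _"])
  then show "convex ?\<rho>" using convex_convex_cone_hull by metis
  fix a b x assume ab: "a \<in> convex_cone hull S" "b \<in> convex_cone hull S" and x: "x \<in> ?\<rho>"
    and seg: "x \<in> open_segment a b"
  obtain c where c: "c \<ge> 0" "x = c *\<^sub>R s" using x by auto
  obtain \<alpha> where \<alpha>: "\<forall>s\<in>S. 0 \<le> \<alpha> s" "a = (\<Sum>s\<in>S. \<alpha> s *\<^sub>R s)"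
    using ab(1) convex_cone_hull_finite[OF assms(1)] by blast
  obtain \<beta> where \<beta>: "\<forall>s\<in>S. 0 \<le> \<beta> s" "b = (\<Sum>s\<in>S. \<beta> s *\<^sub>R s)"
    using ab(2) convex_cone_hull_finite[OF assms(1)] by blast
  obtain t where t: "0 < t" "t < 1" "x = (1 - t) *\<^sub>R a + t *\<^sub>R b" using seg by (auto simp: in_segment)
  define \<gamma> where "\<gamma> s = (1 - t) * \<alpha> s + t * \<beta> s" for s
  have \<gamma>pos: "0 \<le> \<gamma> s" if "s \<in> S" for s using \<alpha> \<beta> t that by (simp add: \<gamma>_def)
  have "x = (\<Sum>s\<in>S. \<gamma> s *\<^sub>R s)"
    unfolding t(3) \<alpha>(2) \<beta>(2) by (simp add: \<gamma>_def scaleR_sum_right scaleR_add_left sum.distrib)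
  also have "\<dots> = \<gamma> s *\<^sub>R s + (\<Sum>s\<in>S-{s}. \<gamma> s *\<^sub>R s)" using assms(1,2) by (simp add: sum.remove)
  finally have rest: "(\<Sum>r\<in>S-{s}. \<gamma> r *\<^sub>R r) = (c - \<gamma> s) *\<^sub>R s" using c by (simp add: algebra_simps)
  \<comment> \<open>Otherwise dividing by \<open>c - \<gamma> s\<close> would write \<open>s\<close>
    through the remaining generators.\<close>
  have nonpos: "c - \<gamma> s \<le> 0"
  proof (rule ccontr)
    assume "\<not> c - \<gamma> s \<le> 0"
    then have "s = (1 / (c - \<gamma> s)) *\<^sub>R (\<Sum>r\<in>S-{s}. \<gamma> r *\<^sub>R r)" unfolding rest by simp
    also have "\<dots> \<in> convex_cone hull (S - {s})"
      using \<open>\<not> c - \<gamma> s \<le> 0\<close> \<gamma>pos by (intro convex_cone_hull_mul convex_cone_hull_sum) (auto simp: hull_inc)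
    finally show False using irr assms(2) by blast
  qed
  \<comment> \<open>Now both \<open>\<gamma> r *\<^sub>R r\<close> and its negative lie in the cone,
    which contains no line.\<close>
  have \<gamma>0: "\<gamma> r = 0" if r: "r \<in> S - {s}" for r
  proof -
    have "- (\<gamma> r *\<^sub>R r) = (\<Sum>q\<in>S-{s}-{r}. \<gamma> q *\<^sub>R q) + (\<gamma> s - c) *\<^sub>R s"
      using rest r assms(1) by (simp add: sum.remove[of "S-{s}" r] algebra_simps)
    also have "\<dots> \<in> convex_cone hull S"
      using nonpos \<gamma>pos assms(2)
      by (intro convex_cone_hull_add convex_cone_hull_sum convex_cone_hull_mul) (auto simp: hull_inc)
    finally have "- (\<gamma> r *\<^sub>R r) \<in> convex_cone hull S" .
    moreover have "\<gamma> r *\<^sub>R r \<in> convex_cone hull S"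
      using \<gamma>pos r by (intro convex_cone_hull_mul) (auto simp: hull_inc)
    ultimately have "\<gamma> r *\<^sub>R r = 0" using pointed by blast
    moreover have "r \<noteq> 0" using irr[of r] r convex_cone_hull_contains_0 by auto
    ultimately show ?thesis by simp
  qed
  have "\<alpha> r = 0 \<and> \<beta> r = 0" if r: "r \<in> S - {s}" for r
  proof -
    have "(1 - t) * \<alpha> r \<ge> 0" "t * \<beta> r \<ge> 0" using \<alpha> \<beta> t r by auto
    then have "(1 - t) * \<alpha> r = 0" "t * \<beta> r = 0" using \<gamma>0[OF r] unfolding \<gamma>_def by linarith+
    then show ?thesis using t by auto
  qed
  then have "a = \<alpha> s *\<^sub>R s" "b = \<beta> s *\<^sub>R s"
    unfolding \<alpha>(2) \<beta>(2) using assms(1,2) by (auto simp: sum.remove)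
  then show "a \<in> ?\<rho>" "b \<in> ?\<rho>" using \<alpha> \<beta> assms(2) by auto
qed

text \<open>A generating set of least cardinality is irredundant, so each of its members spans a
  one-dimensional face. The primitive lattice vector on that ray is one of \<open>cone_gens\<close>
  and has the member as a positive multiple.\<close>

lemma rational_cone_generated:
  fixes B :: "'a::euclidean_space set"
  assumes "finite B" "independent B" and rat: "rational_cone (int_span B) \<sigma>"
  shows "\<sigma> = convex_cone hull (cone_gens (int_span B) \<sigma>)"
proof
  let ?N = "int_span B"
  let ?P = "\<lambda>S. finite S \<and> S \<subseteq> ?N \<and> \<sigma> = convex_cone hull S"
  obtain S0 where "?P S0" using rat by (auto simp: rational_cone_def)
  then obtain S where S: "finite S" "S \<subseteq> ?N" "\<sigma> = convex_cone hull S"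
    and min: "\<And>S'. ?P S' \<Longrightarrow> card S \<le> card S'"
    using ex_has_least_nat[of ?P S0 card] by blast
  have pointed: "v = 0" if "v \<in> convex_cone hull S" "- v \<in> convex_cone hull S" for v
    using rat that S(3) by (auto simp: rational_cone_def)
  have irr: "s \<notin> convex_cone hull (S - {s})" if s: "s \<in> S" for s
  proof
    assume "s \<in> convex_cone hull (S - {s})"
    then have "convex_cone hull S = convex_cone hull (S - {s})"
      using hull_redundant[of s convex_cone "S - {s}"] s by (simp add: insert_absorb)
    then have "card S \<le> card (S - {s})" using min[of "S - {s}"] S by auto
    then show False using s S(1) card_Diff1_less[OF S(1) s] by simp
  qed
  have "S \<subseteq> convex_cone hull (cone_gens ?N \<sigma>)"
  proof
    fix s assume s: "s \<in> S"
    then have "s \<noteq> 0" using irr[of s] convex_cone_hull_contains_0 by auto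
    then obtain w and k :: nat where w: "primitive_in ?N w" "k > 0" "s = real k *\<^sub>R w"
      using primitive_multiple[OF assms(1,2), of s] s S(2) by blast
    let ?\<rho> = "(\<lambda>c. c *\<^sub>R s) ` {0..}"
    have "?\<rho> face_of \<sigma>" using irredundant_generator_face[OF S(1) s irr pointed] S(3) by simp
    moreover have "dim ?\<rho> = 1"
    proof -
      have "span ?\<rho> = span {s}"
      proof (rule subset_antisym)
        show "span ?\<rho> \<subseteq> span {s}" by (rule span_minimal) (auto simp: span_base span_scale)
        have "s \<in> ?\<rho>" by (rule image_eqI[of _ _ 1]) auto
        then show "span {s} \<subseteq> span ?\<rho>" by (intro span_mono) auto
      qed
      then have "dim ?\<rho> = dim {s}" by (metis dim_span)
      then show ?thesis using \<open>s \<noteq> 0\<close> by simp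
    qed
    moreover have "w \<in> ?\<rho>" using w by (intro image_eqI[of _ _ "1 / real k"]) auto
    ultimately have "w \<in> cone_gens ?N \<sigma>" using w(1) by (auto simp: cone_gens_def)
    then show "s \<in> convex_cone hull (cone_gens ?N \<sigma>)"
      unfolding w(3) by (intro convex_cone_hull_mul hull_inc) auto
  qed
  then show "\<sigma> \<subseteq> convex_cone hull (cone_gens ?N \<sigma>)"
    unfolding S(3)[symmetric] by (subst S(3), intro hull_minimal convex_cone_convex_cone_hull)
  have "convex_cone hull (cone_gens ?N \<sigma>) \<subseteq> convex_cone hull S"
    using cone_gens_subset(1)[of ?N \<sigma>] S(3) by (intro hull_minimal convex_cone_convex_cone_hull) simp
  then show "convex_cone hull (cone_gens ?N \<sigma>) \<subseteq> \<sigma>" using S(3) by simp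
qed

section \<open>Affine varieties and monoid algebras\<close>

text \<open>Products are required only up to equality on \<open>V\<close>: the coordinate functions
  are total functions, while a point of \<open>Spec\<close> is multiplicative only as a member of
  \<open>V\<close>.\<close>

definition mult_system :: "'x set \<Rightarrow> ('x \<Rightarrow> complex) set \<Rightarrow> bool" where
  "mult_system V R \<longleftrightarrow> (\<exists>a\<in>R. \<forall>x\<in>V. a x \<noteq> 0) \<and>
     (\<forall>a\<in>R. \<forall>b\<in>R. \<exists>c\<in>R. \<forall>x\<in>V. c x = a x * b x)"

text \<open>The products in \<open>R\<close> make the principal open sets stable under intersection,
  so the generated topology consists of their unions.\<close>

lemma openin_affine_fspace:
  assumes "mult_system V R"
  shows "openin (zariski (affine_fspace V R)) U \<longleftrightarrow>
    U \<subseteq> V \<and> (\<forall>x\<in>U. \<exists>a\<in>R. a x \<noteq> 0 \<and> (\<forall>y\<in>V. a y \<noteq> 0 \<longrightarrow> y \<in> U))" (is "_ \<longleftrightarrow> ?P U")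
proof -
  let ?B = "{{x \<in> V. a x \<noteq> 0} | a. a \<in> R}"
  have "?P U" if "generate_topology_on ?B U" for U
    using that
  proof (induction rule: generate_topology_on.induct)
    case (Int S T)
    have "\<exists>c\<in>R. c x \<noteq> 0 \<and> (\<forall>y\<in>V. c y \<noteq> 0 \<longrightarrow> y \<in> S \<inter> T)" if x: "x \<in> S \<inter> T" for x
    proof -
      obtain a b where ab: "a \<in> R" "a x \<noteq> 0" "\<forall>y\<in>V. a y \<noteq> 0 \<longrightarrow> y \<in> S"
        "b \<in> R" "b x \<noteq> 0" "\<forall>y\<in>V. b y \<noteq> 0 \<longrightarrow> y \<in> T"
        using bspec[OF conjunct2[OF Int.IH(1)], of x] bspec[OF conjunct2[OF Int.IH(2)], of x] x by blast
      obtain c where "c \<in> R" "\<forall>x\<in>V. c x = a x * b x" using assms ab(1,4) unfolding mult_system_def by blast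
      then show ?thesis using ab x Int by (intro bexI[of _ c]) auto
    qed
    then show ?case using Int by blast
  next
    case (UN K)
    show ?case
    proof (intro conjI ballI)
      show "\<Union>K \<subseteq> V" using UN by blast
      fix x assume "x \<in> \<Union>K"
      then obtain k where k: "k \<in> K" "x \<in> k" by blast
      then obtain a where "a \<in> R" "a x \<noteq> 0" "\<forall>y\<in>V. a y \<noteq> 0 \<longrightarrow> y \<in> k" using UN by meson
      then show "\<exists>a\<in>R. a x \<noteq> 0 \<and> (\<forall>y\<in>V. a y \<noteq> 0 \<longrightarrow> y \<in> \<Union>K)" using k by blast
    qed
  qed auto
  moreover have "generate_topology_on ?B U" if U: "?P U"
  proof -
    have "U = \<Union>{K \<in> ?B. K \<subseteq> U}"
    proof (intro equalityI subsetI)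
      fix x assume x: "x \<in> U"
      then obtain a where a: "a \<in> R" "a x \<noteq> 0" "\<forall>y\<in>V. a y \<noteq> 0 \<longrightarrow> y \<in> U" using U by blast
      then show "x \<in> \<Union>{K \<in> ?B. K \<subseteq> U}" using x U by (intro UnionI[of "{x \<in> V. a x \<noteq> 0}"]) auto
    qed auto
    moreover have "generate_topology_on ?B (\<Union>{K \<in> ?B. K \<subseteq> U})"
      by (intro generate_topology_on.UN generate_topology_on.Basis) auto
    ultimately show ?thesis by simp
  qed
  moreover have "openin (zariski (affine_fspace V R)) U \<longleftrightarrow> generate_topology_on ?B U"
    by (simp add: affine_fspace_def Let_def openin_topology_generated_by_iff)
  ultimately show ?thesis by blast
qed

lemma topspace_affine_fspace:
  assumes "mult_system V R"
  shows "pts (affine_fspace V R) = V"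
proof
  show "pts (affine_fspace V R) \<subseteq> V"
    using openin_affine_fspace[OF assms] openin_topspace by blast
  have "openin (zariski (affine_fspace V R)) V"
    using openin_affine_fspace[OF assms] assms unfolding mult_system_def by blast
  then show "V \<subseteq> pts (affine_fspace V R)" by (rule openin_subset)
qed

lemma openin_sub_affine_fspace:
  assumes "mult_system V R"
  shows "openin (zariski (subfspace (affine_fspace V R) Y)) U \<longleftrightarrow>
    U \<subseteq> V \<inter> Y \<and> (\<forall>x\<in>U. \<exists>a\<in>R. a x \<noteq> 0 \<and> (\<forall>y\<in>V \<inter> Y. a y \<noteq> 0 \<longrightarrow> y \<in> U))" (is "_ \<longleftrightarrow> ?P")
proof
  assume "openin (zariski (subfspace (affine_fspace V R) Y)) U"
  then obtain T where "openin (zariski (affine_fspace V R)) T" "U = T \<inter> Y"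
    by (auto simp: subfspace_def openin_subtopology)
  then have T: "T \<subseteq> V" "\<And>x. x \<in> T \<Longrightarrow> \<exists>a\<in>R. a x \<noteq> 0 \<and> (\<forall>y\<in>V. a y \<noteq> 0 \<longrightarrow> y \<in> T)" "U = T \<inter> Y"
    unfolding openin_affine_fspace[OF assms] by auto
  show ?P
  proof (intro conjI ballI)
    show "U \<subseteq> V \<inter> Y" using T by blast
    fix x assume "x \<in> U"
    then obtain a where "a \<in> R" "a x \<noteq> 0" "\<forall>y\<in>V. a y \<noteq> 0 \<longrightarrow> y \<in> T" using T by blast
    then show "\<exists>a\<in>R. a x \<noteq> 0 \<and> (\<forall>y\<in>V \<inter> Y. a y \<noteq> 0 \<longrightarrow> y \<in> U)" using T(3) by blast
  qed
next
  assume U: ?P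
  \<comment> \<open>This is the union of all principal open sets whose trace on \<open>Y\<close>
    lies in \<open>U\<close>, hence the largest open set that cuts out \<open>U\<close>.\<close>
  define T where "T = {x \<in> V. x \<in> U \<or> x \<notin> Y \<and> (\<exists>a\<in>R. a x \<noteq> 0 \<and> (\<forall>y\<in>V \<inter> Y. a y \<noteq> 0 \<longrightarrow> y \<in> U))}"
  have *: "\<exists>a\<in>R. a x \<noteq> 0 \<and> (\<forall>y\<in>V \<inter> Y. a y \<noteq> 0 \<longrightarrow> y \<in> U)" if "x \<in> T" for x
    using that U by (auto simp: T_def)
  have "openin (zariski (affine_fspace V R)) T"
    unfolding openin_affine_fspace[OF assms]
  proof (intro conjI ballI)
    fix x assume "x \<in> T"
    then obtain a where a: "a \<in> R" "a x \<noteq> 0" "\<forall>y\<in>V \<inter> Y. a y \<noteq> 0 \<longrightarrow> y \<in> U" using * by blast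
    then have "\<forall>y\<in>V. a y \<noteq> 0 \<longrightarrow> y \<in> T" unfolding T_def by blast
    then show "\<exists>a\<in>R. a x \<noteq> 0 \<and> (\<forall>y\<in>V. a y \<noteq> 0 \<longrightarrow> y \<in> T)" using a by blast
  qed (auto simp: T_def)
  moreover have "U = T \<inter> Y" using U by (auto simp: T_def)
  ultimately show "openin (zariski (subfspace (affine_fspace V R) Y)) U"
    by (auto simp: subfspace_def openin_subtopology)
qed

text \<open>Multiplying numerator and denominator by a function vanishing off the neighbourhood makes
  the local fraction valid on all of \<open>U\<close>.\<close>

lemma regular_affine_fspace:
  assumes "mult_system V R" and U: "openin (zariski (affine_fspace V R)) U"
  shows "regular (affine_fspace V R) U f \<longleftrightarrow>
    (\<forall>x\<in>U. \<exists>a\<in>R. \<exists>b\<in>R. b x \<noteq> 0 \<and> (\<forall>y\<in>U. f y * b y = a y))" (is "_ \<longleftrightarrow> ?P")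
proof -
  let ?Z = "zariski (affine_fspace V R)"
  have reg: "regular (affine_fspace V R) U f \<longleftrightarrow> (\<forall>x\<in>U. \<exists>W a b. openin ?Z W \<and> x \<in> W \<and> W \<subseteq> U \<and>
      a \<in> R \<and> b \<in> R \<and> (\<forall>y\<in>W. b y \<noteq> 0 \<and> f y = a y / b y))"
    by (simp add: affine_fspace_def Let_def)
  have UV: "U \<subseteq> V" using U openin_affine_fspace[OF assms(1)] by blast
  show ?thesis
  proof
    assume R: "regular (affine_fspace V R) U f"
    show ?P
    proof
      fix x assume x: "x \<in> U"
      obtain W a b where W: "openin ?Z W" "x \<in> W" "W \<subseteq> U" "a \<in> R" "b \<in> R"
        "\<forall>y\<in>W. b y \<noteq> 0 \<and> f y = a y / b y" using R x unfolding reg by meson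
      obtain c where c: "c \<in> R" "c x \<noteq> 0" "\<forall>y\<in>V. c y \<noteq> 0 \<longrightarrow> y \<in> W"
        using W(1,2) openin_affine_fspace[OF assms(1)] by blast
      obtain a' where a': "a' \<in> R" "\<forall>x\<in>V. a' x = a x * c x"
        using assms(1) W(4) c(1) unfolding mult_system_def by blast
      obtain b' where b': "b' \<in> R" "\<forall>x\<in>V. b' x = b x * c x"
        using assms(1) W(5) c(1) unfolding mult_system_def by blast
      have "f y * b' y = a' y" if y: "y \<in> U" for y
      proof (cases "c y = 0")
        case True
        then show ?thesis using a' b' y UV by auto
      next
        case False
        then have "y \<in> W" using c y UV by auto
        then show ?thesis using a' b' y UV W by auto
      qed
      moreover have "b' x \<noteq> 0" using b' c W x UV by auto
      ultimately show "\<exists>a\<in>R. \<exists>b\<in>R. b x \<noteq> 0 \<and> (\<forall>y\<in>U. f y * b y = a y)" using a' b' by blast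
    qed
  next
    assume P: ?P
    show "regular (affine_fspace V R) U f" unfolding reg
    proof
      fix x assume x: "x \<in> U"
      obtain a b where ab: "a \<in> R" "b \<in> R" "b x \<noteq> 0" "\<forall>y\<in>U. f y * b y = a y" using P x by blast
      have "openin ?Z {y \<in> V. b y \<noteq> 0}" unfolding openin_affine_fspace[OF assms(1)] using ab by auto
      then have W: "openin ?Z (U \<inter> {y \<in> V. b y \<noteq> 0})" using U by blast
      have "f y = a y / b y" if "y \<in> U" "b y \<noteq> 0" for y
        using ab(4) that by (metis nonzero_eq_divide_eq)
      then show "\<exists>W a b. openin ?Z W \<and> x \<in> W \<and> W \<subseteq> U \<and> a \<in> R \<and> b \<in> R \<and>
          (\<forall>y\<in>W. b y \<noteq> 0 \<and> f y = a y / b y)"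
        using W ab x UV by (intro exI[of _ "U \<inter> {y \<in> V. b y \<noteq> 0}"] exI[of _ a] exI[of _ b]) auto
    qed
  qed
qed

text \<open>A local extension gives a fraction near a point, and multiplying by a function that
  vanishes off the neighbourhood makes its equation valid on \<open>U\<close>. Conversely
  \<open>a / b\<close> is regular on the principal open set of \<open>b\<close> in the ambient
  variety and extends \<open>f\<close> from there.\<close>

lemma regular_sub_affine_fspace:
  assumes "mult_system V R" and U: "U \<subseteq> V"
  shows "regular (subfspace (affine_fspace V R) Y) U f \<longleftrightarrow>
    (\<forall>x\<in>U. \<exists>a\<in>R. \<exists>b\<in>R. b x \<noteq> 0 \<and> (\<forall>y\<in>U. f y * b y = a y))" (is "_ \<longleftrightarrow> ?P")
proof -
  let ?Z = "zariski (affine_fspace V R)"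
  have reg: "regular (subfspace (affine_fspace V R) Y) U f \<longleftrightarrow> (\<forall>x\<in>U. \<exists>W g. openin ?Z W \<and> x \<in> W \<and>
      regular (affine_fspace V R) W g \<and> (\<forall>z\<in>U \<inter> W. f z = g z))"
    by (simp add: subfspace_def)
  show ?thesis
  proof
    assume R: "regular (subfspace (affine_fspace V R) Y) U f"
    show ?P
    proof
      fix x assume x: "x \<in> U"
      obtain W g where W: "openin ?Z W" "x \<in> W" "regular (affine_fspace V R) W g"
        "\<forall>z\<in>U \<inter> W. f z = g z" using R x unfolding reg by meson
      obtain a b where ab: "a \<in> R" "b \<in> R" "b x \<noteq> 0" "\<forall>y\<in>W. g y * b y = a y"
        using W(2,3) unfolding regular_affine_fspace[OF assms(1) W(1)] by blast
      obtain c where c: "c \<in> R" "c x \<noteq> 0" "\<forall>y\<in>V. c y \<noteq> 0 \<longrightarrow> y \<in> W"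
        using W(1,2) openin_affine_fspace[OF assms(1)] by blast
      obtain a' where a': "a' \<in> R" "\<forall>x\<in>V. a' x = a x * c x"
        using assms(1) ab(1) c(1) unfolding mult_system_def by blast
      obtain b' where b': "b' \<in> R" "\<forall>x\<in>V. b' x = b x * c x"
        using assms(1) ab(2) c(1) unfolding mult_system_def by blast
      have "f y * b' y = a' y" if y: "y \<in> U" for y
      proof (cases "c y = 0")
        case True
        then show ?thesis using a' b' y U by auto
      next
        case False
        then have "y \<in> W" using c y U by auto
        then have "f y = g y" "g y * b y = a y" using W(4) ab(4) y by auto
        then show ?thesis using a' b' y U by auto
      qed
      moreover have "b' x \<noteq> 0" using b' c ab x U by auto
      ultimately show "\<exists>a\<in>R. \<exists>b\<in>R. b x \<noteq> 0 \<and> (\<forall>y\<in>U. f y * b y = a y)" using a' b' by blast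
    qed
  next
    assume P: ?P
    show "regular (subfspace (affine_fspace V R) Y) U f" unfolding reg
    proof
      fix x assume x: "x \<in> U"
      obtain a b where ab: "a \<in> R" "b \<in> R" "b x \<noteq> 0" "\<forall>y\<in>U. f y * b y = a y" using P x by blast
      let ?W = "{y \<in> V. b y \<noteq> 0}"
      have W: "openin ?Z ?W" unfolding openin_affine_fspace[OF assms(1)] using ab by auto
      have "regular (affine_fspace V R) ?W (\<lambda>y. a y / b y)"
        unfolding regular_affine_fspace[OF assms(1) W] using ab by fastforce
      moreover have "\<forall>z\<in>U \<inter> ?W. f z = a z / b z"
        using ab(4) by (auto simp: nonzero_eq_divide_eq)
      ultimately show "\<exists>W g. openin ?Z W \<and> x \<in> W \<and> regular (affine_fspace V R) W g \<and> (\<forall>z\<in>U \<inter> W. f z = g z)"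
        using W ab x U by (intro exI[of _ ?W] exI[of _ "\<lambda>y. a y / b y"]) auto
    qed
  qed
qed

text \<open>The supports \<open>T1\<close>, \<open>T2\<close>, \<open>T3\<close> need not be
  monoids: the lemma is also applied to the graded pieces of an algebra, where the product of two
  pieces lies in a third one.\<close>

lemma monoid_algebra_prod:
  assumes "a \<in> monoid_algebra T1" "b \<in> monoid_algebra T2"
    and "T1 \<subseteq> S" "T2 \<subseteq> S" "\<And>u w. u \<in> T1 \<Longrightarrow> w \<in> T2 \<Longrightarrow> u + w \<in> T3"
  shows "\<exists>c\<in>monoid_algebra T3. \<forall>x\<in>monoid_points S. c x = a x * b x"
proof -
  obtain F k where a: "finite F" "F \<subseteq> T1" "a = (\<lambda>x. \<Sum>u\<in>F. k u * x u)"
    using assms(1) by (auto simp: monoid_algebra_def)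
  obtain H l where b: "finite H" "H \<subseteq> T2" "b = (\<lambda>x. \<Sum>u\<in>H. l u * x u)"
    using assms(2) by (auto simp: monoid_algebra_def)
  let ?p = "\<lambda>z::'a \<times> 'a. fst z + snd z"
  let ?P = "?p ` (F \<times> H)"
  define q where "q w = (\<Sum>z\<in>{z \<in> F \<times> H. ?p z = w}. k (fst z) * l (snd z))" for w
  have fin: "finite (F \<times> H)" using a b by simp
  show ?thesis
  proof (intro bexI[of _ "\<lambda>x. \<Sum>w\<in>?P. q w * x w"] ballI)
    have "?P \<subseteq> T3"
    proof
      fix w assume "w \<in> ?P"
      then obtain u v where "u \<in> F" "v \<in> H" "w = u + v" by auto
      then show "w \<in> T3" using a(2) b(2) assms(5) by blast
    qed
    moreover have "finite ?P" using fin by blast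
    ultimately have "finite ?P" "?P \<subseteq> T3" by auto
    then show "(\<lambda>x. \<Sum>w\<in>?P. q w * x w) \<in> monoid_algebra T3"
      unfolding monoid_algebra_def by blast
    fix x assume x: "x \<in> monoid_points S"
    have "(\<Sum>w\<in>?P. q w * x w) = (\<Sum>w\<in>?P. \<Sum>z\<in>{z \<in> F \<times> H. ?p z = w}. k (fst z) * l (snd z) * x (?p z))"
      unfolding q_def sum_distrib_right by (intro sum.cong refl) auto
    also have "\<dots> = (\<Sum>z\<in>F \<times> H. k (fst z) * l (snd z) * x (?p z))"
      by (rule sum.image_gen[OF fin, symmetric])
    also have "\<dots> = (\<Sum>z\<in>F \<times> H. (k (fst z) * x (fst z)) * (l (snd z) * x (snd z)))"
    proof (rule sum.cong[OF refl])
      fix z assume "z \<in> F \<times> H"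
      then have "fst z \<in> S" "snd z \<in> S" using a(2) b(2) assms(3,4) by auto
      then have "x (?p z) = x (fst z) * x (snd z)" using x by (auto simp: monoid_points_def)
      then show "k (fst z) * l (snd z) * x (?p z) = (k (fst z) * x (fst z)) * (l (snd z) * x (snd z))"
        by simp
    qed
    also have "\<dots> = (\<Sum>u\<in>F. \<Sum>w\<in>H. (k u * x u) * (l w * x w))"
      by (simp add: sum.cartesian_product case_prod_unfold)
    also have "\<dots> = a x * b x" unfolding a(3) b(3) by (simp add: sum_product)
    finally show "(\<Sum>w\<in>?P. q w * x w) = a x * b x" .
  qed
qed

lemma monoid_algebra_character: "u \<in> S \<Longrightarrow> (\<lambda>x. x u) \<in> monoid_algebra S"
  unfolding monoid_algebra_def by (intro CollectI exI[of _ "{u}"] exI[of _ "\<lambda>_. 1"]) auto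

lemma mult_system_monoid:
  assumes "0 \<in> S" "\<And>u w. u \<in> S \<Longrightarrow> w \<in> S \<Longrightarrow> u + w \<in> S"
  shows "mult_system (monoid_points S) (monoid_algebra S)"
  unfolding mult_system_def
proof (intro conjI ballI)
  show "\<exists>a\<in>monoid_algebra S. \<forall>x\<in>monoid_points S. a x \<noteq> 0"
    using monoid_algebra_character[OF assms(1)]
    by (intro bexI[of _ "\<lambda>x. x 0"]) (auto simp: monoid_points_def)
  fix a b assume "a \<in> monoid_algebra S" "b \<in> monoid_algebra S"
  then show "\<exists>c\<in>monoid_algebra S. \<forall>x\<in>monoid_points S. c x = a x * b x"
    by (rule monoid_algebra_prod) (use assms(2) in auto)
qed

lemma monoid_points_scale:
  assumes "x \<in> monoid_points S" "\<And>u w. u \<in> S \<Longrightarrow> w \<in> S \<Longrightarrow> u + w \<in> S" "0 \<in> S" "u \<in> S"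
  shows "real n *\<^sub>R u \<in> S \<and> x (real n *\<^sub>R u) = x u ^ n"
proof (induction n)
  case 0
  then show ?case using assms by (simp add: monoid_points_def)
next
  case (Suc n)
  have "real (Suc n) *\<^sub>R u = u + real n *\<^sub>R u" by (simp add: algebra_simps)
  then show ?case using assms Suc by (auto simp: monoid_points_def)
qed

lemma monoid_points_sum:
  assumes "x \<in> monoid_points S" "\<And>u w. u \<in> S \<Longrightarrow> w \<in> S \<Longrightarrow> u + w \<in> S" "0 \<in> S"
    and "finite I" "\<And>i. i \<in> I \<Longrightarrow> f i \<in> S"
  shows "(\<Sum>i\<in>I. f i) \<in> S \<and> x (\<Sum>i\<in>I. f i) = (\<Prod>i\<in>I. x (f i))"
  using assms(4,5)
proof (induction I)
  case empty
  then show ?case using assms by (simp add: monoid_points_def)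
next
  case (insert i I)
  then show ?case using assms(1,2) by (auto simp: monoid_points_def)
qed

section \<open>Torus rotations, independence of characters, graded powers\<close>

definition torus_rot :: "'a::euclidean_space \<Rightarrow> ('a \<Rightarrow> complex) \<Rightarrow> 'a \<Rightarrow> complex" where
  "torus_rot v x = (\<lambda>u. exp (2 * of_real pi * \<i> * of_real (u \<bullet> v)) * x u)"

lemma exp_2pi_i_eq_iff:
  "exp (2 * of_real pi * \<i> * of_real a) = exp (2 * of_real pi * \<i> * of_real b) \<longleftrightarrow> a - b \<in> \<int>"
proof -
  have "exp (2 * of_real pi * \<i> * of_real a) = exp (2 * of_real pi * \<i> * of_real b) \<longleftrightarrow>
      exp (2 * of_real pi * \<i> * of_real (a - b)) = 1"
    by (simp add: exp_diff right_diff_distrib)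
  also have "\<dots> \<longleftrightarrow> (\<exists>n::int. 2 * pi * (a - b) = of_int (2 * n) * pi)"
    unfolding exp_eq_1 by simp
  also have "\<dots> \<longleftrightarrow> (\<exists>n::int. a - b = of_int n)" by simp
  finally show ?thesis by (auto simp: Ints_def)
qed

lemma torus_rot_in:
  assumes "x \<in> monoid_points S"
  shows "torus_rot v x \<in> monoid_points S"
  using assms by (auto simp: monoid_points_def torus_rot_def inner_add_left exp_add distrib_left)

text \<open>Dedekind's argument: the relation at \<open>v + w\<close>, minus
  \<open>\<psi>0 w\<close> times the relation at \<open>v\<close>, no longer involves
  \<open>\<psi>0\<close>. Setting the characters to zero outside \<open>H\<close> makes distinct
  members of \<open>K\<close> differ at a point of \<open>H\<close>, so a set of functions can be
  used as index set.\<close>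

lemma characters_independent:
  fixes K :: "('v::ab_group_add \<Rightarrow> complex) set"
  assumes "finite K" and H: "add_subgroup H"
    and mult: "\<And>\<psi> v w. \<psi> \<in> K \<Longrightarrow> v \<in> H \<Longrightarrow> w \<in> H \<Longrightarrow> \<psi> (v + w) = \<psi> v * \<psi> w"
    and one: "\<And>\<psi>. \<psi> \<in> K \<Longrightarrow> \<psi> 0 = 1" and out: "\<And>\<psi> v. \<psi> \<in> K \<Longrightarrow> v \<notin> H \<Longrightarrow> \<psi> v = 0"
    and sum: "\<And>v. v \<in> H \<Longrightarrow> (\<Sum>\<psi>\<in>K. c \<psi> * \<psi> v) = 0"
  shows "\<forall>\<psi>\<in>K. c \<psi> = 0"
  using assms(1) mult one out sum
proof (induction K arbitrary: c rule: finite_induct)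
  case (insert \<psi>0 K)
  have cK: "c \<psi>1 = 0" if \<psi>1: "\<psi>1 \<in> K" for \<psi>1
  proof -
    have "\<psi>1 \<noteq> \<psi>0" using insert.hyps \<psi>1 by auto
    then obtain w where "\<psi>1 w \<noteq> \<psi>0 w" by (auto simp: fun_eq_iff)
    then have w: "w \<in> H" "\<psi>1 w \<noteq> \<psi>0 w"
      using insert.prems(3)[of \<psi>1 w] insert.prems(3)[of \<psi>0 w] \<psi>1 by (cases "w \<in> H"; simp)+
    have "\<forall>\<psi>\<in>K. c \<psi> * (\<psi> w - \<psi>0 w) = 0"
    proof (rule insert.IH)
      fix v assume v: "v \<in> H"
      have vw: "v + w \<in> H" using add_subgroupD(4)[OF H v w(1)] .
      have "(\<Sum>\<psi>\<in>K. c \<psi> * (\<psi> w - \<psi>0 w) * \<psi> v) = (\<Sum>\<psi>\<in>insert \<psi>0 K. c \<psi> * (\<psi> w - \<psi>0 w) * \<psi> v)"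
        using insert.hyps by simp
      also have "\<dots> = (\<Sum>\<psi>\<in>insert \<psi>0 K. c \<psi> * \<psi> (v + w) - \<psi>0 w * (c \<psi> * \<psi> v))"
        using insert.prems(1) v w(1) by (intro sum.cong refl) (simp add: algebra_simps)
      also have "\<dots> = (\<Sum>\<psi>\<in>insert \<psi>0 K. c \<psi> * \<psi> (v + w)) - \<psi>0 w * (\<Sum>\<psi>\<in>insert \<psi>0 K. c \<psi> * \<psi> v)"
        by (simp only: sum_subtractf sum_distrib_left)
      also have "\<dots> = 0" using insert.prems(4)[OF v] insert.prems(4)[OF vw] by (simp only:) simp
      finally show "(\<Sum>\<psi>\<in>K. c \<psi> * (\<psi> w - \<psi>0 w) * \<psi> v) = 0" .
    qed (use insert.prems in auto)
    then show ?thesis using \<psi>1 w(2) by auto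
  qed
  have "0 \<in> H" using add_subgroupD(1)[OF H] .
  have "(\<Sum>\<psi>\<in>insert \<psi>0 K. c \<psi> * \<psi> 0) = c \<psi>0"
    using insert.hyps insert.prems(2)[of \<psi>0] cK by simp
  then have "c \<psi>0 = 0" using insert.prems(4)[OF \<open>0 \<in> H\<close>] by simp
  then show ?case using cK by blast
qed simp

lemma monoid_algebra_mono: "S \<subseteq> T \<Longrightarrow> monoid_algebra S \<subseteq> monoid_algebra T"
  unfolding monoid_algebra_def by blast

text \<open>\<open>T\<close> is a grading. In the application \<open>T k\<close> consists of the
  exponents on which a finite group acts by the \<open>k\<close>-th power of a fixed character, and
  some power of an isotypic function becomes invariant.\<close>

lemma monoid_algebra_power:
  assumes "b \<in> monoid_algebra (T 1)" "0 \<in> T 0" "\<And>k. T k \<subseteq> S"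
    and "\<And>k u w. u \<in> T k \<Longrightarrow> w \<in> T 1 \<Longrightarrow> u + w \<in> T (Suc k)"
  shows "\<exists>c\<in>monoid_algebra (T k). \<forall>x\<in>monoid_points S. c x = b x ^ k"
proof (induction k)
  case 0
  show ?case
    using monoid_algebra_character[OF assms(2)] by (intro bexI[of _ "\<lambda>x. x 0"]) (auto simp: monoid_points_def)
next
  case (Suc k)
  then obtain c where c: "c \<in> monoid_algebra (T k)" "\<forall>x\<in>monoid_points S. c x = b x ^ k" by blast
  obtain c' where c': "c' \<in> monoid_algebra (T (Suc k))" "\<forall>x\<in>monoid_points S. c' x = c x * b x"
    using monoid_algebra_prod[OF c(1) assms(1) assms(3,3), of "T (Suc k)"] assms(4) by blast
  then show ?case using c(2) by (intro bexI[of _ c']) auto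
qed

text \<open>Final structures are tested on each piece \<open>\<pi>\<close>; these are the tests for a subset \<open>Y\<close> of the glued space.\<close>

definition rel_open :: "'a::euclidean_space set \<Rightarrow> (('a \<Rightarrow> complex) \<Rightarrow> 'p) \<Rightarrow> 'p set \<Rightarrow> 'p set \<Rightarrow> bool" where
  "rel_open S \<pi> Y U \<longleftrightarrow> (\<forall>x\<in>monoid_points S. \<pi> x \<in> U \<longrightarrow>
     (\<exists>a\<in>monoid_algebra S. a x \<noteq> 0 \<and> (\<forall>y\<in>monoid_points S. \<pi> y \<in> Y \<and> a y \<noteq> 0 \<longrightarrow> \<pi> y \<in> U)))"

definition rel_regular :: "'a::euclidean_space set \<Rightarrow> (('a \<Rightarrow> complex) \<Rightarrow> 'p) \<Rightarrow> 'p set \<Rightarrow> ('p \<Rightarrow> complex) \<Rightarrow> bool" where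
  "rel_regular S \<pi> U f \<longleftrightarrow> (\<forall>x\<in>monoid_points S. \<pi> x \<in> U \<longrightarrow>
     (\<exists>a\<in>monoid_algebra S. \<exists>b\<in>monoid_algebra S. b x \<noteq> 0 \<and>
        (\<forall>y\<in>monoid_points S. \<pi> y \<in> U \<longrightarrow> f (\<pi> y) * b y = a y)))"

section \<open>Simplicial fans\<close>

locale simplicial_toric =
  fixes N :: "'a::euclidean_space set" and \<Xi> :: "'a set set" and C :: "'a set \<Rightarrow> 'a set"
  assumes lattice: "is_lattice N"
    and fan: "is_fan N \<Xi>"
    and simplicial: "simplicial_fan N \<Xi>"
    and complement: "\<And>\<tau>. \<tau> \<in> \<Xi> \<Longrightarrow> lattice_complement N \<tau> (C \<tau>)"
begin

abbreviation "gens \<equiv> cone_gens N"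
abbreviation "M \<equiv> dual_lattice N"

lemma lattice_basis:
  obtains B where "finite B" "independent B" "span B = UNIV" "N = int_span B"
  using lattice unfolding is_lattice_def by (metis independent_imp_finite)

lemma N_subgroup: "add_subgroup N"
  using lattice_basis add_subgroup_int_span by metis

lemma gens_independent: "\<sigma> \<in> \<Xi> \<Longrightarrow> independent (gens \<sigma>)"
  using simplicial by (auto simp: simplicial_fan_def)

lemma gens_finite: "\<sigma> \<in> \<Xi> \<Longrightarrow> finite (gens \<sigma>)"
  using gens_independent independent_imp_finite by blast

lemma cone_eq: "\<sigma> \<in> \<Xi> \<Longrightarrow> \<sigma> = convex_cone hull gens \<sigma>"
  using fan lattice_basis rational_cone_generated unfolding is_fan_def by metis

lemma gens_in_cone: "g \<in> gens \<sigma> \<Longrightarrow> g \<in> \<sigma>" and gens_in_N: "g \<in> gens \<sigma> \<Longrightarrow> g \<in> N"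
  using cone_gens_subset by blast+

lemma cone_subset_span: "\<sigma> \<in> \<Xi> \<Longrightarrow> \<sigma> \<subseteq> span (gens \<sigma>)"
  using cone_eq convex_cone_hull_subset_span by metis

lemma span_cone: "\<sigma> \<in> \<Xi> \<Longrightarrow> span \<sigma> = span (gens \<sigma>)"
  using cone_subset_span cone_gens_subset(1) by (metis span_mono span_span subset_antisym)

lemma zero_in_cone: "\<sigma> \<in> \<Xi> \<Longrightarrow> 0 \<in> \<sigma>"
  using cone_eq convex_cone_hull_contains_0 by metis

lemma face_in_fan: "\<sigma> \<in> \<Xi> \<Longrightarrow> \<tau> face_of \<sigma> \<Longrightarrow> \<tau> \<noteq> {} \<Longrightarrow> \<tau> \<in> \<Xi>"
  using fan by (auto simp: is_fan_def)

lemma Int_face: "\<sigma> \<in> \<Xi> \<Longrightarrow> \<tau> \<in> \<Xi> \<Longrightarrow> \<sigma> \<inter> \<tau> face_of \<sigma>"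
  "\<sigma> \<in> \<Xi> \<Longrightarrow> \<tau> \<in> \<Xi> \<Longrightarrow> \<sigma> \<inter> \<tau> face_of \<tau>"
  using fan unfolding is_fan_def by blast+

lemma Int_in_fan: "\<sigma> \<in> \<Xi> \<Longrightarrow> \<tau> \<in> \<Xi> \<Longrightarrow> \<sigma> \<inter> \<tau> \<in> \<Xi>"
  using face_in_fan Int_face(1) zero_in_cone by (metis IntI empty_iff)

text \<open>In a fan the intersection of two cones is a face of both. Inclusion therefore replaces
  the face relation from here on, and \<open>subset_iff_gens\<close> reduces it further to inclusion
  of generators.\<close>

lemma face_of_iff_subset:
  assumes "\<tau> \<in> \<Xi>" "\<sigma> \<in> \<Xi>"
  shows "\<tau> face_of \<sigma> \<longleftrightarrow> \<tau> \<subseteq> \<sigma>"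
  using Int_face(2)[OF assms] face_of_imp_subset by (metis inf.absorb1)

lemma subset_iff_gens:
  assumes "\<tau> \<in> \<Xi>" "\<sigma> \<in> \<Xi>"
  shows "\<tau> \<subseteq> \<sigma> \<longleftrightarrow> gens \<tau> \<subseteq> gens \<sigma>"
  using assms cone_gens_face face_of_iff_subset by (metis cone_eq hull_mono)

lemma gens_face_in: "\<tau> \<in> \<Xi> \<Longrightarrow> \<sigma> \<in> \<Xi> \<Longrightarrow> \<tau> \<subseteq> \<sigma> \<Longrightarrow> g \<in> gens \<tau> \<Longrightarrow> g \<in> gens \<sigma>"
  using subset_iff_gens by blast

lemma gens_in_face:
  assumes "\<tau> \<in> \<Xi>" "\<sigma> \<in> \<Xi>" "\<tau> \<subseteq> \<sigma>" "g \<in> gens \<sigma>" "g \<in> span \<tau>"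
  shows "g \<in> gens \<tau>"
  using in_independent_span_subset[OF gens_independent[OF assms(2)], of "gens \<tau>" g] assms
    subset_iff_gens span_cone by auto

text \<open>Simpliciality at work: every set of generators spans a cone of the fan. So a cone may be
  prescribed by saying which coordinates of a point vanish, or which coefficients of a vector do
  not.\<close>

lemma face_by_gens:
  assumes "\<sigma> \<in> \<Xi>" "G' \<subseteq> gens \<sigma>"
  obtains \<tau> where "\<tau> \<in> \<Xi>" "\<tau> \<subseteq> \<sigma>" "gens \<tau> = G'"
proof
  let ?\<tau> = "convex_cone hull G'"
  have f: "?\<tau> face_of \<sigma>"
    using simplicial_cone_face[OF gens_independent[OF assms(1)] assms(2)] cone_eq[OF assms(1)] by simp
  then show \<tau>: "?\<tau> \<in> \<Xi>" using face_in_fan[OF assms(1)] convex_cone_hull_nonempty by blast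
  show sub: "?\<tau> \<subseteq> \<sigma>" using f face_of_imp_subset by blast
  show "gens ?\<tau> = G'"
  proof (intro equalityI subsetI)
    fix g assume g: "g \<in> gens ?\<tau>"
    then have "g \<in> gens \<sigma>" using gens_face_in[OF \<tau> assms(1) sub] by blast
    moreover have "g \<in> span G'" using gens_in_cone[OF g] convex_cone_hull_subset_span by blast
    ultimately show "g \<in> G'"
      using in_independent_span_subset[OF gens_independent[OF assms(1)] assms(2)] by blast
  next
    fix g assume g: "g \<in> G'"
    then have "g \<in> ?\<tau>" by (simp add: hull_inc)
    then show "g \<in> gens ?\<tau>"
      using gens_in_face[OF \<tau> assms(1) sub] assms(2) g by (auto simp: span_base)
  qed
qed

lemma zero_cone_in_fan: "{0} \<in> \<Xi>" and gens_zero_cone: "gens {0} = {}"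
proof -
  obtain \<sigma> where \<sigma>: "\<sigma> \<in> \<Xi>" using fan by (auto simp: is_fan_def)
  obtain \<tau> where \<tau>: "\<tau> \<in> \<Xi>" "\<tau> \<subseteq> \<sigma>" "gens \<tau> = {}"
    by (rule face_by_gens[OF \<sigma> empty_subsetI])
  then have "\<tau> = {0}" using cone_eq[of \<tau>] by simp
  then show "{0} \<in> \<Xi>" "gens {0} = {}" using \<tau> by auto
qed

lemma zero_cone_subset: "\<sigma> \<in> \<Xi> \<Longrightarrow> {0} \<subseteq> \<sigma>"
  using zero_in_cone by simp

section \<open>Orthogonal and dual cones, lattices of the charts\<close>

definition perp :: "'a set \<Rightarrow> 'a set" where
  "perp \<tau> = {u. \<forall>v\<in>\<tau>. u \<bullet> v = 0}"

lemma perp_iff_gens: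
  assumes "\<tau> \<in> \<Xi>"
  shows "u \<in> perp \<tau> \<longleftrightarrow> (\<forall>g\<in>gens \<tau>. u \<bullet> g = 0)"
proof
  show "u \<in> perp \<tau> \<Longrightarrow> \<forall>g\<in>gens \<tau>. u \<bullet> g = 0" using gens_in_cone by (auto simp: perp_def)
  assume u: "\<forall>g\<in>gens \<tau>. u \<bullet> g = 0"
  have "u \<bullet> v = 0" if "v \<in> span (gens \<tau>)" for v
    using that by (induction rule: span_induct_alt) (auto simp: inner_add_right u)
  then show "u \<in> perp \<tau>" using cone_subset_span[OF assms] by (auto simp: perp_def)
qed

lemma perp_span: "u \<in> perp \<tau> \<Longrightarrow> v \<in> span \<tau> \<Longrightarrow> u \<bullet> v = 0"
  by (rule span_induct_alt[of v \<tau> "\<lambda>v. u \<bullet> v = 0"]) (auto simp: perp_def inner_add_right)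

lemma perp_antimono: "\<tau> \<subseteq> \<sigma> \<Longrightarrow> perp \<sigma> \<subseteq> perp \<tau>"
  by (auto simp: perp_def)

lemma dual_cone_iff_gens:
  assumes "\<sigma> \<in> \<Xi>"
  shows "u \<in> dual_cone \<sigma> \<longleftrightarrow> (\<forall>g\<in>gens \<sigma>. 0 \<le> u \<bullet> g)"
proof
  show "u \<in> dual_cone \<sigma> \<Longrightarrow> \<forall>g\<in>gens \<sigma>. 0 \<le> u \<bullet> g" using gens_in_cone by (auto simp: dual_cone_def)
  assume u: "\<forall>g\<in>gens \<sigma>. 0 \<le> u \<bullet> g"
  show "u \<in> dual_cone \<sigma>" unfolding dual_cone_def
  proof (intro CollectI ballI)
    fix v assume "v \<in> \<sigma>"
    then obtain a where "\<forall>g\<in>gens \<sigma>. 0 \<le> a g" "v = (\<Sum>g\<in>gens \<sigma>. a g *\<^sub>R g)"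
      using cone_eq[OF assms] convex_cone_hull_finite[OF gens_finite[OF assms]] by blast
    then show "0 \<le> u \<bullet> v" using u by (auto simp: inner_sum_right intro!: sum_nonneg)
  qed
qed

lemma dual_cone_antimono: "\<tau> \<subseteq> \<sigma> \<Longrightarrow> dual_cone \<sigma> \<subseteq> dual_cone \<tau>"
  by (auto simp: dual_cone_def)

lemma complement_subgroup:
  assumes "\<sigma> \<in> \<Xi>"
  shows "add_subgroup (C \<sigma>)" "C \<sigma> \<subseteq> N" "C \<sigma> \<inter> span \<sigma> = {0}"
    "\<And>v. v \<in> N \<Longrightarrow> \<exists>s c. s \<in> N \<and> s \<in> span \<sigma> \<and> c \<in> C \<sigma> \<and> v = s + c"
  using complement[OF assms] unfolding lattice_complement_def add_subgroup_def by blast+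

abbreviation "chart_dual \<sigma> \<equiv> dual_lattice (chart_lattice N \<sigma> (C \<sigma>))"

lemma chart_lattice_subset:
  assumes "\<sigma> \<in> \<Xi>"
  shows "chart_lattice N \<sigma> (C \<sigma>) \<subseteq> N"
proof -
  have "int_span (gens \<sigma>) \<subseteq> N" using int_span_mono_subgroup[OF _ N_subgroup] gens_in_N by blast
  then show ?thesis using complement_subgroup(2)[OF assms] add_subgroupD(4)[OF N_subgroup]
    by (auto simp: chart_lattice_def)
qed

lemma in_chart_dual_iff:
  assumes "\<sigma> \<in> \<Xi>"
  shows "u \<in> chart_dual \<sigma> \<longleftrightarrow> (\<forall>g\<in>gens \<sigma>. u \<bullet> g \<in> \<int>) \<and> (\<forall>c\<in>C \<sigma>. u \<bullet> c \<in> \<int>)"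
proof
  assume u: "u \<in> chart_dual \<sigma>"
  have "g \<in> chart_lattice N \<sigma> (C \<sigma>)" if "g \<in> gens \<sigma>" for g
    unfolding chart_lattice_def using int_span_base[OF gens_finite[OF assms] that]
      add_subgroupD(1)[OF complement_subgroup(1)[OF assms]] by (intro CollectI exI[of _ g] exI[of _ 0]) auto
  moreover have "c \<in> chart_lattice N \<sigma> (C \<sigma>)" if "c \<in> C \<sigma>" for c
    unfolding chart_lattice_def using zero_in_int_span that by (intro CollectI exI[of _ 0] exI[of _ c]) auto
  ultimately show "(\<forall>g\<in>gens \<sigma>. u \<bullet> g \<in> \<int>) \<and> (\<forall>c\<in>C \<sigma>. u \<bullet> c \<in> \<int>)"
    using u by (auto simp: dual_lattice_def)
next
  assume u: "(\<forall>g\<in>gens \<sigma>. u \<bullet> g \<in> \<int>) \<and> (\<forall>c\<in>C \<sigma>. u \<bullet> c \<in> \<int>)"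
  have "add_subgroup {v. u \<bullet> v \<in> \<int>}" by (auto simp: add_subgroup_def inner_diff_right)
  then have "int_span (gens \<sigma>) \<subseteq> {v. u \<bullet> v \<in> \<int>}" using u by (intro int_span_mono_subgroup) auto
  then show "u \<in> chart_dual \<sigma>" using u
    by (auto simp: dual_lattice_def chart_lattice_def inner_add_right)
qed

lemma M_subset_chart_dual: "\<sigma> \<in> \<Xi> \<Longrightarrow> M \<subseteq> chart_dual \<sigma>"
  using chart_lattice_subset dual_lattice_antimono by blast

text \<open>A character orthogonal to \<sigma> sees a vector of \<open>N\<close> only through its
  component in the complement, where characters of the chart are integral. Hence the chart has no
  new characters along its closed orbit.\<close>

lemma perp_chart_dual:
  assumes "\<sigma> \<in> \<Xi>" "u \<in> perp \<sigma>"
  shows "u \<in> chart_dual \<sigma> \<longleftrightarrow> u \<in> M"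
proof
  assume u: "u \<in> chart_dual \<sigma>"
  have "u \<bullet> v \<in> \<int>" if "v \<in> N" for v
  proof -
    obtain s c where "s \<in> span \<sigma>" "c \<in> C \<sigma>" "v = s + c"
      using complement_subgroup(4)[OF assms(1) \<open>v \<in> N\<close>] by blast
    then show ?thesis using u in_chart_dual_iff[OF assms(1)] perp_span[OF assms(2)]
      by (auto simp: inner_add_right)
  qed
  then show "u \<in> M" by (simp add: dual_lattice_def)
qed (use M_subset_chart_dual[OF assms(1)] in auto)

text \<open>The generators and the complement together generate the chart lattice, so the
  coefficient of a generator is an integral functional on it. These are the coordinates that may
  vanish on the chart.\<close>

lemma chart_coordinates_exist:
  assumes "\<sigma> \<in> \<Xi>"
  obtains e where "dual_family (gens \<sigma>) e" "\<And>g. g \<in> gens \<sigma> \<Longrightarrow> e g \<in> chart_dual \<sigma>"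
proof -
  obtain B where B: "finite B" "independent B" "span B = UNIV" "N = int_span B" using lattice_basis .
  obtain b where b: "dual_family B b" using dual_family_exists B(2) .
  obtain d where d: "dual_family (gens \<sigma>) d" using dual_family_exists gens_independent[OF assms] .
  have "\<exists>u. (\<forall>h\<in>gens \<sigma>. u \<bullet> h = (if g = h then 1 else 0)) \<and> (\<forall>c\<in>C \<sigma>. u \<bullet> c = 0)"
    if g: "g \<in> gens \<sigma>" for g
  proof -
    \<comment> \<open>\<open>s\<close> is the projection of \<open>N\<close> onto
      \<open>N \<inter> span \<sigma>\<close> along \<open>C \<sigma>\<close>; it is additive
      because the decomposition is unique.\<close>
    obtain s where s: "\<And>v. v \<in> N \<Longrightarrow> s v \<in> N \<and> s v \<in> span \<sigma> \<and> v - s v \<in> C \<sigma>"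
      using complement_subgroup(4)[OF assms] by (metis add_diff_cancel_left')
    have s_eq: "s v = t" if "v \<in> N" "t \<in> span \<sigma>" "v - t \<in> C \<sigma>" for v t
    proof -
      have "s v - t = (v - t) - (v - s v)" by simp
      then have "s v - t \<in> C \<sigma>"
        using s that add_subgroupD(2)[OF complement_subgroup(1)[OF assms]] by metis
      moreover have "s v - t \<in> span \<sigma>" using s that by (simp add: span_diff)
      ultimately have "s v - t \<in> {0}" using complement_subgroup(3)[OF assms] by blast
      then show ?thesis by simp
    qed
    have s_diff: "s (v - w) = s v - s w" if "v \<in> N" "w \<in> N" for v w
    proof (rule s_eq)
      have "v - w - (s v - s w) = (v - s v) - (w - s w)" by simp
      then show "v - w - (s v - s w) \<in> C \<sigma>"
        using s that add_subgroupD(2)[OF complement_subgroup(1)[OF assms]] by metis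
    qed (use s that N_subgroup in \<open>auto simp: add_subgroup_def span_diff\<close>)
    \<comment> \<open>The vector representing \<open>d g \<circ> s\<close>: it has the right values
      on the lattice basis \<open>B\<close>, hence on all of \<open>N\<close>.\<close>
    define u where "u = (\<Sum>x\<in>B. (d g \<bullet> s x) *\<^sub>R b x)"
    define E where "E = {v \<in> N. u \<bullet> v = d g \<bullet> s v}"
    have "s 0 = 0" using s_eq[of 0 0] add_subgroupD(1)[OF N_subgroup]
        add_subgroupD(1)[OF complement_subgroup(1)[OF assms]] by (simp add: span_zero)
    then have "add_subgroup E" using N_subgroup
      by (auto simp: add_subgroup_def E_def inner_diff_right s_diff)
    moreover have "B \<subseteq> E"
    proof
      fix x assume x: "x \<in> B"
      have "u \<bullet> x = (\<Sum>y\<in>B. if y = x then d g \<bullet> s y else 0)"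
        unfolding u_def inner_sum_left using b x by (intro sum.cong) (auto simp: dual_family_def)
      then show "x \<in> E" using x B int_span_base by (auto simp: E_def)
    qed
    ultimately have "N \<subseteq> E" using int_span_mono_subgroup B(4) by blast
    then have u: "u \<bullet> v = d g \<bullet> s v" if "v \<in> N" for v using that by (auto simp: E_def)
    have "u \<bullet> h = (if g = h then 1 else 0)" if h: "h \<in> gens \<sigma>" for h
    proof -
      have "s h = h" using h gens_in_cone gens_in_N add_subgroupD(1)[OF complement_subgroup(1)[OF assms]]
        by (intro s_eq) (auto simp: span_base)
      then show ?thesis using u[OF gens_in_N[OF h]] d g h by (simp add: dual_family_def)
    qed
    moreover have "u \<bullet> c = 0" if c: "c \<in> C \<sigma>" for c
    proof -
      have "s c = 0" using c complement_subgroup(2)[OF assms] by (intro s_eq) (auto simp: span_zero)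
      then show ?thesis using u[of c] c complement_subgroup(2)[OF assms] by auto
    qed
    ultimately show ?thesis by blast
  qed
  then obtain e where e: "\<And>g. g \<in> gens \<sigma> \<Longrightarrow>
      (\<forall>h\<in>gens \<sigma>. e g \<bullet> h = (if g = h then 1 else 0)) \<and> (\<forall>c\<in>C \<sigma>. e g \<bullet> c = 0)" by metis
  show ?thesis
  proof
    show "dual_family (gens \<sigma>) e" using e by (auto simp: dual_family_def)
    show "e g \<in> chart_dual \<sigma>" if "g \<in> gens \<sigma>" for g
      using e[OF that] in_chart_dual_iff[OF assms] by auto
  qed
qed

text \<open>Lattices of characters commensurable with \<open>M\<close>; they serve for \<open>U\<^sub>\<sigma>\<close> and for the charts alike.\<close>

definition commensurable :: "'a set \<Rightarrow> bool" where
  "commensurable L \<longleftrightarrow> add_subgroup L \<and> M \<subseteq> L \<and> (\<exists>m::nat. m > 0 \<and> (\<forall>u\<in>L. real m *\<^sub>R u \<in> M))"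

lemma commensurable_M: "commensurable M"
  unfolding commensurable_def using dual_lattice_subgroup by (auto intro: exI[of _ 1])

text \<open>\<open>m\<close> is an exponent of the local group. It moves \<open>N\<close> into the
  chart lattice, and dually moves the characters of the chart into \<open>M\<close>.\<close>

lemma exponent:
  assumes "\<sigma> \<in> \<Xi>"
  obtains m :: nat where "m > 0" "\<And>v. v \<in> N \<Longrightarrow> v \<in> span \<sigma> \<Longrightarrow> real m *\<^sub>R v \<in> int_span (gens \<sigma>)"
    "\<And>u. u \<in> chart_dual \<sigma> \<Longrightarrow> real m *\<^sub>R u \<in> M"
proof -
  obtain B where B: "finite B" "independent B" "span B = UNIV" "N = int_span B" using lattice_basis .
  obtain m :: nat where m: "m > 0" "\<And>v. v \<in> N \<Longrightarrow> v \<in> span \<sigma> \<Longrightarrow> real m *\<^sub>R v \<in> int_span (gens \<sigma>)"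
    using multiple_in_int_span[OF B(1,2) gens_independent[OF assms]] gens_in_N B(4) span_cone[OF assms]
    by (metis subsetI)
  have "real m *\<^sub>R u \<in> M" if u: "u \<in> chart_dual \<sigma>" for u
    unfolding dual_lattice_def
  proof (intro CollectI ballI)
    fix v assume "v \<in> N"
    then obtain s c where sc: "s \<in> N" "s \<in> span \<sigma>" "c \<in> C \<sigma>" "v = s + c"
      using complement_subgroup(4)[OF assms] by blast
    have "real m *\<^sub>R v \<in> chart_lattice N \<sigma> (C \<sigma>)" unfolding chart_lattice_def
      using m(2)[OF sc(1,2)] add_subgroup_scale_nat[OF complement_subgroup(1)[OF assms] sc(3), of m]
      by (auto simp: sc(4) scaleR_add_right)
    then have "u \<bullet> (real m *\<^sub>R v) \<in> \<int>" using u by (auto simp: dual_lattice_def)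
    then show "(real m *\<^sub>R u) \<bullet> v \<in> \<int>" by simp
  qed
  then show ?thesis using that m by blast
qed

lemma commensurable_chart_dual: "\<sigma> \<in> \<Xi> \<Longrightarrow> commensurable (chart_dual \<sigma>)"
  unfolding commensurable_def using dual_lattice_subgroup M_subset_chart_dual exponent by metis

text \<open>\<open>L\<close> lies in \<open>M\<close> divided by \<open>m\<close>, which has a
  basis. This suffices to feed \<open>subgroup_of_lattice_basis\<close> and
  \<open>character_extends_to_exp\<close>.\<close>

lemma commensurable_basis:
  assumes "commensurable L"
  obtains A where "finite A" "independent A" "L \<subseteq> int_span A"
proof -
  obtain B where B: "finite B" "independent B" "span B = UNIV" "N = int_span B" using lattice_basis .
  obtain b where b: "dual_family B b" using dual_family_exists B(2) .
  obtain m :: nat where m: "m > 0" "\<And>u. u \<in> L \<Longrightarrow> real m *\<^sub>R u \<in> M"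
    using assms by (auto simp: commensurable_def)
  let ?f = "\<lambda>x. (1 / real m) *\<^sub>R b x"
  have inj: "inj_on b B" and ind: "independent (b ` B)"
    using dual_family_dual_independent[OF b B(1)] by auto
  have "independent ((\<lambda>x. (1 / real m) *\<^sub>R x) ` b ` B)"
    by (rule linear_independent_injective_image[OF _ ind]) (use m(1) in \<open>auto simp: linear_scaleR intro: inj_onI\<close>)
  then have 1: "independent (?f ` B)" by (simp add: image_image)
  have "L \<subseteq> int_span (?f ` B)"
  proof
    fix u assume "u \<in> L"
    then have "real m *\<^sub>R u \<in> int_span (b ` B)"
      using m(2) dual_lattice_int_span[OF b B(1,3)] B(4) by simp
    then obtain k where k: "real m *\<^sub>R u = (\<Sum>x\<in>b ` B. of_int (k x) *\<^sub>R x)" by (auto simp: int_span_def)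
    have "u = (1 / real m) *\<^sub>R (real m *\<^sub>R u)" using m(1) by simp
    also have "\<dots> = (\<Sum>x\<in>B. of_int (k (b x)) *\<^sub>R ?f x)"
      unfolding k by (simp add: sum.reindex[OF inj] scaleR_sum_right mult.commute)
    also have "\<dots> \<in> int_span (?f ` B)"
      using B(1) by (intro add_subgroup_sum add_subgroup_scale_int add_subgroup_int_span int_span_base) auto
    finally show "u \<in> int_span (?f ` B)" .
  qed
  then show ?thesis using that 1 B(1) by blast
qed

text \<open>The dual vectors of the generators are characters of the chart, in general not of
  \<open>M\<close>; a common multiple \<open>k\<close> moves them into \<open>M\<close>.\<close>

lemma dual_vectors_in_M:
  assumes "\<sigma> \<in> \<Xi>"
  obtains d and k :: nat where "k > 0" "\<And>g. g \<in> gens \<sigma> \<Longrightarrow> d g \<in> M"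
    "\<And>g h. g \<in> gens \<sigma> \<Longrightarrow> h \<in> gens \<sigma> \<Longrightarrow> d g \<bullet> h = (if g = h then real k else 0)"
proof -
  obtain e where e: "dual_family (gens \<sigma>) e" "\<And>g. g \<in> gens \<sigma> \<Longrightarrow> e g \<in> chart_dual \<sigma>"
    using chart_coordinates_exist[OF assms] by blast
  obtain m :: nat where m: "m > 0" "\<And>u. u \<in> chart_dual \<sigma> \<Longrightarrow> real m *\<^sub>R u \<in> M"
    using exponent[OF assms] by metis
  show ?thesis
    by (rule that[of m "\<lambda>g. real m *\<^sub>R e g"]) (use e m in \<open>auto simp: dual_family_def\<close>)
qed

section \<open>Points of the toric variety\<close>

text \<open>The coordinates \<tau> and \<open>l\<close> do not depend on \<open>S\<close>, so
  glueing, restricting and projecting change only \<open>S\<close>. \<open>l\<close> is not unique: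
  only \<open>exp \<circ> l\<close> on the characters of \<open>S\<close> orthogonal to \<tau>
  counts.\<close>

definition orbit_point :: "'a set \<Rightarrow> 'a set \<Rightarrow> ('a \<Rightarrow> complex) \<Rightarrow> 'a \<Rightarrow> complex" where
  "orbit_point S \<tau> l = (\<lambda>u. if u \<in> S \<and> u \<in> perp \<tau> then exp (l u) else 0)"

abbreviation "cone_mon \<sigma> \<equiv> dual_cone \<sigma> \<inter> M"
abbreviation "chart_mon \<sigma> \<equiv> dual_cone \<sigma> \<inter> chart_dual \<sigma>"

lemma commensurableD:
  assumes "commensurable L"
  shows "add_subgroup L" "M \<subseteq> L"
  using assms by (auto simp: commensurable_def)

lemma cone_monoid:
  assumes "commensurable L"
  shows "0 \<in> dual_cone \<sigma> \<inter> L" "\<And>u w. u \<in> dual_cone \<sigma> \<inter> L \<Longrightarrow> w \<in> dual_cone \<sigma> \<inter> L \<Longrightarrow> u + w \<in> dual_cone \<sigma> \<inter> L"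
  using add_subgroupD[OF commensurableD(1)[OF assms]] by (auto simp: dual_cone_def inner_add_left)

lemma mult_system_cone:
  assumes "commensurable L"
  shows "mult_system (monoid_points (dual_cone \<sigma> \<inter> L)) (monoid_algebra (dual_cone \<sigma> \<inter> L))"
  by (rule mult_system_monoid[OF cone_monoid[OF assms]])

lemma affine_toric_N: "affine_toric N \<sigma> = affine_fspace (monoid_points (cone_mon \<sigma>)) (monoid_algebra (cone_mon \<sigma>))"
  by (simp add: affine_toric_def Let_def)

lemma affine_toric_chart: "affine_toric (chart_lattice N \<sigma> (C \<sigma>)) \<sigma> =
    affine_fspace (monoid_points (chart_mon \<sigma>)) (monoid_algebra (chart_mon \<sigma>))"
  by (simp add: affine_toric_def Let_def)

lemma pts_affine_toric: "pts (affine_toric N \<sigma>) = monoid_points (cone_mon \<sigma>)"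
  unfolding affine_toric_N using topspace_affine_fspace mult_system_cone commensurable_M by blast

lemma pts_chart: "\<sigma> \<in> \<Xi> \<Longrightarrow> pts (affine_toric (chart_lattice N \<sigma> (C \<sigma>)) \<sigma>) = monoid_points (chart_mon \<sigma>)"
  unfolding affine_toric_chart using topspace_affine_fspace mult_system_cone commensurable_chart_dual by blast

lemma perp_add_iff:
  assumes "u \<in> dual_cone \<tau>" "w \<in> dual_cone \<tau>"
  shows "u + w \<in> perp \<tau> \<longleftrightarrow> u \<in> perp \<tau> \<and> w \<in> perp \<tau>"
  using assms unfolding perp_def dual_cone_def
  by (auto simp: inner_add_left) (metis add_nonneg_eq_0_iff)+

lemma orbit_point_in:
  assumes "commensurable L" "\<tau> \<subseteq> \<sigma>" "linear l"
  shows "orbit_point (dual_cone \<sigma> \<inter> L) \<tau> l \<in> monoid_points (dual_cone \<sigma> \<inter> L)"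
  unfolding monoid_points_def
proof (intro CollectI conjI ballI allI impI)
  show "orbit_point (dual_cone \<sigma> \<inter> L) \<tau> l 0 = 1"
    using cone_monoid(1)[OF assms(1)] linear_0[OF assms(3)] by (auto simp: orbit_point_def perp_def)
  fix u w assume uw: "u \<in> dual_cone \<sigma> \<inter> L" "w \<in> dual_cone \<sigma> \<inter> L"
  have "u \<in> dual_cone \<tau>" "w \<in> dual_cone \<tau>" using dual_cone_antimono[OF assms(2)] uw by auto
  then show "orbit_point (dual_cone \<sigma> \<inter> L) \<tau> l (u + w) =
      orbit_point (dual_cone \<sigma> \<inter> L) \<tau> l u * orbit_point (dual_cone \<sigma> \<inter> L) \<tau> l w"
    using cone_monoid(2)[OF assms(1) uw] uw
    by (auto simp: orbit_point_def perp_add_iff linear_add[OF assms(3)] exp_add)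
qed (auto simp: orbit_point_def)

lemma M_inner_gens_Ints:
  assumes "\<sigma> \<in> \<Xi>" "u \<in> M" "g \<in> gens \<sigma>"
  shows "u \<bullet> g \<in> \<int>"
  using assms gens_in_N by (auto simp: dual_lattice_def)

text \<open>\<open>U\<^sub>\<tau>\<close> is the principal open subset of \<open>U\<^sub>\<sigma>\<close> given by this character.\<close>

lemma face_character:
  assumes "\<sigma> \<in> \<Xi>" "\<tau> \<in> \<Xi>" "\<tau> \<subseteq> \<sigma>"
  obtains u0 where "u0 \<in> cone_mon \<sigma>" "u0 \<in> perp \<tau>" "\<And>g. g \<in> gens \<sigma> \<Longrightarrow> g \<notin> gens \<tau> \<Longrightarrow> u0 \<bullet> g \<ge> 1"
    "\<And>u. u \<in> dual_cone \<tau> \<Longrightarrow> \<exists>k0. \<forall>k\<ge>k0. u + real k *\<^sub>R u0 \<in> dual_cone \<sigma>"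
proof -
  obtain k :: nat and d where d: "k > 0" "\<And>g. g \<in> gens \<sigma> \<Longrightarrow> d g \<in> M"
    "\<And>g h. g \<in> gens \<sigma> \<Longrightarrow> h \<in> gens \<sigma> \<Longrightarrow> d g \<bullet> h = (if g = h then real k else 0)"
    by (rule dual_vectors_in_M[OF assms(1)], rule that)
  \<comment> \<open>Zero on the generators of \<tau> and equal to \<open>k\<close> on the others.
    Adding enough copies repairs the signs of any character that is nonnegative on \<tau>.\<close>
  define u0 where "u0 = (\<Sum>g\<in>gens \<sigma> - gens \<tau>. d g)"
  have ip: "u0 \<bullet> h = (if h \<in> gens \<tau> then 0 else real k)" if h: "h \<in> gens \<sigma>" for h
  proof -
    have "u0 \<bullet> h = (\<Sum>g\<in>gens \<sigma> - gens \<tau>. if g = h then real k else 0)"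
      unfolding u0_def inner_sum_left using d(3) h by (intro sum.cong) auto
    then show ?thesis using h gens_finite[OF assms(1)] by auto
  qed
  have u0: "u0 \<in> M" unfolding u0_def
    by (rule add_subgroup_sum) (auto simp: dual_lattice_subgroup d)
  show ?thesis
  proof
    show "u0 \<in> cone_mon \<sigma>" using u0 ip by (auto simp: dual_cone_iff_gens[OF assms(1)])
    show "u0 \<in> perp \<tau>" using ip gens_face_in[OF assms(2,1,3)] by (auto simp: perp_iff_gens[OF assms(2)])
    show "\<And>g. g \<in> gens \<sigma> \<Longrightarrow> g \<notin> gens \<tau> \<Longrightarrow> u0 \<bullet> g \<ge> 1" using ip d(1) by simp
    fix u assume u: "u \<in> dual_cone \<tau>"
    obtain k0 :: nat where k0: "\<And>g. g \<in> gens \<sigma> \<Longrightarrow> \<bar>u \<bullet> g\<bar> \<le> real k0"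
    proof -
      obtain r where r: "\<And>g. g \<in> gens \<sigma> \<Longrightarrow> \<bar>u \<bullet> g\<bar> \<le> r"
        using gens_finite[OF assms(1)] finite_imp_bounded[of "(\<lambda>g. u \<bullet> g) ` gens \<sigma>"]
        by (auto simp: bounded_iff)
      obtain k0 :: nat where "r \<le> real k0" using real_arch_simple by blast
      then show ?thesis using that r order_trans by blast
    qed
    have "u + real j *\<^sub>R u0 \<in> dual_cone \<sigma>" if j: "k0 \<le> j" for j
      unfolding dual_cone_iff_gens[OF assms(1)]
    proof
      fix g assume g: "g \<in> gens \<sigma>"
      show "0 \<le> (u + real j *\<^sub>R u0) \<bullet> g"
      proof (cases "g \<in> gens \<tau>")
        case True
        then show ?thesis using u ip[OF g] by (auto simp: inner_add_left dual_cone_iff_gens[OF assms(2)])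
      next
        case False
        have "real k0 \<le> real j * real k" using j d(1) by (metis One_nat_def Suc_leI le_trans mult.right_neutral mult_le_mono of_nat_le_iff of_nat_mult)
        then show ?thesis using k0[OF g] ip[OF g] False by (simp add: inner_add_left)
      qed
    qed
    then show "\<exists>k0. \<forall>k\<ge>k0. u + real k *\<^sub>R u0 \<in> dual_cone \<sigma>" by blast
  qed
qed

lemma perp_dual_cone: "u \<in> perp \<tau> \<Longrightarrow> u \<in> dual_cone \<tau>"
  by (simp add: perp_def dual_cone_def)

text \<open>The points are functions on the monoid, while the conclusion concerns all of
  \<open>L \<inter> perp \<tau>\<close>. A character orthogonal to \<tau> is pushed into the monoid
  by a multiple of the face character, whose own value is nonzero and cancels. The nonvanishing of
  face characters also detects the cone.\<close>

lemma orbit_point_eq_iff: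
  assumes "commensurable L" "\<sigma> \<in> \<Xi>" "\<tau> \<in> \<Xi>" "\<tau> \<subseteq> \<sigma>" "\<tau>' \<in> \<Xi>" "\<tau>' \<subseteq> \<sigma>" "linear l" "linear l'"
  shows "orbit_point (dual_cone \<sigma> \<inter> L) \<tau> l = orbit_point (dual_cone \<sigma> \<inter> L) \<tau>' l' \<longleftrightarrow>
    \<tau> = \<tau>' \<and> (\<forall>u\<in>L \<inter> perp \<tau>. exp (l u) = exp (l' u))" (is "?x = ?y \<longleftrightarrow> _")
proof
  assume eq: "?x = ?y"
  have sub: "\<tau>1 \<subseteq> \<tau>2" if t: "\<tau>1 \<in> \<Xi>" "\<tau>1 \<subseteq> \<sigma>" "\<tau>2 \<in> \<Xi>" "\<tau>2 \<subseteq> \<sigma>"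
    and eq: "orbit_point (dual_cone \<sigma> \<inter> L) \<tau>1 l1 = orbit_point (dual_cone \<sigma> \<inter> L) \<tau>2 l2" for \<tau>1 \<tau>2 l1 l2
  proof -
    obtain u0 where u0: "u0 \<in> cone_mon \<sigma>" "u0 \<in> perp \<tau>2" "\<And>g. g \<in> gens \<sigma> \<Longrightarrow> g \<notin> gens \<tau>2 \<Longrightarrow> u0 \<bullet> g \<ge> 1"
      using face_character[OF assms(2) t(3,4)] by metis
    have "orbit_point (dual_cone \<sigma> \<inter> L) \<tau>2 l2 u0 \<noteq> 0"
      using u0 commensurableD(2)[OF assms(1)] by (auto simp: orbit_point_def)
    then have "orbit_point (dual_cone \<sigma> \<inter> L) \<tau>1 l1 u0 \<noteq> 0" using eq by simp
    then have "u0 \<in> perp \<tau>1" by (auto simp: orbit_point_def split: if_splits)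
    have "gens \<tau>1 \<subseteq> gens \<tau>2"
    proof
      fix g assume g: "g \<in> gens \<tau>1"
      then have "u0 \<bullet> g = 0" using \<open>u0 \<in> perp \<tau>1\<close> perp_iff_gens t(1) by blast
      then show "g \<in> gens \<tau>2" using u0(3)[of g] g gens_face_in[OF t(1) assms(2) t(2)] by force
    qed
    then show ?thesis using subset_iff_gens t by blast
  qed
  have \<tau>: "\<tau> = \<tau>'" using sub[OF assms(3,4,5,6) eq] sub[OF assms(5,6,3,4) eq[symmetric]] by blast
  moreover have "exp (l u) = exp (l' u)" if u: "u \<in> L" "u \<in> perp \<tau>" for u
  proof -
    obtain u0 where u0: "u0 \<in> cone_mon \<sigma>" "u0 \<in> perp \<tau>"
      "\<And>u. u \<in> dual_cone \<tau> \<Longrightarrow> \<exists>k0. \<forall>k\<ge>k0. u + real k *\<^sub>R u0 \<in> dual_cone \<sigma>"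
      using face_character[OF assms(2,3,4)] by metis
    obtain k where k: "u + real k *\<^sub>R u0 \<in> dual_cone \<sigma>" using u0(3)[OF perp_dual_cone[OF u(2)]] by blast
    let ?w = "real k *\<^sub>R u0"
    have w: "?w \<in> dual_cone \<sigma>" "?w \<in> L" "?w \<in> perp \<tau>"
      using u0 add_subgroup_scale_nat[OF commensurableD(1)[OF assms(1)]] commensurableD(2)[OF assms(1)]
      by (auto simp: dual_cone_def perp_def)
    have uw: "u + ?w \<in> dual_cone \<sigma>" "u + ?w \<in> L" "u + ?w \<in> perp \<tau>"
      using k w u add_subgroupD(4)[OF commensurableD(1)[OF assms(1)]] by (auto simp: perp_def inner_add_left)
    have "exp (l ?w) = exp (l' ?w)" using fun_cong[OF eq, of ?w] w \<tau> by (simp add: orbit_point_def)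
    moreover have "exp (l (u + ?w)) = exp (l' (u + ?w))"
      using fun_cong[OF eq, of "u + ?w"] uw \<tau> by (simp add: orbit_point_def)
    ultimately show ?thesis by (simp add: linear_add assms exp_add)
  qed
  ultimately show "\<tau> = \<tau>' \<and> (\<forall>u\<in>L \<inter> perp \<tau>. exp (l u) = exp (l' u))" by blast
qed (auto simp: orbit_point_def fun_eq_iff)

text \<open>\<tau> is spanned by those generators whose coordinate \<open>d g\<close> vanishes at
  \<open>x\<close>. To see that this decides the vanishing of every character, a multiple of
  \<open>u\<close> is written as a natural combination of the \<open>d g\<close> plus a unit of the
  monoid.\<close>

lemma monoid_point_form:
  assumes "commensurable L" "\<sigma> \<in> \<Xi>" "x \<in> monoid_points (dual_cone \<sigma> \<inter> L)"
  obtains \<tau> l where "\<tau> \<in> \<Xi>" "\<tau> \<subseteq> \<sigma>" "linear l" "x = orbit_point (dual_cone \<sigma> \<inter> L) \<tau> l"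
proof -
  let ?S = "dual_cone \<sigma> \<inter> L"
  note mon = cone_monoid[OF assms(1), where \<sigma> = \<sigma>]
  obtain k :: nat and d where d: "k > 0" "\<And>g. g \<in> gens \<sigma> \<Longrightarrow> d g \<in> M"
    "\<And>g h. g \<in> gens \<sigma> \<Longrightarrow> h \<in> gens \<sigma> \<Longrightarrow> d g \<bullet> h = (if g = h then real k else 0)"
    by (rule dual_vectors_in_M[OF assms(2)], rule that)
  obtain m :: nat where m: "m > 0" "\<And>u. u \<in> L \<Longrightarrow> real m *\<^sub>R u \<in> M"
    using assms(1) by (auto simp: commensurable_def)
  have subL: "M \<subseteq> L" and L: "add_subgroup L" using commensurableD[OF assms(1)] by auto
  have dS: "d g \<in> ?S" if "g \<in> gens \<sigma>" for g
    using d that subL by (auto simp: dual_cone_iff_gens[OF assms(2)])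
  obtain \<tau> where \<tau>: "\<tau> \<in> \<Xi>" "\<tau> \<subseteq> \<sigma>" "gens \<tau> = {g \<in> gens \<sigma>. x (d g) = 0}"
    by (rule face_by_gens[OF assms(2), of "{g \<in> gens \<sigma>. x (d g) = 0}"]) auto
  have x0: "x 0 = 1" and xadd: "\<And>u w. u \<in> ?S \<Longrightarrow> w \<in> ?S \<Longrightarrow> x (u + w) = x u * x w"
    and xout: "\<And>u. u \<notin> ?S \<Longrightarrow> x u = 0" using assms(3) by (auto simp: monoid_points_def)
  have supp: "x u \<noteq> 0 \<longleftrightarrow> u \<in> perp \<tau>" if u: "u \<in> ?S" for u
  proof -
    have mu: "real m *\<^sub>R u \<in> M" using m u by auto
    have "\<exists>n::nat. (real m *\<^sub>R u) \<bullet> g = real n" if g: "g \<in> gens \<sigma>" for g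
    proof -
      have "(real m *\<^sub>R u) \<bullet> g \<in> \<int>" using M_inner_gens_Ints[OF assms(2) mu g] .
      moreover have "0 \<le> (real m *\<^sub>R u) \<bullet> g" using u g by (auto simp: dual_cone_iff_gens[OF assms(2)])
      ultimately show ?thesis by (metis Ints_cases of_int_0_le_iff zero_le_imp_eq_int of_int_of_nat_eq)
    qed
    then obtain n :: "'a \<Rightarrow> nat" where n: "\<And>g. g \<in> gens \<sigma> \<Longrightarrow> (real m *\<^sub>R u) \<bullet> g = real (n g)" by metis
    define s where "s = (\<Sum>g\<in>gens \<sigma>. real (n g) *\<^sub>R d g)"
    \<comment> \<open>\<open>s\<close> matches \<open>k * m\<close> times \<open>u\<close> on every
      generator, so \<open>w\<close> is orthogonal to \<sigma>. Then \<open>w\<close> and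
      \<open>- w\<close> both lie in the monoid, and \<open>x w\<close> is invertible.\<close>
    define w where "w = real k *\<^sub>R (real m *\<^sub>R u) - s"
    have sM: "s \<in> M" unfolding s_def
      by (rule add_subgroup_sum[OF dual_lattice_subgroup]) (auto intro: add_subgroup_scale_nat dual_lattice_subgroup d)
    have "w \<bullet> h = 0" if h: "h \<in> gens \<sigma>" for h
    proof -
      have "s \<bullet> h = (\<Sum>g\<in>gens \<sigma>. if g = h then real (n h) * real k else 0)"
        unfolding s_def inner_sum_left using d(3) h by (intro sum.cong) auto
      then have "s \<bullet> h = real (n h) * real k" using h gens_finite[OF assms(2)] by simp
      then show ?thesis using n[OF h] by (simp add: w_def inner_diff_left)
    qed
    moreover have "w \<in> M" unfolding w_def
      using sM add_subgroup_scale_nat[OF dual_lattice_subgroup mu] add_subgroupD(2)[OF dual_lattice_subgroup] by blast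
    ultimately have w: "w \<in> ?S" "- w \<in> ?S"
      using subL add_subgroupD(3)[OF L] by (auto simp: dual_cone_iff_gens[OF assms(2)])
    have "x w * x (- w) = 1" using xadd[OF w] x0 by simp
    then have xw: "x w \<noteq> 0" by auto
    have s: "s \<in> ?S \<and> x s = (\<Prod>g\<in>gens \<sigma>. x (real (n g) *\<^sub>R d g))"
      unfolding s_def using monoid_points_scale[OF assms(3) mon(2,1) dS] gens_finite[OF assms(2)]
      by (intro monoid_points_sum[OF assms(3) mon(2,1)]) auto
    also have "(\<Prod>g\<in>gens \<sigma>. x (real (n g) *\<^sub>R d g)) = (\<Prod>g\<in>gens \<sigma>. x (d g) ^ n g)"
      using monoid_points_scale[OF assms(3) mon(2,1) dS] by (intro prod.cong) auto
    finally have s: "s \<in> ?S" "x s = (\<Prod>g\<in>gens \<sigma>. x (d g) ^ n g)" by auto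
    have "x u ^ (k * m) = x (real (k * m) *\<^sub>R u)"
      using monoid_points_scale[OF assms(3) mon(2,1) u, of "k * m"] by simp
    also have "real (k * m) *\<^sub>R u = s + w" by (simp add: w_def)
    also have "x (s + w) = (\<Prod>g\<in>gens \<sigma>. x (d g) ^ n g) * x w" using xadd s w by simp
    finally have "x u ^ (k * m) = (\<Prod>g\<in>gens \<sigma>. x (d g) ^ n g) * x w" .
    then have "x u = 0 \<longleftrightarrow> (\<exists>g\<in>gens \<sigma>. x (d g) = 0 \<and> n g > 0)"
      using xw d(1) m(1) gens_finite[OF assms(2)] power_eq_0_iff[of "x u" "k * m"] by auto
    moreover have "n g > 0 \<longleftrightarrow> u \<bullet> g \<noteq> 0" if "g \<in> gens \<sigma>" for g
      using n[OF that] m(1) by (cases "n g = 0") auto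
    ultimately show ?thesis using \<tau> by (auto simp: perp_iff_gens)
  qed
  obtain A where A: "finite A" "independent A" "L \<subseteq> int_span A" using commensurable_basis[OF assms(1)] .
  have "\<tau> \<subseteq> \<sigma>" by fact
  then have *: "u \<in> dual_cone \<tau>" if "u \<in> ?S" for u using that dual_cone_antimono by blast
  \<comment> \<open>On the characters orthogonal to \<tau> the point has no zeros, so it is the
    exponential of a linear map there.\<close>
  obtain l where l: "linear l" "\<And>u. u \<in> ?S \<inter> perp \<tau> \<Longrightarrow> x u = exp (l u)"
  proof (rule character_extends_to_exp[OF A(1,2), of "?S \<inter> perp \<tau>" x])
    show "?S \<inter> perp \<tau> \<subseteq> int_span A" using A(3) by auto
    show "0 \<in> ?S \<inter> perp \<tau>" using mon(1) by (auto simp: perp_def)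
    show "u + w \<in> ?S \<inter> perp \<tau>" if "u \<in> ?S \<inter> perp \<tau>" "w \<in> ?S \<inter> perp \<tau>" for u w
      using mon(2)[of u w] that perp_add_iff[of u \<tau> w] * by blast
    show "x u \<noteq> 0" if "u \<in> ?S \<inter> perp \<tau>" for u using supp that by blast
    show "x (u + w) = x u * x w" if "u \<in> ?S \<inter> perp \<tau>" "w \<in> ?S \<inter> perp \<tau>" for u w
      using xadd that by blast
  qed blast
  have "x = orbit_point ?S \<tau> l"
    using l(2) supp xout by (auto simp: fun_eq_iff orbit_point_def)
  then show ?thesis using that \<tau> l(1) by blast
qed

section \<open>Points and orbits of the glued variety\<close>

lemma restrict_orbit_point:
  assumes "cone_mon \<sigma> \<subseteq> S"
  shows "restrict_point N \<sigma> (orbit_point S \<tau> l) = orbit_point (cone_mon \<sigma>) \<tau> l"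
  using assms by (auto simp: restrict_point_def orbit_point_def fun_eq_iff)

text \<open>The glueing class written out, with one representative in each affine piece whose cone
  contains \<tau>. It contains the piece of \<tau> itself, from which the coordinates can be
  recovered.\<close>

definition pt :: "'a set \<Rightarrow> ('a \<Rightarrow> complex) \<Rightarrow> 'a toric_point" where
  "pt \<tau> l = {(\<sigma>, orbit_point (cone_mon \<sigma>) \<tau> l) | \<sigma>. \<sigma> \<in> \<Xi> \<and> \<tau> \<subseteq> \<sigma>}"

text \<open>A partner under \<open>glue_rel\<close> comes from a point of the piece over
  \<open>\<sigma> \<inter> \<sigma>'\<close>. That point has coordinates as well, and restricting it
  to \<sigma> shows that they are those of the given point.\<close>

lemma toric_class_orbit_point:
  assumes "\<sigma> \<in> \<Xi>" "\<tau> \<in> \<Xi>" "\<tau> \<subseteq> \<sigma>" "linear l"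
  shows "toric_class N \<Xi> \<sigma> (orbit_point (cone_mon \<sigma>) \<tau> l) = pt \<tau> l"
proof (intro equalityI subsetI)
  fix z assume "z \<in> toric_class N \<Xi> \<sigma> (orbit_point (cone_mon \<sigma>) \<tau> l)"
  then have "((\<sigma>, orbit_point (cone_mon \<sigma>) \<tau> l), z) \<in> glue_rel N \<Xi>" by (simp add: toric_class_def)
  then obtain \<sigma>' y where y: "\<sigma>' \<in> \<Xi>" "y \<in> monoid_points (cone_mon (\<sigma> \<inter> \<sigma>'))" "z = (\<sigma>', restrict_point N \<sigma>' y)"
    "orbit_point (cone_mon \<sigma>) \<tau> l = restrict_point N \<sigma> y"
    unfolding glue_rel_def pts_affine_toric by blast
  obtain \<tau>' l' where y': "\<tau>' \<in> \<Xi>" "\<tau>' \<subseteq> \<sigma> \<inter> \<sigma>'" "linear l'" "y = orbit_point (cone_mon (\<sigma> \<inter> \<sigma>')) \<tau>' l'"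
    by (rule monoid_point_form[OF commensurable_M Int_in_fan[OF assms(1) y(1)] y(2)])
  have r: "restrict_point N \<sigma> y = orbit_point (cone_mon \<sigma>) \<tau>' l'" "restrict_point N \<sigma>' y = orbit_point (cone_mon \<sigma>') \<tau>' l'"
    unfolding y'(4) using dual_cone_antimono by (intro restrict_orbit_point; blast)+
  then have eq: "\<tau> = \<tau>' \<and> (\<forall>u\<in>M \<inter> perp \<tau>. exp (l u) = exp (l' u))"
    using orbit_point_eq_iff[OF commensurable_M assms(1,2,3) y'(1) _ assms(4) y'(3)] y(4) y'(2) by auto
  then have "orbit_point (cone_mon \<sigma>') \<tau>' l' = orbit_point (cone_mon \<sigma>') \<tau> l"
    by (auto simp: orbit_point_def fun_eq_iff)
  then show "z \<in> pt \<tau> l" using y(1,3) r(2) eq y'(2) unfolding pt_def by auto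
next
  fix z assume "z \<in> pt \<tau> l"
  then obtain \<sigma>' where \<sigma>': "\<sigma>' \<in> \<Xi>" "\<tau> \<subseteq> \<sigma>'" "z = (\<sigma>', orbit_point (cone_mon \<sigma>') \<tau> l)" by (auto simp: pt_def)
  let ?y = "orbit_point (cone_mon (\<sigma> \<inter> \<sigma>')) \<tau> l"
  have y: "?y \<in> pts (affine_toric N (\<sigma> \<inter> \<sigma>'))"
    unfolding pts_affine_toric using orbit_point_in[OF commensurable_M] assms \<sigma>' by simp
  have r: "restrict_point N \<sigma> ?y = orbit_point (cone_mon \<sigma>) \<tau> l" "restrict_point N \<sigma>' ?y = orbit_point (cone_mon \<sigma>') \<tau> l"
    using dual_cone_antimono by (intro restrict_orbit_point; blast)+
  have "((\<sigma>, restrict_point N \<sigma> ?y), (\<sigma>', restrict_point N \<sigma>' ?y)) \<in> glue_rel N \<Xi>"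
    unfolding glue_rel_def using assms(1) \<sigma>'(1) y by blast
  then show "z \<in> toric_class N \<Xi> \<sigma> (orbit_point (cone_mon \<sigma>) \<tau> l)"
    using \<sigma>'(3) r by (simp add: toric_class_def)
qed

lemma pt_eq_iff:
  assumes "\<tau> \<in> \<Xi>" "\<tau>' \<in> \<Xi>" "linear l" "linear l'"
  shows "pt \<tau> l = pt \<tau>' l' \<longleftrightarrow> \<tau> = \<tau>' \<and> (\<forall>u\<in>M \<inter> perp \<tau>. exp (l u) = exp (l' u))"
proof
  assume eq: "pt \<tau> l = pt \<tau>' l'"
  have "(\<tau>, orbit_point (cone_mon \<tau>) \<tau> l) \<in> pt \<tau>' l'" "(\<tau>', orbit_point (cone_mon \<tau>') \<tau>' l') \<in> pt \<tau> l"
    using assms eq unfolding pt_def by blast+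
  then have "\<tau>' \<subseteq> \<tau>" "\<tau> \<subseteq> \<tau>'" "orbit_point (cone_mon \<tau>) \<tau> l = orbit_point (cone_mon \<tau>) \<tau>' l'"
    by (auto simp: pt_def)
  then show "\<tau> = \<tau>' \<and> (\<forall>u\<in>M \<inter> perp \<tau>. exp (l u) = exp (l' u))"
    using orbit_point_eq_iff[OF commensurable_M assms(1,1) _ assms(2) _ assms(3,4)] by simp
next
  assume eq: "\<tau> = \<tau>' \<and> (\<forall>u\<in>M \<inter> perp \<tau>. exp (l u) = exp (l' u))"
  then have "orbit_point (cone_mon \<sigma>) \<tau> l = orbit_point (cone_mon \<sigma>) \<tau>' l'" for \<sigma>
    by (auto simp: orbit_point_def fun_eq_iff)
  then show "pt \<tau> l = pt \<tau>' l'" using eq by (simp add: pt_def)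
qed

lemma toric_points_eq: "toric_points N \<Xi> = {pt \<tau> l | \<tau> l. \<tau> \<in> \<Xi> \<and> linear l}"
proof (intro equalityI subsetI)
  fix p assume "p \<in> toric_points N \<Xi>"
  then obtain \<sigma> x where x: "\<sigma> \<in> \<Xi>" "x \<in> monoid_points (cone_mon \<sigma>)" "p = toric_class N \<Xi> \<sigma> x"
    by (auto simp: toric_points_def quotient_def toric_class_def pts_affine_toric)
  obtain \<tau> l where "\<tau> \<in> \<Xi>" "\<tau> \<subseteq> \<sigma>" "linear l" "x = orbit_point (cone_mon \<sigma>) \<tau> l"
    by (rule monoid_point_form[OF commensurable_M x(1,2)])
  then show "p \<in> {pt \<tau> l | \<tau> l. \<tau> \<in> \<Xi> \<and> linear l}" using toric_class_orbit_point x by blast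
next
  fix p assume "p \<in> {pt \<tau> l | \<tau> l. \<tau> \<in> \<Xi> \<and> linear l}"
  then obtain \<tau> l where *: "\<tau> \<in> \<Xi>" "linear l" "p = pt \<tau> l" by blast
  have "orbit_point (cone_mon \<tau>) \<tau> l \<in> monoid_points (cone_mon \<tau>)"
    using orbit_point_in[OF commensurable_M] * by simp
  moreover have "p = toric_class N \<Xi> \<tau> (orbit_point (cone_mon \<tau>) \<tau> l)"
    using toric_class_orbit_point * by simp
  ultimately show "p \<in> toric_points N \<Xi>" using *
    by (auto simp: toric_points_def quotient_def toric_class_def pts_affine_toric)
qed

text \<open>A torus point is a character of the group \<open>M\<close>, hence an exponential;
  multiplying by the distinguished point merely cuts it down to the characters orthogonal to
  \<tau>.\<close>

lemma orbit_eq: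
  assumes "\<tau> \<in> \<Xi>"
  shows "orbit N \<Xi> \<tau> = {pt \<tau> l | l. linear l}"
proof -
  have dist: "distinguished_point N \<tau> = (\<lambda>u. if u \<in> cone_mon \<tau> \<and> u \<in> perp \<tau> then 1 else 0)"
    by (auto simp: distinguished_point_def restrict_point_def perp_def fun_eq_iff)
  show ?thesis
  proof (intro equalityI subsetI)
    fix p assume "p \<in> orbit N \<Xi> \<tau>"
    then obtain t where t: "t \<in> monoid_points M" "p = toric_class N \<Xi> \<tau> (\<lambda>u. t u * distinguished_point N \<tau> u)"
      by (auto simp: orbit_def)
    obtain A where A: "finite A" "independent A" "M \<subseteq> int_span A" using commensurable_basis[OF commensurable_M] .
    obtain l where l: "linear l" "\<And>u. u \<in> M \<Longrightarrow> t u = exp (l u)"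
    proof (rule character_extends_to_exp[OF A, of t])
      show "0 \<in> M" "\<And>u w. u \<in> M \<Longrightarrow> w \<in> M \<Longrightarrow> u + w \<in> M"
        using add_subgroupD[OF dual_lattice_subgroup] by auto
      show tm: "t (u + w) = t u * t w" if "u \<in> M" "w \<in> M" for u w using t(1) that by (auto simp: monoid_points_def)
      show "t u \<noteq> 0" if u: "u \<in> M" for u
      proof -
        have "t u * t (- u) = t (u + - u)"
          by (rule tm[OF u add_subgroupD(3)[OF dual_lattice_subgroup u], symmetric])
        then show ?thesis using t(1) by (auto simp: monoid_points_def)
      qed
    qed blast
    have "(\<lambda>u. t u * distinguished_point N \<tau> u) = orbit_point (cone_mon \<tau>) \<tau> l"
      using l(2) by (auto simp: dist orbit_point_def fun_eq_iff)
    then show "p \<in> {pt \<tau> l | l. linear l}" using toric_class_orbit_point[OF assms assms _ l(1)] t(2) l(1) by auto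
  next
    fix p assume "p \<in> {pt \<tau> l | l. linear l}"
    then obtain l where l: "linear l" "p = pt \<tau> l" by blast
    let ?t = "\<lambda>u. if u \<in> M then exp (l u) else 0"
    have "?t \<in> monoid_points M"
      using add_subgroupD[OF dual_lattice_subgroup[of N]] linear_0[OF l(1)] linear_add[OF l(1)]
      by (auto simp: monoid_points_def exp_add)
    moreover have "(\<lambda>u. ?t u * distinguished_point N \<tau> u) = orbit_point (cone_mon \<tau>) \<tau> l"
      by (auto simp: dist orbit_point_def fun_eq_iff)
    then have "p = toric_class N \<Xi> \<tau> (\<lambda>u. ?t u * distinguished_point N \<tau> u)"
      using toric_class_orbit_point[OF assms assms _ l(1)] l(2) by simp
    ultimately show "p \<in> orbit N \<Xi> \<tau>" unfolding orbit_def by (intro CollectI exI[of _ ?t] conjI)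
  qed
qed

lemma cone_of_pt:
  assumes "\<tau> \<in> \<Xi>" "linear l"
  shows "cone_of_point N \<Xi> (pt \<tau> l) = \<tau>"
  unfolding cone_of_point_def
proof (rule the_equality)
  show "\<tau> \<in> \<Xi> \<and> pt \<tau> l \<in> orbit N \<Xi> \<tau>" using assms orbit_eq by blast
  fix \<tau>' assume "\<tau>' \<in> \<Xi> \<and> pt \<tau> l \<in> orbit N \<Xi> \<tau>'"
  then show "\<tau>' = \<tau>" using assms orbit_eq pt_eq_iff by fastforce
qed

lemma orbit_closure_eq:
  assumes "\<tau> \<in> \<Xi>"
  shows "orbit_closure N \<Xi> \<tau> = {pt \<gamma> l | \<gamma> l. \<gamma> \<in> \<Xi> \<and> \<tau> \<subseteq> \<gamma> \<and> linear l}"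
proof -
  have "orbit_closure N \<Xi> \<tau> = (\<Union>\<gamma>\<in>{\<gamma> \<in> \<Xi>. \<tau> \<subseteq> \<gamma>}. {pt \<gamma> l | l. linear l})"
    unfolding orbit_closure_def by (rule SUP_cong) (use assms face_of_iff_subset orbit_eq in auto)
  then show ?thesis by blast
qed

section \<open>Local groups and injections of charts\<close>

definition coset :: "'a set \<Rightarrow> 'a \<Rightarrow> 'a set" where
  "coset \<gamma> v = {h + v | h. h \<in> int_span (gens \<gamma>)}"

lemma coset_eq_iff: "coset \<gamma> v = coset \<gamma> v' \<longleftrightarrow> v - v' \<in> int_span (gens \<gamma>)"
proof
  assume "coset \<gamma> v = coset \<gamma> v'"
  moreover have "v \<in> coset \<gamma> v" using zero_in_int_span by (force simp: coset_def)
  ultimately obtain h where "h \<in> int_span (gens \<gamma>)" "v = h + v'" by (auto simp: coset_def)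
  then show "v - v' \<in> int_span (gens \<gamma>)" by simp
next
  have *: "coset \<gamma> v \<subseteq> coset \<gamma> v'" if vv': "v - v' \<in> int_span (gens \<gamma>)" for v v'
  proof
    fix w assume "w \<in> coset \<gamma> v"
    then obtain h where h: "h \<in> int_span (gens \<gamma>)" "w = h + v" by (auto simp: coset_def)
    then have "w = (h + (v - v')) + v'" by simp
    then show "w \<in> coset \<gamma> v'" using int_span_add[OF h(1) vv'] unfolding coset_def by blast
  qed
  assume vv': "v - v' \<in> int_span (gens \<gamma>)"
  then have "v' - v \<in> int_span (gens \<gamma>)" using int_span_uminus by fastforce
  then show "coset \<gamma> v = coset \<gamma> v'" using * vv' by blast
qed

abbreviation span_group :: "'a set \<Rightarrow> 'a monoid" where
  "span_group \<gamma> \<equiv> \<lparr>carrier = N \<inter> span \<gamma>, monoid.mult = (+), one = 0\<rparr>"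

lemma span_group_comm_group: "comm_group (span_group \<gamma>)"
proof (rule comm_groupI)
  fix x assume "x \<in> carrier (span_group \<gamma>)"
  then show "\<exists>y\<in>carrier (span_group \<gamma>). y \<otimes>\<^bsub>span_group \<gamma>\<^esub> x = \<one>\<^bsub>span_group \<gamma>\<^esub>"
    using add_subgroupD(3)[OF N_subgroup] by (intro bexI[of _ "- x"]) (auto simp: span_neg)
qed (auto simp: add_subgroupD[OF N_subgroup] span_zero span_add)

lemma int_span_gens: "int_span (gens \<gamma>) \<subseteq> N" "int_span (gens \<gamma>) \<subseteq> span \<gamma>"
proof -
  show "int_span (gens \<gamma>) \<subseteq> N" using int_span_mono_subgroup[OF _ N_subgroup] gens_in_N by blast
  show "int_span (gens \<gamma>) \<subseteq> span \<gamma>"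
    using int_span_subset_span span_mono cone_gens_subset(1) by (metis order_trans)
qed

lemma int_span_subgroup: "subgroup (int_span (gens \<gamma>)) (span_group \<gamma>)"
proof -
  interpret comm_group "span_group \<gamma>" by (rule span_group_comm_group)
  show ?thesis
  proof (rule subgroupI)
    fix a assume a: "a \<in> int_span (gens \<gamma>)"
    then have "inv\<^bsub>span_group \<gamma>\<^esub> a = - a"
      using int_span_gens[of \<gamma>] add_subgroupD(3)[OF N_subgroup]
      by (intro inv_equality) (auto simp: span_neg)
    then show "inv\<^bsub>span_group \<gamma>\<^esub> a \<in> int_span (gens \<gamma>)" using a int_span_uminus by simp
  qed (use int_span_gens[of \<gamma>] zero_in_int_span in \<open>auto simp: int_span_add\<close>)
qed

lemma cone_group_comm_group: "comm_group (cone_group N \<gamma>)"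
  unfolding cone_group_def by (rule comm_group.abelian_FactGroup[OF span_group_comm_group int_span_subgroup])

lemma r_coset_eq: "int_span (gens \<gamma>) #>\<^bsub>span_group \<gamma>\<^esub> v = coset \<gamma> v"
  by (auto simp: r_coset_def coset_def)

lemma carrier_cone_group: "carrier (cone_group N \<gamma>) = {coset \<gamma> v | v. v \<in> N \<and> v \<in> span \<gamma>}"
  unfolding cone_group_def carrier_FactGroup by (auto simp: r_coset_eq image_iff)

lemma one_cone_group: "\<one>\<^bsub>cone_group N \<gamma>\<^esub> = coset \<gamma> 0"
  by (simp add: cone_group_def coset_def)

lemma mult_cone_group: "coset \<gamma> v \<otimes>\<^bsub>cone_group N \<gamma>\<^esub> coset \<gamma> w = coset \<gamma> (v + w)"
proof -
  have "coset \<gamma> v <#>\<^bsub>span_group \<gamma>\<^esub> coset \<gamma> w = coset \<gamma> (v + w)"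
  proof (intro equalityI subsetI)
    fix z assume "z \<in> coset \<gamma> v <#>\<^bsub>span_group \<gamma>\<^esub> coset \<gamma> w"
    then obtain h h' where h: "h \<in> int_span (gens \<gamma>)" "h' \<in> int_span (gens \<gamma>)" "z = (h + v) + (h' + w)"
      by (auto simp: set_mult_def coset_def)
    then have "z = (h + h') + (v + w)" by simp
    then show "z \<in> coset \<gamma> (v + w)" using int_span_add[OF h(1,2)] unfolding coset_def by blast
  next
    fix z assume "z \<in> coset \<gamma> (v + w)"
    then obtain h where h: "h \<in> int_span (gens \<gamma>)" "z = (h + v) + (0 + w)" by (auto simp: coset_def)
    have "h + v \<in> coset \<gamma> v" using h unfolding coset_def by blast
    moreover have "0 + w \<in> coset \<gamma> w" using zero_in_int_span unfolding coset_def by blast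
    ultimately show "z \<in> coset \<gamma> v <#>\<^bsub>span_group \<gamma>\<^esub> coset \<gamma> w"
      unfolding set_mult_def h(2) by fastforce
  qed
  then show ?thesis by (simp add: cone_group_def)
qed

lemma conj_class_cone_group:
  assumes "g \<in> carrier (cone_group N \<gamma>)"
  shows "conj_class (cone_group N \<gamma>) g = {g}"
proof -
  interpret comm_group "cone_group N \<gamma>" by (rule cone_group_comm_group)
  have "h \<otimes>\<^bsub>cone_group N \<gamma>\<^esub> g \<otimes>\<^bsub>cone_group N \<gamma>\<^esub> inv\<^bsub>cone_group N \<gamma>\<^esub> h = g"
    if "h \<in> carrier (cone_group N \<gamma>)" for h
    using that assms m_comm[of h g] by (simp add: m_assoc)
  moreover have "\<one>\<^bsub>cone_group N \<gamma>\<^esub> \<in> carrier (cone_group N \<gamma>)" by simp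
  ultimately show ?thesis unfolding conj_class_def by blast
qed

text \<open>Two representatives of the coset differ by an element of the chart lattice, which pairs
  integrally with every character of the chart; at all other arguments the point is zero. From here
  on the group acts through explicit vectors.\<close>

lemma cone_action_coset:
  assumes "\<gamma> \<in> \<Xi>" "x \<in> monoid_points (chart_mon \<gamma>)"
  shows "cone_action (coset \<gamma> v) x = torus_rot v x"
proof
  fix u
  show "cone_action (coset \<gamma> v) x u = torus_rot v x u"
  proof (cases "u \<in> chart_mon \<gamma>")
    case True
    let ?w = "SOME w. w \<in> coset \<gamma> v"
    have "v \<in> coset \<gamma> v" using zero_in_int_span by (force simp: coset_def)
    then have "?w \<in> coset \<gamma> v" by (rule someI)
    then obtain h where h: "h \<in> int_span (gens \<gamma>)" "?w = h + v" by (auto simp: coset_def)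
    have "h \<in> chart_lattice N \<gamma> (C \<gamma>)" unfolding chart_lattice_def
      using h(1) add_subgroupD(1)[OF complement_subgroup(1)[OF assms(1)]] by (intro CollectI exI[of _ h] exI[of _ 0]) auto
    then have "u \<bullet> ?w - u \<bullet> v \<in> \<int>" using True h(2) by (auto simp: dual_lattice_def inner_add_right)
    then show ?thesis using exp_2pi_i_eq_iff[of "u \<bullet> ?w" "u \<bullet> v"] by (simp add: cone_action_def torus_rot_def)
  next
    case False
    then show ?thesis using assms(2) by (auto simp: monoid_points_def cone_action_def torus_rot_def)
  qed
qed

section \<open>The orbifold charts in coordinates\<close>

abbreviation "Q \<equiv> toric_orbifold N \<Xi> C"

lemma orbifold_at_pt:
  assumes "\<gamma> \<in> \<Xi>" "linear l"
  shows "chart Q (pt \<gamma> l) = affine_fspace (monoid_points (chart_mon \<gamma>)) (monoid_algebra (chart_mon \<gamma>))"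
    and "pts (chart Q (pt \<gamma> l)) = monoid_points (chart_mon \<gamma>)"
    and "local_group Q (pt \<gamma> l) = cone_group N \<gamma>"
    and "chart_action Q (pt \<gamma> l) = cone_action"
    and "chart_proj Q (pt \<gamma> l) x = toric_class N \<Xi> \<gamma> (restrict_point N \<gamma> x)"
  using pts_chart[OF assms(1)] affine_toric_chart[of \<gamma>]
  by (simp_all add: toric_orbifold_def cone_of_pt[OF assms] Let_def)

lemma orb_points_Q: "orb_points Q = {pt \<tau> l | \<tau> l. \<tau> \<in> \<Xi> \<and> linear l}"
  using toric_points_eq by (simp add: toric_orbifold_def)

lemma chart_mon_supset: "\<gamma> \<in> \<Xi> \<Longrightarrow> cone_mon \<gamma> \<subseteq> chart_mon \<gamma>"
  using M_subset_chart_dual by blast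

lemma chart_proj_orbit_point:
  assumes "\<gamma> \<in> \<Xi>" "\<tau> \<in> \<Xi>" "\<tau> \<subseteq> \<gamma>" "linear l" "linear l0"
  shows "chart_proj Q (pt \<gamma> l0) (orbit_point (chart_mon \<gamma>) \<tau> l) = pt \<tau> l"
  using orbifold_at_pt(5)[OF assms(1,5)] toric_class_orbit_point[OF assms(1-4)]
    restrict_orbit_point[OF chart_mon_supset[OF assms(1)]] by simp

lemma chart_point_form:
  assumes "\<gamma> \<in> \<Xi>" "x \<in> monoid_points (chart_mon \<gamma>)"
  obtains \<tau> l where "\<tau> \<in> \<Xi>" "\<tau> \<subseteq> \<gamma>" "linear l" "x = orbit_point (chart_mon \<gamma>) \<tau> l"
  by (rule monoid_point_form[OF commensurable_chart_dual[OF assms(1)] assms])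

lemma chart_orbit_point_in:
  assumes "\<gamma> \<in> \<Xi>" "\<tau> \<subseteq> \<gamma>" "linear l"
  shows "orbit_point (chart_mon \<gamma>) \<tau> l \<in> monoid_points (chart_mon \<gamma>)"
  by (rule orbit_point_in[OF commensurable_chart_dual[OF assms(1)] assms(2,3)])

text \<open>Along the closed orbit the chart has no characters beyond those of \<open>M\<close>, so
  the fibre over a point of that orbit is a single point. This fixes the base point of every chart
  injection.\<close>

lemma chart_centre:
  assumes "\<tau> \<in> \<Xi>" "linear l" "x \<in> monoid_points (chart_mon \<tau>)" "chart_proj Q (pt \<tau> l) x = pt \<tau> l"
  shows "x = orbit_point (chart_mon \<tau>) \<tau> l"
proof -
  obtain \<tau>' l' where x: "\<tau>' \<in> \<Xi>" "\<tau>' \<subseteq> \<tau>" "linear l'" "x = orbit_point (chart_mon \<tau>) \<tau>' l'"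
    by (rule chart_point_form[OF assms(1,3)])
  then have "pt \<tau>' l' = pt \<tau> l" using chart_proj_orbit_point[OF assms(1) x(1-3) assms(2)] assms(4) by simp
  then have "\<tau>' = \<tau>" "\<forall>u\<in>M \<inter> perp \<tau>. exp (l' u) = exp (l u)"
    using pt_eq_iff[OF x(1) assms(1) x(3) assms(2)] by auto
  then show ?thesis unfolding x(4) using perp_chart_dual[OF assms(1)] by (auto simp: orbit_point_def fun_eq_iff)
qed

lemma chart_mon_inner_nat:
  assumes "\<sigma> \<in> \<Xi>" "u \<in> chart_mon \<sigma>" "g \<in> gens \<sigma>"
  shows "u \<bullet> g = real (nat \<lfloor>u \<bullet> g\<rfloor>)"
proof -
  have "u \<bullet> g \<in> \<int>" "0 \<le> u \<bullet> g"
    using assms in_chart_dual_iff[OF assms(1)] dual_cone_iff_gens[OF assms(1)] by auto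
  then show ?thesis by (auto elim: Ints_cases)
qed

lemma coset_carrier: "v \<in> N \<Longrightarrow> v \<in> span \<gamma> \<Longrightarrow> coset \<gamma> v \<in> carrier (cone_group N \<gamma>)"
  using carrier_cone_group by blast

text \<open>
  The rotations \<open>t v\<close>, \<open>0 \<le> t \<le> 1\<close>, join a torus point \<open>y\<close> near the centre of the chart at \<open>q\<close> to its
  translate by the class of \<open>v\<close>. Rotating the image path back, its coordinates have constant \<open>m\<close>-th powers,
  so they are constant.
\<close>

lemma chart_injection_hom:
  assumes \<gamma>: "\<gamma> \<in> \<Xi>" "linear l0" and \<gamma>': "\<gamma>' \<in> \<Xi>" "linear l" "\<gamma>' \<subseteq> \<gamma>"
    and inj: "chart_injection Q (pt \<gamma>' l) (pt \<gamma> l0) W \<phi> lam"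
    and v: "v \<in> N" "v \<in> span \<gamma>'"
  shows "lam (coset \<gamma>' v) = coset \<gamma> v"
proof -
  let ?q = "pt \<gamma>' l" and ?p = "pt \<gamma> l0" and ?S = "chart_mon \<gamma>'"
  note q = orbifold_at_pt[OF \<gamma>'(1,2)] and p = orbifold_at_pt[OF \<gamma>]
  have W_open: "openin (top_of_set (monoid_points ?S)) W"
    and W_base: "{y \<in> monoid_points ?S. chart_proj Q ?q y = ?q} \<subseteq> W"
    and \<phi>_in: "\<phi> ` W \<subseteq> monoid_points (chart_mon \<gamma>)"
    and \<phi>_cont: "continuous_on W \<phi>"
    and \<phi>_proj: "\<And>y. y \<in> W \<Longrightarrow> chart_proj Q ?p (\<phi> y) = chart_proj Q ?q y"
    and lam_hom: "lam \<in> hom (cone_group N \<gamma>') (cone_group N \<gamma>)"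
    and \<phi>_equiv: "\<And>g y. g \<in> carrier (cone_group N \<gamma>') \<Longrightarrow> y \<in> W \<Longrightarrow>
      \<phi> (cone_action g y) = cone_action (lam g) (\<phi> y)"
  proof -
    have *: "openin (top_of_set (monoid_points ?S)) W"
      "{y \<in> monoid_points ?S. chart_proj Q ?q y = ?q} \<subseteq> W"
      "openin (top_of_set (monoid_points (chart_mon \<gamma>))) (\<phi> ` W)"
      "homeomorphic_map (top_of_set W) (top_of_set (\<phi> ` W)) \<phi>"
      "\<forall>y\<in>W. chart_proj Q ?p (\<phi> y) = chart_proj Q ?q y"
      "lam \<in> hom (cone_group N \<gamma>') (cone_group N \<gamma>)"
      "\<forall>g\<in>carrier (cone_group N \<gamma>'). \<forall>y\<in>W. \<phi> (cone_action g y) = cone_action (lam g) (\<phi> y)"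
      using inj unfolding chart_injection_def q(2,3,4) p(2,3,4) by blast+
    from * show "openin (top_of_set (monoid_points ?S)) W"
      "{y \<in> monoid_points ?S. chart_proj Q ?q y = ?q} \<subseteq> W"
      "\<And>y. y \<in> W \<Longrightarrow> chart_proj Q ?p (\<phi> y) = chart_proj Q ?q y"
      "lam \<in> hom (cone_group N \<gamma>') (cone_group N \<gamma>)"
      "\<And>g y. g \<in> carrier (cone_group N \<gamma>') \<Longrightarrow> y \<in> W \<Longrightarrow> \<phi> (cone_action g y) = cone_action (lam g) (\<phi> y)"
      by blast+
    show "\<phi> ` W \<subseteq> monoid_points (chart_mon \<gamma>)" using openin_imp_subset[OF *(3)] .
    show "continuous_on W \<phi>"
      using homeomorphic_imp_continuous_map[OF *(4)] by (simp add: continuous_map_in_subtopology)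
  qed
  \<comment> \<open>The sum of the generators pairs to zero exactly with the characters orthogonal
    to \<open>\<gamma>'\<close>; scaling along it contracts the chart to its centre.\<close>
  define w where "w = (\<Sum>g\<in>gens \<gamma>'. g)"
  have w_nat: "u \<bullet> w = real (nat \<lfloor>u \<bullet> w\<rfloor>)" if u: "u \<in> ?S" for u
  proof -
    have "u \<bullet> w = (\<Sum>g\<in>gens \<gamma>'. real (nat \<lfloor>u \<bullet> g\<rfloor>))"
      unfolding w_def inner_sum_right using chart_mon_inner_nat[OF \<gamma>'(1) u] by (rule sum.cong[OF refl])
    then have "u \<bullet> w = real (\<Sum>g\<in>gens \<gamma>'. nat \<lfloor>u \<bullet> g\<rfloor>)" by simp
    then show ?thesis by (metis floor_of_nat nat_int of_int_of_nat_eq)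
  qed
  have w_zero: "u \<bullet> w = 0 \<longleftrightarrow> u \<in> perp \<gamma>'" if u: "u \<in> ?S" for u
  proof -
    have "u \<bullet> w = (\<Sum>g\<in>gens \<gamma>'. u \<bullet> g)" unfolding w_def inner_sum_right ..
    moreover have "\<And>g. g \<in> gens \<gamma>' \<Longrightarrow> 0 \<le> u \<bullet> g" using u dual_cone_iff_gens[OF \<gamma>'(1)] by auto
    ultimately show ?thesis
      using sum_nonneg_eq_0_iff[OF gens_finite[OF \<gamma>'(1)]] perp_iff_gens[OF \<gamma>'(1)] by auto
  qed
  \<comment> \<open>For \<open>s > 0\<close> a torus point rotated by \<open>t v\<close>. At
    \<open>s = 0\<close> the convention \<open>0 ^ 0 = 1\<close> keeps just the characters
    orthogonal to \<open>\<gamma>'\<close>, for which the rotation is invisible, so the whole path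
    collapses to the centre.\<close>
  define y where "y s t = (\<lambda>u. if u \<in> ?S
      then of_real s ^ nat \<lfloor>u \<bullet> w\<rfloor> * exp (l u + 2 * of_real pi * \<i> * of_real (t * (u \<bullet> v))) else 0)" for s t :: real
  have y0: "y 0 t = orbit_point ?S \<gamma>' l" for t
  proof
    fix u
    show "y 0 t u = orbit_point ?S \<gamma>' l u"
    proof (cases "u \<in> ?S")
      case True
      obtain n :: nat where n: "u \<bullet> w = real n" using w_nat[OF True] by blast
      have "nat \<lfloor>u \<bullet> w\<rfloor> = 0 \<longleftrightarrow> u \<in> perp \<gamma>'" using w_zero[OF True] by (simp add: n)
      then show ?thesis using True perp_span[OF _ v(2), of u] by (auto simp: y_def orbit_point_def)
    qed (auto simp: y_def orbit_point_def)
  qed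
  have base_in: "orbit_point ?S \<gamma>' l \<in> W"
    using W_base chart_orbit_point_in[OF \<gamma>'(1) _ \<gamma>'(2)] chart_proj_orbit_point[OF \<gamma>'(1,1) _ \<gamma>'(2,2)] by auto
  obtain T where T: "open T" "W = monoid_points ?S \<inter> T" using W_open by (auto simp: openin_open)
  have y_cont: "continuous_on UNIV (\<lambda>z. y (fst z) (snd z))"
  proof (rule continuous_on_coordinatewise_then_product)
    fix u
    show "continuous_on UNIV (\<lambda>z. y (fst z) (snd z) u)"
      by (cases "u \<in> ?S") (auto simp: y_def intro!: continuous_intros)
  qed
  define X where "X = (\<lambda>z. y (fst z) (snd z)) -` T"
  have "open X" unfolding X_def using open_vimage[OF T(1) y_cont] .
  \<comment> \<open>\<open>W\<close> is only a neighbourhood of the centre; the tube lemma yields a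
    single positive \<open>s\<close> for which the entire path stays inside.\<close>
  have "{0} \<times> {0..1} \<subseteq> X" using y0 base_in T(2) by (auto simp: X_def)
  then obtain X0 where X0: "0 \<in> X0" "open X0" "X0 \<times> {0..1} \<subseteq> X"
    using Elementary_Topology.tube_lemma[OF compact_Icc \<open>open X\<close>] by metis
  obtain \<epsilon> where \<epsilon>: "\<epsilon> > 0" "ball 0 \<epsilon> \<subseteq> X0" using X0 open_contains_ball by blast
  define s where "s = \<epsilon> / 2"
  have s: "s > 0" "s \<in> X0" using \<epsilon> by (auto simp: s_def subset_iff dist_norm)
  \<comment> \<open>The logarithm of the torus point \<open>y s t\<close>, the factor
    \<open>s\<close> entering through \<open>ln s\<close>.\<close>
  define L where "L t u = of_real (ln s * (u \<bullet> w)) + (l u + 2 * of_real pi * \<i> * of_real (t * (u \<bullet> v)))" for t u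
  have L_lin: "linear (L t)" for t
  proof (rule linearI)
    show "L t (a + b) = L t a + L t b" for a b
      using linear_add[OF \<gamma>'(2)] by (simp add: L_def inner_add_left algebra_simps)
    show "L t (c *\<^sub>R a) = c *\<^sub>R L t a" for c a
      using linear_cmul[OF \<gamma>'(2)] by (simp add: L_def algebra_simps scaleR_conv_of_real)
  qed
  have y_form: "y s t = orbit_point ?S {0} (L t)" for t
  proof
    fix u
    show "y s t u = orbit_point ?S {0} (L t) u"
    proof (cases "u \<in> ?S")
      case True
      have "of_real (exp (ln s * (u \<bullet> w))) = (of_real s ^ nat \<lfloor>u \<bullet> w\<rfloor> :: complex)"
        using w_nat[OF True] s(1) by (metis exp_ln exp_of_nat_mult mult.commute of_real_power)
      then show ?thesis using True
        by (simp add: y_def orbit_point_def L_def perp_def exp_add flip: exp_of_real)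
    qed (auto simp: y_def orbit_point_def)
  qed
  have yW: "y s t \<in> W" if "t \<in> {0..1}" for t
  proof -
    have "(s, t) \<in> X" using X0(3) s(2) that by blast
    then have "y s t \<in> T" by (simp add: X_def)
    moreover have "y s t \<in> monoid_points ?S"
      unfolding y_form using chart_orbit_point_in[OF \<gamma>'(1) zero_cone_subset[OF \<gamma>'(1)] L_lin] .
    ultimately show ?thesis using T(2) by blast
  qed
  obtain m :: nat where m: "m > 0" "\<And>u. u \<in> chart_dual \<gamma> \<Longrightarrow> real m *\<^sub>R u \<in> M"
    using exponent[OF \<gamma>(1)] by metis
  \<comment> \<open>Both points lie over the same point of the open orbit, so they agree on
    \<open>M\<close>, and \<open>m\<close> times a character of the chart at \<open>p\<close>
    belongs to \<open>M\<close>.\<close>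
  have z_power: "\<phi> (y s t) u \<noteq> 0 \<and> \<phi> (y s t) u ^ m = exp (of_nat m * L t u)"
    if t: "t \<in> {0..1}" and u: "u \<in> chart_mon \<gamma>" for t u
  proof -
    have in_chart: "\<phi> (y s t) \<in> monoid_points (chart_mon \<gamma>)" using \<phi>_in yW[OF t] by blast
    obtain \<tau>1 l1 where z: "\<tau>1 \<in> \<Xi>" "\<tau>1 \<subseteq> \<gamma>" "linear l1" "\<phi> (y s t) = orbit_point (chart_mon \<gamma>) \<tau>1 l1"
      by (rule chart_point_form[OF \<gamma>(1) in_chart])
    have "pt \<tau>1 l1 = chart_proj Q ?p (\<phi> (y s t))"
      using chart_proj_orbit_point[OF \<gamma>(1) z(1-3) \<gamma>(2)] z(4) by simp
    also have "\<dots> = chart_proj Q ?q (y s t)" by (rule \<phi>_proj[OF yW[OF t]])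
    also have "\<dots> = pt {0} (L t)" unfolding y_form
      by (rule chart_proj_orbit_point[OF \<gamma>'(1) zero_cone_in_fan zero_cone_subset[OF \<gamma>'(1)] L_lin \<gamma>'(2)])
    finally have eq: "\<tau>1 = {0}" "\<forall>u\<in>M. exp (l1 u) = exp (L t u)"
      using pt_eq_iff[OF z(1) zero_cone_in_fan z(3) L_lin] by (auto simp: perp_def)
    have zu: "\<phi> (y s t) u = exp (l1 u)" using z(4) eq(1) u by (simp add: orbit_point_def perp_def)
    have "exp (l1 u) ^ m = exp (l1 (real m *\<^sub>R u))"
      by (simp add: linear_cmul[OF z(3)] scaleR_conv_of_real exp_of_nat_mult)
    also have "\<dots> = exp (L t (real m *\<^sub>R u))" using eq(2) m(2) u by blast
    also have "\<dots> = exp (of_nat m * L t u)" by (simp add: linear_cmul[OF L_lin] scaleR_conv_of_real)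
    finally show ?thesis using zu by simp
  qed
  have rotated: "\<phi> (y s 1) u = exp (2 * of_real pi * \<i> * of_real (u \<bullet> v)) * \<phi> (y s 0) u"
    if u: "u \<in> chart_mon \<gamma>" for u
  proof -
    define \<zeta> where "\<zeta> t = \<phi> (y s t) u * exp (- (2 * of_real pi * \<i> * of_real (t * (u \<bullet> v))))" for t
    have "continuous_on {0..1} (\<lambda>t. y s t)"
      by (rule continuous_on_compose2[OF y_cont, of _ "\<lambda>t. (s, t)", simplified]) (intro continuous_intros)
    then have "continuous_on {0..1} (\<lambda>t. \<phi> (y s t))"
      by (rule continuous_on_compose2[OF \<phi>_cont]) (use yW in auto)
    then have "continuous_on {0..1} (\<lambda>t. \<phi> (y s t) u)" by (rule continuous_on_product_then_coordinatewise)
    then have cont: "continuous_on {0..1} \<zeta>" unfolding \<zeta>_def by (intro continuous_intros)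
    have "\<zeta> t ^ m = exp (of_nat m * L 0 u)" if t: "t \<in> {0..1}" for t
    proof -
      have "\<zeta> t ^ m = exp (of_nat m * L t u) * exp (of_nat m * (- (2 * of_real pi * \<i> * of_real (t * (u \<bullet> v)))))"
        unfolding \<zeta>_def power_mult_distrib exp_of_nat_mult using z_power[OF t u] by (simp add: exp_of_nat_mult)
      also have "\<dots> = exp (of_nat m * L 0 u)" by (simp add: L_def algebra_simps flip: exp_add)
      finally show ?thesis .
    qed
    then have "\<zeta> ` {0..1} \<subseteq> {z. z ^ m = exp (of_nat m * L 0 u)}" by blast
    then have fin: "finite (\<zeta> ` {0..1})" using finite_subset finite_nth_roots[OF m(1)] by blast
    have "\<zeta> constant_on {0..1}" by (rule continuous_finite_range_constant[OF _ cont fin]) simp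
    then have "\<zeta> 1 = \<zeta> 0" by (auto simp: constant_on_def)
    then have "\<phi> (y s 1) u * exp (- (2 * of_real pi * \<i> * of_real (u \<bullet> v))) = \<phi> (y s 0) u"
      by (simp add: \<zeta>_def)
    then show ?thesis by (simp add: exp_minus field_simps)
  qed
  have "coset \<gamma>' v \<in> carrier (cone_group N \<gamma>')" using coset_carrier v by blast
  then have "lam (coset \<gamma>' v) \<in> carrier (cone_group N \<gamma>)" using lam_hom by (auto simp: hom_def)
  then obtain v' where v': "v' \<in> N" "v' \<in> span \<gamma>" "lam (coset \<gamma>' v) = coset \<gamma> v'"
    by (auto simp: carrier_cone_group)
  have "y s 1 = torus_rot v (y s 0)"
    by (auto simp: y_def torus_rot_def fun_eq_iff exp_add)
  also have "\<dots> = cone_action (coset \<gamma>' v) (y s 0)"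
    using cone_action_coset[OF \<gamma>'(1)] yW[of 0] T(2) by auto
  finally have "\<phi> (y s 1) = cone_action (coset \<gamma> v') (\<phi> (y s 0))"
    using \<phi>_equiv[OF \<open>coset \<gamma>' v \<in> _\<close> yW[of 0]] v'(3) by simp
  also have "\<dots> = torus_rot v' (\<phi> (y s 0))" using cone_action_coset[OF \<gamma>(1)] \<phi>_in yW[of 0] by auto
  finally have rot': "\<phi> (y s 1) = torus_rot v' (\<phi> (y s 0))" .
  have int: "u \<bullet> v' - u \<bullet> v \<in> \<int>" if u: "u \<in> chart_mon \<gamma>" for u
  proof -
    have "exp (2 * of_real pi * \<i> * of_real (u \<bullet> v')) * \<phi> (y s 0) u =
        exp (2 * of_real pi * \<i> * of_real (u \<bullet> v)) * \<phi> (y s 0) u"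
      using rotated[OF u] fun_cong[OF rot', of u] by (simp add: torus_rot_def)
    then show ?thesis using z_power[of 0 u] u exp_2pi_i_eq_iff by simp
  qed
  \<comment> \<open>The image point has no vanishing coordinate, so the rotations by
    \<open>v\<close> and \<open>v'\<close> agree on every character. Testing on the coordinates
    \<open>e g\<close> makes the coefficients of \<open>v' - v\<close> integral.\<close>
  obtain e where e: "dual_family (gens \<gamma>) e" "\<And>g. g \<in> gens \<gamma> \<Longrightarrow> e g \<in> chart_dual \<gamma>"
    using chart_coordinates_exist[OF \<gamma>(1)] by blast
  have "e g \<in> chart_mon \<gamma>" if "g \<in> gens \<gamma>" for g
    using e that by (auto simp: dual_cone_iff_gens[OF \<gamma>(1)] dual_family_def)
  then have "\<forall>g\<in>gens \<gamma>. e g \<bullet> (v' - v) \<in> \<int>" using int by (simp add: inner_diff_right)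
  moreover have "v' - v \<in> span (gens \<gamma>)"
    using v' v span_mono[OF \<gamma>'(3)] span_cone[OF \<gamma>(1)] by (auto intro: span_diff)
  ultimately have "v' - v \<in> int_span (gens \<gamma>)"
    using in_int_span_dual[OF e(1) gens_finite[OF \<gamma>(1)]] by blast
  then show ?thesis using v'(3) coset_eq_iff by simp
qed

section \<open>Frames and transition maps between charts\<close>

text \<open>
  Coordinates of the chart over \<open>U\<^sub>\<Gamma>\<close> near the orbit of a face \<open>\<tau>\<close>: \<open>e g\<close> are those vanishing there,
  \<open>A\<close> those which stay invertible, and \<open>D\<close> reads off exponents.
\<close>

definition frame :: "'a set \<Rightarrow> 'a set \<Rightarrow> ('a \<Rightarrow> 'a) \<Rightarrow> 'a set \<Rightarrow> ('a \<Rightarrow> 'a) \<Rightarrow> bool" where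
  "frame \<tau> \<Gamma> e A D \<longleftrightarrow> finite A \<and> A \<subseteq> chart_mon \<Gamma> \<inter> perp \<tau> \<and> (\<forall>g\<in>gens \<tau>. e g \<in> chart_mon \<Gamma>) \<and>
     (\<forall>u. u = (\<Sum>g\<in>gens \<tau>. (u \<bullet> g) *\<^sub>R e g) + (\<Sum>a\<in>A. (D a \<bullet> u) *\<^sub>R a)) \<and>
     dual_family (gens \<tau>) e \<and> dual_family A D \<and> (\<forall>a\<in>A. \<forall>g\<in>gens \<tau>. D a \<bullet> e g = 0) \<and>
     (\<forall>u\<in>chart_mon \<Gamma>. \<forall>a\<in>A. D a \<bullet> u \<in> \<int>)"

text \<open>The coordinates \<open>e g\<close> of all generators of \<Gamma>, with a basis
  \<open>F\<close> of the chart characters orthogonal to \<Gamma>, form a basis of the space. The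
  frame splits it according to whether the character vanishes on the orbit of \<tau>.\<close>

lemma frame_exists:
  assumes "\<Gamma> \<in> \<Xi>" "\<tau> \<in> \<Xi>" "\<tau> \<subseteq> \<Gamma>"
  shows "\<exists>e A D. frame \<tau> \<Gamma> e A D"
proof -
  let ?G = "gens \<Gamma>" and ?M' = "chart_dual \<Gamma>"
  have finG: "finite ?G" using gens_finite[OF assms(1)] .
  obtain e where e: "dual_family ?G e" "\<And>g. g \<in> ?G \<Longrightarrow> e g \<in> ?M'"
    using chart_coordinates_exist[OF assms(1)] by blast
  have edual: "e g \<bullet> h = (if g = h then 1 else 0)" if "g \<in> ?G" "h \<in> ?G" for g h
    using e(1) that by (simp add: dual_family_def)
  have sub': "add_subgroup ?M'" by (rule dual_lattice_subgroup)
  obtain A0 where A0: "finite A0" "independent A0" "?M' \<subseteq> int_span A0"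
    using commensurable_basis[OF commensurable_chart_dual[OF assms(1)]] .
  have "add_subgroup (?M' \<inter> perp \<Gamma>)"
    using sub' by (auto simp: add_subgroup_def perp_def inner_diff_left)
  then obtain F where F: "finite F" "independent F" "?M' \<inter> perp \<Gamma> = int_span F"
    using subgroup_of_lattice_basis[OF A0(1,2), of "?M' \<inter> perp \<Gamma>"] A0(3) by blast
  have FM: "F \<subseteq> ?M' \<inter> perp \<Gamma>" using F int_span_base by blast
  \<comment> \<open>Removing the \<open>e\<close>-part leaves a chart character orthogonal to every
    generator of \<Gamma>, hence an integral combination of \<open>F\<close>.\<close>
  define P where "P u = u - (\<Sum>g\<in>?G. (u \<bullet> g) *\<^sub>R e g)" for u
  have Pin: "P u \<in> int_span F" if u: "u \<in> ?M'" for u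
  proof -
    have "P u \<in> ?M'" unfolding P_def
      using in_chart_dual_iff[OF assms(1)] u e(2)
      by (intro add_subgroupD(2)[OF sub'] add_subgroup_sum[OF sub'] add_subgroup_scale_Ints[OF sub']) auto
    moreover have "P u \<bullet> h = 0" if h: "h \<in> ?G" for h
    proof -
      have "(\<Sum>g\<in>?G. (u \<bullet> g) *\<^sub>R e g) \<bullet> h = (\<Sum>g\<in>?G. if g = h then u \<bullet> h else 0)"
        unfolding inner_sum_left using edual h by (intro sum.cong) auto
      then show ?thesis using h finG by (simp add: P_def inner_diff_left)
    qed
    then have "P u \<in> perp \<Gamma>" by (simp add: perp_iff_gens[OF assms(1)])
    ultimately show ?thesis using F(3) by blast
  qed
  have injE: "inj_on e ?G" and indE: "independent (e ` ?G)"
    using dual_family_dual_independent[OF e(1) finG] by auto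
  let ?B = "e ` ?G \<union> F"
  have finB: "finite ?B" using finG F(1) by simp
  have spanF0: "x \<bullet> h = 0" if "x \<in> span F" "h \<in> ?G" for x h
    using that(1)
  proof (induction rule: span_induct_alt)
    case (step c x y)
    then have "x \<bullet> h = 0" using FM perp_iff_gens[OF assms(1)] that(2) by blast
    then show ?case using step by (simp add: inner_add_left)
  qed simp
  have disj: "e ` ?G \<inter> F = {}"
  proof (rule ccontr)
    assume "e ` ?G \<inter> F \<noteq> {}"
    then obtain g where g: "g \<in> ?G" "e g \<in> F" by auto
    then show False using spanF0[of "e g" g] edual[of g g] by (simp add: span_base)
  qed
  have indB: "independent ?B"
  proof (rule independent_if_scalars_zero[OF finB])
    fix c x assume s: "(\<Sum>b\<in>?B. c b *\<^sub>R b) = 0" and x: "x \<in> ?B"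
    have s: "(\<Sum>g\<in>?G. c (e g) *\<^sub>R e g) + (\<Sum>f\<in>F. c f *\<^sub>R f) = 0"
      using s finG F(1) disj by (simp add: sum.union_disjoint sum.reindex[OF injE])
    have cE: "c (e h) = 0" if h: "h \<in> ?G" for h
    proof -
      have "(\<Sum>f\<in>F. c f *\<^sub>R f) \<in> span F" by (intro span_sum span_scale span_base)
      then have "(\<Sum>f\<in>F. c f *\<^sub>R f) \<bullet> h = 0" using spanF0 h by blast
      moreover have "(\<Sum>g\<in>?G. c (e g) *\<^sub>R e g) \<bullet> h = (\<Sum>g\<in>?G. if g = h then c (e h) else 0)"
        unfolding inner_sum_left using edual h by (intro sum.cong) auto
      ultimately show ?thesis using arg_cong[OF s, of "\<lambda>z. z \<bullet> h"] h finG by (simp add: inner_add_left)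
    qed
    then have "(\<Sum>f\<in>F. c f *\<^sub>R f) = 0" using s by simp
    then have "c f = 0" if "f \<in> F" for f
      using independentD[OF F(2,1) subset_refl] that by blast
    then show "c x = 0" using cE x by auto
  qed
  \<comment> \<open>The dual lattice \<open>M\<close> spans by a dimension count, and
    \<open>P\<close> carries it into the span of \<open>F\<close>.\<close>
  have spanB: "u \<in> span ?B" for u
  proof -
    obtain B where B: "finite B" "independent B" "span B = UNIV" "N = int_span B" using lattice_basis .
    obtain b where b: "dual_family B b" using dual_family_exists B(2) .
    have bM: "b x \<in> span ?B" if "x \<in> B" for x
    proof -
      have "b x \<in> int_span (b ` B)" using B(1) that by (intro int_span_base) auto
      then have "b x \<in> M" using dual_lattice_int_span[OF b B(1,3)] B(4) by simp
      then have "P (b x) \<in> span F" using Pin M_subset_chart_dual[OF assms(1)] int_span_subset_span by blast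
      then have "P (b x) \<in> span ?B" using span_mono[of F ?B] by blast
      moreover have "(\<Sum>g\<in>?G. (b x \<bullet> g) *\<^sub>R e g) \<in> span ?B"
        by (intro span_sum span_scale span_base) auto
      ultimately have "P (b x) + (\<Sum>g\<in>?G. (b x \<bullet> g) *\<^sub>R e g) \<in> span ?B" by (rule span_add)
      then show ?thesis by (simp add: P_def)
    qed
    have "independent (b ` B)" "inj_on b B" using dual_family_dual_independent[OF b B(1)] by auto
    then have "card (b ` B) = DIM('a)"
      using B(2,3) basis_card_eq_dim[of B UNIV] by (simp add: card_image)
    then have "span (b ` B) = UNIV"
      using card_eq_dim[of "b ` B" UNIV] \<open>independent (b ` B)\<close> B(1) by auto
    then have "u \<in> span (b ` B)" by blast
    moreover have "span (b ` B) \<subseteq> span ?B" using bM by (intro span_minimal) auto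
    ultimately show ?thesis by blast
  qed
  obtain D where D: "dual_family ?B D" using dual_family_exists[OF indB] .
  \<comment> \<open>Besides \<open>F\<close>, this contains the coordinates \<open>e g\<close> of
    generators outside \<tau>: they may vanish on the chart but not near the orbit of
    \<tau>.\<close>
  define A where "A = ?B - e ` gens \<tau>"
  have G\<tau>: "gens \<tau> \<subseteq> ?G" using subset_iff_gens assms by blast
  have expand: "u = (\<Sum>g\<in>gens \<tau>. (D (e g) \<bullet> u) *\<^sub>R e g) + (\<Sum>a\<in>A. (D a \<bullet> u) *\<^sub>R a)" for u
  proof -
    have "u = (\<Sum>b\<in>?B. (D b \<bullet> u) *\<^sub>R b)" by (rule dual_family_expand[OF D finB spanB])
    also have "\<dots> = (\<Sum>b\<in>e ` gens \<tau>. (D b \<bullet> u) *\<^sub>R b) + (\<Sum>b\<in>A. (D b \<bullet> u) *\<^sub>R b)"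
      unfolding A_def using finB G\<tau> by (subst sum.subset_diff[of "e ` gens \<tau>"]) (auto simp: add.commute)
    also have "(\<Sum>b\<in>e ` gens \<tau>. (D b \<bullet> u) *\<^sub>R b) = (\<Sum>g\<in>gens \<tau>. (D (e g) \<bullet> u) *\<^sub>R e g)"
      using inj_on_subset[OF injE G\<tau>] by (simp add: sum.reindex)
    finally show ?thesis .
  qed
  have De: "D (e h) \<bullet> u = u \<bullet> h" if h: "h \<in> ?G" for u h
  proof -
    have "u = (\<Sum>b\<in>?B. (D b \<bullet> u) *\<^sub>R b)" by (rule dual_family_expand[OF D finB spanB])
    then have "u \<bullet> h = (\<Sum>b\<in>?B. (D b \<bullet> u) *\<^sub>R b) \<bullet> h" by (rule arg_cong)
    also have "\<dots> = (\<Sum>b\<in>?B. if b = e h then D (e h) \<bullet> u else 0)"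
      unfolding inner_sum_left
    proof (rule sum.cong[OF refl])
      fix b assume "b \<in> ?B"
      then consider g where "g \<in> ?G" "b = e g" | "b \<in> F" by blast
      then show "(D b \<bullet> u) *\<^sub>R b \<bullet> h = (if b = e h then D (e h) \<bullet> u else 0)"
      proof cases
        case 1
        then show ?thesis using edual[of g h] h inj_onD[OF injE, of g h] by auto
      next
        case 2
        then show ?thesis using spanF0[of b h] h disj by (auto simp: span_base)
      qed
    qed
    also have "\<dots> = D (e h) \<bullet> u" using h finB by simp
    finally show ?thesis by simp
  qed
  have Ddual: "D b \<bullet> b' = (if b = b' then 1 else 0)" if "b \<in> ?B" "b' \<in> ?B" for b b'
    using D that by (simp add: dual_family_def)
  have intF: "D f \<bullet> u \<in> \<int>" if f: "f \<in> F" and u: "u \<in> ?M'" for f u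
  proof -
    have "dual_family F D" using dual_family_subset[OF D] by blast
    then have "D f \<bullet> P u \<in> \<int>" using in_int_span_dual[of F D] F(1) Pin[OF u] f by blast
    moreover have "D f \<bullet> P u = D f \<bullet> u - (\<Sum>g\<in>?G. (u \<bullet> g) * (D f \<bullet> e g))"
      by (simp add: P_def inner_diff_right inner_sum_right)
    moreover have "(\<Sum>g\<in>?G. (u \<bullet> g) * (D f \<bullet> e g)) = 0"
      using Ddual[of f] f disj by (intro sum.neutral) auto
    ultimately show ?thesis by simp
  qed
  have eS: "e g \<in> chart_mon \<Gamma>" if "g \<in> ?G" for g
    using e(2)[OF that] edual[OF that] by (auto simp: dual_cone_iff_gens[OF assms(1)])
  have "frame \<tau> \<Gamma> e A D"
    unfolding frame_def
  proof (intro conjI ballI allI)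
    show "finite A" using finB by (simp add: A_def)
    show "A \<subseteq> chart_mon \<Gamma> \<inter> perp \<tau>"
    proof
      fix a assume "a \<in> A"
      then consider g where "g \<in> ?G" "g \<notin> gens \<tau>" "a = e g" | "a \<in> F" unfolding A_def by blast
      then show "a \<in> chart_mon \<Gamma> \<inter> perp \<tau>"
      proof cases
        case 1
        then have "e g \<in> perp \<tau>" using edual[of g] G\<tau> by (auto simp: perp_iff_gens[OF assms(2)])
        then show ?thesis using 1 eS by blast
      next
        case 2
        then show ?thesis using FM perp_antimono[OF assms(3)] perp_dual_cone by blast
      qed
    qed
    show "e g \<in> chart_mon \<Gamma>" if "g \<in> gens \<tau>" for g using eS that G\<tau> by blast
    show "u = (\<Sum>g\<in>gens \<tau>. (u \<bullet> g) *\<^sub>R e g) + (\<Sum>a\<in>A. (D a \<bullet> u) *\<^sub>R a)" for u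
    proof -
      have "(\<Sum>g\<in>gens \<tau>. (u \<bullet> g) *\<^sub>R e g) = (\<Sum>g\<in>gens \<tau>. (D (e g) \<bullet> u) *\<^sub>R e g)"
        using De G\<tau> by (intro sum.cong) auto
      then show ?thesis using expand[of u] by argo
    qed
    show "dual_family (gens \<tau>) e" by (rule dual_family_subset[OF e(1) G\<tau>])
    show "dual_family A D" by (rule dual_family_subset[OF D]) (auto simp: A_def)
    show "D a \<bullet> e g = 0" if "a \<in> A" "g \<in> gens \<tau>" for a g
    proof -
      have "a \<in> ?B" "e g \<in> ?B" "a \<noteq> e g" using that G\<tau> by (auto simp: A_def)
      then show ?thesis using Ddual[of a "e g"] by simp
    qed
    show "D a \<bullet> u \<in> \<int>" if u: "u \<in> chart_mon \<Gamma>" and "a \<in> A" for a u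
    proof -
      from \<open>a \<in> A\<close> consider g where "g \<in> ?G" "a = e g" | "a \<in> F" unfolding A_def by blast
      then show ?thesis
      proof cases
        case 1
        then show ?thesis using De[of g u] u in_chart_dual_iff[OF assms(1)] by auto
      next
        case 2
        then show ?thesis using intF u by blast
      qed
    qed
  qed
  then show ?thesis by blast
qed

text \<open>The logarithm of \<open>x\<close> relative to \<open>exp \<circ> l\<close>, measured on
  the invertible coordinates and extended linearly through the exponents \<open>D\<close>. It is
  zero at the centre.\<close>

definition log_shift :: "('a \<Rightarrow> complex) \<Rightarrow> 'a set \<Rightarrow> ('a \<Rightarrow> 'a) \<Rightarrow> ('a \<Rightarrow> complex) \<Rightarrow> 'a \<Rightarrow> complex" where
  "log_shift l A D x u = (\<Sum>a\<in>A. of_real (D a \<bullet> u) * Ln (x a * exp (- l a)))"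

text \<open>A point is rebuilt from its frame coordinates: the vanishing ones enter with natural
  exponents, the invertible ones through logarithms. So \<open>D a \<bullet> u\<close> may be
  fractional, as happens when \<open>u\<close> is a character of a different chart.\<close>

definition transition :: "'a set \<Rightarrow> 'a set \<Rightarrow> ('a \<Rightarrow> complex) \<Rightarrow> ('a \<Rightarrow> 'a) \<Rightarrow> 'a set \<Rightarrow> ('a \<Rightarrow> 'a) \<Rightarrow>
    ('a \<Rightarrow> complex) \<Rightarrow> 'a \<Rightarrow> complex" where
  "transition \<tau> \<Gamma>' l e A D x = (\<lambda>u. if u \<in> chart_mon \<Gamma>'
     then (\<Prod>g\<in>gens \<tau>. x (e g) ^ nat \<lfloor>u \<bullet> g\<rfloor>) *
       exp (l (u - (\<Sum>g\<in>gens \<tau>. (u \<bullet> g) *\<^sub>R e g)) + log_shift l A D x u) else 0)"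

text \<open>The first condition keeps \<open>Ln\<close> continuous. The second keeps the logarithms
  in the strip where \<open>Ln\<close> inverts \<open>exp\<close>, so that they survive a transfer
  to another frame.\<close>

definition log_domain :: "'a set \<Rightarrow> ('a \<Rightarrow> complex) \<Rightarrow> 'a set \<Rightarrow> ('a \<Rightarrow> 'a) \<Rightarrow> 'a set \<Rightarrow> ('a \<Rightarrow> complex) set" where
  "log_domain \<Gamma> l A D E = {x \<in> monoid_points (chart_mon \<Gamma>).
     (\<forall>a\<in>A. x a * exp (- l a) \<notin> \<real>\<^sub>\<le>\<^sub>0) \<and> (\<forall>a\<in>E. \<bar>Im (log_shift l A D x a)\<bar> < pi)}"

lemma log_shift_linear: "linear (log_shift l A D x)"
proof (rule linearI)
  show "log_shift l A D x (u + w) = log_shift l A D x u + log_shift l A D x w" for u w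
    by (simp add: log_shift_def inner_add_right distrib_right sum.distrib)
  show "log_shift l A D x (c *\<^sub>R u) = c *\<^sub>R log_shift l A D x u" for c u
    by (simp add: log_shift_def scaleR_conv_of_real sum_distrib_left mult.assoc)
qed

lemma chart_mon_face_inner_nat:
  assumes "\<Gamma> \<in> \<Xi>" "\<tau> \<in> \<Xi>" "\<tau> \<subseteq> \<Gamma>" "u \<in> chart_mon \<Gamma>" "g \<in> gens \<tau>"
  obtains n :: nat where "u \<bullet> g = real n"
  using chart_mon_inner_nat[OF assms(1,4) gens_face_in[OF assms(2,1,3,5)]] by blast

text \<open>Within one chart the exponents \<open>D a \<bullet> u\<close> are integers. Their
  negative parts are moved to the other side of the equation, because a member of \<open>A\<close>
  need not have an inverse in the monoid although its value is nonzero.\<close>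

lemma transition_id:
  assumes \<Gamma>: "\<Gamma> \<in> \<Xi>" "\<tau> \<in> \<Xi>" "\<tau> \<subseteq> \<Gamma>" and fr: "frame \<tau> \<Gamma> e A D" and l: "linear l"
    and x: "x \<in> monoid_points (chart_mon \<Gamma>)" "\<forall>a\<in>A. x a \<noteq> 0" and u: "u \<in> chart_mon \<Gamma>"
  shows "x u = (\<Prod>g\<in>gens \<tau>. x (e g) ^ nat \<lfloor>u \<bullet> g\<rfloor>) *
       exp (l (u - (\<Sum>g\<in>gens \<tau>. (u \<bullet> g) *\<^sub>R e g)) + log_shift l A D x u)"
proof -
  let ?S = "chart_mon \<Gamma>"
  note mon = cone_monoid[OF commensurable_chart_dual[OF \<Gamma>(1)], where \<sigma> = \<Gamma>]
  have fin: "finite A" "finite (gens \<tau>)" using fr gens_finite[OF \<Gamma>(2)] by (auto simp: frame_def)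
  have AS: "a \<in> ?S" if "a \<in> A" for a using fr that unfolding frame_def by blast
  have eS: "e g \<in> ?S" if "g \<in> gens \<tau>" for g using fr that unfolding frame_def by blast
  have expand: "u = (\<Sum>g\<in>gens \<tau>. (u \<bullet> g) *\<^sub>R e g) + (\<Sum>a\<in>A. (D a \<bullet> u) *\<^sub>R a)"
    using fr unfolding frame_def by blast
  define p n where "p a = nat \<lfloor>D a \<bullet> u\<rfloor>" and "n a = nat (- \<lfloor>D a \<bullet> u\<rfloor>)" for a
  have pn: "D a \<bullet> u = real (p a) - real (n a)" if "a \<in> A" for a
  proof -
    have "D a \<bullet> u \<in> \<int>" using fr that u unfolding frame_def by blast
    then obtain i where "D a \<bullet> u = of_int i" by (auto elim: Ints_cases)
    then show ?thesis by (cases "i \<ge> 0") (auto simp: p_def n_def)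
  qed
  have sc: "real k *\<^sub>R w \<in> ?S \<and> x (real k *\<^sub>R w) = x w ^ k" if "w \<in> ?S" for k w
    using monoid_points_scale[OF x(1) mon(2,1) that] .
  have sumA: "(\<Sum>a\<in>A. real (k a) *\<^sub>R a) \<in> ?S \<and> x (\<Sum>a\<in>A. real (k a) *\<^sub>R a) = (\<Prod>a\<in>A. x a ^ k a)" for k
    using monoid_points_sum[OF x(1) mon(2,1) fin(1), of "\<lambda>a. real (k a) *\<^sub>R a"] sc[OF AS]
    by (auto cong: prod.cong)
  have sumE: "(\<Sum>g\<in>gens \<tau>. real (k g) *\<^sub>R e g) \<in> ?S \<and>
      x (\<Sum>g\<in>gens \<tau>. real (k g) *\<^sub>R e g) = (\<Prod>g\<in>gens \<tau>. x (e g) ^ k g)" for k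
    using monoid_points_sum[OF x(1) mon(2,1) fin(2), of "\<lambda>g. real (k g) *\<^sub>R e g"] sc[OF eS]
    by (auto cong: prod.cong)
  have ng: "u \<bullet> g = real (nat \<lfloor>u \<bullet> g\<rfloor>)" if "g \<in> gens \<tau>" for g
    using chart_mon_inner_nat[OF \<Gamma>(1) u gens_face_in[OF \<Gamma>(2,1,3) that]] .
  let ?E = "\<Sum>g\<in>gens \<tau>. real (nat \<lfloor>u \<bullet> g\<rfloor>) *\<^sub>R e g"
  have E: "(\<Sum>g\<in>gens \<tau>. (u \<bullet> g) *\<^sub>R e g) = ?E" using ng by (intro sum.cong) auto
  have Apn: "(\<Sum>a\<in>A. (D a \<bullet> u) *\<^sub>R a) = (\<Sum>a\<in>A. real (p a) *\<^sub>R a) - (\<Sum>a\<in>A. real (n a) *\<^sub>R a)"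
    unfolding sum_subtractf[symmetric] using pn by (intro sum.cong) (auto simp: scaleR_diff_left)
  have "u + (\<Sum>a\<in>A. real (n a) *\<^sub>R a) = ?E + (\<Sum>a\<in>A. real (p a) *\<^sub>R a)"
    using expand unfolding E Apn by (simp add: algebra_simps)
  then have "x (u + (\<Sum>a\<in>A. real (n a) *\<^sub>R a)) = x (?E + (\<Sum>a\<in>A. real (p a) *\<^sub>R a))" by (rule arg_cong)
  moreover have xadd: "x (v + w) = x v * x w" if "v \<in> ?S" "w \<in> ?S" for v w
    using x(1) that by (auto simp: monoid_points_def)
  ultimately have "x u * x (\<Sum>a\<in>A. real (n a) *\<^sub>R a) = x ?E * x (\<Sum>a\<in>A. real (p a) *\<^sub>R a)"
    using xadd[OF u conjunct1[OF sumA[of n]]]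
      xadd[OF conjunct1[OF sumE[of "\<lambda>g. nat \<lfloor>u \<bullet> g\<rfloor>"]] conjunct1[OF sumA[of p]]] by simp
  then have eq: "x u * (\<Prod>a\<in>A. x a ^ n a) = (\<Prod>g\<in>gens \<tau>. x (e g) ^ nat \<lfloor>u \<bullet> g\<rfloor>) * (\<Prod>a\<in>A. x a ^ p a)"
    unfolding conjunct2[OF sumA] conjunct2[OF sumE] .
  define \<Lambda> where "\<Lambda> a = l a + Ln (x a * exp (- l a))" for a
  have xa: "x a = exp (\<Lambda> a)" if "a \<in> A" for a
    using x(2) that by (simp add: \<Lambda>_def exp_add exp_minus)
  have powA: "(\<Prod>a\<in>A. x a ^ k a) = exp (\<Sum>a\<in>A. of_nat (k a) * \<Lambda> a)" for k
    unfolding exp_sum[OF fin(1)] using xa by (intro prod.cong) (auto simp: exp_of_nat_mult)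
  have "(\<Sum>a\<in>A. of_nat (p a) * \<Lambda> a) = (\<Sum>a\<in>A. of_real (D a \<bullet> u) * \<Lambda> a) + (\<Sum>a\<in>A. of_nat (n a) * \<Lambda> a)"
    unfolding sum.distrib[symmetric] by (intro sum.cong refl) (simp add: pn left_diff_distrib)
  then have "x u * exp (\<Sum>a\<in>A. of_nat (n a) * \<Lambda> a) = (\<Prod>g\<in>gens \<tau>. x (e g) ^ nat \<lfloor>u \<bullet> g\<rfloor>) *
      exp (\<Sum>a\<in>A. of_real (D a \<bullet> u) * \<Lambda> a) * exp (\<Sum>a\<in>A. of_nat (n a) * \<Lambda> a)"
    using eq unfolding powA by (simp add: exp_add)
  then have "x u = (\<Prod>g\<in>gens \<tau>. x (e g) ^ nat \<lfloor>u \<bullet> g\<rfloor>) * exp (\<Sum>a\<in>A. of_real (D a \<bullet> u) * \<Lambda> a)" by simp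
  also have "(\<Sum>a\<in>A. of_real (D a \<bullet> u) * \<Lambda> a) = l (\<Sum>a\<in>A. (D a \<bullet> u) *\<^sub>R a) + log_shift l A D x u"
    unfolding linear_sum[OF l] linear_cmul[OF l]
    by (simp add: \<Lambda>_def log_shift_def distrib_left sum.distrib scaleR_conv_of_real)
  also have "(\<Sum>a\<in>A. (D a \<bullet> u) *\<^sub>R a) = u - (\<Sum>g\<in>gens \<tau>. (u \<bullet> g) *\<^sub>R e g)"
    using expand by (simp add: algebra_simps)
  finally show ?thesis .
qed

lemma transition_in:
  assumes \<Gamma>: "\<Gamma>' \<in> \<Xi>" "\<tau> \<in> \<Xi>" "\<tau> \<subseteq> \<Gamma>'" and l: "linear l"
  shows "transition \<tau> \<Gamma>' l e A D x \<in> monoid_points (chart_mon \<Gamma>')"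
  unfolding monoid_points_def
proof (intro CollectI conjI ballI allI impI)
  note mon = cone_monoid[OF commensurable_chart_dual[OF \<Gamma>(1)], where \<sigma> = \<Gamma>']
  note lin = linear_0[OF log_shift_linear] linear_add[OF log_shift_linear] linear_0[OF l] linear_add[OF l] linear_diff[OF l]
  show "transition \<tau> \<Gamma>' l e A D x 0 = 1" using mon(1) by (simp add: transition_def lin)
  fix u w assume uw: "u \<in> chart_mon \<Gamma>'" "w \<in> chart_mon \<Gamma>'"
  have fl: "nat \<lfloor>(u + w) \<bullet> g\<rfloor> = nat \<lfloor>u \<bullet> g\<rfloor> + nat \<lfloor>w \<bullet> g\<rfloor>" if g: "g \<in> gens \<tau>" for g
  proof -
    obtain i where "u \<bullet> g = real i" by (rule chart_mon_face_inner_nat[OF \<Gamma> uw(1) g])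
    moreover obtain j where "w \<bullet> g = real j" by (rule chart_mon_face_inner_nat[OF \<Gamma> uw(2) g])
    ultimately show ?thesis by (simp add: inner_add_left nat_add_distrib)
  qed
  have pr: "(\<Prod>g\<in>gens \<tau>. x (e g) ^ nat \<lfloor>(u + w) \<bullet> g\<rfloor>) =
      (\<Prod>g\<in>gens \<tau>. x (e g) ^ nat \<lfloor>u \<bullet> g\<rfloor>) * (\<Prod>g\<in>gens \<tau>. x (e g) ^ nat \<lfloor>w \<bullet> g\<rfloor>)"
    unfolding prod.distrib[symmetric] using fl by (intro prod.cong) (auto simp: power_add)
  have "(u + w) - (\<Sum>g\<in>gens \<tau>. ((u + w) \<bullet> g) *\<^sub>R e g) =
      (u - (\<Sum>g\<in>gens \<tau>. (u \<bullet> g) *\<^sub>R e g)) + (w - (\<Sum>g\<in>gens \<tau>. (w \<bullet> g) *\<^sub>R e g))"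
    by (simp add: inner_add_left scaleR_add_left sum.distrib)
  then show "transition \<tau> \<Gamma>' l e A D x (u + w) = transition \<tau> \<Gamma>' l e A D x u * transition \<tau> \<Gamma>' l e A D x w"
    using uw mon(2)[OF uw] unfolding transition_def pr by (simp only: if_True lin exp_add mult_ac)
qed (auto simp: transition_def)

lemma transition_perp:
  assumes \<tau>: "\<tau> \<in> \<Xi>" and l: "linear l" and u: "u \<in> chart_mon \<Gamma>'" "u \<in> perp \<tau>"
  shows "transition \<tau> \<Gamma>' l e A D x u = exp (l u + log_shift l A D x u)"
proof -
  have "\<forall>g\<in>gens \<tau>. u \<bullet> g = 0" using u(2) perp_iff_gens[OF \<tau>] by blast
  then show ?thesis using u(1) by (simp add: transition_def)
qed

text \<open>On characters orthogonal to \<tau> the transferred point is \<open>exp\<close> of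
  \<open>l\<close> plus the old shift; inside the strip \<open>Ln\<close> recovers the shift. Other
  characters are first projected along \<open>e'\<close>, since the new frame measures only its
  invertible part.\<close>

lemma log_shift_transition:
  assumes \<tau>: "\<tau> \<in> \<Xi>" and l: "linear l" and fr': "frame \<tau> \<Gamma>' e' A' D'"
    and x: "x \<in> log_domain \<Gamma> l A D (A \<union> A')"
  shows "\<And>a. a \<in> A' \<Longrightarrow> Ln (transition \<tau> \<Gamma>' l e A D x a * exp (- l a)) = log_shift l A D x a"
    and "\<And>u. log_shift l A' D' (transition \<tau> \<Gamma>' l e A D x) u =
      log_shift l A D x (u - (\<Sum>g\<in>gens \<tau>. (u \<bullet> g) *\<^sub>R e' g))"
proof -
  have *: "transition \<tau> \<Gamma>' l e A D x a * exp (- l a) = exp (log_shift l A D x a)" if "a \<in> A'" for a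
  proof -
    have "a \<in> chart_mon \<Gamma>'" "a \<in> perp \<tau>" using fr' that unfolding frame_def by blast+
    then show ?thesis using transition_perp[OF \<tau> l] by (simp add: exp_add exp_minus)
  qed
  show ln: "Ln (transition \<tau> \<Gamma>' l e A D x a * exp (- l a)) = log_shift l A D x a" if a: "a \<in> A'" for a
  proof -
    have "\<bar>Im (log_shift l A D x a)\<bar> < pi" using x a by (auto simp: log_domain_def)
    then show ?thesis unfolding *[OF a] by (intro Ln_exp) auto
  qed
  fix u
  have "log_shift l A' D' (transition \<tau> \<Gamma>' l e A D x) u =
      (\<Sum>a\<in>A'. of_real (D' a \<bullet> u) * log_shift l A D x a)"
    unfolding log_shift_def[of l A'] using ln by (intro sum.cong) auto
  also have "\<dots> = log_shift l A D x (\<Sum>a\<in>A'. (D' a \<bullet> u) *\<^sub>R a)"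
    unfolding linear_sum[OF log_shift_linear] linear_cmul[OF log_shift_linear] by (simp add: scaleR_conv_of_real)
  also have "(\<Sum>a\<in>A'. (D' a \<bullet> u) *\<^sub>R a) = u - (\<Sum>g\<in>gens \<tau>. (u \<bullet> g) *\<^sub>R e' g)"
  proof -
    have "u = (\<Sum>g\<in>gens \<tau>. (u \<bullet> g) *\<^sub>R e' g) + (\<Sum>a\<in>A'. (D' a \<bullet> u) *\<^sub>R a)"
      using fr' unfolding frame_def by blast
    then show ?thesis by (simp add: algebra_simps)
  qed
  finally show "log_shift l A' D' (transition \<tau> \<Gamma>' l e A D x) u =
      log_shift l A D x (u - (\<Sum>g\<in>gens \<tau>. (u \<bullet> g) *\<^sub>R e' g))" .
qed

text \<open>Both domains impose the strip condition on the same set \<open>A \<union> A'\<close>.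
  Its members are orthogonal to \<tau>, and there the two log shifts coincide, which makes the
  conditions symmetric.\<close>

lemma transition_domain:
  assumes \<Gamma>: "\<Gamma>' \<in> \<Xi>" "\<tau> \<in> \<Xi>" "\<tau> \<subseteq> \<Gamma>'" and l: "linear l"
    and fr: "frame \<tau> \<Gamma> e A D" and fr': "frame \<tau> \<Gamma>' e' A' D'"
    and x: "x \<in> log_domain \<Gamma> l A D (A \<union> A')"
  shows "transition \<tau> \<Gamma>' l e A D x \<in> log_domain \<Gamma>' l A' D' (A \<union> A')"
proof -
  let ?y = "transition \<tau> \<Gamma>' l e A D x"
  have "?y a * exp (- l a) \<notin> \<real>\<^sub>\<le>\<^sub>0" if a: "a \<in> A'" for a
  proof
    assume n: "?y a * exp (- l a) \<in> \<real>\<^sub>\<le>\<^sub>0"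
    have "a \<in> chart_mon \<Gamma>'" "a \<in> perp \<tau>" using fr' that unfolding frame_def by blast+
    then have "?y a * exp (- l a) = exp (log_shift l A D x a)"
      using transition_perp[OF \<Gamma>(2) l] by (simp add: exp_add exp_minus)
    then have "?y a * exp (- l a) \<noteq> 0" by simp
    then have "Im (Ln (?y a * exp (- l a))) = pi"
      using n Im_Ln_eq_pi[of "?y a * exp (- l a)"] by (auto simp: complex_nonpos_Reals_iff complex_eq_iff)
    then have "Im (log_shift l A D x a) = pi" using log_shift_transition(1)[OF \<Gamma>(2) l fr' x a] by simp
    moreover have "\<bar>Im (log_shift l A D x a)\<bar> < pi" using x a by (auto simp: log_domain_def)
    ultimately show False using pi_gt_zero by simp
  qed
  moreover have "\<bar>Im (log_shift l A' D' ?y a)\<bar> < pi" if a: "a \<in> A \<union> A'" for a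
  proof -
    have "a \<in> perp \<tau>" using a fr fr' unfolding frame_def by blast
    then have "\<forall>g\<in>gens \<tau>. a \<bullet> g = 0" using perp_iff_gens[OF \<Gamma>(2)] by blast
    then show ?thesis using log_shift_transition(2)[OF \<Gamma>(2) l fr' x, of e a] x a by (simp add: log_domain_def)
  qed
  ultimately show ?thesis using transition_in[OF \<Gamma> l] by (simp add: log_domain_def)
qed

lemma transition_inverse:
  assumes \<Gamma>: "\<Gamma> \<in> \<Xi>" "\<tau> \<in> \<Xi>" "\<tau> \<subseteq> \<Gamma>" and l: "linear l"
    and fr: "frame \<tau> \<Gamma> e A D" and fr': "frame \<tau> \<Gamma>' e' A' D'"
    and x: "x \<in> log_domain \<Gamma> l A D (A \<union> A')"
  shows "transition \<tau> \<Gamma> l e' A' D' (transition \<tau> \<Gamma>' l e A D x) = x"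
proof
  fix u :: 'a
  let ?y = "transition \<tau> \<Gamma>' l e A D x" and ?G = "gens \<tau>" and ?n = "\<lambda>g. nat \<lfloor>u \<bullet> g\<rfloor>"
  have xin: "x \<in> monoid_points (chart_mon \<Gamma>)" using x by (simp add: log_domain_def)
  show "transition \<tau> \<Gamma> l e' A' D' ?y u = x u"
  proof (cases "u \<in> chart_mon \<Gamma>")
    case False
    then show ?thesis using xin by (auto simp: transition_def monoid_points_def)
  next
    case True
    have xA: "\<forall>a\<in>A. x a \<noteq> 0" using x by (auto simp: log_domain_def)
    have finG: "finite ?G" using gens_finite[OF \<Gamma>(2)] .
    \<comment> \<open>\<open>e' g\<close> and \<open>e g\<close> differ by a character orthogonal to
      \<tau>, so the two coordinates differ by a unit, and \<open>c g\<close> is its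
      logarithm.\<close>
    define c where "c g = l (e' g) - l (e g) + log_shift l A D x (e' g)" for g
    have ye: "?y (e' g) = x (e g) * exp (c g)" if g: "g \<in> ?G" for g
    proof -
      have eg: "e' g \<bullet> h = (if h = g then 1 else 0)" if "h \<in> ?G" for h
        using fr' g that unfolding frame_def dual_family_def by auto
      have "e' g \<in> chart_mon \<Gamma>'" using fr' g unfolding frame_def by blast
      moreover have "(\<Prod>h\<in>?G. x (e h) ^ nat \<lfloor>e' g \<bullet> h\<rfloor>) = (\<Prod>h\<in>?G. if h = g then x (e h) else 1)"
        using eg by (intro prod.cong) auto
      moreover have "(\<Sum>h\<in>?G. (e' g \<bullet> h) *\<^sub>R e h) = (\<Sum>h\<in>?G. if h = g then e h else 0)"
        using eg by (intro sum.cong) auto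
      ultimately show ?thesis using g finG by (simp add: transition_def c_def linear_diff[OF l])
    qed
    have ng: "u \<bullet> g = real (?n g)" if "g \<in> ?G" for g
      using chart_mon_inner_nat[OF \<Gamma>(1) True gens_face_in[OF \<Gamma>(2,1,3) that]] .
    have "(\<Prod>g\<in>?G. ?y (e' g) ^ ?n g) = (\<Prod>g\<in>?G. x (e g) ^ ?n g * exp (of_real (u \<bullet> g) * c g))"
    proof (rule prod.cong[OF refl])
      fix g assume g: "g \<in> ?G"
      have "exp (of_real (u \<bullet> g) * c g) = exp (c g) ^ ?n g"
        by (subst ng[OF g]) (simp add: exp_of_nat_mult)
      then show "?y (e' g) ^ ?n g = x (e g) ^ ?n g * exp (of_real (u \<bullet> g) * c g)"
        using ye[OF g] by (simp add: power_mult_distrib)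
    qed
    also have "\<dots> = (\<Prod>g\<in>?G. x (e g) ^ ?n g) * exp (\<Sum>g\<in>?G. of_real (u \<bullet> g) * c g)"
      by (simp add: prod.distrib exp_sum[OF finG])
    finally have pr: "(\<Prod>g\<in>?G. ?y (e' g) ^ ?n g) =
      (\<Prod>g\<in>?G. x (e g) ^ ?n g) * exp (\<Sum>g\<in>?G. of_real (u \<bullet> g) * c g)" .
    \<comment> \<open>The terms \<open>c g\<close> trade the projection along \<open>e'\<close> for
      the projection along \<open>e\<close>; what remains is the formula of
      \<open>transition_id\<close>.\<close>
    have ex: "(\<Sum>g\<in>?G. of_real (u \<bullet> g) * c g) + (l (u - (\<Sum>g\<in>?G. (u \<bullet> g) *\<^sub>R e' g)) + log_shift l A' D' ?y u) =
        l (u - (\<Sum>g\<in>?G. (u \<bullet> g) *\<^sub>R e g)) + log_shift l A D x u"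
      unfolding log_shift_transition(2)[OF \<Gamma>(2) l fr' x] linear_diff[OF l] linear_diff[OF log_shift_linear]
        linear_sum[OF l] linear_sum[OF log_shift_linear] linear_cmul[OF l] linear_cmul[OF log_shift_linear]
      by (simp add: c_def scaleR_conv_of_real algebra_simps sum.distrib sum_subtractf)
    have "transition \<tau> \<Gamma> l e' A' D' ?y u = (\<Prod>g\<in>?G. x (e g) ^ ?n g) *
        exp (l (u - (\<Sum>g\<in>?G. (u \<bullet> g) *\<^sub>R e g)) + log_shift l A D x u)"
      unfolding ex[symmetric] exp_add[of "\<Sum>g\<in>?G. _ g"] mult.assoc[symmetric] pr[symmetric]
      using True by (simp add: transition_def)
    also have "\<dots> = x u" by (rule transition_id[OF \<Gamma> fr l xin xA True, symmetric])
    finally show ?thesis .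
  qed
qed

lemma continuous_on_coordinate: "continuous_on X (\<lambda>x::'a \<Rightarrow> complex. x u)"
  by (rule continuous_on_subset[OF continuous_on_product_coordinates]) simp

lemma continuous_on_log_shift:
  "continuous_on {x. \<forall>a\<in>A. x a * exp (- l a) \<notin> \<real>\<^sub>\<le>\<^sub>0} (\<lambda>x. log_shift l A D x u)"
  unfolding log_shift_def by (intro continuous_intros continuous_on_coordinate) auto

lemma log_domain_open:
  assumes "finite A" "finite E"
  shows "openin (top_of_set (monoid_points (chart_mon \<Gamma>))) (log_domain \<Gamma> l A D E)"
proof -
  let ?O = "{x. \<forall>a\<in>A. x a * exp (- l a) \<notin> \<real>\<^sub>\<le>\<^sub>0}"
  have "open {x::'a \<Rightarrow> complex. x a * exp (- l a) \<notin> \<real>\<^sub>\<le>\<^sub>0}" for a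
  proof -
    have "open ((\<lambda>x::'a \<Rightarrow> complex. x a * exp (- l a)) -` (- \<real>\<^sub>\<le>\<^sub>0))"
      by (intro open_vimage) (auto intro!: continuous_intros continuous_on_coordinate simp: open_Compl)
    then show ?thesis by (simp add: vimage_def)
  qed
  then have "open (\<Inter>a\<in>A. {x::'a \<Rightarrow> complex. x a * exp (- l a) \<notin> \<real>\<^sub>\<le>\<^sub>0})"
    using assms(1) by (intro open_INT) auto
  moreover have "(\<Inter>a\<in>A. {x::'a \<Rightarrow> complex. x a * exp (- l a) \<notin> \<real>\<^sub>\<le>\<^sub>0}) = ?O" by auto
  ultimately have opO: "open ?O" by simp
  have "open (?O \<inter> (\<lambda>x. log_shift l A D x a) -` {z. \<bar>Im z\<bar> < pi})" for a
  proof (rule continuous_open_preimage[OF continuous_on_log_shift opO])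
    have "open ((\<lambda>z. \<bar>Im z\<bar>) -` {..<pi})" by (intro open_vimage) (auto intro!: continuous_intros)
    then show "open {z. \<bar>Im z\<bar> < pi}" by (simp add: vimage_def)
  qed
  then have op: "open (?O \<inter> (\<Inter>a\<in>E. ?O \<inter> (\<lambda>x. log_shift l A D x a) -` {z. \<bar>Im z\<bar> < pi}))"
    using assms(2) opO by (intro open_Int open_INT) auto
  have eq: "log_domain \<Gamma> l A D E = monoid_points (chart_mon \<Gamma>) \<inter>
      (?O \<inter> (\<Inter>a\<in>E. ?O \<inter> (\<lambda>x. log_shift l A D x a) -` {z. \<bar>Im z\<bar> < pi}))"
    by (auto simp: log_domain_def)
  show ?thesis unfolding eq by (rule openin_open_Int[OF op])
qed

lemma continuous_on_transition: "continuous_on (log_domain \<Gamma> l A D E) (transition \<tau> \<Gamma>' l e A D)"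
proof (rule continuous_on_coordinatewise_then_product)
  fix u
  have "continuous_on (log_domain \<Gamma> l A D E) (\<lambda>x. log_shift l A D x u)"
    by (rule continuous_on_subset[OF continuous_on_log_shift]) (auto simp: log_domain_def)
  then show "continuous_on (log_domain \<Gamma> l A D E) (\<lambda>x. transition \<tau> \<Gamma>' l e A D x u)"
    by (cases "u \<in> chart_mon \<Gamma>'") (auto simp: transition_def intro!: continuous_intros continuous_on_coordinate)
qed

text \<open>For \<open>v\<close> in the span of \<tau> the invertible coordinates are unchanged and
  only the \<open>e g\<close> rotate. Their angles, weighted by the exponents
  \<open>u \<bullet> g\<close>, add up to the pairing of \<open>u\<close> with
  \<open>v\<close>.\<close>

lemma torus_rot_transition:
  assumes \<Gamma>: "\<Gamma>' \<in> \<Xi>" "\<tau> \<in> \<Xi>" "\<tau> \<subseteq> \<Gamma>'" and fr: "frame \<tau> \<Gamma> e A D"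
    and x: "x \<in> log_domain \<Gamma> l A D E" and v: "v \<in> span \<tau>"
  shows "torus_rot v x \<in> log_domain \<Gamma> l A D E"
    and "transition \<tau> \<Gamma>' l e A D (torus_rot v x) = torus_rot v (transition \<tau> \<Gamma>' l e A D x)"
proof -
  let ?G = "gens \<tau>"
  have ra: "torus_rot v x a = x a" if "a \<in> A" for a
  proof -
    have "a \<in> perp \<tau>" using fr that unfolding frame_def by blast
    then show ?thesis using perp_span[OF _ v] by (simp add: torus_rot_def)
  qed
  then have ls: "log_shift l A D (torus_rot v x) = log_shift l A D x"
    by (auto simp: log_shift_def fun_eq_iff)
  show "torus_rot v x \<in> log_domain \<Gamma> l A D E"
    using x ra ls torus_rot_in by (auto simp: log_domain_def)
  show "transition \<tau> \<Gamma>' l e A D (torus_rot v x) = torus_rot v (transition \<tau> \<Gamma>' l e A D x)"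
  proof
    fix u
    show "transition \<tau> \<Gamma>' l e A D (torus_rot v x) u = torus_rot v (transition \<tau> \<Gamma>' l e A D x) u"
    proof (cases "u \<in> chart_mon \<Gamma>'")
      case True
      have finG: "finite ?G" using gens_finite[OF \<Gamma>(2)] .
      let ?c = "2 * of_real pi * \<i> :: complex"
      have ed: "dual_family ?G e" using fr unfolding frame_def by blast
      have "v = (\<Sum>g\<in>?G. (e g \<bullet> v) *\<^sub>R g)"
        using dual_family_expand[OF ed finG] v span_cone[OF \<Gamma>(2)] by simp
      then have "u \<bullet> v = u \<bullet> (\<Sum>g\<in>?G. (e g \<bullet> v) *\<^sub>R g)" by (rule arg_cong)
      then have uv: "u \<bullet> v = (\<Sum>g\<in>?G. (u \<bullet> g) * (e g \<bullet> v))" by (simp add: inner_sum_right mult.commute)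
      have "torus_rot v x (e g) ^ nat \<lfloor>u \<bullet> g\<rfloor> =
          exp (?c * of_real ((u \<bullet> g) * (e g \<bullet> v))) * x (e g) ^ nat \<lfloor>u \<bullet> g\<rfloor>" if g: "g \<in> ?G" for g
      proof -
        obtain n :: nat where n: "u \<bullet> g = real n" by (rule chart_mon_face_inner_nat[OF \<Gamma> True g])
        have "exp (?c * of_real (e g \<bullet> v)) ^ n = exp (of_nat n * (?c * of_real (e g \<bullet> v)))"
          by (simp add: exp_of_nat_mult)
        then show ?thesis by (simp add: n torus_rot_def power_mult_distrib mult_ac)
      qed
      then have "(\<Prod>g\<in>?G. torus_rot v x (e g) ^ nat \<lfloor>u \<bullet> g\<rfloor>) =
          (\<Prod>g\<in>?G. exp (?c * of_real ((u \<bullet> g) * (e g \<bullet> v))) * x (e g) ^ nat \<lfloor>u \<bullet> g\<rfloor>)"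
        by (rule prod.cong[OF refl])
      also have "\<dots> = exp (?c * of_real (u \<bullet> v)) * (\<Prod>g\<in>?G. x (e g) ^ nat \<lfloor>u \<bullet> g\<rfloor>)"
        unfolding prod.distrib exp_sum[OF finG, symmetric] by (simp add: uv sum_distrib_left)
      finally show ?thesis using True ls by (simp add: transition_def torus_rot_def)
    qed (auto simp: transition_def torus_rot_def)
  qed
qed

text \<open>The projection uses only characters of \<open>M\<close> regular over \<gamma>. These are
  characters of both charts, and on them \<open>transition_id\<close> says that the point is
  unchanged.\<close>

lemma transition_proj:
  assumes \<gamma>: "\<gamma> \<in> \<Xi>" "\<tau> \<in> \<Xi>" "\<tau> \<subseteq> \<gamma>" and l: "linear l" "linear l0"
    and fr: "frame \<tau> \<tau> e A D" and x: "x \<in> log_domain \<tau> l A D E"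
  shows "chart_proj Q (pt \<gamma> l0) (transition \<tau> \<gamma> l e A D x) = chart_proj Q (pt \<tau> l) x"
proof -
  have xin: "x \<in> monoid_points (chart_mon \<tau>)" and xA: "\<forall>a\<in>A. x a \<noteq> 0" using x by (auto simp: log_domain_def)
  obtain \<tau>2 l2 where x2: "\<tau>2 \<in> \<Xi>" "\<tau>2 \<subseteq> \<tau>" "linear l2" "x = orbit_point (chart_mon \<tau>) \<tau>2 l2"
    by (rule chart_point_form[OF \<gamma>(2) xin])
  have sub: "cone_mon \<gamma> \<subseteq> chart_mon \<tau>" "cone_mon \<gamma> \<subseteq> chart_mon \<gamma>"
    using chart_mon_supset[OF \<gamma>(2)] chart_mon_supset[OF \<gamma>(1)] dual_cone_antimono[OF \<gamma>(3)] by blast+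
  have "transition \<tau> \<gamma> l e A D x u = x u" if u: "u \<in> cone_mon \<gamma>" for u
  proof -
    have 1: "u \<in> chart_mon \<tau>" "u \<in> chart_mon \<gamma>" using sub u by blast+
    show ?thesis using transition_id[OF \<gamma>(2,2) subset_refl fr l(1) xin xA 1(1)] 1(2) by (simp add: transition_def)
  qed
  then have "restrict_point N \<gamma> (transition \<tau> \<gamma> l e A D x) = restrict_point N \<gamma> x"
    by (auto simp: restrict_point_def fun_eq_iff)
  also have "\<dots> = orbit_point (cone_mon \<gamma>) \<tau>2 l2" unfolding x2(4) by (rule restrict_orbit_point[OF sub(1)])
  finally have "chart_proj Q (pt \<gamma> l0) (transition \<tau> \<gamma> l e A D x) = pt \<tau>2 l2"
    using toric_class_orbit_point[OF \<gamma>(1) x2(1) _ x2(3)] x2(2) \<gamma>(3) orbifold_at_pt(5)[OF \<gamma>(1) l(2)] by simp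
  then show ?thesis using chart_proj_orbit_point[OF \<gamma>(2) x2(1,2,3) l(1)] x2(4) by simp
qed

lemma transition_centre:
  assumes \<gamma>: "\<gamma> \<in> \<Xi>" "\<tau> \<in> \<Xi>" "\<tau> \<subseteq> \<gamma>" and l: "linear l" and fr: "frame \<tau> \<tau> e A D"
  shows "orbit_point (chart_mon \<tau>) \<tau> l \<in> log_domain \<tau> l A D E"
    and "transition \<tau> \<gamma> l e A D (orbit_point (chart_mon \<tau>) \<tau> l) = orbit_point (chart_mon \<gamma>) \<tau> l"
proof -
  let ?y = "orbit_point (chart_mon \<tau>) \<tau> l"
  have ya: "?y a * exp (- l a) = 1" if "a \<in> A" for a
  proof -
    have "a \<in> chart_mon \<tau>" "a \<in> perp \<tau>" using fr that unfolding frame_def by blast+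
    then show ?thesis by (simp add: orbit_point_def exp_minus)
  qed
  then have ls: "log_shift l A D ?y = (\<lambda>_. 0)" by (simp add: log_shift_def fun_eq_iff)
  show "?y \<in> log_domain \<tau> l A D E"
    using chart_orbit_point_in[OF \<gamma>(2) subset_refl l] ya ls pi_gt_zero by (auto simp: log_domain_def)
  have ye: "?y (e g) = 0" if g: "g \<in> gens \<tau>" for g
  proof -
    have "e g \<bullet> g = 1" using fr g unfolding frame_def dual_family_def by auto
    then have "\<exists>h\<in>gens \<tau>. e g \<bullet> h \<noteq> 0" using g by (intro bexI[of _ g]) auto
    then have "e g \<notin> perp \<tau>" using perp_iff_gens[OF \<gamma>(2)] by blast
    then show ?thesis by (simp add: orbit_point_def)
  qed
  show "transition \<tau> \<gamma> l e A D ?y = orbit_point (chart_mon \<gamma>) \<tau> l"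
  proof
    fix u
    show "transition \<tau> \<gamma> l e A D ?y u = orbit_point (chart_mon \<gamma>) \<tau> l u"
    proof (cases "u \<in> chart_mon \<gamma>")
      case True
      show ?thesis
      proof (cases "u \<in> perp \<tau>")
        case True
        then show ?thesis using \<open>u \<in> chart_mon \<gamma>\<close> transition_perp[OF \<gamma>(2) l] ls by (simp add: orbit_point_def)
      next
        case False
        then obtain g where g: "g \<in> gens \<tau>" "u \<bullet> g \<noteq> 0" using perp_iff_gens[OF \<gamma>(2)] by blast
        obtain n :: nat where n: "u \<bullet> g = real n" by (rule chart_mon_face_inner_nat[OF \<gamma> True g(1)])
        have "?y (e g) ^ nat \<lfloor>u \<bullet> g\<rfloor> = 0" using ye[OF g(1)] g(2) by (simp add: n)
        then have "(\<Prod>g\<in>gens \<tau>. ?y (e g) ^ nat \<lfloor>u \<bullet> g\<rfloor>) = 0"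
          by (rule prod_zero[OF gens_finite[OF \<gamma>(2)] bexI[OF _ g(1)]])
        then show ?thesis using False by (simp add: transition_def orbit_point_def)
      qed
    qed (auto simp: transition_def orbit_point_def)
  qed
qed

text \<open>The second part says that the lattice of the face is the intersection of the larger
  lattice with its span; it makes the map of local groups injective.\<close>

lemma int_span_face:
  assumes "\<tau> \<in> \<Xi>" "\<gamma> \<in> \<Xi>" "\<tau> \<subseteq> \<gamma>"
  shows "int_span (gens \<tau>) \<subseteq> int_span (gens \<gamma>)"
    and "v \<in> int_span (gens \<gamma>) \<Longrightarrow> v \<in> span \<tau> \<Longrightarrow> v \<in> int_span (gens \<tau>)"
proof -
  have sub: "gens \<tau> \<subseteq> gens \<gamma>" using subset_iff_gens assms by blast
  show "int_span (gens \<tau>) \<subseteq> int_span (gens \<gamma>)"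
    using sub int_span_base[OF gens_finite[OF assms(2)]] by (intro int_span_mono_subgroup add_subgroup_int_span) auto
  obtain d where d: "dual_family (gens \<gamma>) d" using dual_family_exists gens_independent[OF assms(2)] .
  show "v \<in> int_span (gens \<tau>)" if "v \<in> int_span (gens \<gamma>)" "v \<in> span \<tau>"
    using that in_int_span_dual[OF d gens_finite[OF assms(2)]] sub span_cone[OF assms(1)]
      in_int_span_dual[OF dual_family_subset[OF d sub] gens_finite[OF assms(1)]] by blast
qed

text \<open>The injection also carries the centre to the point of the larger chart with coordinates
  \<tau> and \<open>l\<close>. As \<open>l\<close> is arbitrary, every point of that chart is
  reached, as the projection of sector charts requires.\<close>

lemma chart_injection_exists:
  assumes \<gamma>: "\<gamma> \<in> \<Xi>" "linear l0" and \<tau>: "\<tau> \<in> \<Xi>" "\<tau> \<subseteq> \<gamma>" and l: "linear l"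
  shows "\<exists>W \<phi> lam. chart_injection Q (pt \<tau> l) (pt \<gamma> l0) W \<phi> lam \<and> orbit_point (chart_mon \<tau>) \<tau> l \<in> W \<and>
    \<phi> (orbit_point (chart_mon \<tau>) \<tau> l) = orbit_point (chart_mon \<gamma>) \<tau> l"
proof -
  let ?q = "pt \<tau> l" and ?p = "pt \<gamma> l0"
  note q = orbifold_at_pt[OF \<tau>(1) l] and p = orbifold_at_pt[OF \<gamma>]
  obtain e A D where fr: "frame \<tau> \<tau> e A D" using frame_exists[OF \<tau>(1,1) subset_refl] by blast
  obtain e' A' D' where fr': "frame \<tau> \<gamma> e' A' D'" using frame_exists[OF \<gamma>(1) \<tau>] by blast
  have fin: "finite A" "finite A'" using fr fr' by (auto simp: frame_def)
  define W where "W = log_domain \<tau> l A D (A \<union> A')"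
  define W' where "W' = log_domain \<gamma> l A' D' (A \<union> A')"
  define \<phi> where "\<phi> = transition \<tau> \<gamma> l e A D"
  define \<psi> where "\<psi> = transition \<tau> \<tau> l e' A' D'"
  \<comment> \<open>Taking a union over the coset avoids choosing a representative; all its members
    give the same coset of the larger lattice.\<close>
  define lam where "lam g = (\<Union>v\<in>g. coset \<gamma> v)" for g
  have lam: "lam (coset \<tau> v) = coset \<gamma> v" for v
  proof (intro equalityI subsetI)
    fix w assume "w \<in> lam (coset \<tau> v)"
    then obtain h where h: "h \<in> int_span (gens \<tau>)" "w \<in> coset \<gamma> (h + v)" by (auto simp: lam_def coset_def)
    then have "coset \<gamma> (h + v) = coset \<gamma> v" using int_span_face(1)[OF \<tau>(1) \<gamma>(1) \<tau>(2)] by (auto simp: coset_eq_iff)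
    then show "w \<in> coset \<gamma> v" using h by simp
  next
    fix w assume w: "w \<in> coset \<gamma> v"
    have "v \<in> coset \<tau> v" using zero_in_int_span by (force simp: coset_def)
    then show "w \<in> lam (coset \<tau> v)" using w by (auto simp: lam_def)
  qed
  have \<phi>W: "\<phi> x \<in> W'" "\<psi> (\<phi> x) = x" if "x \<in> W" for x
    using transition_domain[OF \<gamma>(1) \<tau> l fr fr'] transition_inverse[OF \<tau>(1,1) subset_refl l fr fr'] that
    unfolding W_def W'_def \<phi>_def \<psi>_def by auto
  have \<psi>W: "\<psi> x \<in> W" "\<phi> (\<psi> x) = x" if "x \<in> W'" for x
    using transition_domain[OF \<tau>(1,1) subset_refl l fr' fr] transition_inverse[OF \<gamma>(1) \<tau> l fr' fr] that
    unfolding W_def W'_def \<phi>_def \<psi>_def by (auto simp: Un_commute)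
  have im: "\<phi> ` W = W'" using \<phi>W \<psi>W by (metis image_eqI subsetI image_subsetI subset_antisym)
  have base: "orbit_point (chart_mon \<tau>) \<tau> l \<in> W" "\<phi> (orbit_point (chart_mon \<tau>) \<tau> l) = orbit_point (chart_mon \<gamma>) \<tau> l"
    using transition_centre[OF \<gamma>(1) \<tau> l fr] unfolding W_def \<phi>_def by auto
  have Wsub: "W \<subseteq> monoid_points (chart_mon \<tau>)" "W' \<subseteq> monoid_points (chart_mon \<gamma>)"
    by (auto simp: W_def W'_def log_domain_def)
  have act: "cone_action g y \<in> W \<and> \<phi> (cone_action g y) = cone_action (lam g) (\<phi> y)"
    if g: "g \<in> carrier (cone_group N \<tau>)" and y: "y \<in> W" for g y
  proof -
    obtain v where v: "v \<in> N" "v \<in> span \<tau>" "g = coset \<tau> v" using g by (auto simp: carrier_cone_group)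
    have "cone_action g y = torus_rot v y" using cone_action_coset[OF \<tau>(1)] y Wsub v by blast
    moreover have "cone_action (lam g) (\<phi> y) = torus_rot v (\<phi> y)"
      using cone_action_coset[OF \<gamma>(1)] \<phi>W(1)[OF y] Wsub v lam by auto
    ultimately show ?thesis
      using torus_rot_transition[OF \<gamma>(1) \<tau> fr _ v(2), of y l "A \<union> A'"] y unfolding W_def \<phi>_def by simp
  qed
  have "chart_injection Q ?q ?p W \<phi> lam"
    unfolding chart_injection_def q(2,3,4) p(2,3,4)
  proof (intro conjI)
    show "openin (top_of_set (monoid_points (chart_mon \<tau>))) W"
      unfolding W_def using log_domain_open fin by blast
    show "{y \<in> monoid_points (chart_mon \<tau>). chart_proj Q ?q y = ?q} \<subseteq> W"
      using chart_centre[OF \<tau>(1) l] base(1) by blast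
    show "\<forall>g\<in>carrier (cone_group N \<tau>). \<forall>y\<in>W. cone_action g y \<in> W" using act by blast
    show "openin (top_of_set (monoid_points (chart_mon \<gamma>))) (\<phi> ` W)"
      unfolding im W'_def using log_domain_open fin by blast
    have "homeomorphic_maps (top_of_set W) (top_of_set W') \<phi> \<psi>"
      unfolding homeomorphic_maps_def
    proof (intro conjI ballI)
      show "continuous_map (top_of_set W) (top_of_set W') \<phi>"
        using continuous_on_transition \<phi>W(1) by (auto simp: W_def \<phi>_def)
      show "continuous_map (top_of_set W') (top_of_set W) \<psi>"
        using continuous_on_transition \<psi>W(1) by (auto simp: W'_def \<psi>_def)
    qed (use \<phi>W \<psi>W in auto)
    then show "homeomorphic_map (top_of_set W) (top_of_set (\<phi> ` W)) \<phi>"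
      unfolding im using homeomorphic_maps_map by blast
    show "\<forall>y\<in>W. chart_proj Q ?p (\<phi> y) = chart_proj Q ?q y"
      using transition_proj[OF \<gamma>(1) \<tau> l \<gamma>(2) fr] unfolding W_def \<phi>_def by blast
    show "lam \<in> hom (cone_group N \<tau>) (cone_group N \<gamma>)"
    proof (rule homI)
      fix g assume "g \<in> carrier (cone_group N \<tau>)"
      then show "lam g \<in> carrier (cone_group N \<gamma>)"
        using lam span_mono[OF \<tau>(2)] by (auto simp: carrier_cone_group)
      fix h assume "h \<in> carrier (cone_group N \<tau>)"
      then show "lam (g \<otimes>\<^bsub>cone_group N \<tau>\<^esub> h) = lam g \<otimes>\<^bsub>cone_group N \<gamma>\<^esub> lam h"
        using \<open>g \<in> carrier (cone_group N \<tau>)\<close> by (auto simp: carrier_cone_group mult_cone_group lam)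
    qed
    show "inj_on lam (carrier (cone_group N \<tau>))"
    proof (rule inj_onI)
      fix g h assume "g \<in> carrier (cone_group N \<tau>)" "h \<in> carrier (cone_group N \<tau>)" and eq: "lam g = lam h"
      then obtain v w where v: "v \<in> span \<tau>" "g = coset \<tau> v" and w: "w \<in> span \<tau>" "h = coset \<tau> w"
        by (auto simp: carrier_cone_group)
      have "v - w \<in> int_span (gens \<gamma>)" using eq v w by (simp add: lam coset_eq_iff)
      then have "v - w \<in> int_span (gens \<tau>)"
        using int_span_face(2)[OF \<tau>(1) \<gamma>(1) \<tau>(2)] v w by (auto intro: span_diff)
      then show "g = h" using v w by (simp add: coset_eq_iff)
    qed
    show "\<forall>g\<in>carrier (cone_group N \<tau>). \<forall>y\<in>W. \<phi> (cone_action g y) = cone_action (lam g) (\<phi> y)"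
      using act by blast
  qed
  then show ?thesis using base by blast
qed

section \<open>Twisted sectors\<close>

text \<open>Charts and continuity leave the argument here: the identifications become inclusions of
  cones together with a common representative \<open>v\<close>.\<close>

lemma class_identification_iff:
  "(a, b) \<in> class_identification Q \<longleftrightarrow>
    (\<exists>\<gamma>' l' \<gamma> l v. \<gamma>' \<in> \<Xi> \<and> \<gamma> \<in> \<Xi> \<and> \<gamma>' \<subseteq> \<gamma> \<and> linear l' \<and> linear l \<and> v \<in> N \<and> v \<in> span \<gamma>' \<and>
      a = (pt \<gamma>' l', {coset \<gamma>' v}) \<and> b = (pt \<gamma> l, {coset \<gamma> v}))" (is "_ \<longleftrightarrow> ?R")
proof
  assume "(a, b) \<in> class_identification Q"
  then obtain q p g lam W \<phi> where *: "p \<in> orb_points Q" "q \<in> orb_points Q" "q \<in> chart_proj Q p ` pts (chart Q p)"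
    "g \<in> carrier (local_group Q q)" "chart_injection Q q p W \<phi> lam"
    "a = (q, conj_class (local_group Q q) g)" "b = (p, conj_class (local_group Q p) (lam g))"
    unfolding class_identification_def by blast
  obtain \<gamma> l where p: "\<gamma> \<in> \<Xi>" "linear l" "p = pt \<gamma> l" using *(1) orb_points_Q by blast
  obtain \<gamma>' l' where q: "\<gamma>' \<in> \<Xi>" "linear l'" "q = pt \<gamma>' l'" using *(2) orb_points_Q by blast
  note op = orbifold_at_pt[OF p(1,2)] and oq = orbifold_at_pt[OF q(1,2)]
  obtain x where x: "x \<in> monoid_points (chart_mon \<gamma>)" "q = chart_proj Q p x" using *(3) p(3) op(2) by auto
  obtain \<tau> l2 where \<tau>: "\<tau> \<in> \<Xi>" "\<tau> \<subseteq> \<gamma>" "linear l2" "x = orbit_point (chart_mon \<gamma>) \<tau> l2"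
    by (rule chart_point_form[OF p(1) x(1)])
  have "q = pt \<tau> l2" using chart_proj_orbit_point[OF p(1) \<tau>(1-3) p(2)] x(2) p(3) \<tau>(4) by simp
  then have sub: "\<gamma>' \<subseteq> \<gamma>" using pt_eq_iff[OF q(1) \<tau>(1) q(2) \<tau>(3)] q(3) \<tau>(2) by simp
  obtain v where v: "v \<in> N" "v \<in> span \<gamma>'" "g = coset \<gamma>' v"
    using *(4) oq(3) q(3) by (auto simp: carrier_cone_group)
  have "lam g = coset \<gamma> v" using chart_injection_hom[OF p(1,2) q(1,2) sub _ v(1,2)] *(5) p(3) q(3) v(3) by blast
  moreover have "v \<in> span \<gamma>" using v(2) span_mono[OF sub] by blast
  ultimately have "b = (pt \<gamma> l, {coset \<gamma> v})" "a = (pt \<gamma>' l', {coset \<gamma>' v})"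
    using *(6,7) p(3) q(3) op(3) oq(3) v conj_class_cone_group[OF coset_carrier] by auto
  then show ?R using p q v sub by blast
next
  assume ?R
  then obtain \<gamma>' l' \<gamma> l v where *: "\<gamma>' \<in> \<Xi>" "\<gamma> \<in> \<Xi>" "\<gamma>' \<subseteq> \<gamma>" "linear l'" "linear l" "v \<in> N" "v \<in> span \<gamma>'"
    "a = (pt \<gamma>' l', {coset \<gamma>' v})" "b = (pt \<gamma> l, {coset \<gamma> v})" by blast
  note op = orbifold_at_pt[OF *(2,5)] and oq = orbifold_at_pt[OF *(1,4)]
  obtain W \<phi> lam where inj: "chart_injection Q (pt \<gamma>' l') (pt \<gamma> l) W \<phi> lam"
    using chart_injection_exists[OF *(2,5,1,3,4)] by blast
  have lam: "lam (coset \<gamma>' v) = coset \<gamma> v" by (rule chart_injection_hom[OF *(2,5,1,4,3) inj *(6,7)])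
  have vs: "v \<in> span \<gamma>" using *(7) span_mono[OF *(3)] by blast
  have "pt \<gamma>' l' = chart_proj Q (pt \<gamma> l) (orbit_point (chart_mon \<gamma>) \<gamma>' l')"
    using chart_proj_orbit_point[OF *(2,1,3,4,5)] by simp
  then have "pt \<gamma>' l' \<in> chart_proj Q (pt \<gamma> l) ` pts (chart Q (pt \<gamma> l))"
    unfolding op(2) using chart_orbit_point_in[OF *(2,3,4)] by (rule image_eqI)
  moreover have "a = (pt \<gamma>' l', conj_class (local_group Q (pt \<gamma>' l')) (coset \<gamma>' v))"
    using *(8) oq(3) conj_class_cone_group[OF coset_carrier[OF *(6,7)]] by simp
  moreover have "b = (pt \<gamma> l, conj_class (local_group Q (pt \<gamma> l)) (lam (coset \<gamma>' v)))"
    using *(9) op(3) conj_class_cone_group[OF coset_carrier[OF *(6) vs]] lam by simp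
  moreover have "pt \<gamma> l \<in> orb_points Q" "pt \<gamma>' l' \<in> orb_points Q" using orb_points_Q * by blast+
  moreover have "coset \<gamma>' v \<in> carrier (local_group Q (pt \<gamma>' l'))" using oq(3) coset_carrier[OF *(6,7)] by simp
  ultimately show "(a, b) \<in> class_identification Q" unfolding class_identification_def using inj by blast
qed

section \<open>Box vectors and the classification of sectors\<close>

definition cone_box :: "'a set \<Rightarrow> 'a set" where
  "cone_box \<tau> = {v \<in> N. \<exists>a. (\<forall>w\<in>gens \<tau>. 0 < a w \<and> a w < 1) \<and> v = (\<Sum>w\<in>gens \<tau>. a w *\<^sub>R w)}"

text \<open>Positivity of all coordinates is an open condition, and within the span of \<tau> it
  implies membership in \<tau>. So positive coefficients place a vector in the relative
  interior.\<close>

lemma box_vectors_eq: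
  assumes "\<tau> \<in> \<Xi>"
  shows "box_vectors N \<tau> = cone_box \<tau>"
proof -
  have fin: "finite (gens \<tau>)" using gens_finite[OF assms] .
  obtain d where d: "dual_family (gens \<tau>) d" using dual_family_exists gens_independent[OF assms] .
  have "v \<in> rel_interior \<tau>" if v: "v \<in> cone_box \<tau>" for v
  proof -
    obtain a where a: "\<forall>w\<in>gens \<tau>. 0 < a w" "v = (\<Sum>w\<in>gens \<tau>. a w *\<^sub>R w)" using v by (auto simp: cone_box_def)
    define T where "T = (\<Inter>g\<in>gens \<tau>. {x. 0 < d g \<bullet> x})"
    have "open T" unfolding T_def using fin by (intro open_INT) (auto simp: open_halfspace_gt)
    moreover have "v \<in> T" using a dual_family_coord[OF d fin, of _ a] by (auto simp: T_def)
    moreover have sub: "x \<in> \<tau>" if "x \<in> T" "x \<in> span (gens \<tau>)" for x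
    proof -
      have "x \<in> convex_cone hull gens \<tau>"
        using in_convex_cone_hull_dual[OF d fin] that by (auto simp: T_def intro: less_imp_le)
      then show ?thesis using cone_eq[OF assms] by blast
    qed
    moreover have "v \<in> span (gens \<tau>)" unfolding a(2) by (intro span_sum span_scale span_base)
    moreover have "affine hull \<tau> \<subseteq> span (gens \<tau>)" using affine_hull_subset_span[of \<tau>] span_cone[OF assms] by simp
    ultimately show ?thesis unfolding mem_rel_interior by blast
  qed
  then show ?thesis by (auto simp: box_vectors_def cone_box_def)
qed

lemma cone_boxD:
  assumes "\<tau> \<in> \<Xi>" "v \<in> cone_box \<tau>"
  shows "v \<in> N" "v \<in> span \<tau>"
    and "dual_family G d \<Longrightarrow> finite G \<Longrightarrow> gens \<tau> \<subseteq> G \<Longrightarrow> g \<in> gens \<tau> \<Longrightarrow> 0 < d g \<bullet> v \<and> d g \<bullet> v < 1"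
proof -
  obtain a where a: "v \<in> N" "\<forall>w\<in>gens \<tau>. 0 < a w \<and> a w < 1" "v = (\<Sum>w\<in>gens \<tau>. a w *\<^sub>R w)"
    using assms(2) by (auto simp: cone_box_def)
  show "v \<in> N" by fact
  have "v \<in> span (gens \<tau>)" unfolding a(3) by (intro span_sum span_scale span_base)
  then show "v \<in> span \<tau>" using span_cone[OF assms(1)] by simp
  assume "dual_family G d" "finite G" "gens \<tau> \<subseteq> G" "g \<in> gens \<tau>"
  then have "d g \<bullet> v = a g"
    using dual_family_coord[OF dual_family_subset gens_finite[OF assms(1)], of G d] a(3) by simp
  then show "0 < d g \<bullet> v \<and> d g \<bullet> v < 1" using a(2) \<open>g \<in> gens \<tau>\<close> by simp
qed

lemma not_Ints_between: "0 < (a::real) \<Longrightarrow> a < 1 \<Longrightarrow> a \<notin> \<int>"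
  by (auto elim!: Ints_cases)

text \<open>A box vector has a nonintegral coefficient at every generator of \<tau>. A class that
  comes from the face \<open>\<gamma>'\<close> has integral coefficients, modulo the lattice, at all
  generators outside that face; so \<tau> must lie in it.\<close>

lemma box_coset_descend:
  assumes "\<tau> \<in> \<Xi>" "\<gamma> \<in> \<Xi>" "\<gamma>' \<in> \<Xi>" "\<tau> \<subseteq> \<gamma>" "\<gamma>' \<subseteq> \<gamma>" "v \<in> cone_box \<tau>" "v' \<in> span \<gamma>'"
    and eq: "coset \<gamma> v' = coset \<gamma> v"
  shows "\<tau> \<subseteq> \<gamma>'" "coset \<gamma>' v' = coset \<gamma>' v"
proof -
  have fin: "finite (gens \<gamma>)" using gens_finite[OF assms(2)] .
  obtain d where d: "dual_family (gens \<gamma>) d" using dual_family_exists gens_independent[OF assms(2)] .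
  have diff: "v' - v \<in> int_span (gens \<gamma>)" using eq by (simp add: coset_eq_iff)
  have sub: "gens \<tau> \<subseteq> gens \<gamma>" "gens \<gamma>' \<subseteq> gens \<gamma>" using subset_iff_gens assms by blast+
  have "g \<in> gens \<gamma>'" if g: "g \<in> gens \<tau>" for g
  proof (rule ccontr)
    assume ng: "g \<notin> gens \<gamma>'"
    have "v' = (\<Sum>h\<in>gens \<gamma>'. (d h \<bullet> v') *\<^sub>R h)"
      using dual_family_expand[OF dual_family_subset[OF d sub(2)] gens_finite[OF assms(3)]] assms(7) span_cone[OF assms(3)] by simp
    then have "d g \<bullet> v' = d g \<bullet> (\<Sum>h\<in>gens \<gamma>'. (d h \<bullet> v') *\<^sub>R h)" by (rule arg_cong)
    also have "\<dots> = (\<Sum>h\<in>gens \<gamma>'. (d h \<bullet> v') * (d g \<bullet> h))" by (simp add: inner_sum_right)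
    also have "\<dots> = 0"
    proof (rule sum.neutral, rule ballI)
      fix h assume "h \<in> gens \<gamma>'"
      then have "g \<noteq> h" "h \<in> gens \<gamma>" "g \<in> gens \<gamma>" using ng g sub by auto
      then show "(d h \<bullet> v') * (d g \<bullet> h) = 0" using d by (simp add: dual_family_def)
    qed
    finally have "d g \<bullet> (v' - v) = - (d g \<bullet> v)" by (simp add: inner_diff_right)
    moreover have "d g \<bullet> (v' - v) \<in> \<int>" using in_int_span_dual[OF d fin] diff g sub by blast
    ultimately have "d g \<bullet> v \<in> \<int>" by simp
    then show False using cone_boxD(3)[OF assms(1,6) d fin sub(1) g] not_Ints_between by blast
  qed
  then show *: "\<tau> \<subseteq> \<gamma>'" using subset_iff_gens assms by blast
  have "v \<in> span \<gamma>'" using cone_boxD(2)[OF assms(1,6)] span_mono[OF *] by blast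
  then have "v' - v \<in> int_span (gens \<gamma>')"
    using int_span_face(2)[OF assms(3,2,5) diff] assms(7) by (auto intro: span_diff)
  then show "coset \<gamma>' v' = coset \<gamma>' v" by (simp add: coset_eq_iff)
qed

lemma coset_up:
  assumes "\<gamma>' \<in> \<Xi>" "\<gamma> \<in> \<Xi>" "\<gamma>' \<subseteq> \<gamma>" "coset \<gamma>' v = coset \<gamma>' w"
  shows "coset \<gamma> v = coset \<gamma> w"
  using assms(4) int_span_face(1)[OF assms(1-3)] by (auto simp: coset_eq_iff)

lemma box_decomposition:
  assumes "\<gamma> \<in> \<Xi>" "v0 \<in> N" "v0 \<in> span \<gamma>"
  obtains \<tau> v where "\<tau> \<in> \<Xi>" "\<tau> \<subseteq> \<gamma>" "v \<in> cone_box \<tau>" "coset \<gamma> v0 = coset \<gamma> v"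
proof -
  have fin: "finite (gens \<gamma>)" using gens_finite[OF assms(1)] .
  obtain d where d: "dual_family (gens \<gamma>) d" using dual_family_exists gens_independent[OF assms(1)] .
  define a where "a g = frac (d g \<bullet> v0)" for g
  define v where "v = (\<Sum>g\<in>gens \<gamma>. a g *\<^sub>R g)"
  \<comment> \<open>Generators with integral coefficient are left out, so that the remaining
    fractional parts are strictly positive.\<close>
  obtain \<tau> where \<tau>: "\<tau> \<in> \<Xi>" "\<tau> \<subseteq> \<gamma>" "gens \<tau> = {g \<in> gens \<gamma>. a g \<noteq> 0}"
    by (rule face_by_gens[OF assms(1), of "{g \<in> gens \<gamma>. a g \<noteq> 0}"]) auto
  have "v0 = (\<Sum>g\<in>gens \<gamma>. (d g \<bullet> v0) *\<^sub>R g)"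
    using dual_family_expand[OF d fin] assms(3) span_cone[OF assms(1)] by simp
  then have "v0 - v = (\<Sum>g\<in>gens \<gamma>. (d g \<bullet> v0) *\<^sub>R g) - v" by (rule arg_cong)
  also have "\<dots> = (\<Sum>g\<in>gens \<gamma>. of_int \<lfloor>d g \<bullet> v0\<rfloor> *\<^sub>R g)"
    by (simp add: v_def a_def frac_def scaleR_diff_left sum_subtractf)
  also have "\<dots> \<in> int_span (gens \<gamma>)" unfolding int_span_def by auto
  finally have diff: "v0 - v \<in> int_span (gens \<gamma>)" .
  have "v0 - (v0 - v) \<in> N" using assms(2) diff int_span_gens(1) add_subgroupD(2)[OF N_subgroup] by blast
  then have "v \<in> N" by simp
  moreover have "v = (\<Sum>g\<in>gens \<tau>. a g *\<^sub>R g)"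
    unfolding v_def \<tau>(3) using fin by (intro sum.mono_neutral_right) auto
  moreover have "\<forall>g\<in>gens \<tau>. 0 < a g \<and> a g < 1"
    using \<tau>(3) by (simp add: a_def frac_lt_1 frac_gt_0_iff)
  ultimately have "v \<in> cone_box \<tau>" unfolding cone_box_def by blast
  then show ?thesis using that \<tau>(1,2) diff coset_eq_iff by blast
qed

definition sector :: "'a set \<Rightarrow> 'a \<Rightarrow> ('a toric_point \<times> 'a set set) set" where
  "sector \<tau> v = {(pt \<gamma> l, {coset \<gamma> v}) | \<gamma> l. \<gamma> \<in> \<Xi> \<and> \<tau> \<subseteq> \<gamma> \<and> linear l}"

text \<open>The set is closed under identifications with larger cones by \<open>coset_up\<close> and
  with smaller ones by \<open>box_coset_descend\<close>; the latter is where the box representative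
  matters.\<close>

lemma sector_of_eq:
  assumes \<tau>: "\<tau> \<in> \<Xi>" "v \<in> cone_box \<tau>" and a: "a \<in> sector \<tau> v"
  shows "sector_of Q a = sector \<tau> v"
proof -
  let ?R = "class_identification Q \<union> (class_identification Q)\<inverse>"
  have step: "c \<in> sector \<tau> v" if b: "b \<in> sector \<tau> v" and bc: "(b, c) \<in> ?R" for b c
  proof -
    obtain \<gamma>0 l0 where b0: "\<gamma>0 \<in> \<Xi>" "\<tau> \<subseteq> \<gamma>0" "linear l0" "b = (pt \<gamma>0 l0, {coset \<gamma>0 v})"
      using b unfolding sector_def by blast
    from bc consider "(b, c) \<in> class_identification Q" | "(c, b) \<in> class_identification Q" by blast
    then show ?thesis
    proof cases
      case 1
      then obtain \<gamma>' l' \<gamma> l w where *: "\<gamma>' \<in> \<Xi>" "\<gamma> \<in> \<Xi>" "\<gamma>' \<subseteq> \<gamma>" "linear l'" "linear l"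
        "b = (pt \<gamma>' l', {coset \<gamma>' w})" "c = (pt \<gamma> l, {coset \<gamma> w})"
        unfolding class_identification_iff by blast
      have "\<gamma>0 = \<gamma>'" using pt_eq_iff[OF b0(1) *(1) b0(3) *(4)] b0(4) *(6) by simp
      then have "coset \<gamma>' v = coset \<gamma>' w" using b0(4) *(6) by simp
      then have "coset \<gamma> v = coset \<gamma> w" by (rule coset_up[OF *(1-3)])
      then show ?thesis using * b0(2) \<open>\<gamma>0 = \<gamma>'\<close> unfolding sector_def by blast
    next
      case 2
      then obtain \<gamma>' l' \<gamma> l w where *: "\<gamma>' \<in> \<Xi>" "\<gamma> \<in> \<Xi>" "\<gamma>' \<subseteq> \<gamma>" "linear l'" "linear l" "w \<in> N" "w \<in> span \<gamma>'"
        "c = (pt \<gamma>' l', {coset \<gamma>' w})" "b = (pt \<gamma> l, {coset \<gamma> w})"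
        unfolding class_identification_iff by blast
      have "\<gamma>0 = \<gamma>" using pt_eq_iff[OF b0(1) *(2) b0(3) *(5)] b0(4) *(9) by simp
      then have eq: "coset \<gamma> w = coset \<gamma> v" using b0(4) *(9) by simp
      have "\<tau> \<subseteq> \<gamma>'" "coset \<gamma>' w = coset \<gamma>' v"
        using box_coset_descend[OF \<tau>(1) *(2,1) _ *(3) \<tau>(2) *(7) eq] b0(2) \<open>\<gamma>0 = \<gamma>\<close> by blast+
      then show ?thesis using * unfolding sector_def by blast
    qed
  qed
  have link: "(a, b) \<in> ?R\<^sup>*" if "a \<in> sector \<tau> v" "b \<in> sector \<tau> v" for a b
  proof -
    \<comment> \<open>The distinguished point of the smallest possible cone is identified directly
      with every member, so any two members are two steps apart.\<close>
    let ?c = "(pt \<tau> (\<lambda>_. 0), {coset \<tau> v})"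
    have lin0: "linear (\<lambda>_. 0 :: complex)" by (simp add: linear_zero)
    have "(?c, b) \<in> class_identification Q" if "b \<in> sector \<tau> v" for b
    proof -
      obtain \<gamma> l where "\<gamma> \<in> \<Xi>" "\<tau> \<subseteq> \<gamma>" "linear l" "b = (pt \<gamma> l, {coset \<gamma> v})"
        using \<open>b \<in> sector \<tau> v\<close> unfolding sector_def by blast
      then show ?thesis unfolding class_identification_iff using \<tau>(1) lin0 cone_boxD(1,2)[OF \<tau>] by blast
    qed
    then have "(a, ?c) \<in> ?R" "(?c, b) \<in> ?R" using that by blast+
    then show ?thesis by (meson converse_rtrancl_into_rtrancl r_into_rtrancl)
  qed
  show ?thesis
  proof (intro equalityI subsetI)
    fix b assume "b \<in> sector_of Q a"
    then have "(a, b) \<in> ?R\<^sup>*" by (simp add: sector_of_def)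
    then show "b \<in> sector \<tau> v" by (induction rule: rtrancl_induct) (use a step in blast)+
  next
    fix b assume "b \<in> sector \<tau> v"
    then show "b \<in> sector_of Q a" using link a by (simp add: sector_of_def)
  qed
qed

text \<open>The zero cone contributes only the vector \<open>0\<close>, which gives the untwisted
  sector. Hence \<open>g \<noteq> 1\<close> corresponds to a nonzero cone.\<close>

lemma box_coset_nontrivial:
  assumes "\<tau> \<in> \<Xi>" "v \<in> cone_box \<tau>"
  shows "coset \<tau> v = coset \<tau> 0 \<longleftrightarrow> \<tau> = {0}"
proof -
  have fin: "finite (gens \<tau>)" using gens_finite[OF assms(1)] .
  obtain d where d: "dual_family (gens \<tau>) d" using dual_family_exists gens_independent[OF assms(1)] .
  have "coset \<tau> v = coset \<tau> 0 \<longleftrightarrow> gens \<tau> = {}"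
  proof
    assume "coset \<tau> v = coset \<tau> 0"
    then have v: "v \<in> int_span (gens \<tau>)" by (simp add: coset_eq_iff)
    show "gens \<tau> = {}"
    proof (rule ccontr)
      assume "gens \<tau> \<noteq> {}"
      then obtain g where g: "g \<in> gens \<tau>" by blast
      then have "d g \<bullet> v \<in> \<int>" using in_int_span_dual[OF d fin] v by blast
      then show False using cone_boxD(3)[OF assms d fin subset_refl g] not_Ints_between by blast
    qed
  next
    assume "gens \<tau> = {}"
    then have "v = 0" using assms(2) by (auto simp: cone_box_def)
    then show "coset \<tau> v = coset \<tau> 0" by simp
  qed
  also have "\<dots> \<longleftrightarrow> \<tau> = {0}" using cone_eq[OF assms(1)] gens_zero_cone by (metis convex_cone_hull_empty)
  finally show ?thesis .
qed

lemma twisted_sectors_eq: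
  "twisted_sectors Q = {sector \<tau> v | \<tau> v. \<tau> \<in> \<Xi> \<and> \<tau> \<noteq> {0} \<and> v \<in> cone_box \<tau>}"
proof (intro equalityI subsetI)
  fix S assume "S \<in> twisted_sectors Q"
  then obtain p g where *: "S = sector_of Q (p, conj_class (local_group Q p) g)" "p \<in> orb_points Q"
    "g \<in> carrier (local_group Q p)" "g \<noteq> \<one>\<^bsub>local_group Q p\<^esub>" unfolding twisted_sectors_def by blast
  obtain \<gamma> l where p: "\<gamma> \<in> \<Xi>" "linear l" "p = pt \<gamma> l" using *(2) orb_points_Q by blast
  note op = orbifold_at_pt[OF p(1,2)]
  obtain v0 where v0: "v0 \<in> N" "v0 \<in> span \<gamma>" "g = coset \<gamma> v0"
    using *(3) op(3) p(3) by (auto simp: carrier_cone_group)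
  obtain \<tau> v where \<tau>: "\<tau> \<in> \<Xi>" "\<tau> \<subseteq> \<gamma>" "v \<in> cone_box \<tau>" "coset \<gamma> v0 = coset \<gamma> v"
    by (rule box_decomposition[OF p(1) v0(1,2)])
  have "(p, conj_class (local_group Q p) g) = (pt \<gamma> l, {coset \<gamma> v})"
    using conj_class_cone_group[OF coset_carrier[OF v0(1,2)]] p(3) op(3) v0(3) \<tau>(4) by simp
  then have "(p, conj_class (local_group Q p) g) \<in> sector \<tau> v" using p \<tau> unfolding sector_def by blast
  then have "S = sector \<tau> v" using *(1) sector_of_eq[OF \<tau>(1,3)] by simp
  moreover have "\<tau> \<noteq> {0}"
  proof
    assume "\<tau> = {0}"
    then have "coset \<tau> v = coset \<tau> 0" using box_coset_nontrivial[OF \<tau>(1,3)] by simp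
    then have "g = coset \<gamma> 0" using coset_up[OF \<tau>(1) p(1) \<tau>(2)] v0(3) \<tau>(4) by metis
    then show False using *(4) p(3) op(3) one_cone_group by simp
  qed
  ultimately show "S \<in> {sector \<tau> v | \<tau> v. \<tau> \<in> \<Xi> \<and> \<tau> \<noteq> {0} \<and> v \<in> cone_box \<tau>}" using \<tau> by blast
next
  fix S assume "S \<in> {sector \<tau> v | \<tau> v. \<tau> \<in> \<Xi> \<and> \<tau> \<noteq> {0} \<and> v \<in> cone_box \<tau>}"
  then obtain \<tau> v where *: "\<tau> \<in> \<Xi>" "\<tau> \<noteq> {0}" "v \<in> cone_box \<tau>" "S = sector \<tau> v" by blast
  have lin0: "linear (\<lambda>_. 0 :: complex)" by (simp add: linear_zero)
  let ?p = "pt \<tau> (\<lambda>_. 0)"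
  note op = orbifold_at_pt[OF *(1) lin0]
  have "(?p, {coset \<tau> v}) \<in> sector \<tau> v" using * lin0 unfolding sector_def by blast
  moreover have "conj_class (local_group Q ?p) (coset \<tau> v) = {coset \<tau> v}"
    using conj_class_cone_group[OF coset_carrier] cone_boxD(1,2)[OF *(1,3)] op(3) by simp
  ultimately have "S = sector_of Q (?p, conj_class (local_group Q ?p) (coset \<tau> v))"
    using sector_of_eq[OF *(1,3)] *(4) by simp
  moreover have "?p \<in> orb_points Q" using orb_points_Q *(1) lin0 by blast
  moreover have "coset \<tau> v \<in> carrier (local_group Q ?p)" "coset \<tau> v \<noteq> \<one>\<^bsub>local_group Q ?p\<^esub>"
    using op(3) coset_carrier cone_boxD(1,2)[OF *(1,3)] box_coset_nontrivial[OF *(1,3)] *(2) one_cone_group by auto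
  ultimately show "S \<in> twisted_sectors Q" unfolding twisted_sectors_def by blast
qed

text \<open>Compare the classes over a point of the orbit of \<tau>: the coefficients of the two box
  vectors differ by integers of absolute value below one.\<close>

lemma sector_inj:
  assumes "\<tau> \<in> \<Xi>" "v \<in> cone_box \<tau>" "v' \<in> cone_box \<tau>" "sector \<tau> v = sector \<tau> v'"
  shows "v = v'"
proof -
  have fin: "finite (gens \<tau>)" using gens_finite[OF assms(1)] .
  obtain d where d: "dual_family (gens \<tau>) d" using dual_family_exists gens_independent[OF assms(1)] .
  have lin0: "linear (\<lambda>_. 0 :: complex)" by (simp add: linear_zero)
  have "(pt \<tau> (\<lambda>_. 0), {coset \<tau> v}) \<in> sector \<tau> v'" using assms lin0 unfolding sector_def by blast
  then obtain \<gamma> l where \<gamma>: "\<gamma> \<in> \<Xi>" "linear l" "pt \<tau> (\<lambda>_. 0) = pt \<gamma> l" "coset \<tau> v = coset \<gamma> v'"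
    unfolding sector_def by blast
  then have "\<tau> = \<gamma>" using pt_eq_iff[OF assms(1) \<gamma>(1) lin0 \<gamma>(2)] by simp
  then have "v - v' \<in> int_span (gens \<tau>)" using \<gamma>(4) by (simp add: coset_eq_iff)
  then have *: "v - v' \<in> span (gens \<tau>)" "\<forall>g\<in>gens \<tau>. d g \<bullet> (v - v') \<in> \<int>"
    using in_int_span_dual[OF d fin] by auto
  have "d g \<bullet> (v - v') = 0" if g: "g \<in> gens \<tau>" for g
  proof -
    have "\<bar>d g \<bullet> (v - v')\<bar> < 1"
      using cone_boxD(3)[OF assms(1,2) d fin subset_refl g] cone_boxD(3)[OF assms(1,3) d fin subset_refl g]
      by (simp add: inner_diff_right abs_if)
    then show ?thesis using *(2) g Ints_nonzero_abs_less1 by blast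
  qed
  then have "(\<Sum>g\<in>gens \<tau>. (d g \<bullet> (v - v')) *\<^sub>R g) = 0" by simp
  then show ?thesis using dual_family_expand[OF d fin *(1)] by simp
qed

text \<open>This justifies the \<open>THE\<close>. An injection exists, and any two agree on the
  answer, since each induces the natural map of local groups and that map is injective.\<close>

lemma sector_chart_proj_eq:
  assumes \<gamma>: "\<gamma> \<in> \<Xi>" "linear l0" and \<tau>: "\<tau> \<in> \<Xi>" "\<tau> \<subseteq> \<gamma>" "linear l" and v: "v \<in> N" "v \<in> span \<tau>"
  shows "sector_chart_proj Q (pt \<gamma> l0) (coset \<gamma> v) (orbit_point (chart_mon \<gamma>) \<tau> l) = (pt \<tau> l, {coset \<tau> v})"
proof -
  let ?x = "orbit_point (chart_mon \<gamma>) \<tau> l" and ?q = "pt \<tau> l" and ?p = "pt \<gamma> l0"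
  note oq = orbifold_at_pt[OF \<tau>(1,3)]
  have pr: "chart_proj Q ?p ?x = ?q" by (rule chart_proj_orbit_point[OF \<gamma>(1) \<tau> \<gamma>(2)])
  have cl: "conj_class (local_group Q ?q) h = {h}" if "h \<in> carrier (cone_group N \<tau>)" for h
    using that oq(3) conj_class_cone_group by simp
  show ?thesis unfolding sector_chart_proj_def pr Let_def
  proof (rule the_equality)
    obtain W \<phi> lam where inj: "chart_injection Q ?q ?p W \<phi> lam" "orbit_point (chart_mon \<tau>) \<tau> l \<in> W"
      "\<phi> (orbit_point (chart_mon \<tau>) \<tau> l) = ?x" using chart_injection_exists[OF \<gamma> \<tau>] by blast
    have "lam (coset \<tau> v) = coset \<gamma> v" by (rule chart_injection_hom[OF \<gamma> \<tau>(1,3,2) inj(1) v])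
    moreover have "chart_proj Q ?q (orbit_point (chart_mon \<tau>) \<tau> l) = ?q"
      by (rule chart_proj_orbit_point[OF \<tau>(1,1) subset_refl \<tau>(3,3)])
    ultimately show "\<exists>W \<phi> lam y h. chart_injection Q ?q ?p W \<phi> lam \<and> y \<in> W \<and> chart_proj Q ?q y = ?q \<and> \<phi> y = ?x \<and>
        h \<in> carrier (local_group Q ?q) \<and> lam h = coset \<gamma> v \<and>
        (?q, {coset \<tau> v}) = (?q, conj_class (local_group Q ?q) h)"
      using inj coset_carrier[OF v] cl oq(3)
      by (intro exI[of _ W] exI[of _ \<phi>] exI[of _ lam] exI[of _ "orbit_point (chart_mon \<tau>) \<tau> l"] exI[of _ "coset \<tau> v"]) auto
    fix a assume "\<exists>W \<phi> lam y h. chart_injection Q ?q ?p W \<phi> lam \<and> y \<in> W \<and> chart_proj Q ?q y = ?q \<and> \<phi> y = ?x \<and>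
        h \<in> carrier (local_group Q ?q) \<and> lam h = coset \<gamma> v \<and> a = (?q, conj_class (local_group Q ?q) h)"
    then obtain W \<phi> lam h where *: "chart_injection Q ?q ?p W \<phi> lam" "h \<in> carrier (cone_group N \<tau>)"
      "lam h = coset \<gamma> v" "a = (?q, conj_class (local_group Q ?q) h)" using oq(3) by auto
    obtain w where w: "w \<in> N" "w \<in> span \<tau>" "h = coset \<tau> w" using *(2) by (auto simp: carrier_cone_group)
    have "coset \<gamma> w = coset \<gamma> v" using chart_injection_hom[OF \<gamma> \<tau>(1,3,2) *(1) w(1,2)] *(3) w(3) by simp
    then have "w - v \<in> int_span (gens \<tau>)"
      using int_span_face(2)[OF \<tau>(1) \<gamma>(1) \<tau>(2)] w(2) v(2) by (auto simp: coset_eq_iff intro: span_diff)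
    then have "h = coset \<tau> v" using w(3) coset_eq_iff by simp
    then show "a = (?q, {coset \<tau> v})" using *(4) cl[OF *(2)] by simp
  qed
qed

text \<open>The coordinates \<open>e g\<close> of generators outside \<tau> do not vanish at the
  point, so being fixed makes the corresponding coefficients of \<open>v\<close> integral. Dropping
  them stays in the same coset.\<close>

lemma fixed_point_coset:
  assumes \<gamma>: "\<gamma> \<in> \<Xi>" and \<tau>: "\<tau> \<in> \<Xi>" "\<tau> \<subseteq> \<gamma>" "linear l" and v: "v \<in> N" "v \<in> span \<gamma>"
    and fixed: "torus_rot v (orbit_point (chart_mon \<gamma>) \<tau> l) = orbit_point (chart_mon \<gamma>) \<tau> l"
  obtains v' where "v' \<in> N" "v' \<in> span \<tau>" "coset \<gamma> v = coset \<gamma> v'"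
proof -
  obtain e where e: "dual_family (gens \<gamma>) e" "\<And>g. g \<in> gens \<gamma> \<Longrightarrow> e g \<in> chart_dual \<gamma>"
    using chart_coordinates_exist[OF \<gamma>] by blast
  have fin: "finite (gens \<gamma>)" using gens_finite[OF \<gamma>] .
  have sub: "gens \<tau> \<subseteq> gens \<gamma>" using subset_iff_gens \<gamma> \<tau> by blast
  have int: "e g \<bullet> v \<in> \<int>" if g: "g \<in> gens \<gamma> - gens \<tau>" for g
  proof -
    have eg: "e g \<bullet> h = (if g = h then 1 else 0)" if "h \<in> gens \<gamma>" for h
      using e(1) that g by (simp add: dual_family_def)
    have "e g \<in> chart_mon \<gamma>" using e(2) g eg by (auto simp: dual_cone_iff_gens[OF \<gamma>])
    moreover have "e g \<in> perp \<tau>" using eg g sub by (auto simp: perp_iff_gens[OF \<tau>(1)])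
    ultimately have "exp (2 * of_real pi * \<i> * of_real (e g \<bullet> v)) = 1"
      using fun_cong[OF fixed, of "e g"] by (simp add: torus_rot_def orbit_point_def)
    then show ?thesis using exp_2pi_i_eq_iff[of "e g \<bullet> v" 0] by simp
  qed
  define v' where "v' = (\<Sum>g\<in>gens \<tau>. (e g \<bullet> v) *\<^sub>R g)"
  have "v = (\<Sum>g\<in>gens \<gamma>. (e g \<bullet> v) *\<^sub>R g)"
    using dual_family_expand[OF e(1) fin] v(2) span_cone[OF \<gamma>] by simp
  also have "\<dots> = v' + (\<Sum>g\<in>gens \<gamma> - gens \<tau>. (e g \<bullet> v) *\<^sub>R g)"
    unfolding v'_def using fin sub by (simp add: sum.subset_diff add.commute)
  finally have "v - v' = (\<Sum>g\<in>gens \<gamma> - gens \<tau>. (e g \<bullet> v) *\<^sub>R g)" by (simp add: algebra_simps)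
  also have "\<dots> \<in> int_span (gens \<gamma>)"
    using int int_span_base[OF fin]
    by (intro add_subgroup_sum[OF add_subgroup_int_span] add_subgroup_scale_Ints[OF add_subgroup_int_span]) auto
  finally have diff: "v - v' \<in> int_span (gens \<gamma>)" .
  have "v - (v - v') \<in> N" using v(1) diff int_span_gens(1) add_subgroupD(2)[OF N_subgroup] by blast
  then have "v' \<in> N" by simp
  moreover have "v' \<in> span \<tau>" unfolding v'_def
    using gens_in_cone by (intro span_sum span_scale span_base)
  ultimately show ?thesis using that diff coset_eq_iff by blast
qed

lemma torus_rot_face_fixed:
  assumes "v \<in> span \<tau>"
  shows "torus_rot v (orbit_point S \<tau> l) = orbit_point S \<tau> l"
  using perp_span[OF _ assms] by (auto simp: torus_rot_def orbit_point_def fun_eq_iff)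

section \<open>The isomorphism with the orbit closure\<close>

abbreviation "base_proj \<gamma> \<equiv> toric_class N \<Xi> \<gamma>"

definition cover_proj :: "'a set \<Rightarrow> ('a \<Rightarrow> complex) \<Rightarrow> 'a toric_point" where
  "cover_proj \<gamma> x = base_proj \<gamma> (restrict_point N \<gamma> x)"

text \<open>
  The norm of the finite quotient: split numerator and denominator into isotypic components, keep a
  component of the denominator that is nonzero at \<open>x\<close>, and multiply by its power that makes it invariant.
\<close>

lemma isotypic_descent:
  assumes \<gamma>: "\<gamma> \<in> \<Xi>" and a': "a' \<in> monoid_algebra (chart_mon \<gamma>)" and b': "b' \<in> monoid_algebra (chart_mon \<gamma>)"
    and x: "x \<in> monoid_points (chart_mon \<gamma>)" "b' x \<noteq> 0"
  shows "\<exists>a\<in>monoid_algebra (cone_mon \<gamma>). \<exists>b\<in>monoid_algebra (cone_mon \<gamma>). b x \<noteq> 0 \<and>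
    (\<forall>c. \<forall>y\<in>monoid_points (chart_mon \<gamma>).
       (\<forall>v\<in>N \<inter> span \<gamma>. c * b' (torus_rot v y) = a' (torus_rot v y)) \<longrightarrow> c * b y = a y)"
proof -
  let ?S = "chart_mon \<gamma>" and ?H = "N \<inter> span \<gamma>"
  let ?e = "\<lambda>t. exp (2 * of_real pi * \<i> * of_real t) :: complex"
  have H: "add_subgroup ?H" using N_subgroup by (auto simp: add_subgroup_def span_zero span_diff)
  obtain F1 k1 where F1: "finite F1" "F1 \<subseteq> ?S" "a' = (\<lambda>x. \<Sum>u\<in>F1. k1 u * x u)"
    using a' unfolding monoid_algebra_def by blast
  obtain F2 k2 where F2: "finite F2" "F2 \<subseteq> ?S" "b' = (\<lambda>x. \<Sum>u\<in>F2. k2 u * x u)"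
    using b' unfolding monoid_algebra_def by blast
  define F where "F = F1 \<union> F2"
  define k l where "k u = (if u \<in> F1 then k1 u else 0)" and "l u = (if u \<in> F2 then k2 u else 0)" for u
  have F: "finite F" "F \<subseteq> ?S" using F1 F2 by (auto simp: F_def)
  have a'_eq: "a' x = (\<Sum>u\<in>F. k u * x u)" for x
    unfolding F1(3) F_def k_def using F1(1) F2(1) by (intro sum.mono_neutral_cong_left) auto
  have b'_eq: "b' x = (\<Sum>u\<in>F. l u * x u)" for x
    unfolding F2(3) F_def l_def using F1(1) F2(1) by (intro sum.mono_neutral_cong_left) auto
  \<comment> \<open>The character of the group by which the exponent \<open>u\<close> transforms,
    cut off outside \<open>?H\<close> as \<open>characters_independent\<close> demands.\<close>
  define ch where "ch u = (\<lambda>v. if v \<in> ?H then ?e (u \<bullet> v) else 0)" for u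
  define part where "part q \<kappa> x = (\<Sum>u\<in>{u \<in> F. ch u = \<kappa>}. q u * x u)" for q :: "'a \<Rightarrow> complex" and \<kappa> x
  have "b' x = (\<Sum>\<kappa>\<in>ch ` F. part l \<kappa> x)"
    unfolding b'_eq part_def by (rule sum.image_gen[OF F(1)])
  then obtain \<kappa> where \<kappa>: "\<kappa> \<in> ch ` F" "part l \<kappa> x \<noteq> 0" using x(2) by (metis sum.neutral)
  obtain u0 where u0: "u0 \<in> F" "\<kappa> = ch u0" using \<kappa>(1) by blast
  \<comment> \<open>\<open>c * b' - a'\<close> vanishes along the whole orbit of \<open>y\<close>;
    independence of the characters separates this into one equation per isotypic component.\<close>
  have proportional: "c * part l \<kappa> y = part k \<kappa> y"
    if c: "\<forall>v\<in>?H. c * b' (torus_rot v y) = a' (torus_rot v y)" for c y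
  proof -
    have "\<forall>\<kappa>\<in>ch ` F. c * part l \<kappa> y - part k \<kappa> y = 0"
    proof (rule characters_independent[OF _ H])
      show "finite (ch ` F)" using F(1) by simp
      show "\<psi> (v + w) = \<psi> v * \<psi> w" if "\<psi> \<in> ch ` F" "v \<in> ?H" "w \<in> ?H" for \<psi> v w
        using that add_subgroupD(4)[OF H that(2,3)]
        by (auto simp: ch_def inner_add_right exp_add distrib_left)
      show "\<psi> 0 = 1" if "\<psi> \<in> ch ` F" for \<psi> using that add_subgroupD(1)[OF H] by (auto simp: ch_def)
      show "\<psi> v = 0" if "\<psi> \<in> ch ` F" "v \<notin> ?H" for \<psi> v using that by (auto simp: ch_def)
      fix v assume v: "v \<in> ?H"
      have rot: "(\<Sum>u\<in>F. q u * torus_rot v y u) = (\<Sum>\<psi>\<in>ch ` F. part q \<psi> y * \<psi> v)" for q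
      proof -
        have "(\<Sum>u\<in>F. q u * torus_rot v y u) = (\<Sum>\<psi>\<in>ch ` F. \<Sum>u\<in>{u \<in> F. ch u = \<psi>}. q u * torus_rot v y u)"
          by (rule sum.image_gen[OF F(1)])
        also have "\<dots> = (\<Sum>\<psi>\<in>ch ` F. part q \<psi> y * \<psi> v)"
          unfolding part_def sum_distrib_right using v by (intro sum.cong refl) (auto simp: torus_rot_def ch_def)
        finally show ?thesis .
      qed
      have "(\<Sum>\<psi>\<in>ch ` F. (c * part l \<psi> y - part k \<psi> y) * \<psi> v) =
          c * (\<Sum>\<psi>\<in>ch ` F. part l \<psi> y * \<psi> v) - (\<Sum>\<psi>\<in>ch ` F. part k \<psi> y * \<psi> v)"
        by (simp add: sum_subtractf sum_distrib_left left_diff_distrib mult.assoc)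
      also have "\<dots> = 0" using c v unfolding rot[symmetric] a'_eq[symmetric] b'_eq[symmetric] by simp
      finally show "(\<Sum>\<psi>\<in>ch ` F. (c * part l \<psi> y - part k \<psi> y) * \<psi> v) = 0" .
    qed
    then have "c * part l \<kappa> y - part k \<kappa> y = 0" using \<kappa>(1) by blast
    then show ?thesis by simp
  qed
  obtain m :: nat where m: "m > 0" "\<And>v. v \<in> N \<Longrightarrow> v \<in> span \<gamma> \<Longrightarrow> real m *\<^sub>R v \<in> int_span (gens \<gamma>)"
    using exponent[OF \<gamma>] by metis
  define T where "T j = {u \<in> ?S. \<forall>v\<in>?H. ?e (u \<bullet> v) = \<kappa> v ^ j}" for j :: nat
  note mon = cone_monoid[OF commensurable_chart_dual[OF \<gamma>], where \<sigma> = \<gamma>]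
  have T: "0 \<in> T 0" "\<And>j. T j \<subseteq> ?S" using mon(1) by (auto simp: T_def)
  have T_add: "u + w \<in> T (Suc j)" if "u \<in> T j" "w \<in> T 1" for u w j
    using that mon(2)[of u w] by (auto simp: T_def inner_add_left exp_add distrib_left mult.commute)
  have part_in: "(\<lambda>x. part q \<kappa> x) \<in> monoid_algebra (T 1)" for q
  proof -
    have "{u \<in> F. ch u = \<kappa>} \<subseteq> T 1" using F(2) by (auto simp: T_def ch_def)
    moreover have "finite {u \<in> F. ch u = \<kappa>}" using F(1) by simp
    ultimately show ?thesis unfolding monoid_algebra_def part_def by blast
  qed
  \<comment> \<open>On \<open>N \<inter> span \<gamma>\<close> such an exponent agrees modulo
    integers with \<open>u0\<close> paired with \<open>m\<close> times the vector, which lies in the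
    chart lattice. On the complement it is integral anyway, so it belongs to
    \<open>M\<close>.\<close>
  have Tm: "T m \<subseteq> cone_mon \<gamma>"
  proof
    fix u assume u: "u \<in> T m"
    have "u \<bullet> v \<in> \<int>" if v: "v \<in> N" for v
    proof -
      obtain s c where sc: "s \<in> N" "s \<in> span \<gamma>" "c \<in> C \<gamma>" "v = s + c"
        using complement_subgroup(4)[OF \<gamma> v] by blast
      have "?e (u \<bullet> s) = \<kappa> s ^ m" using u sc(1,2) by (auto simp: T_def)
      also have "\<dots> = exp (of_nat m * (2 * of_real pi * \<i> * of_real (u0 \<bullet> s)))"
        using sc(1,2) unfolding u0(2) ch_def by (simp add: exp_of_nat_mult)
      also have "\<dots> = ?e (u0 \<bullet> (real m *\<^sub>R s))" by (simp add: mult_ac)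
      finally have "?e (u \<bullet> s) = ?e (u0 \<bullet> (real m *\<^sub>R s))" .
      then have "u \<bullet> s - u0 \<bullet> (real m *\<^sub>R s) \<in> \<int>" by (simp only: exp_2pi_i_eq_iff)
      moreover have "u0 \<bullet> (real m *\<^sub>R s) \<in> \<int>"
      proof -
        have "real m *\<^sub>R s \<in> chart_lattice N \<gamma> (C \<gamma>)" unfolding chart_lattice_def
          using m(2)[OF sc(1,2)] add_subgroupD(1)[OF complement_subgroup(1)[OF \<gamma>]]
          by (intro CollectI exI[of _ "real m *\<^sub>R s"] exI[of _ 0]) auto
        moreover have "u0 \<in> chart_dual \<gamma>" using u0(1) F(2) by blast
        ultimately show ?thesis unfolding dual_lattice_def by blast
      qed
      ultimately have "u \<bullet> s \<in> \<int>" using Ints_add by fastforce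
      moreover have "u \<bullet> c \<in> \<int>" using u sc(3) in_chart_dual_iff[OF \<gamma>] by (auto simp: T_def)
      ultimately show ?thesis by (simp add: sc(4) inner_add_right)
    qed
    then show "u \<in> cone_mon \<gamma>" using u by (auto simp: T_def dual_lattice_def)
  qed
  obtain b1 where b1: "b1 \<in> monoid_algebra (T (m - 1))" "\<forall>x\<in>monoid_points ?S. b1 x = part l \<kappa> x ^ (m - 1)"
    using monoid_algebra_power[OF part_in T T_add, of "m - 1"] by blast
  have T_Suc: "u + w \<in> T m" if "u \<in> T (m - 1)" "w \<in> T 1" for u w using T_add[OF that] m(1) by simp
  obtain a where a: "a \<in> monoid_algebra (T m)" "\<forall>x\<in>monoid_points ?S. a x = b1 x * part k \<kappa> x"
    using monoid_algebra_prod[OF b1(1) part_in T(2,2) T_Suc] by blast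
  obtain b where b: "b \<in> monoid_algebra (T m)" "\<forall>x\<in>monoid_points ?S. b x = b1 x * part l \<kappa> x"
    using monoid_algebra_prod[OF b1(1) part_in T(2,2) T_Suc] by blast
  have "a \<in> monoid_algebra (cone_mon \<gamma>)" "b \<in> monoid_algebra (cone_mon \<gamma>)"
    using a(1) b(1) monoid_algebra_mono[OF Tm] by auto
  moreover have "b x \<noteq> 0" using b(2) b1(2) x(1) \<kappa>(2) by simp
  moreover have "c * b y = a y" if "y \<in> monoid_points ?S"
    "\<forall>v\<in>?H. c * b' (torus_rot v y) = a' (torus_rot v y)" for c y
    using proportional[OF that(2)] a(2) b(2) that(1) by (metis mult.left_commute)
  ultimately show ?thesis by blast
qed

section \<open>Comparing a chart with its quotient\<close>

lemma monoid_algebra_restrict: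
  assumes "\<gamma> \<in> \<Xi>" "a \<in> monoid_algebra (cone_mon \<gamma>)"
  shows "a (restrict_point N \<gamma> x) = a x" "a \<in> monoid_algebra (chart_mon \<gamma>)"
proof -
  obtain F k where "F \<subseteq> cone_mon \<gamma>" "a = (\<lambda>x. \<Sum>u\<in>F. k u * x u)"
    using assms(2) unfolding monoid_algebra_def by blast
  then show "a (restrict_point N \<gamma> x) = a x" by (auto simp: restrict_point_def intro!: sum.cong)
  show "a \<in> monoid_algebra (chart_mon \<gamma>)"
    using monoid_algebra_mono[OF chart_mon_supset[OF assms(1)]] assms(2) by blast
qed

lemma restrict_point_in:
  assumes "\<gamma> \<in> \<Xi>" "x \<in> monoid_points (chart_mon \<gamma>)"
  shows "restrict_point N \<gamma> x \<in> monoid_points (cone_mon \<gamma>)"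
proof -
  obtain \<tau> l where "\<tau> \<in> \<Xi>" "\<tau> \<subseteq> \<gamma>" "linear l" "x = orbit_point (chart_mon \<gamma>) \<tau> l"
    by (rule chart_point_form[OF assms])
  then show ?thesis
    using restrict_orbit_point[OF chart_mon_supset[OF assms(1)]] orbit_point_in[OF commensurable_M] by simp
qed

lemma restrict_point_lift:
  assumes "\<gamma> \<in> \<Xi>" "y \<in> monoid_points (cone_mon \<gamma>)"
  obtains x where "x \<in> monoid_points (chart_mon \<gamma>)" "restrict_point N \<gamma> x = y"
proof -
  obtain \<tau> l where *: "\<tau> \<in> \<Xi>" "\<tau> \<subseteq> \<gamma>" "linear l" "y = orbit_point (cone_mon \<gamma>) \<tau> l"
    by (rule monoid_point_form[OF commensurable_M assms])
  show ?thesis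
    by (rule that[OF chart_orbit_point_in[OF assms(1) *(2,3)]])
      (simp add: restrict_orbit_point[OF chart_mon_supset[OF assms(1)]] *(4))
qed

lemma cover_proj_rot:
  assumes "v \<in> N"
  shows "cover_proj \<gamma> (torus_rot v x) = cover_proj \<gamma> x"
proof -
  have "restrict_point N \<gamma> (torus_rot v x) = restrict_point N \<gamma> x"
  proof
    fix u
    show "restrict_point N \<gamma> (torus_rot v x) u = restrict_point N \<gamma> x u"
    proof (cases "u \<in> cone_mon \<gamma>")
      case True
      then have "u \<bullet> v - 0 \<in> \<int>" using assms by (auto simp: dual_lattice_def)
      then have "exp (2 * of_real pi * \<i> * of_real (u \<bullet> v)) = (1::complex)"
        using exp_2pi_i_eq_iff[of "u \<bullet> v" 0] by simp
      then show ?thesis using True by (simp add: restrict_point_def torus_rot_def)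
    qed (auto simp: restrict_point_def)
  qed
  then show ?thesis by (simp add: cover_proj_def)
qed

lemma rel_open_cover_iff:
  assumes \<gamma>: "\<gamma> \<in> \<Xi>"
  shows "rel_open (chart_mon \<gamma>) (cover_proj \<gamma>) Y U \<longleftrightarrow> rel_open (cone_mon \<gamma>) (base_proj \<gamma>) Y U"
proof
  assume R: "rel_open (chart_mon \<gamma>) (cover_proj \<gamma>) Y U"
  show "rel_open (cone_mon \<gamma>) (base_proj \<gamma>) Y U" unfolding rel_open_def
  proof (intro ballI impI)
    fix x0 assume x0: "x0 \<in> monoid_points (cone_mon \<gamma>)" "base_proj \<gamma> x0 \<in> U"
    obtain x where x: "x \<in> monoid_points (chart_mon \<gamma>)" "restrict_point N \<gamma> x = x0"
      by (rule restrict_point_lift[OF \<gamma> x0(1)])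
    obtain b' where b': "b' \<in> monoid_algebra (chart_mon \<gamma>)" "b' x \<noteq> 0"
      "\<And>y. y \<in> monoid_points (chart_mon \<gamma>) \<Longrightarrow> cover_proj \<gamma> y \<in> Y \<Longrightarrow> b' y \<noteq> 0 \<Longrightarrow> cover_proj \<gamma> y \<in> U"
      using R x x0(2) unfolding rel_open_def cover_proj_def by blast
    \<comment> \<open>The descent is applied to the pair \<open>0\<close>, \<open>b'\<close>. Where
      \<open>b'\<close> vanishes on a whole orbit, the conclusion holds for both
      \<open>c = 0\<close> and \<open>c = 1\<close>, which forces \<open>b\<close> to vanish as
      well.\<close>
    have z: "(\<lambda>_. 0) \<in> monoid_algebra (chart_mon \<gamma>)"
      unfolding monoid_algebra_def by (intro CollectI exI[of _ "{}"]) auto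
    obtain a b where ab: "b \<in> monoid_algebra (cone_mon \<gamma>)" "b x \<noteq> 0"
      "\<And>c y. y \<in> monoid_points (chart_mon \<gamma>) \<Longrightarrow> (\<forall>v\<in>N \<inter> span \<gamma>. c * b' (torus_rot v y) = 0) \<Longrightarrow> c * b y = a y"
      using isotypic_descent[OF \<gamma> z b'(1) x(1) b'(2)] by blast
    have "base_proj \<gamma> y0 \<in> U" if y0: "y0 \<in> monoid_points (cone_mon \<gamma>)" "base_proj \<gamma> y0 \<in> Y" "b y0 \<noteq> 0" for y0
    proof -
      obtain y where y: "y \<in> monoid_points (chart_mon \<gamma>)" "restrict_point N \<gamma> y = y0"
        by (rule restrict_point_lift[OF \<gamma> y0(1)])
      have by0: "b y \<noteq> 0" using monoid_algebra_restrict(1)[OF \<gamma> ab(1), of y] y y0(3) by simp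
      have "\<exists>v\<in>N \<inter> span \<gamma>. b' (torus_rot v y) \<noteq> 0"
      proof (rule ccontr)
        assume "\<not> ?thesis"
        then have "1 * b y = a y" "0 * b y = a y" using ab(3)[OF y(1), of 1] ab(3)[OF y(1), of 0] by simp_all
        then show False using by0 by simp
      qed
      then obtain v where v: "v \<in> N" "b' (torus_rot v y) \<noteq> 0" by blast
      have "cover_proj \<gamma> (torus_rot v y) \<in> U"
        using b'(3)[OF torus_rot_in[OF y(1)] _ v(2)] cover_proj_rot[OF v(1)] y(2) y0(2) by (simp add: cover_proj_def)
      then show ?thesis using cover_proj_rot[OF v(1)] y(2) by (simp add: cover_proj_def)
    qed
    moreover have "b x0 \<noteq> 0" using monoid_algebra_restrict(1)[OF \<gamma> ab(1), of x] x(2) ab(2) by simp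
    ultimately show "\<exists>a\<in>monoid_algebra (cone_mon \<gamma>). a x0 \<noteq> 0 \<and>
        (\<forall>y\<in>monoid_points (cone_mon \<gamma>). base_proj \<gamma> y \<in> Y \<and> a y \<noteq> 0 \<longrightarrow> base_proj \<gamma> y \<in> U)"
      using ab(1) by blast
  qed
next
  assume R: "rel_open (cone_mon \<gamma>) (base_proj \<gamma>) Y U"
  show "rel_open (chart_mon \<gamma>) (cover_proj \<gamma>) Y U" unfolding rel_open_def
  proof (intro ballI impI)
    fix x assume x: "x \<in> monoid_points (chart_mon \<gamma>)" "cover_proj \<gamma> x \<in> U"
    obtain a where a: "a \<in> monoid_algebra (cone_mon \<gamma>)" "a (restrict_point N \<gamma> x) \<noteq> 0"
      "\<And>y. y \<in> monoid_points (cone_mon \<gamma>) \<Longrightarrow> base_proj \<gamma> y \<in> Y \<Longrightarrow> a y \<noteq> 0 \<Longrightarrow> base_proj \<gamma> y \<in> U"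
      using R x(2) restrict_point_in[OF \<gamma> x(1)] unfolding rel_open_def cover_proj_def by blast
    show "\<exists>a\<in>monoid_algebra (chart_mon \<gamma>). a x \<noteq> 0 \<and>
        (\<forall>y\<in>monoid_points (chart_mon \<gamma>). cover_proj \<gamma> y \<in> Y \<and> a y \<noteq> 0 \<longrightarrow> cover_proj \<gamma> y \<in> U)"
      using a monoid_algebra_restrict[OF \<gamma> a(1)] restrict_point_in[OF \<gamma>]
      by (intro bexI[of _ a]) (auto simp: cover_proj_def)
  qed
qed

lemma rel_regular_cover_iff:
  assumes \<gamma>: "\<gamma> \<in> \<Xi>"
  shows "rel_regular (chart_mon \<gamma>) (cover_proj \<gamma>) U f \<longleftrightarrow> rel_regular (cone_mon \<gamma>) (base_proj \<gamma>) U f"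
proof
  assume R: "rel_regular (chart_mon \<gamma>) (cover_proj \<gamma>) U f"
  show "rel_regular (cone_mon \<gamma>) (base_proj \<gamma>) U f" unfolding rel_regular_def
  proof (intro ballI impI)
    fix x0 assume x0: "x0 \<in> monoid_points (cone_mon \<gamma>)" "base_proj \<gamma> x0 \<in> U"
    obtain x where x: "x \<in> monoid_points (chart_mon \<gamma>)" "restrict_point N \<gamma> x = x0"
      by (rule restrict_point_lift[OF \<gamma> x0(1)])
    obtain a' b' where ab': "a' \<in> monoid_algebra (chart_mon \<gamma>)" "b' \<in> monoid_algebra (chart_mon \<gamma>)" "b' x \<noteq> 0"
      "\<And>y. y \<in> monoid_points (chart_mon \<gamma>) \<Longrightarrow> cover_proj \<gamma> y \<in> U \<Longrightarrow> f (cover_proj \<gamma> y) * b' y = a' y"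
      using R x x0(2) unfolding rel_regular_def cover_proj_def by blast
    obtain a b where ab: "a \<in> monoid_algebra (cone_mon \<gamma>)" "b \<in> monoid_algebra (cone_mon \<gamma>)" "b x \<noteq> 0"
      "\<And>c y. y \<in> monoid_points (chart_mon \<gamma>) \<Longrightarrow>
        (\<forall>v\<in>N \<inter> span \<gamma>. c * b' (torus_rot v y) = a' (torus_rot v y)) \<Longrightarrow> c * b y = a y"
      using isotypic_descent[OF \<gamma> ab'(1,2) x(1) ab'(3)] by blast
    have "f (base_proj \<gamma> y0) * b y0 = a y0" if y0: "y0 \<in> monoid_points (cone_mon \<gamma>)" "base_proj \<gamma> y0 \<in> U" for y0
    proof -
      obtain y where y: "y \<in> monoid_points (chart_mon \<gamma>)" "restrict_point N \<gamma> y = y0"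
        by (rule restrict_point_lift[OF \<gamma> y0(1)])
      have yp: "cover_proj \<gamma> y = base_proj \<gamma> y0" using y(2) by (simp add: cover_proj_def)
      \<comment> \<open>The constant fed to the descent is the value of \<open>f\<close> at the
        common image point, the same along the whole orbit.\<close>
      have "f (base_proj \<gamma> y0) * b' (torus_rot v y) = a' (torus_rot v y)" if v: "v \<in> N \<inter> span \<gamma>" for v
        using ab'(4)[OF torus_rot_in[OF y(1)], of v] cover_proj_rot[of v \<gamma> y] v yp y0(2) by simp
      then have "f (base_proj \<gamma> y0) * b y = a y" using ab(4)[OF y(1)] by blast
      then show ?thesis
        using monoid_algebra_restrict(1)[OF \<gamma> ab(1), of y] monoid_algebra_restrict(1)[OF \<gamma> ab(2), of y] y(2) by simp
    qed
    moreover have "b x0 \<noteq> 0" using monoid_algebra_restrict(1)[OF \<gamma> ab(2), of x] x(2) ab(3) by simp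
    ultimately show "\<exists>a\<in>monoid_algebra (cone_mon \<gamma>). \<exists>b\<in>monoid_algebra (cone_mon \<gamma>). b x0 \<noteq> 0 \<and>
        (\<forall>y\<in>monoid_points (cone_mon \<gamma>). base_proj \<gamma> y \<in> U \<longrightarrow> f (base_proj \<gamma> y) * b y = a y)"
      using ab(1,2) by blast
  qed
next
  assume R: "rel_regular (cone_mon \<gamma>) (base_proj \<gamma>) U f"
  show "rel_regular (chart_mon \<gamma>) (cover_proj \<gamma>) U f" unfolding rel_regular_def
  proof (intro ballI impI)
    fix x assume x: "x \<in> monoid_points (chart_mon \<gamma>)" "cover_proj \<gamma> x \<in> U"
    obtain a b where ab: "a \<in> monoid_algebra (cone_mon \<gamma>)" "b \<in> monoid_algebra (cone_mon \<gamma>)"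
      "b (restrict_point N \<gamma> x) \<noteq> 0"
      "\<And>y. y \<in> monoid_points (cone_mon \<gamma>) \<Longrightarrow> base_proj \<gamma> y \<in> U \<Longrightarrow> f (base_proj \<gamma> y) * b y = a y"
      using R x(2) restrict_point_in[OF \<gamma> x(1)] unfolding rel_regular_def cover_proj_def by blast
    have "f (cover_proj \<gamma> y) * b y = a y" if "y \<in> monoid_points (chart_mon \<gamma>)" "cover_proj \<gamma> y \<in> U" for y
      using ab(4)[OF restrict_point_in[OF \<gamma> that(1)]] that(2)
        monoid_algebra_restrict(1)[OF \<gamma> ab(1), of y] monoid_algebra_restrict(1)[OF \<gamma> ab(2), of y]
      by (simp add: cover_proj_def)
    then show "\<exists>a\<in>monoid_algebra (chart_mon \<gamma>). \<exists>b\<in>monoid_algebra (chart_mon \<gamma>). b x \<noteq> 0 \<and>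
        (\<forall>y\<in>monoid_points (chart_mon \<gamma>). cover_proj \<gamma> y \<in> U \<longrightarrow> f (cover_proj \<gamma> y) * b y = a y)"
      using ab(3) monoid_algebra_restrict[OF \<gamma> ab(1)] monoid_algebra_restrict[OF \<gamma> ab(2)]
      by (intro bexI[of _ a] bexI[of _ b]) auto
  qed
qed

text \<open>The character \<open>s\<close> of \<open>U\<^sub>\<sigma>\<close> vanishes exactly off \<open>U\<^sub>\<sigma> \<inter> U\<^sub>\<gamma>\<close> and clears the denominators of \<open>a\<close> and \<open>b\<close>.\<close>

lemma transfer_functions:
  assumes \<sigma>: "\<sigma> \<in> \<Xi>" and \<gamma>: "\<gamma> \<in> \<Xi>"
    and a: "a \<in> monoid_algebra (cone_mon \<gamma>)" and b: "b \<in> monoid_algebra (cone_mon \<gamma>)"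
  shows "\<exists>s\<in>cone_mon \<sigma>. \<exists>a'\<in>monoid_algebra (cone_mon \<sigma>). \<exists>b'\<in>monoid_algebra (cone_mon \<sigma>).
    (\<forall>\<tau>\<in>\<Xi>. \<tau> \<subseteq> \<sigma> \<longrightarrow> (s \<in> perp \<tau> \<longleftrightarrow> \<tau> \<subseteq> \<gamma>)) \<and>
    (\<forall>\<tau>\<in>\<Xi>. \<forall>l. \<tau> \<subseteq> \<sigma> \<longrightarrow> \<tau> \<subseteq> \<gamma> \<longrightarrow> linear l \<longrightarrow>
       a' (orbit_point (cone_mon \<sigma>) \<tau> l) = exp (l s) * a (orbit_point (cone_mon \<gamma>) \<tau> l) \<and>
       b' (orbit_point (cone_mon \<sigma>) \<tau> l) = exp (l s) * b (orbit_point (cone_mon \<gamma>) \<tau> l))"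
proof -
  let ?\<rho> = "\<sigma> \<inter> \<gamma>"
  have \<rho>: "?\<rho> \<in> \<Xi>" using Int_in_fan[OF \<sigma> \<gamma>] .
  obtain u0 where u0: "u0 \<in> cone_mon \<sigma>" "u0 \<in> perp ?\<rho>" "\<And>g. g \<in> gens \<sigma> \<Longrightarrow> g \<notin> gens ?\<rho> \<Longrightarrow> u0 \<bullet> g \<ge> 1"
    "\<And>u. u \<in> dual_cone ?\<rho> \<Longrightarrow> \<exists>k0. \<forall>k\<ge>k0. u + real k *\<^sub>R u0 \<in> dual_cone \<sigma>"
    using face_character[OF \<sigma> \<rho> Int_lower1] by metis
  obtain F1 k1 where F1: "finite F1" "F1 \<subseteq> cone_mon \<gamma>" "a = (\<lambda>x. \<Sum>u\<in>F1. k1 u * x u)"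
    using a unfolding monoid_algebra_def by blast
  obtain F2 k2 where F2: "finite F2" "F2 \<subseteq> cone_mon \<gamma>" "b = (\<lambda>x. \<Sum>u\<in>F2. k2 u * x u)"
    using b unfolding monoid_algebra_def by blast
  have F\<rho>: "u \<in> dual_cone ?\<rho>" if "u \<in> F1 \<union> F2" for u
    using that F1(2) F2(2) dual_cone_antimono[of ?\<rho> \<gamma>] by blast
  obtain K where K: "\<And>u k. u \<in> F1 \<union> F2 \<Longrightarrow> K u \<le> k \<Longrightarrow> u + real k *\<^sub>R u0 \<in> dual_cone \<sigma>"
    using u0(4)[OF F\<rho>] by metis
  \<comment> \<open>The sum dominates every bound \<open>K u\<close>; the successor makes
    \<open>n\<close> positive, so that \<open>s\<close> and \<open>u0\<close> are orthogonal to the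
    same faces.\<close>
  define n where "n = Suc (\<Sum>u\<in>F1 \<union> F2. K u)"
  define s where "s = real n *\<^sub>R u0"
  have Kn: "K u \<le> n" if "u \<in> F1 \<union> F2" for u
    using that F1(1) F2(1) member_le_sum[of u "F1 \<union> F2" K] by (simp add: n_def)
  have sM: "s \<in> M" unfolding s_def using add_subgroup_scale_nat[OF dual_lattice_subgroup] u0(1) by blast
  have s\<sigma>: "s \<in> cone_mon \<sigma>" using u0(1) sM by (auto simp: s_def dual_cone_def)
  have us: "u + s \<in> cone_mon \<sigma>" if u: "u \<in> F1 \<union> F2" for u
  proof -
    have "u \<in> M" using u F1(2) F2(2) by blast
    then show ?thesis using K[OF u Kn[OF u]] sM add_subgroupD(4)[OF dual_lattice_subgroup] by (simp add: s_def)
  qed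
  have s_perp: "s \<in> perp \<tau> \<longleftrightarrow> \<tau> \<subseteq> \<gamma>" if \<tau>: "\<tau> \<in> \<Xi>" "\<tau> \<subseteq> \<sigma>" for \<tau>
  proof
    assume s: "s \<in> perp \<tau>"
    have "gens \<tau> \<subseteq> gens ?\<rho>"
    proof
      fix g assume g: "g \<in> gens \<tau>"
      have "s \<bullet> g = 0" using s g perp_iff_gens[OF \<tau>(1)] by blast
      moreover have "n \<noteq> 0" by (simp add: n_def)
      ultimately have "u0 \<bullet> g = 0" by (simp add: s_def)
      then show "g \<in> gens ?\<rho>" using u0(3)[OF gens_face_in[OF \<tau>(1) \<sigma> \<tau>(2) g]] by force
    qed
    then show "\<tau> \<subseteq> \<gamma>" using subset_iff_gens[OF \<tau>(1) \<rho>] by blast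
  next
    assume "\<tau> \<subseteq> \<gamma>"
    then have "perp ?\<rho> \<subseteq> perp \<tau>" using \<tau>(2) by (intro perp_antimono) blast
    then have "u0 \<in> perp \<tau>" using u0(2) by blast
    then show "s \<in> perp \<tau>" by (auto simp: perp_def s_def)
  qed
  have shift: "\<exists>a'\<in>monoid_algebra (cone_mon \<sigma>). \<forall>\<tau>\<in>\<Xi>. \<forall>l. \<tau> \<subseteq> \<sigma> \<longrightarrow> \<tau> \<subseteq> \<gamma> \<longrightarrow> linear l \<longrightarrow>
      a' (orbit_point (cone_mon \<sigma>) \<tau> l) = exp (l s) * (\<Sum>u\<in>F. k u * orbit_point (cone_mon \<gamma>) \<tau> l u)"
    if F: "finite F" "F \<subseteq> F1 \<union> F2" for F and k :: "'a \<Rightarrow> complex"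
  proof (intro bexI[of _ "\<lambda>x. \<Sum>u\<in>(\<lambda>u. u + s) ` F. k (u - s) * x u"] ballI allI impI)
    show "(\<lambda>x. \<Sum>u\<in>(\<lambda>u. u + s) ` F. k (u - s) * x u) \<in> monoid_algebra (cone_mon \<sigma>)"
      unfolding monoid_algebra_def
      by (intro CollectI exI[of _ "(\<lambda>u. u + s) ` F"] exI[of _ "\<lambda>u. k (u - s)"]) (use F us in auto)
    fix \<tau> and l :: "'a \<Rightarrow> complex" assume \<tau>: "\<tau> \<in> \<Xi>" "\<tau> \<subseteq> \<sigma>" "\<tau> \<subseteq> \<gamma>" and l: "linear l"
    have "(\<Sum>u\<in>(\<lambda>u. u + s) ` F. k (u - s) * orbit_point (cone_mon \<sigma>) \<tau> l u) =
        (\<Sum>u\<in>F. k u * orbit_point (cone_mon \<sigma>) \<tau> l (u + s))"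
      by (subst sum.reindex) (auto simp: inj_on_def)
    also have "\<dots> = (\<Sum>u\<in>F. exp (l s) * (k u * orbit_point (cone_mon \<gamma>) \<tau> l u))"
    proof (rule sum.cong[OF refl])
      fix u assume u: "u \<in> F"
      have sp: "s \<in> perp \<tau>" using s_perp[OF \<tau>(1,2)] \<tau>(3) by blast
      have "u + s \<in> perp \<tau> \<longleftrightarrow> u \<in> perp \<tau>" using sp by (auto simp: perp_def inner_add_left)
      moreover have "u + s \<in> cone_mon \<sigma>" "u \<in> cone_mon \<gamma>" using us u F(2) F1(2) F2(2) by blast+
      ultimately show "k u * orbit_point (cone_mon \<sigma>) \<tau> l (u + s) =
          exp (l s) * (k u * orbit_point (cone_mon \<gamma>) \<tau> l u)"
        by (simp add: orbit_point_def linear_add[OF l] exp_add)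
    qed
    also have "\<dots> = exp (l s) * (\<Sum>u\<in>F. k u * orbit_point (cone_mon \<gamma>) \<tau> l u)" by (simp add: sum_distrib_left)
    finally show "(\<Sum>u\<in>(\<lambda>u. u + s) ` F. k (u - s) * orbit_point (cone_mon \<sigma>) \<tau> l u) =
        exp (l s) * (\<Sum>u\<in>F. k u * orbit_point (cone_mon \<gamma>) \<tau> l u)" .
  qed
  obtain a' where a': "a' \<in> monoid_algebra (cone_mon \<sigma>)" "\<forall>\<tau>\<in>\<Xi>. \<forall>l. \<tau> \<subseteq> \<sigma> \<longrightarrow> \<tau> \<subseteq> \<gamma> \<longrightarrow> linear l \<longrightarrow>
      a' (orbit_point (cone_mon \<sigma>) \<tau> l) = exp (l s) * a (orbit_point (cone_mon \<gamma>) \<tau> l)"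
    using shift[OF F1(1) Un_upper1, of k1] unfolding F1(3) by blast
  obtain b' where b': "b' \<in> monoid_algebra (cone_mon \<sigma>)" "\<forall>\<tau>\<in>\<Xi>. \<forall>l. \<tau> \<subseteq> \<sigma> \<longrightarrow> \<tau> \<subseteq> \<gamma> \<longrightarrow> linear l \<longrightarrow>
      b' (orbit_point (cone_mon \<sigma>) \<tau> l) = exp (l s) * b (orbit_point (cone_mon \<gamma>) \<tau> l)"
    using shift[OF F2(1) Un_upper2, of k2] unfolding F2(3) by blast
  show ?thesis
  proof (rule bexI[OF _ s\<sigma>], rule bexI[OF _ a'(1)], rule bexI[OF _ b'(1)], intro conjI ballI allI impI)
    show "s \<in> perp \<tau> \<longleftrightarrow> \<tau> \<subseteq> \<gamma>" if "\<tau> \<in> \<Xi>" "\<tau> \<subseteq> \<sigma>" for \<tau> using s_perp that .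
    fix \<tau> and l :: "'a \<Rightarrow> complex" assume *: "\<tau> \<in> \<Xi>" "\<tau> \<subseteq> \<sigma>" "\<tau> \<subseteq> \<gamma>" "linear l"
    show "a' (orbit_point (cone_mon \<sigma>) \<tau> l) = exp (l s) * a (orbit_point (cone_mon \<gamma>) \<tau> l)"
      by (rule a'(2)[rule_format, OF *])
    show "b' (orbit_point (cone_mon \<sigma>) \<tau> l) = exp (l s) * b (orbit_point (cone_mon \<gamma>) \<tau> l)"
      by (rule b'(2)[rule_format, OF *])
  qed
qed

section \<open>Structure sheaves of the toric variety and of an orbit closure\<close>

lemma pt_in_orbit_closure_iff:
  assumes "\<tau> \<in> \<Xi>" "\<gamma> \<in> \<Xi>" "linear l"
  shows "pt \<gamma> l \<in> orbit_closure N \<Xi> \<tau> \<longleftrightarrow> \<tau> \<subseteq> \<gamma>"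
proof
  assume "pt \<gamma> l \<in> orbit_closure N \<Xi> \<tau>"
  then obtain \<gamma>' l' where *: "\<gamma>' \<in> \<Xi>" "\<tau> \<subseteq> \<gamma>'" "linear l'" "pt \<gamma> l = pt \<gamma>' l'"
    unfolding orbit_closure_eq[OF assms(1)] by blast
  then show "\<tau> \<subseteq> \<gamma>" using pt_eq_iff[OF assms(2) *(1) assms(3) *(3)] by simp
qed (use assms orbit_closure_eq[OF assms(1)] in blast)

lemma base_point_form:
  assumes "\<sigma> \<in> \<Xi>" "y \<in> monoid_points (cone_mon \<sigma>)"
  obtains \<tau> l where "\<tau> \<in> \<Xi>" "\<tau> \<subseteq> \<sigma>" "linear l" "y = orbit_point (cone_mon \<sigma>) \<tau> l" "base_proj \<sigma> y = pt \<tau> l"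
proof -
  obtain \<tau> l where "\<tau> \<in> \<Xi>" "\<tau> \<subseteq> \<sigma>" "linear l" "y = orbit_point (cone_mon \<sigma>) \<tau> l"
    by (rule monoid_point_form[OF commensurable_M assms])
  then show ?thesis using that toric_class_orbit_point[OF assms(1)] by blast
qed

lemma base_proj_in: "\<sigma> \<in> \<Xi> \<Longrightarrow> y \<in> monoid_points (cone_mon \<sigma>) \<Longrightarrow> base_proj \<sigma> y \<in> toric_points N \<Xi>"
  unfolding toric_points_eq by (erule (1) base_point_form) blast

lemma openin_toric_variety:
  "openin (zariski (toric_variety N \<Xi>)) T \<longleftrightarrow>
    T \<subseteq> toric_points N \<Xi> \<and> (\<forall>\<sigma>\<in>\<Xi>. rel_open (cone_mon \<sigma>) (base_proj \<sigma>) UNIV T)"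
proof -
  have "openin (zariski (affine_toric N \<sigma>)) {y \<in> pts (affine_toric N \<sigma>). base_proj \<sigma> y \<in> T} \<longleftrightarrow>
      rel_open (cone_mon \<sigma>) (base_proj \<sigma>) UNIV T" for \<sigma>
    unfolding pts_affine_toric unfolding affine_toric_N
      openin_affine_fspace[OF mult_system_cone[OF commensurable_M]] rel_open_def by auto
  then show ?thesis unfolding toric_variety_def openin_final_fspace by simp
qed

lemma regular_toric_variety:
  assumes "openin (zariski (toric_variety N \<Xi>)) T"
  shows "regular (toric_variety N \<Xi>) T g \<longleftrightarrow> (\<forall>\<sigma>\<in>\<Xi>. rel_regular (cone_mon \<sigma>) (base_proj \<sigma>) T g)"
proof -
  have "regular (affine_toric N \<sigma>) {y \<in> pts (affine_toric N \<sigma>). base_proj \<sigma> y \<in> T} (g \<circ> base_proj \<sigma>) \<longleftrightarrow>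
      rel_regular (cone_mon \<sigma>) (base_proj \<sigma>) T g" if \<sigma>: "\<sigma> \<in> \<Xi>" for \<sigma>
  proof -
    have "openin (zariski (affine_toric N \<sigma>)) {y \<in> pts (affine_toric N \<sigma>). base_proj \<sigma> y \<in> T}"
      using assms \<sigma> unfolding toric_variety_def openin_final_fspace by blast
    note op = this[unfolded pts_affine_toric, unfolded affine_toric_N]
    show ?thesis unfolding pts_affine_toric
      unfolding affine_toric_N rel_regular_def regular_affine_fspace[OF mult_system_cone[OF commensurable_M] op]
      by (simp add: Ball_def imp_conjL)
  qed
  moreover have "regular (toric_variety N \<Xi>) T g \<longleftrightarrow> (\<forall>\<sigma>\<in>\<Xi>. regular (affine_toric N \<sigma>)
      {y \<in> pts (affine_toric N \<sigma>). base_proj \<sigma> y \<in> T} (g \<circ> base_proj \<sigma>))"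
    by (simp add: toric_variety_def final_fspace_def)
  ultimately show ?thesis by simp
qed

lemma rel_open_self: "rel_open S \<pi> Y Y" if "0 \<in> S"
  unfolding rel_open_def
  using monoid_algebra_character[OF that] by (intro ballI impI bexI[of _ "\<lambda>x. x 0"]) (auto simp: monoid_points_def)

lemma openin_orbit_closure:
  assumes \<tau>: "\<tau> \<in> \<Xi>"
  shows "openin (zariski (orbit_closure_variety N \<Xi> \<tau>)) U \<longleftrightarrow> U \<subseteq> orbit_closure N \<Xi> \<tau> \<and>
    (\<forall>\<gamma>\<in>\<Xi>. \<tau> \<subseteq> \<gamma> \<longrightarrow> rel_open (cone_mon \<gamma>) (base_proj \<gamma>) (orbit_closure N \<Xi> \<tau>) U)" (is "_ \<longleftrightarrow> ?R")
proof -
  let ?O = "orbit_closure N \<Xi> \<tau>"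
  have sub: "openin (zariski (orbit_closure_variety N \<Xi> \<tau>)) U \<longleftrightarrow>
      (\<exists>T. openin (zariski (toric_variety N \<Xi>)) T \<and> U = T \<inter> ?O)"
    by (simp add: orbit_closure_variety_def subfspace_def openin_subtopology)
  show ?thesis
  proof
    assume "openin (zariski (orbit_closure_variety N \<Xi> \<tau>)) U"
    then obtain T where T: "\<forall>\<sigma>\<in>\<Xi>. rel_open (cone_mon \<sigma>) (base_proj \<sigma>) UNIV T" "U = T \<inter> ?O"
      unfolding sub openin_toric_variety by blast
    show ?R
    proof (intro conjI ballI impI)
      show "U \<subseteq> ?O" using T(2) by blast
      fix \<gamma> assume "\<gamma> \<in> \<Xi>" "\<tau> \<subseteq> \<gamma>"
      then show "rel_open (cone_mon \<gamma>) (base_proj \<gamma>) ?O U" using T unfolding rel_open_def by (metis IntD1 IntI UNIV_I)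
    qed
  next
    assume R: ?R
    \<comment> \<open>The complement of the closure is added to extend \<open>U\<close> to the whole
      variety; that the result is open includes that the closure is closed.\<close>
    define T where "T = U \<union> (toric_points N \<Xi> - ?O)"
    have Opts: "?O \<subseteq> toric_points N \<Xi>" unfolding orbit_closure_eq[OF \<tau>] toric_points_eq by blast
    have "rel_open (cone_mon \<sigma>) (base_proj \<sigma>) UNIV T" if \<sigma>: "\<sigma> \<in> \<Xi>" for \<sigma>
      unfolding rel_open_def
    proof (intro ballI impI)
      fix x assume x: "x \<in> monoid_points (cone_mon \<sigma>)" "base_proj \<sigma> x \<in> T"
      obtain \<tau>1 l1 where x1: "\<tau>1 \<in> \<Xi>" "\<tau>1 \<subseteq> \<sigma>" "linear l1" "x = orbit_point (cone_mon \<sigma>) \<tau>1 l1"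
        "base_proj \<sigma> x = pt \<tau>1 l1" by (rule base_point_form[OF \<sigma> x(1)])
      show "\<exists>a\<in>monoid_algebra (cone_mon \<sigma>). a x \<noteq> 0 \<and>
          (\<forall>y\<in>monoid_points (cone_mon \<sigma>). base_proj \<sigma> y \<in> UNIV \<and> a y \<noteq> 0 \<longrightarrow> base_proj \<sigma> y \<in> T)"
      proof (cases "base_proj \<sigma> x \<in> ?O")
        case True
        then have "\<tau> \<subseteq> \<sigma>" using pt_in_orbit_closure_iff[OF \<tau> x1(1,3)] x1(2,5) by auto
        moreover have "base_proj \<sigma> x \<in> U" using True x(2) by (simp add: T_def)
        ultimately obtain a where a: "a \<in> monoid_algebra (cone_mon \<sigma>)" "a x \<noteq> 0"
          "\<forall>y\<in>monoid_points (cone_mon \<sigma>). base_proj \<sigma> y \<in> ?O \<and> a y \<noteq> 0 \<longrightarrow> base_proj \<sigma> y \<in> U"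
          using R \<sigma> x(1) unfolding rel_open_def by blast
        then show ?thesis using base_proj_in[OF \<sigma>] unfolding T_def by blast
      next
        case False
        then have n: "\<not> \<tau> \<subseteq> \<tau>1" using pt_in_orbit_closure_iff[OF \<tau> x1(1,3)] x1(5) by auto
        \<comment> \<open>The locus where \<open>u0\<close> does not vanish consists of the orbits
          of faces of \<open>\<tau>1\<close>, and none of these contains \<tau>.\<close>
        obtain u0 where u0: "u0 \<in> cone_mon \<sigma>" "u0 \<in> perp \<tau>1"
          "\<And>g. g \<in> gens \<sigma> \<Longrightarrow> g \<notin> gens \<tau>1 \<Longrightarrow> u0 \<bullet> g \<ge> 1" using face_character[OF \<sigma> x1(1,2)] by metis
        have "base_proj \<sigma> y \<in> T" if y: "y \<in> monoid_points (cone_mon \<sigma>)" "y u0 \<noteq> 0" for y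
        proof -
          obtain \<tau>2 l2 where y2: "\<tau>2 \<in> \<Xi>" "\<tau>2 \<subseteq> \<sigma>" "linear l2" "y = orbit_point (cone_mon \<sigma>) \<tau>2 l2"
            "base_proj \<sigma> y = pt \<tau>2 l2" by (rule base_point_form[OF \<sigma> y(1)])
          have "u0 \<in> perp \<tau>2" using y(2) y2(4) by (auto simp: orbit_point_def split: if_splits)
          have "gens \<tau>2 \<subseteq> gens \<tau>1"
          proof
            fix g assume g: "g \<in> gens \<tau>2"
            then have "u0 \<bullet> g = 0" using \<open>u0 \<in> perp \<tau>2\<close> perp_iff_gens[OF y2(1)] by blast
            then show "g \<in> gens \<tau>1" using u0(3)[OF gens_face_in[OF y2(1) \<sigma> y2(2) g]] by force
          qed
          then have "\<not> \<tau> \<subseteq> \<tau>2" using n subset_iff_gens[OF y2(1) x1(1)] by blast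
          then have "base_proj \<sigma> y \<notin> ?O" using pt_in_orbit_closure_iff[OF \<tau> y2(1,3)] y2(5) by simp
          then show ?thesis using base_proj_in[OF \<sigma> y(1)] by (simp add: T_def)
        qed
        moreover have "x u0 \<noteq> 0" using x1(4) u0(1,2) by (simp add: orbit_point_def)
        ultimately show ?thesis using monoid_algebra_character[OF u0(1)] by (intro bexI[of _ "\<lambda>x. x u0"]) auto
      qed
    qed
    moreover have "T \<subseteq> toric_points N \<Xi>" "U = T \<inter> ?O" using R Opts by (auto simp: T_def)
    ultimately show "openin (zariski (orbit_closure_variety N \<Xi> \<tau>)) U" unfolding sub openin_toric_variety by blast
  qed
qed

lemma base_proj_inj:
  assumes "\<gamma> \<in> \<Xi>"
  shows "inj_on (base_proj \<gamma>) (monoid_points (cone_mon \<gamma>))"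
proof (rule inj_onI)
  fix x y assume x: "x \<in> monoid_points (cone_mon \<gamma>)" and y: "y \<in> monoid_points (cone_mon \<gamma>)"
    and eq: "base_proj \<gamma> x = base_proj \<gamma> y"
  obtain \<tau>1 l1 where 1: "\<tau>1 \<in> \<Xi>" "\<tau>1 \<subseteq> \<gamma>" "linear l1" "x = orbit_point (cone_mon \<gamma>) \<tau>1 l1"
    "base_proj \<gamma> x = pt \<tau>1 l1" by (rule base_point_form[OF assms x])
  obtain \<tau>2 l2 where 2: "\<tau>2 \<in> \<Xi>" "\<tau>2 \<subseteq> \<gamma>" "linear l2" "y = orbit_point (cone_mon \<gamma>) \<tau>2 l2"
    "base_proj \<gamma> y = pt \<tau>2 l2" by (rule base_point_form[OF assms y])
  show "x = y" unfolding 1(4) 2(4)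
    using orbit_point_eq_iff[OF commensurable_M assms 1(1,2) 2(1,2) 1(3) 2(3)]
      pt_eq_iff[OF 1(1) 2(1) 1(3) 2(3)] eq 1(5) 2(5) by simp
qed

text \<open>The glued structure tests a function on every affine piece, although \<open>a\<close>
  and \<open>b\<close> live on one of them. \<open>transfer_functions\<close> provides the
  numerators and denominators on the others.\<close>

lemma fraction_on_toric_variety:
  assumes \<gamma>: "\<gamma> \<in> \<Xi>" and a: "a \<in> monoid_algebra (cone_mon \<gamma>)" and b: "b \<in> monoid_algebra (cone_mon \<gamma>)"
  defines "W \<equiv> base_proj \<gamma> ` {y \<in> monoid_points (cone_mon \<gamma>). b y \<noteq> 0}"
  shows "openin (zariski (toric_variety N \<Xi>)) W"
    and "\<exists>g. regular (toric_variety N \<Xi>) W g \<and>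
      (\<forall>y\<in>monoid_points (cone_mon \<gamma>). b y \<noteq> 0 \<longrightarrow> g (base_proj \<gamma> y) = a y / b y)"
proof -
  define g where "g q = (let y = inv_into (monoid_points (cone_mon \<gamma>)) (base_proj \<gamma>) q in a y / b y)" for q
  have g: "g (base_proj \<gamma> y) = a y / b y" if "y \<in> monoid_points (cone_mon \<gamma>)" for y
    using that by (simp add: g_def inv_into_f_f[OF base_proj_inj[OF \<gamma>]])
  have W_iff: "pt \<tau> l \<in> W \<longleftrightarrow> \<tau> \<subseteq> \<gamma> \<and> b (orbit_point (cone_mon \<gamma>) \<tau> l) \<noteq> 0" if \<tau>: "\<tau> \<in> \<Xi>" "linear l" for \<tau> l
  proof
    assume "pt \<tau> l \<in> W"
    then obtain y where y: "y \<in> monoid_points (cone_mon \<gamma>)" "b y \<noteq> 0" "pt \<tau> l = base_proj \<gamma> y" by (auto simp: W_def)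
    obtain \<tau>1 l1 where 1: "\<tau>1 \<in> \<Xi>" "\<tau>1 \<subseteq> \<gamma>" "linear l1" "y = orbit_point (cone_mon \<gamma>) \<tau>1 l1"
      "base_proj \<gamma> y = pt \<tau>1 l1" by (rule base_point_form[OF \<gamma> y(1)])
    have *: "\<tau> = \<tau>1 \<and> (\<forall>u\<in>M \<inter> perp \<tau>. exp (l u) = exp (l1 u))"
      using pt_eq_iff[OF \<tau>(1) 1(1) \<tau>(2) 1(3)] y(3) 1(5) by simp
    then have "y = orbit_point (cone_mon \<gamma>) \<tau> l"
      unfolding 1(4) using orbit_point_eq_iff[OF commensurable_M \<gamma> \<tau>(1) _ 1(1,2) \<tau>(2) 1(3)] 1(2) by simp
    then show "\<tau> \<subseteq> \<gamma> \<and> b (orbit_point (cone_mon \<gamma>) \<tau> l) \<noteq> 0" using * 1(2) y(2) by simp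
  next
    assume *: "\<tau> \<subseteq> \<gamma> \<and> b (orbit_point (cone_mon \<gamma>) \<tau> l) \<noteq> 0"
    then have "pt \<tau> l = base_proj \<gamma> (orbit_point (cone_mon \<gamma>) \<tau> l)"
      using toric_class_orbit_point[OF \<gamma> \<tau>(1) _ \<tau>(2)] by simp
    moreover have "orbit_point (cone_mon \<gamma>) \<tau> l \<in> monoid_points (cone_mon \<gamma>)"
      using orbit_point_in[OF commensurable_M _ \<tau>(2)] * by blast
    ultimately show "pt \<tau> l \<in> W" using * by (auto simp: W_def)
  qed
  have local: "\<exists>s\<in>cone_mon \<sigma>. \<exists>a'\<in>monoid_algebra (cone_mon \<sigma>). \<exists>b'\<in>monoid_algebra (cone_mon \<sigma>).
      \<forall>y\<in>monoid_points (cone_mon \<sigma>). (base_proj \<sigma> y \<in> W \<longleftrightarrow> y s \<noteq> 0 \<and> b' y \<noteq> 0) \<and>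
        (base_proj \<sigma> y \<in> W \<longrightarrow> g (base_proj \<sigma> y) * b' y = a' y)" if \<sigma>: "\<sigma> \<in> \<Xi>" for \<sigma>
  proof -
    obtain s a' b' where s: "s \<in> cone_mon \<sigma>" "a' \<in> monoid_algebra (cone_mon \<sigma>)" "b' \<in> monoid_algebra (cone_mon \<sigma>)"
      and sp: "\<forall>\<tau>\<in>\<Xi>. \<tau> \<subseteq> \<sigma> \<longrightarrow> (s \<in> perp \<tau> \<longleftrightarrow> \<tau> \<subseteq> \<gamma>)"
      and tr: "\<forall>\<tau>\<in>\<Xi>. \<forall>l. \<tau> \<subseteq> \<sigma> \<longrightarrow> \<tau> \<subseteq> \<gamma> \<longrightarrow> linear l \<longrightarrow>
         a' (orbit_point (cone_mon \<sigma>) \<tau> l) = exp (l s) * a (orbit_point (cone_mon \<gamma>) \<tau> l) \<and>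
         b' (orbit_point (cone_mon \<sigma>) \<tau> l) = exp (l s) * b (orbit_point (cone_mon \<gamma>) \<tau> l)"
      using transfer_functions[OF \<sigma> \<gamma> a b] by (elim bexE conjE) (rule that)
    have "(base_proj \<sigma> y \<in> W \<longleftrightarrow> y s \<noteq> 0 \<and> b' y \<noteq> 0) \<and> (base_proj \<sigma> y \<in> W \<longrightarrow> g (base_proj \<sigma> y) * b' y = a' y)"
      if y: "y \<in> monoid_points (cone_mon \<sigma>)" for y
    proof -
      obtain \<tau> l where 1: "\<tau> \<in> \<Xi>" "\<tau> \<subseteq> \<sigma>" "linear l" "y = orbit_point (cone_mon \<sigma>) \<tau> l"
        "base_proj \<sigma> y = pt \<tau> l" by (rule base_point_form[OF \<sigma> y])
      have ys: "y s \<noteq> 0 \<longleftrightarrow> \<tau> \<subseteq> \<gamma>" using sp 1(1,2) s(1) unfolding 1(4) by (simp add: orbit_point_def)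
      show ?thesis
      proof (cases "\<tau> \<subseteq> \<gamma>")
        case True
        let ?z = "orbit_point (cone_mon \<gamma>) \<tau> l"
        have b': "b' y = exp (l s) * b ?z" "a' y = exp (l s) * a ?z" using tr 1 True by simp_all
        have zin: "?z \<in> monoid_points (cone_mon \<gamma>)" by (rule orbit_point_in[OF commensurable_M True 1(3)])
        have "base_proj \<gamma> ?z = pt \<tau> l" by (rule toric_class_orbit_point[OF \<gamma> 1(1) True 1(3)])
        then have "g (pt \<tau> l) = a ?z / b ?z" using g[OF zin] by simp
        then show ?thesis using b' ys True W_iff[OF 1(1,3)] 1(5) by simp
      next
        case False
        then show ?thesis using ys W_iff[OF 1(1,3)] 1(5) by simp
      qed
    qed
    then show ?thesis using s by blast
  qed
  show W_open: "openin (zariski (toric_variety N \<Xi>)) W"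
    unfolding openin_toric_variety
  proof (intro conjI ballI)
    show "W \<subseteq> toric_points N \<Xi>" using base_proj_in[OF \<gamma>] by (auto simp: W_def)
    fix \<sigma> assume \<sigma>: "\<sigma> \<in> \<Xi>"
    obtain s b' where s: "s \<in> cone_mon \<sigma>" "b' \<in> monoid_algebra (cone_mon \<sigma>)"
      "\<forall>y\<in>monoid_points (cone_mon \<sigma>). base_proj \<sigma> y \<in> W \<longleftrightarrow> y s \<noteq> 0 \<and> b' y \<noteq> 0" using local[OF \<sigma>] by blast
    obtain c where c: "c \<in> monoid_algebra (cone_mon \<sigma>)" "\<forall>y\<in>monoid_points (cone_mon \<sigma>). c y = y s * b' y"
      using monoid_algebra_prod[OF monoid_algebra_character[OF s(1)] s(2) subset_refl subset_refl
          cone_monoid(2)[OF commensurable_M]] by blast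
    show "rel_open (cone_mon \<sigma>) (base_proj \<sigma>) UNIV W"
      unfolding rel_open_def using s c by (intro ballI impI bexI[of _ c]) auto
  qed
  have "regular (toric_variety N \<Xi>) W g"
    unfolding regular_toric_variety[OF W_open] rel_regular_def
  proof (intro ballI impI)
    fix \<sigma> x assume \<sigma>: "\<sigma> \<in> \<Xi>" and x: "x \<in> monoid_points (cone_mon \<sigma>)" "base_proj \<sigma> x \<in> W"
    obtain s a' b' where s: "a' \<in> monoid_algebra (cone_mon \<sigma>)" "b' \<in> monoid_algebra (cone_mon \<sigma>)"
      "\<forall>y\<in>monoid_points (cone_mon \<sigma>). (base_proj \<sigma> y \<in> W \<longleftrightarrow> y s \<noteq> 0 \<and> b' y \<noteq> 0) \<and>
        (base_proj \<sigma> y \<in> W \<longrightarrow> g (base_proj \<sigma> y) * b' y = a' y)" using local[OF \<sigma>] by blast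
    then show "\<exists>a\<in>monoid_algebra (cone_mon \<sigma>). \<exists>b\<in>monoid_algebra (cone_mon \<sigma>). b x \<noteq> 0 \<and>
        (\<forall>y\<in>monoid_points (cone_mon \<sigma>). base_proj \<sigma> y \<in> W \<longrightarrow> g (base_proj \<sigma> y) * b y = a y)"
      using x by blast
  qed
  then show "\<exists>g. regular (toric_variety N \<Xi>) W g \<and>
      (\<forall>y\<in>monoid_points (cone_mon \<gamma>). b y \<noteq> 0 \<longrightarrow> g (base_proj \<gamma> y) = a y / b y)" using g by blast
qed

lemma regular_orbit_closure:
  assumes \<tau>: "\<tau> \<in> \<Xi>" and U: "U \<subseteq> orbit_closure N \<Xi> \<tau>"
  shows "regular (orbit_closure_variety N \<Xi> \<tau>) U f \<longleftrightarrow>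
    (\<forall>\<gamma>\<in>\<Xi>. \<tau> \<subseteq> \<gamma> \<longrightarrow> rel_regular (cone_mon \<gamma>) (base_proj \<gamma>) U f)" (is "_ \<longleftrightarrow> ?R")
proof -
  let ?X = "toric_variety N \<Xi>"
  have reg: "regular (orbit_closure_variety N \<Xi> \<tau>) U f \<longleftrightarrow> (\<forall>q\<in>U. \<exists>W g. openin (zariski ?X) W \<and> q \<in> W \<and>
      regular ?X W g \<and> (\<forall>z\<in>U \<inter> W. f z = g z))"
    by (simp add: orbit_closure_variety_def subfspace_def)
  show ?thesis
  proof
    assume L: "regular (orbit_closure_variety N \<Xi> \<tau>) U f"
    show ?R
    proof (intro ballI impI)
      fix \<gamma> assume \<gamma>: "\<gamma> \<in> \<Xi>" "\<tau> \<subseteq> \<gamma>"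
      let ?S = "cone_mon \<gamma>"
      show "rel_regular ?S (base_proj \<gamma>) U f" unfolding rel_regular_def
      proof (intro ballI impI)
        fix x assume x: "x \<in> monoid_points ?S" "base_proj \<gamma> x \<in> U"
        obtain W g where W: "openin (zariski ?X) W" "base_proj \<gamma> x \<in> W" "regular ?X W g"
          "\<forall>z\<in>U \<inter> W. f z = g z" using L x(2) unfolding reg by blast
        obtain a b where ab: "a \<in> monoid_algebra ?S" "b \<in> monoid_algebra ?S" "b x \<noteq> 0"
          "\<forall>y\<in>monoid_points ?S. base_proj \<gamma> y \<in> W \<longrightarrow> g (base_proj \<gamma> y) * b y = a y"
          using W(2,3) x(1) \<gamma>(1) unfolding regular_toric_variety[OF W(1)] rel_regular_def by blast
        \<comment> \<open>\<open>c\<close> vanishes off the preimage of \<open>W\<close>, so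
          multiplying by it extends the local equation to all of \<open>U\<close>.\<close>
        obtain c where c: "c \<in> monoid_algebra ?S" "c x \<noteq> 0"
          "\<forall>y\<in>monoid_points ?S. c y \<noteq> 0 \<longrightarrow> base_proj \<gamma> y \<in> W"
          using W(1,2) x(1) \<gamma>(1) unfolding openin_toric_variety rel_open_def by blast
        obtain a' where a': "a' \<in> monoid_algebra ?S" "\<forall>y\<in>monoid_points ?S. a' y = a y * c y"
          using monoid_algebra_prod[OF ab(1) c(1) subset_refl subset_refl cone_monoid(2)[OF commensurable_M]] by blast
        obtain b' where b': "b' \<in> monoid_algebra ?S" "\<forall>y\<in>monoid_points ?S. b' y = b y * c y"
          using monoid_algebra_prod[OF ab(2) c(1) subset_refl subset_refl cone_monoid(2)[OF commensurable_M]] by blast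
        have "f (base_proj \<gamma> y) * b' y = a' y" if y: "y \<in> monoid_points ?S" "base_proj \<gamma> y \<in> U" for y
        proof (cases "c y = 0")
          case True
          then show ?thesis using a' b' y by simp
        next
          case False
          then have "base_proj \<gamma> y \<in> W" using c y by blast
          then have "f (base_proj \<gamma> y) = g (base_proj \<gamma> y)" "g (base_proj \<gamma> y) * b y = a y" using W(4) ab(4) y by auto
          then show ?thesis using a' b' y by simp
        qed
        moreover have "b' x \<noteq> 0" using b'(2) x(1) ab(3) c(2) by simp
        ultimately show "\<exists>a\<in>monoid_algebra ?S. \<exists>b\<in>monoid_algebra ?S. b x \<noteq> 0 \<and>
            (\<forall>y\<in>monoid_points ?S. base_proj \<gamma> y \<in> U \<longrightarrow> f (base_proj \<gamma> y) * b y = a y)" using a'(1) b'(1) by blast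
      qed
    qed
  next
    assume R: ?R
    show "regular (orbit_closure_variety N \<Xi> \<tau>) U f" unfolding reg
    proof
      fix q assume q: "q \<in> U"
      then obtain \<gamma> l where \<gamma>: "\<gamma> \<in> \<Xi>" "\<tau> \<subseteq> \<gamma>" "linear l" "q = pt \<gamma> l"
        using U unfolding orbit_closure_eq[OF \<tau>] by blast
      \<comment> \<open>The piece of \<gamma> is chosen because \<open>q\<close> lies on its closed
        orbit; since \<gamma> contains \<tau>, the hypothesis applies to it.\<close>
      let ?x = "orbit_point (cone_mon \<gamma>) \<gamma> l"
      have x: "?x \<in> monoid_points (cone_mon \<gamma>)" "base_proj \<gamma> ?x = q"
        using orbit_point_in[OF commensurable_M subset_refl \<gamma>(3)] toric_class_orbit_point[OF \<gamma>(1,1) subset_refl \<gamma>(3)] \<gamma>(4) by auto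
      obtain a b where ab: "a \<in> monoid_algebra (cone_mon \<gamma>)" "b \<in> monoid_algebra (cone_mon \<gamma>)" "b ?x \<noteq> 0"
        "\<forall>y\<in>monoid_points (cone_mon \<gamma>). base_proj \<gamma> y \<in> U \<longrightarrow> f (base_proj \<gamma> y) * b y = a y"
        using R \<gamma>(1,2) x q unfolding rel_regular_def by blast
      let ?W = "base_proj \<gamma> ` {y \<in> monoid_points (cone_mon \<gamma>). b y \<noteq> 0}"
      obtain g where g: "regular ?X ?W g"
        "\<forall>y\<in>monoid_points (cone_mon \<gamma>). b y \<noteq> 0 \<longrightarrow> g (base_proj \<gamma> y) = a y / b y"
        using fraction_on_toric_variety(2)[OF \<gamma>(1) ab(1,2)] by blast
      have "\<forall>z\<in>U \<inter> ?W. f z = g z"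
      proof
        fix z assume "z \<in> U \<inter> ?W"
        then obtain y where y: "y \<in> monoid_points (cone_mon \<gamma>)" "b y \<noteq> 0" "z = base_proj \<gamma> y" "z \<in> U" by blast
        then have "f z * b y = a y" using ab(4) by blast
        then have "f z = a y / b y" using y(2) by (metis nonzero_eq_divide_eq)
        then show "f z = g z" using g(2) y by simp
      qed
      moreover have "q \<in> ?W" using x ab(3) by blast
      ultimately show "\<exists>W g. openin (zariski ?X) W \<and> q \<in> W \<and> regular ?X W g \<and> (\<forall>z\<in>U \<inter> W. f z = g z)"
        using fraction_on_toric_variety(1)[OF \<gamma>(1) ab(1,2)] g(1) by blast
    qed
  qed
qed

section \<open>Fixed loci and the structure of a sector\<close>

lemma fixed_locus_at_pt:
  assumes "\<gamma> \<in> \<Xi>" "linear l"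
  shows "fixed_locus Q (pt \<gamma> l) g = subfspace (affine_fspace (monoid_points (chart_mon \<gamma>)) (monoid_algebra (chart_mon \<gamma>)))
      {x \<in> monoid_points (chart_mon \<gamma>). cone_action g x = x}"
    and "pts (fixed_locus Q (pt \<gamma> l) g) = {x \<in> monoid_points (chart_mon \<gamma>). cone_action g x = x}"
proof -
  note o = orbifold_at_pt[OF assms]
  show eq: "fixed_locus Q (pt \<gamma> l) g = subfspace (affine_fspace (monoid_points (chart_mon \<gamma>)) (monoid_algebra (chart_mon \<gamma>)))
      {x \<in> monoid_points (chart_mon \<gamma>). cone_action g x = x}"
    unfolding fixed_locus_def o(2,4) unfolding o(1) ..
  have t: "pts (affine_fspace (monoid_points (chart_mon \<gamma>)) (monoid_algebra (chart_mon \<gamma>))) = monoid_points (chart_mon \<gamma>)"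
    using topspace_affine_fspace mult_system_cone commensurable_chart_dual[OF assms(1)] by blast
  show "pts (fixed_locus Q (pt \<gamma> l) g) = {x \<in> monoid_points (chart_mon \<gamma>). cone_action g x = x}"
    unfolding eq subfspace_def by (auto simp: t topspace_subtopology)
qed

lemma cover_proj_orbit_point:
  assumes "\<gamma> \<in> \<Xi>" "\<tau> \<in> \<Xi>" "\<tau> \<subseteq> \<gamma>" "linear l"
  shows "cover_proj \<gamma> (orbit_point (chart_mon \<gamma>) \<tau> l) = pt \<tau> l"
  using toric_class_orbit_point[OF assms] restrict_orbit_point[OF chart_mon_supset[OF assms(1)]]
  by (simp add: cover_proj_def)

text \<open>A point on the orbit of \<open>\<tau>'\<close> is fixed exactly when the class of
  \<open>v\<close> comes from that face. For a box vector this means that \<open>\<tau>'\<close>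
  contains \<tau>.\<close>

lemma fixed_iff_orbit_closure:
  assumes \<tau>: "\<tau> \<in> \<Xi>" "v \<in> cone_box \<tau>" and \<gamma>: "\<gamma> \<in> \<Xi>" "\<tau> \<subseteq> \<gamma>" and x: "x \<in> monoid_points (chart_mon \<gamma>)"
  shows "cone_action (coset \<gamma> v) x = x \<longleftrightarrow> cover_proj \<gamma> x \<in> orbit_closure N \<Xi> \<tau>"
proof -
  obtain \<tau>' l where 1: "\<tau>' \<in> \<Xi>" "\<tau>' \<subseteq> \<gamma>" "linear l" "x = orbit_point (chart_mon \<gamma>) \<tau>' l"
    by (rule chart_point_form[OF \<gamma>(1) x])
  have act: "cone_action (coset \<gamma> v) x = torus_rot v x" by (rule cone_action_coset[OF \<gamma>(1) x])
  have v: "v \<in> N" "v \<in> span \<gamma>" using cone_boxD(1,2)[OF \<tau>] span_mono[OF \<gamma>(2)] by blast+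
  have "torus_rot v x = x \<longleftrightarrow> \<tau> \<subseteq> \<tau>'"
  proof
    assume "torus_rot v x = x"
    then obtain v' where v': "v' \<in> span \<tau>'" "coset \<gamma> v = coset \<gamma> v'"
      using fixed_point_coset[OF \<gamma>(1) 1(1-3) v] 1(4) by metis
    show "\<tau> \<subseteq> \<tau>'" by (rule box_coset_descend(1)[OF \<tau>(1) \<gamma>(1) 1(1) \<gamma>(2) 1(2) \<tau>(2) v'(1) v'(2)[symmetric]])
  next
    assume "\<tau> \<subseteq> \<tau>'"
    then have "v \<in> span \<tau>'" using cone_boxD(2)[OF \<tau>] span_mono by blast
    then show "torus_rot v x = x" unfolding 1(4) by (rule torus_rot_face_fixed)
  qed
  then show ?thesis
    unfolding act using cover_proj_orbit_point[OF \<gamma>(1) 1(1-3)] pt_in_orbit_closure_iff[OF \<tau>(1) 1(1,3)] 1(4) by simp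
qed

lemma sector_chart_proj_fixed:
  assumes \<gamma>: "\<gamma> \<in> \<Xi>" "linear l0" and g: "g \<in> carrier (cone_group N \<gamma>)"
    and x: "x \<in> monoid_points (chart_mon \<gamma>)" "cone_action g x = x"
  obtains \<tau>' l v' where "\<tau>' \<in> \<Xi>" "\<tau>' \<subseteq> \<gamma>" "linear l" "v' \<in> N" "v' \<in> span \<tau>'" "g = coset \<gamma> v'"
    "cover_proj \<gamma> x = pt \<tau>' l" "sector_chart_proj Q (pt \<gamma> l0) g x = (pt \<tau>' l, {coset \<tau>' v'})"
proof -
  obtain \<tau>' l where 1: "\<tau>' \<in> \<Xi>" "\<tau>' \<subseteq> \<gamma>" "linear l" "x = orbit_point (chart_mon \<gamma>) \<tau>' l"
    by (rule chart_point_form[OF \<gamma>(1) x(1)])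
  obtain v0 where v0: "v0 \<in> N" "v0 \<in> span \<gamma>" "g = coset \<gamma> v0" using g by (auto simp: carrier_cone_group)
  have "torus_rot v0 x = x" using x(2) cone_action_coset[OF \<gamma>(1) x(1)] v0(3) by simp
  then obtain v' where v': "v' \<in> N" "v' \<in> span \<tau>'" "coset \<gamma> v0 = coset \<gamma> v'"
    using fixed_point_coset[OF \<gamma>(1) 1(1-3) v0(1,2)] 1(4) by metis
  show ?thesis
    using that[OF 1(1-3) v'(1,2)] v0(3) v'(3) cover_proj_orbit_point[OF \<gamma>(1) 1(1-3)]
      sector_chart_proj_eq[OF \<gamma> 1(1-3) v'(1,2)] 1(4) by simp
qed

abbreviation sector_part :: "'a set \<Rightarrow> 'a \<Rightarrow> 'a toric_point set \<Rightarrow> ('a toric_point \<times> 'a set set) set" where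
  "sector_part \<tau> v U \<equiv> {s \<in> sector \<tau> v. fst s \<in> U}"

lemma in_sector_iff:
  assumes "\<tau> \<in> \<Xi>" "\<gamma> \<in> \<Xi>" "linear l"
  shows "(pt \<gamma> l, c) \<in> sector \<tau> v \<longleftrightarrow> \<tau> \<subseteq> \<gamma> \<and> c = {coset \<gamma> v}"
proof
  assume "(pt \<gamma> l, c) \<in> sector \<tau> v"
  then obtain \<gamma>' l' where *: "\<gamma>' \<in> \<Xi>" "\<tau> \<subseteq> \<gamma>'" "linear l'" "pt \<gamma> l = pt \<gamma>' l'" "c = {coset \<gamma>' v}"
    unfolding sector_def by blast
  then show "\<tau> \<subseteq> \<gamma> \<and> c = {coset \<gamma> v}" using pt_eq_iff[OF assms(2) *(1) assms(3) *(3)] by simp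
qed (use assms in \<open>auto simp: sector_def\<close>)

text \<open>In each chart only the class of \<open>v\<close> itself meets the sector, and only if
  the cone contains \<tau>. All other fixed loci have empty preimage, so the test on the inertia
  space reduces to one condition per cone.\<close>

lemma sector_preimage:
  assumes \<tau>: "\<tau> \<in> \<Xi>" "v \<in> cone_box \<tau>" and U: "U \<subseteq> orbit_closure N \<Xi> \<tau>"
    and \<gamma>: "\<gamma> \<in> \<Xi>" "linear l0" and g: "g \<in> carrier (cone_group N \<gamma>)"
  shows "{x \<in> pts (fixed_locus Q (pt \<gamma> l0) g). sector_chart_proj Q (pt \<gamma> l0) g x \<in> sector_part \<tau> v U} =
    (if \<tau> \<subseteq> \<gamma> \<and> g = coset \<gamma> v then {x \<in> monoid_points (chart_mon \<gamma>). cover_proj \<gamma> x \<in> U} else {})" (is "?L = ?R")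
proof (intro equalityI subsetI)
  fix x assume "x \<in> ?L"
  then have x: "x \<in> monoid_points (chart_mon \<gamma>)" "cone_action g x = x"
    "sector_chart_proj Q (pt \<gamma> l0) g x \<in> sector \<tau> v" "fst (sector_chart_proj Q (pt \<gamma> l0) g x) \<in> U"
    unfolding fixed_locus_at_pt(2)[OF \<gamma>] by auto
  obtain \<tau>' l v' where *: "\<tau>' \<in> \<Xi>" "\<tau>' \<subseteq> \<gamma>" "linear l" "v' \<in> N" "v' \<in> span \<tau>'" "g = coset \<gamma> v'"
    "cover_proj \<gamma> x = pt \<tau>' l" "sector_chart_proj Q (pt \<gamma> l0) g x = (pt \<tau>' l, {coset \<tau>' v'})"
    by (rule sector_chart_proj_fixed[OF \<gamma> g x(1,2)])
  have s: "\<tau> \<subseteq> \<tau>'" "coset \<tau>' v' = coset \<tau>' v" using x(3) unfolding *(8) in_sector_iff[OF \<tau>(1) *(1,3)] by auto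
  then have "g = coset \<gamma> v" using coset_up[OF *(1) \<gamma>(1) *(2)] *(6) by metis
  then show "x \<in> ?R" using s(1) *(2,7,8) x by auto
next
  fix x assume "x \<in> ?R"
  then have x: "\<tau> \<subseteq> \<gamma>" "g = coset \<gamma> v" "x \<in> monoid_points (chart_mon \<gamma>)" "cover_proj \<gamma> x \<in> U"
    by (auto split: if_splits)
  have fx: "cone_action g x = x" using fixed_iff_orbit_closure[OF \<tau> \<gamma>(1) x(1,3)] x(2,4) U by blast
  obtain \<tau>' l v' where *: "\<tau>' \<in> \<Xi>" "\<tau>' \<subseteq> \<gamma>" "linear l" "v' \<in> N" "v' \<in> span \<tau>'" "g = coset \<gamma> v'"
    "cover_proj \<gamma> x = pt \<tau>' l" "sector_chart_proj Q (pt \<gamma> l0) g x = (pt \<tau>' l, {coset \<tau>' v'})"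
    by (rule sector_chart_proj_fixed[OF \<gamma> g x(3) fx])
  have "\<tau> \<subseteq> \<tau>'" "coset \<tau>' v' = coset \<tau>' v"
    using box_coset_descend[OF \<tau>(1) \<gamma>(1) *(1) x(1) *(2) \<tau>(2) *(5)] *(6) x(2) by simp_all
  then have "(pt \<tau>' l, {coset \<tau>' v'}) \<in> sector \<tau> v" using in_sector_iff[OF \<tau>(1) *(1,3)] by simp
  then show "x \<in> ?L" unfolding fixed_locus_at_pt(2)[OF \<gamma>] using x fx *(7,8) by simp
qed

lemma sector_subset_inertia_points:
  assumes "\<tau> \<in> \<Xi>" "v \<in> cone_box \<tau>"
  shows "sector \<tau> v \<subseteq> inertia_points Q"
proof
  fix s assume "s \<in> sector \<tau> v"
  then obtain \<gamma> l where \<gamma>: "\<gamma> \<in> \<Xi>" "\<tau> \<subseteq> \<gamma>" "linear l" "s = (pt \<gamma> l, {coset \<gamma> v})" unfolding sector_def by blast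
  have c: "coset \<gamma> v \<in> carrier (cone_group N \<gamma>)"
    using coset_carrier cone_boxD(1,2)[OF assms] span_mono[OF \<gamma>(2)] by blast
  have "s = (pt \<gamma> l, conj_class (local_group Q (pt \<gamma> l)) (coset \<gamma> v))"
    using conj_class_cone_group[OF c] orbifold_at_pt(3)[OF \<gamma>(1,3)] \<gamma>(4) by simp
  moreover have "pt \<gamma> l \<in> orb_points Q" using orb_points_Q \<gamma> by blast
  moreover have "coset \<gamma> v \<in> carrier (local_group Q (pt \<gamma> l))" using orbifold_at_pt(3)[OF \<gamma>(1,3)] c by simp
  ultimately show "s \<in> inertia_points Q" unfolding inertia_points_def by blast
qed

lemmas mult_system_chart = mult_system_cone[OF commensurable_chart_dual]

text \<open>The condition at \<open>p\<close> depends only on the cone of \<open>p\<close>, so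
  testing at the point with \<open>l = 0\<close> for each cone covers all charts.\<close>

lemma openin_inertia:
  assumes \<tau>: "\<tau> \<in> \<Xi>" "v \<in> cone_box \<tau>" and U: "U \<subseteq> orbit_closure N \<Xi> \<tau>"
  shows "openin (zariski (inertia_space Q)) (sector_part \<tau> v U) \<longleftrightarrow>
    (\<forall>\<gamma>\<in>\<Xi>. \<tau> \<subseteq> \<gamma> \<longrightarrow> rel_open (chart_mon \<gamma>) (cover_proj \<gamma>) (orbit_closure N \<Xi> \<tau>) U)" (is "?L \<longleftrightarrow> ?R")
proof -
  let ?pre = "\<lambda>p g. {x \<in> pts (fixed_locus Q p g). sector_chart_proj Q p g x \<in> sector_part \<tau> v U}"
  have L: "?L \<longleftrightarrow> (\<forall>p g. p \<in> orb_points Q \<and> g \<in> carrier (local_group Q p) \<longrightarrow>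
      openin (zariski (fixed_locus Q p g)) (?pre p g))"
    unfolding inertia_space_def openin_final_fspace using sector_subset_inertia_points[OF \<tau>] by auto
  have main: "openin (zariski (fixed_locus Q (pt \<gamma> l) (coset \<gamma> v))) (?pre (pt \<gamma> l) (coset \<gamma> v)) \<longleftrightarrow>
      rel_open (chart_mon \<gamma>) (cover_proj \<gamma>) (orbit_closure N \<Xi> \<tau>) U"
    if \<gamma>: "\<gamma> \<in> \<Xi>" "linear l" "\<tau> \<subseteq> \<gamma>" for \<gamma> l
  proof -
    have c: "coset \<gamma> v \<in> carrier (cone_group N \<gamma>)" using coset_carrier cone_boxD(1,2)[OF \<tau>] span_mono[OF \<gamma>(3)] by blast
    have fx: "{x \<in> monoid_points (chart_mon \<gamma>). cone_action (coset \<gamma> v) x = x} =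
        {x \<in> monoid_points (chart_mon \<gamma>). cover_proj \<gamma> x \<in> orbit_closure N \<Xi> \<tau>}"
      using fixed_iff_orbit_closure[OF \<tau> \<gamma>(1,3)] by blast
    let ?V = "monoid_points (chart_mon \<gamma>)" and ?A = "monoid_algebra (chart_mon \<gamma>)" and ?O = "orbit_closure N \<Xi> \<tau>"
    have pre: "?pre (pt \<gamma> l) (coset \<gamma> v) = {x \<in> ?V. cover_proj \<gamma> x \<in> U}"
      unfolding sector_preimage[OF \<tau> U \<gamma>(1,2) c] using \<gamma>(3) by simp
    have "openin (zariski (fixed_locus Q (pt \<gamma> l) (coset \<gamma> v))) {x \<in> ?V. cover_proj \<gamma> x \<in> U} \<longleftrightarrow>
        {x \<in> ?V. cover_proj \<gamma> x \<in> U} \<subseteq> ?V \<inter> {x \<in> ?V. cover_proj \<gamma> x \<in> ?O} \<and>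
        (\<forall>x\<in>{x \<in> ?V. cover_proj \<gamma> x \<in> U}. \<exists>a\<in>?A. a x \<noteq> 0 \<and>
          (\<forall>y\<in>?V \<inter> {x \<in> ?V. cover_proj \<gamma> x \<in> ?O}. a y \<noteq> 0 \<longrightarrow> y \<in> {x \<in> ?V. cover_proj \<gamma> x \<in> U}))"
      unfolding fixed_locus_at_pt(1)[OF \<gamma>(1,2)] fx
      by (rule openin_sub_affine_fspace[OF mult_system_chart[OF \<gamma>(1)]])
    also have "\<dots> \<longleftrightarrow> (\<forall>x\<in>{x \<in> ?V. cover_proj \<gamma> x \<in> U}. \<exists>a\<in>?A. a x \<noteq> 0 \<and>
          (\<forall>y\<in>?V. cover_proj \<gamma> y \<in> ?O \<and> a y \<noteq> 0 \<longrightarrow> cover_proj \<gamma> y \<in> U))"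
    proof -
      have "{x \<in> ?V. cover_proj \<gamma> x \<in> U} \<subseteq> ?V \<inter> {x \<in> ?V. cover_proj \<gamma> x \<in> ?O}" using U by blast
      moreover have "(\<forall>y\<in>?V \<inter> {x \<in> ?V. cover_proj \<gamma> x \<in> ?O}. a y \<noteq> 0 \<longrightarrow> y \<in> {x \<in> ?V. cover_proj \<gamma> x \<in> U}) \<longleftrightarrow>
          (\<forall>y\<in>?V. cover_proj \<gamma> y \<in> ?O \<and> a y \<noteq> 0 \<longrightarrow> cover_proj \<gamma> y \<in> U)" for a :: "('a \<Rightarrow> complex) \<Rightarrow> complex"
        by blast
      ultimately show ?thesis by (simp only: simp_thms)
    qed
    also have "\<dots> \<longleftrightarrow> rel_open (chart_mon \<gamma>) (cover_proj \<gamma>) ?O U" unfolding rel_open_def by blast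
    finally show ?thesis unfolding pre .
  qed
  show ?thesis
  proof
    assume ?L
    have lin0: "linear (\<lambda>_. 0 :: complex)" by (simp add: linear_zero)
    show ?R
    proof (intro ballI impI)
      fix \<gamma> assume \<gamma>: "\<gamma> \<in> \<Xi>" "\<tau> \<subseteq> \<gamma>"
      have "coset \<gamma> v \<in> carrier (cone_group N \<gamma>)" using coset_carrier cone_boxD(1,2)[OF \<tau>] span_mono[OF \<gamma>(2)] by blast
      then have "coset \<gamma> v \<in> carrier (local_group Q (pt \<gamma> (\<lambda>_. 0)))" using orbifold_at_pt(3)[OF \<gamma>(1) lin0] by simp
      moreover have "pt \<gamma> (\<lambda>_. 0) \<in> orb_points Q" using orb_points_Q \<gamma>(1) lin0 by blast
      ultimately show "rel_open (chart_mon \<gamma>) (cover_proj \<gamma>) (orbit_closure N \<Xi> \<tau>) U"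
        using \<open>?L\<close> main[OF \<gamma>(1) lin0 \<gamma>(2)] unfolding L by blast
    qed
  next
    assume R: ?R
    show ?L unfolding L
    proof (intro allI impI)
      fix p g assume pg: "p \<in> orb_points Q \<and> g \<in> carrier (local_group Q p)"
      then obtain \<gamma> l where \<gamma>: "\<gamma> \<in> \<Xi>" "linear l" "p = pt \<gamma> l" using orb_points_Q by blast
      have g: "g \<in> carrier (cone_group N \<gamma>)" using pg orbifold_at_pt(3)[OF \<gamma>(1,2)] \<gamma>(3) by simp
      show "openin (zariski (fixed_locus Q p g)) (?pre p g)"
      proof (cases "\<tau> \<subseteq> \<gamma> \<and> g = coset \<gamma> v")
        case True
        then show ?thesis using main[OF \<gamma>(1,2)] R \<gamma> by blast
      next
        case False
        have empty: "?pre p g = {}"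
          unfolding \<gamma>(3) by (rule trans[OF sector_preimage[OF \<tau> U \<gamma>(1,2) g] if_not_P[OF False]])
        show ?thesis unfolding empty by (rule openin_empty)
      qed
    qed
  qed
qed

lemma sector_part_all:
  assumes "\<tau> \<in> \<Xi>"
  shows "sector_part \<tau> v (orbit_closure N \<Xi> \<tau>) = sector \<tau> v" "fst ` sector \<tau> v = orbit_closure N \<Xi> \<tau>"
    "inj_on fst (sector \<tau> v)"
proof -
  have "fst s \<in> orbit_closure N \<Xi> \<tau>" if "s \<in> sector \<tau> v" for s
    using that unfolding orbit_closure_eq[OF assms] sector_def by force
  then show "sector_part \<tau> v (orbit_closure N \<Xi> \<tau>) = sector \<tau> v" by blast
  show "fst ` sector \<tau> v = orbit_closure N \<Xi> \<tau>"
    unfolding orbit_closure_eq[OF assms] sector_def by force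
  show "inj_on fst (sector \<tau> v)"
  proof (rule inj_onI)
    fix s t assume s: "s \<in> sector \<tau> v" and t: "t \<in> sector \<tau> v" and eq: "fst s = fst t"
    obtain \<gamma> l where \<gamma>: "\<gamma> \<in> \<Xi>" "linear l" "s = (pt \<gamma> l, {coset \<gamma> v})" using s unfolding sector_def by blast
    have "t = (pt \<gamma> l, snd t)" using eq \<gamma>(3) by (metis fst_conv prod.collapse)
    then have "snd t = {coset \<gamma> v}" using t in_sector_iff[OF assms \<gamma>(1,2)] by metis
    then show "s = t" using \<gamma>(3) \<open>t = _\<close> by simp
  qed
qed

text \<open>Applied to the whole closure, \<open>openin_inertia\<close> shows that a sector is open
  in the inertia space, so relative openness is plain openness.\<close>

lemma openin_sector_space:
  assumes \<tau>: "\<tau> \<in> \<Xi>" "v \<in> cone_box \<tau>" and U: "U \<subseteq> orbit_closure N \<Xi> \<tau>"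
  shows "openin (zariski (sector_space Q (sector \<tau> v))) (sector_part \<tau> v U) \<longleftrightarrow>
      (\<forall>\<gamma>\<in>\<Xi>. \<tau> \<subseteq> \<gamma> \<longrightarrow> rel_open (chart_mon \<gamma>) (cover_proj \<gamma>) (orbit_closure N \<Xi> \<tau>) U)"
    and "pts (sector_space Q (sector \<tau> v)) = sector \<tau> v"
proof -
  have "rel_open (chart_mon \<gamma>) (cover_proj \<gamma>) (orbit_closure N \<Xi> \<tau>) (orbit_closure N \<Xi> \<tau>)" if "\<gamma> \<in> \<Xi>" for \<gamma>
    using rel_open_self cone_monoid(1)[OF commensurable_chart_dual[OF that]] by blast
  then have op: "openin (zariski (inertia_space Q)) (sector \<tau> v)"
    using openin_inertia[OF \<tau> subset_refl] sector_part_all(1)[OF \<tau>(1)] by simp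
  show "openin (zariski (sector_space Q (sector \<tau> v))) (sector_part \<tau> v U) \<longleftrightarrow>
      (\<forall>\<gamma>\<in>\<Xi>. \<tau> \<subseteq> \<gamma> \<longrightarrow> rel_open (chart_mon \<gamma>) (cover_proj \<gamma>) (orbit_closure N \<Xi> \<tau>) U)"
    using openin_inertia[OF \<tau> U] openin_open_subtopology[OF op] by (auto simp: sector_space_def subfspace_def)
  show "pts (sector_space Q (sector \<tau> v)) = sector \<tau> v"
    using openin_subset[OF op] by (auto simp: sector_space_def subfspace_def topspace_subtopology)
qed

lemma regular_sector_space:
  assumes \<tau>: "\<tau> \<in> \<Xi>" "v \<in> cone_box \<tau>" and U: "U \<subseteq> orbit_closure N \<Xi> \<tau>"
    and op: "openin (zariski (sector_space Q (sector \<tau> v))) (sector_part \<tau> v U)"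
  shows "regular (sector_space Q (sector \<tau> v)) (sector_part \<tau> v U) (f \<circ> fst) \<longleftrightarrow>
      (\<forall>\<gamma>\<in>\<Xi>. \<tau> \<subseteq> \<gamma> \<longrightarrow> rel_regular (chart_mon \<gamma>) (cover_proj \<gamma>) U f)" (is "?L \<longleftrightarrow> ?R")
proof -
  let ?I = "inertia_space Q" and ?P = "sector_part \<tau> v U"
  let ?pre = "\<lambda>p g W. {x \<in> pts (fixed_locus Q p g). sector_chart_proj Q p g x \<in> W}"
  have reg_sub: "?L \<longleftrightarrow> (\<forall>s\<in>?P. \<exists>W g. openin (zariski ?I) W \<and> s \<in> W \<and> regular ?I W g \<and>
      (\<forall>z\<in>?P \<inter> W. f (fst z) = g z))" by (simp add: sector_space_def subfspace_def)
  have reg_I: "regular ?I W h \<longleftrightarrow> (\<forall>p g. p \<in> orb_points Q \<and> g \<in> carrier (local_group Q p) \<longrightarrow>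
      regular (fixed_locus Q p g) (?pre p g W) (h \<circ> sector_chart_proj Q p g))" for W h
    unfolding inertia_space_def final_fspace_def by auto
  have open_I: "openin (zariski ?I) W \<Longrightarrow> p \<in> orb_points Q \<Longrightarrow> g \<in> carrier (local_group Q p) \<Longrightarrow>
      openin (zariski (fixed_locus Q p g)) (?pre p g W)" for W p g
    unfolding inertia_space_def openin_final_fspace by auto
  have opI: "openin (zariski ?I) ?P"
    using op openin_inertia[OF \<tau> U] openin_sector_space(1)[OF \<tau> U] by blast
  have lin0: "linear (\<lambda>_. 0 :: complex)" by (simp add: linear_zero)
  have fst_proj: "fst (sector_chart_proj Q (pt \<gamma> l) g x) = cover_proj \<gamma> x"
    if "\<gamma> \<in> \<Xi>" "linear l" "g \<in> carrier (cone_group N \<gamma>)" "x \<in> pts (fixed_locus Q (pt \<gamma> l) g)" for \<gamma> l g x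
  proof -
    have x: "x \<in> monoid_points (chart_mon \<gamma>)" "cone_action g x = x"
      using that(4) fixed_locus_at_pt(2)[OF that(1,2)] by auto
    show ?thesis by (rule sector_chart_proj_fixed[OF that(1-3) x]) simp
  qed
  show ?thesis
  proof
    assume L: ?L
    show ?R
    proof (intro ballI impI)
      fix \<gamma> assume \<gamma>: "\<gamma> \<in> \<Xi>" "\<tau> \<subseteq> \<gamma>"
      let ?S = "chart_mon \<gamma>" and ?p = "pt \<gamma> (\<lambda>_. 0)" and ?g = "coset \<gamma> v"
      let ?V = "monoid_points ?S" and ?A = "monoid_algebra ?S"
      note fl = fixed_locus_at_pt[OF \<gamma>(1) lin0, of ?g]
      note ms = mult_system_chart[OF \<gamma>(1)]
      have c: "?g \<in> carrier (cone_group N \<gamma>)" using coset_carrier cone_boxD(1,2)[OF \<tau>] span_mono[OF \<gamma>(2)] by blast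
      have pg: "?p \<in> orb_points Q" "?g \<in> carrier (local_group Q ?p)"
        using orb_points_Q \<gamma>(1) lin0 orbifold_at_pt(3)[OF \<gamma>(1) lin0] c by auto
      have pre: "x \<in> ?pre ?p ?g ?P \<longleftrightarrow> x \<in> ?V \<and> cover_proj \<gamma> x \<in> U" for x
        unfolding sector_preimage[OF \<tau> U \<gamma>(1) lin0 c] using \<gamma>(2) by simp
      show "rel_regular ?S (cover_proj \<gamma>) U f" unfolding rel_regular_def
      proof (intro ballI impI)
        fix x assume x: "x \<in> ?V" "cover_proj \<gamma> x \<in> U"
        then have xP: "x \<in> ?pre ?p ?g ?P" using pre by blast
        then obtain W h where W: "openin (zariski ?I) W" "sector_chart_proj Q ?p ?g x \<in> W" "regular ?I W h"
          "\<forall>z\<in>?P \<inter> W. f (fst z) = h z" using L unfolding reg_sub by blast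
        let ?preW = "?pre ?p ?g W"
        have oW: "openin (zariski (fixed_locus Q ?p ?g)) ?preW" by (rule open_I[OF W(1) pg])
        have xW: "x \<in> ?preW" using xP W(2) by blast
        have WV: "?preW \<subseteq> ?V" unfolding fl(2) by blast
        have "regular (fixed_locus Q ?p ?g) ?preW (h \<circ> sector_chart_proj Q ?p ?g)" using W(3) pg unfolding reg_I by blast
        then obtain a b where ab: "a \<in> ?A" "b \<in> ?A" "b x \<noteq> 0"
          "\<forall>y\<in>?preW. h (sector_chart_proj Q ?p ?g y) * b y = a y"
          using xW unfolding fl(1) regular_sub_affine_fspace[OF ms WV[unfolded fl(1)]] o_def by blast
        \<comment> \<open>The fraction is valid only over \<open>W\<close>. On the fixed locus
          \<open>k\<close> vanishes outside the preimage of \<open>W\<close>, and multiplying by it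
          makes the equation valid on the preimage of \<open>U\<close>.\<close>
        obtain k where k: "k \<in> ?A" "k x \<noteq> 0"
          "\<forall>y\<in>?V \<inter> {x \<in> ?V. cone_action ?g x = x}. k y \<noteq> 0 \<longrightarrow> y \<in> ?preW"
          using oW xW unfolding fl(1) openin_sub_affine_fspace[OF ms] by blast
        obtain a' where a': "a' \<in> ?A" "\<forall>y\<in>?V. a' y = a y * k y"
          using monoid_algebra_prod[OF ab(1) k(1) subset_refl subset_refl cone_monoid(2)[OF commensurable_chart_dual[OF \<gamma>(1)]]] by blast
        obtain b' where b': "b' \<in> ?A" "\<forall>y\<in>?V. b' y = b y * k y"
          using monoid_algebra_prod[OF ab(2) k(1) subset_refl subset_refl cone_monoid(2)[OF commensurable_chart_dual[OF \<gamma>(1)]]] by blast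
        have "f (cover_proj \<gamma> y) * b' y = a' y" if y: "y \<in> ?V" "cover_proj \<gamma> y \<in> U" for y
        proof (cases "k y = 0")
          case True
          then show ?thesis using a' b' y by simp
        next
          case False
          have yP: "y \<in> ?pre ?p ?g ?P" using pre y by blast
          then have yF: "y \<in> pts (fixed_locus Q ?p ?g)" by blast
          then have yW: "y \<in> ?preW" using k(3) False unfolding fl(2) by blast
          let ?z = "sector_chart_proj Q ?p ?g y"
          have "?z \<in> ?P" "?z \<in> W" using yP yW by auto
          then have "f (fst ?z) = h ?z" using W(4) by blast
          then have "f (cover_proj \<gamma> y) * b y = a y"
            using fst_proj[OF \<gamma>(1) lin0 c yF] ab(4) yW by simp
          then show ?thesis using a' b' y by simp
        qed
        moreover have "b' x \<noteq> 0" using b'(2) x(1) ab(3) k(2) by simp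
        ultimately show "\<exists>a\<in>?A. \<exists>b\<in>?A. b x \<noteq> 0 \<and> (\<forall>y\<in>?V. cover_proj \<gamma> y \<in> U \<longrightarrow> f (cover_proj \<gamma> y) * b y = a y)"
          using a'(1) b'(1) by blast
      qed
    qed
  next
    assume R: ?R
    have "regular ?I ?P (f \<circ> fst)" unfolding reg_I
    proof (intro allI impI)
      fix p g assume pg: "p \<in> orb_points Q \<and> g \<in> carrier (local_group Q p)"
      then obtain \<gamma> l where \<gamma>: "\<gamma> \<in> \<Xi>" "linear l" "p = pt \<gamma> l" using orb_points_Q by blast
      have g: "g \<in> carrier (cone_group N \<gamma>)" using pg orbifold_at_pt(3)[OF \<gamma>(1,2)] \<gamma>(3) by simp
      let ?S = "chart_mon \<gamma>"
      let ?V = "monoid_points ?S" and ?A = "monoid_algebra ?S"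
      have pre: "?pre p g ?P = (if \<tau> \<subseteq> \<gamma> \<and> g = coset \<gamma> v then {x \<in> ?V. cover_proj \<gamma> x \<in> U} else {})"
        using sector_preimage[OF \<tau> U \<gamma>(1,2) g] \<gamma>(3) by simp
      have sub: "?pre p g ?P \<subseteq> ?V" unfolding pre by auto
      have eq: "(f \<circ> fst \<circ> sector_chart_proj Q p g) y = f (cover_proj \<gamma> y)" if "y \<in> ?pre p g ?P" for y
        using fst_proj[OF \<gamma>(1,2) g] that \<gamma>(3) by simp
      have "\<forall>x\<in>?pre p g ?P. \<exists>a\<in>?A. \<exists>b\<in>?A. b x \<noteq> 0 \<and>
          (\<forall>y\<in>?pre p g ?P. (f \<circ> fst \<circ> sector_chart_proj Q p g) y * b y = a y)"
      proof (cases "\<tau> \<subseteq> \<gamma> \<and> g = coset \<gamma> v")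
        case True
        then have P: "?pre p g ?P = {x \<in> ?V. cover_proj \<gamma> x \<in> U}" using pre by simp
        have rr: "rel_regular ?S (cover_proj \<gamma>) U f" using R \<gamma>(1) True by blast
        show ?thesis
        proof
          fix x assume "x \<in> ?pre p g ?P"
          then have "x \<in> ?V" "cover_proj \<gamma> x \<in> U" unfolding P by auto
          then obtain a b where ab: "a \<in> ?A" "b \<in> ?A" "b x \<noteq> 0"
            "\<forall>y\<in>?V. cover_proj \<gamma> y \<in> U \<longrightarrow> f (cover_proj \<gamma> y) * b y = a y" using rr unfolding rel_regular_def by blast
          have "(f \<circ> fst \<circ> sector_chart_proj Q p g) y * b y = a y" if "y \<in> ?pre p g ?P" for y
            unfolding eq[OF that] using ab(4) that unfolding P by blast
          then show "\<exists>a\<in>?A. \<exists>b\<in>?A. b x \<noteq> 0 \<and>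
              (\<forall>y\<in>?pre p g ?P. (f \<circ> fst \<circ> sector_chart_proj Q p g) y * b y = a y)" using ab(1-3) by blast
        qed
      next
        case False
        have empty: "?pre p g ?P = {}" by (rule trans[OF pre if_not_P[OF False]])
        show ?thesis unfolding empty by simp
      qed
      then show "regular (fixed_locus Q p g) (?pre p g ?P) (f \<circ> fst \<circ> sector_chart_proj Q p g)"
        using regular_sub_affine_fspace[OF mult_system_chart[OF \<gamma>(1)] sub] fixed_locus_at_pt(1)[OF \<gamma>(1,2)] \<gamma>(3) by simp
    qed
    then show ?L unfolding reg_sub using opI by (intro ballI exI[of _ ?P] exI[of _ "f \<circ> fst"]) auto
  qed
qed

text \<open>\<open>fst\<close> is a bijection, and the tests on the charts and on their quotients
  agree by \<open>rel_open_cover_iff\<close> and \<open>rel_regular_cover_iff\<close>.\<close>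

lemma sector_iso_orbit_closure:
  assumes \<tau>: "\<tau> \<in> \<Xi>" "v \<in> cone_box \<tau>"
  shows "fspace_iso fst (sector_space Q (sector \<tau> v)) (orbit_closure_variety N \<Xi> \<tau>)"
proof -
  let ?X = "sector_space Q (sector \<tau> v)" and ?Y = "orbit_closure_variety N \<Xi> \<tau>" and ?O = "orbit_closure N \<Xi> \<tau>"
  have open_iff: "openin (zariski ?X) (sector_part \<tau> v U) \<longleftrightarrow> openin (zariski ?Y) U" if U: "U \<subseteq> ?O" for U
    unfolding openin_sector_space(1)[OF \<tau> U] openin_orbit_closure[OF \<tau>(1)]
    using rel_open_cover_iff U by blast
  have ptsX: "pts ?X = sector \<tau> v" by (rule openin_sector_space(2)[OF \<tau> subset_refl])
  have opO: "openin (zariski ?Y) ?O"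
    unfolding openin_orbit_closure[OF \<tau>(1)] using rel_open_self cone_monoid(1)[OF commensurable_M] by blast
  then have ptsY: "pts ?Y = ?O"
    using openin_subset[OF opO] openin_topspace[of "zariski ?Y"] openin_orbit_closure[OF \<tau>(1)] by blast
  show ?thesis unfolding fspace_iso_def
  proof (intro conjI allI impI)
    show "homeomorphic_map (zariski ?X) (zariski ?Y) fst"
      unfolding homeomorphic_map_def quotient_map_def ptsX ptsY
      using sector_part_all(2,3)[OF \<tau>(1)] open_iff by blast
    fix U f assume U: "openin (zariski ?Y) U"
    then have UO: "U \<subseteq> ?O" using openin_orbit_closure[OF \<tau>(1)] by blast
    show "regular ?Y U f \<longleftrightarrow> regular ?X {x \<in> pts ?X. fst x \<in> U} (f \<circ> fst)"
      unfolding ptsX regular_orbit_closure[OF \<tau>(1) UO]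
      using regular_sector_space[OF \<tau> UO] open_iff[OF UO] U rel_regular_cover_iff by blast
  qed
qed

section \<open>Types of sectors\<close>

lemma orbit_closure_inj:
  assumes "\<tau> \<in> \<Xi>" "\<tau>' \<in> \<Xi>" "orbit_closure N \<Xi> \<tau> = orbit_closure N \<Xi> \<tau>'"
  shows "\<tau> = \<tau>'"
proof -
  have lin0: "linear (\<lambda>_. 0 :: complex)" by (simp add: linear_zero)
  show ?thesis
    using pt_in_orbit_closure_iff[OF assms(1,1) lin0] pt_in_orbit_closure_iff[OF assms(1,2) lin0]
      pt_in_orbit_closure_iff[OF assms(2,1) lin0] pt_in_orbit_closure_iff[OF assms(2,2) lin0] assms(3) by blast
qed

text \<open>The type determines the cone: an isomorphism given by \<open>fst\<close> has the orbit
  closure as its image, and orbit closures of distinct cones differ.\<close>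

lemma sectors_of_type_eq:
  assumes \<tau>: "\<tau> \<in> \<Xi>" "\<tau> \<noteq> {0}"
  shows "sectors_of_type N \<Xi> C \<tau> = sector \<tau> ` cone_box \<tau>"
proof (intro equalityI subsetI)
  fix S assume S: "S \<in> sectors_of_type N \<Xi> C \<tau>"
  then obtain \<tau>' v where *: "\<tau>' \<in> \<Xi>" "v \<in> cone_box \<tau>'" "S = sector \<tau>' v"
    and iso: "fspace_iso fst (sector_space Q S) (orbit_closure_variety N \<Xi> \<tau>)"
    unfolding sectors_of_type_def twisted_sectors_eq by blast
  have im: "fst ` pts (sector_space Q S) = pts (orbit_closure_variety N \<Xi> \<rho>)"
    if "fspace_iso fst (sector_space Q S) (orbit_closure_variety N \<Xi> \<rho>)" for \<rho>
    using that by (auto simp: fspace_iso_def dest: homeomorphic_imp_surjective_map)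
  have pY: "pts (orbit_closure_variety N \<Xi> \<rho>) = orbit_closure N \<Xi> \<rho>" if "\<rho> \<in> \<Xi>" for \<rho>
  proof -
    have "openin (zariski (orbit_closure_variety N \<Xi> \<rho>)) (orbit_closure N \<Xi> \<rho>)"
      unfolding openin_orbit_closure[OF that] using rel_open_self cone_monoid(1)[OF commensurable_M] by blast
    then show ?thesis
      using openin_subset openin_topspace[of "zariski (orbit_closure_variety N \<Xi> \<rho>)"] openin_orbit_closure[OF that] by blast
  qed
  have "orbit_closure N \<Xi> \<tau>' = orbit_closure N \<Xi> \<tau>"
    using im[OF iso] im[of \<tau>'] sector_iso_orbit_closure[OF *(1,2)] *(3) pY[OF *(1)] pY[OF \<tau>(1)] by simp
  then have "\<tau>' = \<tau>" by (rule orbit_closure_inj[OF *(1) \<tau>(1)])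
  then show "S \<in> sector \<tau> ` cone_box \<tau>" using * by blast
next
  fix S assume "S \<in> sector \<tau> ` cone_box \<tau>"
  then show "S \<in> sectors_of_type N \<Xi> C \<tau>"
    unfolding sectors_of_type_def twisted_sectors_eq using \<tau> sector_iso_orbit_closure[OF \<tau>(1)] by blast
qed

lemma twisted_sector_isomorphic:
  assumes "S \<in> twisted_sectors Q"
  shows "\<exists>\<tau>\<in>\<Xi>. isomorphic_fspace (sector_space Q S) (orbit_closure_variety N \<Xi> \<tau>)"
  using assms sector_iso_orbit_closure unfolding twisted_sectors_eq isomorphic_fspace_def by blast

lemma sectors_box_bijection:
  assumes "\<tau> \<in> \<Xi>" "\<tau> \<noteq> {0}"
  shows "\<exists>f. bij_betw f (sectors_of_type N \<Xi> C \<tau>) (box_vectors N \<tau>)"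
proof -
  have "bij_betw (sector \<tau>) (cone_box \<tau>) (sector \<tau> ` cone_box \<tau>)"
    by (intro inj_on_imp_bij_betw inj_onI sector_inj[OF assms(1)])
  then show ?thesis
    unfolding sectors_of_type_eq[OF assms] box_vectors_eq[OF assms(1)] using bij_betw_inv by blast
qed

end

theorem theorem1:
  fixes N :: "'a::euclidean_space set" and \<Xi> :: "'a set set" and C :: "'a set \<Rightarrow> 'a set"
  assumes "is_lattice N"
    and "is_fan N \<Xi>"
    and "simplicial_fan N \<Xi>"
    and "rays_span \<Xi>"
    and "\<And>\<tau>. \<tau> \<in> \<Xi> \<Longrightarrow> lattice_complement N \<tau> (C \<tau>)"
  shows "(\<forall>S \<in> twisted_sectors (toric_orbifold N \<Xi> C).
            \<exists>\<tau>\<in>\<Xi>. isomorphic_fspace (sector_space (toric_orbifold N \<Xi> C) S)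
                                     (orbit_closure_variety N \<Xi> \<tau>)) \<and>
         (\<forall>\<tau>\<in>\<Xi>. \<tau> \<noteq> {0} \<longrightarrow>
            (\<exists>f. bij_betw f (sectors_of_type N \<Xi> C \<tau>) (box_vectors N \<tau>)))"
proof -
  interpret simplicial_toric N \<Xi> C
    using assms by unfold_locales
  show ?thesis using twisted_sector_isomorphic sectors_box_bijection by blast
qed

end
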